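(* Let $L_\infty/L$ be an infinite Galois extension with group $\Gamma$, and $\Gamma\supseteq\Gamma_1\supseteq\Gamma_2\supseteq\cdots$ open normal subgroups with $\bigcap_n\Gamma_n=1$. Suppose that $\Gamma$ is abelian, that $p\nmid|\Gamma/\Gamma_1|$, and that $\Gamma_1$ is a torsionfree pro-$p$ group of finite rank. Then $o_\infty^*$ is a free $\Lambda(\Gamma)$-module of rank $1$ if and only if the natural map $k_1\to k_\infty^{\Gamma_1}$ is an isomorphism.
   Context: $L/\mathbb{Q}_p$ finite with uniformizer $\pi$ and residue field $k_L$. $L_n=L_\infty^{\Gamma_n}$, $o_n$ the integral closure of $o_L$ in $L_n$, $o_n^*=\mathrm{Hom}_{o_L}(o_n,o_L)$, $k_n=o_n/\pi o_n$. $\Lambda(\Gamma)=\varprojlim_n o_L[\Gamma/\Gamma_n]$; $o_\infty^*=\varprojlim_n o_n^*$ (transition maps dual to the inclusions $o_n\subseteq o_{n+1}$), a $\Lambda(\Gamma)$-module; $k_\infty=\varinjlim_n k_n$ with its $\Gamma$-action. *)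

theory Defs
  imports
    "HOL-Computational_Algebra.Primes"
    "HOL-Analysis.T1_Spaces"
    "HOL-Algebra.Algebra"
begin

definition padic_abs :: "nat \<Rightarrow> rat \<Rightarrow> real" where
  "padic_abs p q =
     (if q = 0 then 0
      else real p powi (int (multiplicity (int p) (snd (quotient_of q)))
                        - int (multiplicity (int p) (fst (quotient_of q)))))"

definition padic_cauchy :: "nat \<Rightarrow> (nat \<Rightarrow> rat) set" where
  "padic_cauchy p =
     {x. \<forall>e>0. \<exists>N. \<forall>m\<ge>N. \<forall>n\<ge>N. padic_abs p (x m - x n) < e}"

definition padic_null :: "nat \<Rightarrow> (nat \<Rightarrow> rat) set" where
  "padic_null p = {x. (\<lambda>n. padic_abs p (x n)) \<longlonglongrightarrow> 0}"

definition padic_cauchy_ring :: "nat \<Rightarrow> (nat \<Rightarrow> rat) ring" where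
  "padic_cauchy_ring p =
     \<lparr>carrier = padic_cauchy p,
      monoid.mult = (\<lambda>x y n. x n * y n), monoid.one = (\<lambda>n. 1),
      ring.zero = (\<lambda>n. 0), ring.add = (\<lambda>x y n. x n + y n)\<rparr>"

text \<open>The completion of the rationals: Cauchy sequences modulo null sequences.\<close>

definition padic_field :: "nat \<Rightarrow> (nat \<Rightarrow> rat) set ring" where
  "padic_field p = padic_cauchy_ring p Quot padic_null p"

text \<open>The closed unit ball: the classes of Cauchy sequences whose terms have absolute value
  at most 1.\<close>

definition padic_ints :: "nat \<Rightarrow> (nat \<Rightarrow> rat) set set" where
  "padic_ints p = {Z \<in> carrier (padic_field p). \<exists>x\<in>Z. \<forall>n. padic_abs p (x n) \<le> 1}"

definition galois_group :: "('a, 'b) ring_scheme \<Rightarrow> 'a set \<Rightarrow> ('a \<Rightarrow> 'a) monoid" where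
  "galois_group F K =
     BijGroup (carrier F)
       \<lparr>carrier := {\<sigma> \<in> Bij (carrier F). \<sigma> \<in> ring_hom F F \<and> (\<forall>x\<in>K. \<sigma> x = x)}\<rparr>"

definition fixed_field :: "('a, 'b) ring_scheme \<Rightarrow> ('a \<Rightarrow> 'a) set \<Rightarrow> 'a set" where
  "fixed_field F H = {x \<in> carrier F. \<forall>\<sigma>\<in>H. \<sigma> x = x}"

definition galois_extension :: "('a, 'b) ring_scheme \<Rightarrow> 'a set \<Rightarrow> bool" where
  "galois_extension F K \<longleftrightarrow>
     field F \<and> subfield K F \<and>
     (\<forall>x\<in>carrier F. ring.algebraic F K x) \<and>
     fixed_field F (carrier (galois_group F K)) = K"

definition krull_topology :: "('a, 'b) ring_scheme \<Rightarrow> 'a set \<Rightarrow> ('a \<Rightarrow> 'a) topology" where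
  "krull_topology F K =
     topology_generated_by
       {\<sigma> <#\<^bsub>galois_group F K\<^esub> carrier (galois_group F E) | \<sigma> E.
          \<sigma> \<in> carrier (galois_group F K) \<and>
          subfield E F \<and> K \<subseteq> E \<and> ring.finite_dimension F K E}"

definition profinite_group :: "('g, 'm) monoid_scheme \<Rightarrow> 'g topology \<Rightarrow> bool" where
  "profinite_group G T \<longleftrightarrow>
     group G \<and> topspace T = carrier G \<and>
     continuous_map (prod_topology T T) T (\<lambda>(x, y). x \<otimes>\<^bsub>G\<^esub> y) \<and>
     continuous_map T T (\<lambda>x. inv\<^bsub>G\<^esub> x) \<and>
     compact_space T \<and> Hausdorff_space T \<and>
     (\<forall>U. openin T U \<and> \<one>\<^bsub>G\<^esub> \<in> U \<longrightarrow> (\<exists>H. subgroup H G \<and> openin T H \<and> H \<subseteq> U))"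

definition pro_p_group :: "nat \<Rightarrow> ('g, 'm) monoid_scheme \<Rightarrow> 'g topology \<Rightarrow> bool" where
  "pro_p_group p G T \<longleftrightarrow>
     profinite_group G T \<and>
     (\<forall>N. N \<lhd> G \<and> openin T N \<longrightarrow> (\<exists>k. card (rcosets\<^bsub>G\<^esub> N) = p ^ k))"

definition torsionfree_group :: "('g, 'm) monoid_scheme \<Rightarrow> bool" where
  "torsionfree_group G \<longleftrightarrow>
     (\<forall>g\<in>carrier G. \<forall>n::nat. n > 0 \<and> g [^]\<^bsub>G\<^esub> n = \<one>\<^bsub>G\<^esub> \<longrightarrow> g = \<one>\<^bsub>G\<^esub>)"

text \<open>The rank of a profinite group is the supremum, over its closed subgroups, of the
  minimal number of topological generators.\<close>

definition finite_rank :: "('g, 'm) monoid_scheme \<Rightarrow> 'g topology \<Rightarrow> bool" where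
  "finite_rank G T \<longleftrightarrow>
     (\<exists>r. \<forall>H. subgroup H G \<and> closedin T H \<longrightarrow>
        (\<exists>S\<subseteq>H. finite S \<and> card S \<le> r \<and> T closure_of (generate G S) = H))"

definition integral_closure :: "('a, 'b) ring_scheme \<Rightarrow> 'a set \<Rightarrow> 'a set \<Rightarrow> 'a set" where
  "integral_closure F A B =
     {x \<in> B. \<exists>q. polynomial\<^bsub>F\<^esub> A q \<and> q \<noteq> [] \<and> lead_coeff q = \<one>\<^bsub>F\<^esub> \<and>
                 ring.eval F q x = \<zero>\<^bsub>F\<^esub>}"

text \<open>Meant for a discrete valuation ring, where there is only one maximal ideal.\<close>

definition uniformizer :: "('a, 'b) ring_scheme \<Rightarrow> 'a \<Rightarrow> bool" where
  "uniformizer R \<pi> \<longleftrightarrow> \<pi> \<in> carrier R \<and> maximalideal (PIdl\<^bsub>R\<^esub> \<pi>) R"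

definition free_module_of_rank ::
    "('r, 'c) ring_scheme \<Rightarrow> ('r, 'm, 'd) module_scheme \<Rightarrow> nat \<Rightarrow> bool" where
  "free_module_of_rank R M n \<longleftrightarrow>
     module R M \<and>
     (\<exists>B\<subseteq>carrier M. finite B \<and> card B = n \<and>
        (\<forall>m\<in>carrier M. \<exists>!c. c \<in> B \<rightarrow>\<^sub>E carrier R \<and>
           m = (\<Oplus>\<^bsub>M\<^esub>b\<in>B. c b \<odot>\<^bsub>M\<^esub> b)))"

text \<open>For a finite group, so that all functions have finite support.\<close>

definition finite_group_ring ::
    "('a, 'b) ring_scheme \<Rightarrow> ('g, 'm) monoid_scheme \<Rightarrow> ('g \<Rightarrow> 'a) ring" where
  "finite_group_ring R G =
     \<lparr>carrier = carrier G \<rightarrow>\<^sub>E carrier R,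
      monoid.mult = (\<lambda>a b. \<lambda>g\<in>carrier G. \<Oplus>\<^bsub>R\<^esub>h\<in>carrier G. a h \<otimes>\<^bsub>R\<^esub> b (inv\<^bsub>G\<^esub> h \<otimes>\<^bsub>G\<^esub> g)),
      monoid.one = (\<lambda>g\<in>carrier G. if g = \<one>\<^bsub>G\<^esub> then \<one>\<^bsub>R\<^esub> else \<zero>\<^bsub>R\<^esub>),
      ring.zero = (\<lambda>g\<in>carrier G. \<zero>\<^bsub>R\<^esub>),
      ring.add = (\<lambda>a b. \<lambda>g\<in>carrier G. a g \<oplus>\<^bsub>R\<^esub> b g)\<rparr>"

text \<open>All systems below are indexed by the positive integers. An inverse system is given by
  its one-step maps \<open>\<phi> n : R (n + 1) \<rightarrow> R n\<close>, a direct system by all maps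
  \<open>\<phi> m n : R m \<rightarrow> R n\<close> with \<open>m \<le> n\<close>.\<close>

definition inverse_limit_ring ::
    "(nat \<Rightarrow> ('a, 'b) ring_scheme) \<Rightarrow> (nat \<Rightarrow> 'a \<Rightarrow> 'a) \<Rightarrow> (nat \<Rightarrow> 'a) ring" where
  "inverse_limit_ring R \<phi> =
     \<lparr>carrier = {x \<in> (\<Pi>\<^sub>E n\<in>{1..}. carrier (R n)). \<forall>n\<ge>1. \<phi> n (x (Suc n)) = x n},
      monoid.mult = (\<lambda>x y. \<lambda>n\<in>{1..}. x n \<otimes>\<^bsub>R n\<^esub> y n),
      monoid.one = (\<lambda>n\<in>{1..}. \<one>\<^bsub>R n\<^esub>),
      ring.zero = (\<lambda>n\<in>{1..}. \<zero>\<^bsub>R n\<^esub>),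
      ring.add = (\<lambda>x y. \<lambda>n\<in>{1..}. x n \<oplus>\<^bsub>R n\<^esub> y n)\<rparr>"

definition direct_limit_rel ::
    "(nat \<Rightarrow> ('a, 'b) ring_scheme) \<Rightarrow> (nat \<Rightarrow> nat \<Rightarrow> 'a \<Rightarrow> 'a) \<Rightarrow> ((nat \<times> 'a) \<times> (nat \<times> 'a)) set"
  where
  "direct_limit_rel R \<phi> =
     {((m, x), (n, y)) | m x n y.
        m \<ge> 1 \<and> n \<ge> 1 \<and> x \<in> carrier (R m) \<and> y \<in> carrier (R n) \<and>
        (\<exists>l. m \<le> l \<and> n \<le> l \<and> \<phi> m l x = \<phi> n l y)}"

definition direct_limit_map ::
    "(nat \<Rightarrow> ('a, 'b) ring_scheme) \<Rightarrow> (nat \<Rightarrow> nat \<Rightarrow> 'a \<Rightarrow> 'a) \<Rightarrow> nat \<Rightarrow> 'a \<Rightarrow> (nat \<times> 'a) set"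
  where
  "direct_limit_map R \<phi> n x = direct_limit_rel R \<phi> `` {(n, x)}"

text \<open>To add or multiply two classes, push any representatives to any common level. The result
  does not depend on these choices, so the unions below are unions of one repeated class.\<close>

definition direct_limit_ring ::
    "(nat \<Rightarrow> ('a, 'b) ring_scheme) \<Rightarrow> (nat \<Rightarrow> nat \<Rightarrow> 'a \<Rightarrow> 'a) \<Rightarrow> (nat \<times> 'a) set ring"
  where
  "direct_limit_ring R \<phi> =
     \<lparr>carrier = (SIGMA n:{1..}. carrier (R n)) // direct_limit_rel R \<phi>,
      monoid.mult = (\<lambda>c d. \<Union>{direct_limit_map R \<phi> l (\<phi> m l x \<otimes>\<^bsub>R l\<^esub> \<phi> n l y) | l m x n y.
                       (m, x) \<in> c \<and> (n, y) \<in> d \<and> m \<le> l \<and> n \<le> l}),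
      monoid.one = direct_limit_map R \<phi> 1 \<one>\<^bsub>R 1\<^esub>,
      ring.zero = direct_limit_map R \<phi> 1 \<zero>\<^bsub>R 1\<^esub>,
      ring.add = (\<lambda>c d. \<Union>{direct_limit_map R \<phi> l (\<phi> m l x \<oplus>\<^bsub>R l\<^esub> \<phi> n l y) | l m x n y.
                       (m, x) \<in> c \<and> (n, y) \<in> d \<and> m \<le> l \<and> n \<le> l})\<rparr>"

text \<open>In the following definitions \<open>A\<close> is the base ring, \<open>G\<close> the group, \<open>Gn n\<close> the descending sequence
  of normal subgroups, and \<open>on n\<close> the integer ring (a subset of the big field \<open>F\<close>) at level
  \<open>n\<close>.\<close>

text \<open>The image of a coset of \<open>Gn (n + 1)\<close> in \<open>G / Gn n\<close> is the coset containing it.\<close>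

definition iwasawa_trans ::
    "('a, 'b) ring_scheme \<Rightarrow> ('g, 'm) monoid_scheme \<Rightarrow> (nat \<Rightarrow> 'g set) \<Rightarrow>
     nat \<Rightarrow> ('g set \<Rightarrow> 'a) \<Rightarrow> 'g set \<Rightarrow> 'a" where
  "iwasawa_trans A G Gn n a =
     (\<lambda>C\<in>carrier (G Mod Gn n).
        \<Oplus>\<^bsub>A\<^esub>D\<in>{D \<in> carrier (G Mod Gn (Suc n)). D \<subseteq> C}. a D)"

definition iwasawa_algebra ::
    "('a, 'b) ring_scheme \<Rightarrow> ('g, 'm) monoid_scheme \<Rightarrow> (nat \<Rightarrow> 'g set) \<Rightarrow>
     (nat \<Rightarrow> 'g set \<Rightarrow> 'a) ring" where
  "iwasawa_algebra A G Gn =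
     inverse_limit_ring (\<lambda>n. finite_group_ring A (G Mod Gn n)) (iwasawa_trans A G Gn)"

text \<open>\<open>dual_lattice A B\<close> is the set of \<open>A\<close>-linear maps from \<open>B\<close> to \<open>A\<close>, where \<open>B\<close> is an
  \<open>A\<close>-submodule of a ring containing \<open>A\<close>.\<close>

definition dual_lattice :: "('a, 'b) ring_scheme \<Rightarrow> 'a set \<Rightarrow> ('a \<Rightarrow> 'a) set" where
  "dual_lattice A B =
     {f \<in> B \<rightarrow>\<^sub>E carrier A.
        (\<forall>x\<in>B. \<forall>y\<in>B. f (x \<oplus>\<^bsub>A\<^esub> y) = f x \<oplus>\<^bsub>A\<^esub> f y) \<and>
        (\<forall>a\<in>carrier A. \<forall>x\<in>B. f (a \<otimes>\<^bsub>A\<^esub> x) = a \<otimes>\<^bsub>A\<^esub> f x)}"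

text \<open>The contragredient action \<open>(\<sigma> f) x = f (\<sigma>\<inverse> x)\<close>, extended linearly to the group ring of
  \<open>G / N\<close>. If \<open>N\<close> acts trivially on \<open>B\<close>, the image under \<^const>\<open>the_elem\<close> is a singleton: all
  \<open>\<sigma>\<close> in a coset \<open>C\<close> give the same value.\<close>

definition group_ring_act ::
    "('a, 'b) ring_scheme \<Rightarrow> ('a \<Rightarrow> 'a, 'm) monoid_scheme \<Rightarrow> ('a \<Rightarrow> 'a) set \<Rightarrow> 'a set \<Rightarrow>
     (('a \<Rightarrow> 'a) set \<Rightarrow> 'a) \<Rightarrow> ('a \<Rightarrow> 'a) \<Rightarrow> 'a \<Rightarrow> 'a" where
  "group_ring_act A G N B a f =
     (\<lambda>x\<in>B. \<Oplus>\<^bsub>A\<^esub>C\<in>carrier (G Mod N).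
        a C \<otimes>\<^bsub>A\<^esub> the_elem ((\<lambda>\<sigma>. f ((inv\<^bsub>G\<^esub> \<sigma>) x)) ` C))"

text \<open>The fields \<open>mult\<close> and \<open>one\<close> of the module record play no role in a module.\<close>

definition dual_limit_module ::
    "('a, 'b) ring_scheme \<Rightarrow> ('a \<Rightarrow> 'a, 'm) monoid_scheme \<Rightarrow> (nat \<Rightarrow> ('a \<Rightarrow> 'a) set) \<Rightarrow>
     (nat \<Rightarrow> 'a set) \<Rightarrow> (nat \<Rightarrow> ('a \<Rightarrow> 'a) set \<Rightarrow> 'a, nat \<Rightarrow> 'a \<Rightarrow> 'a) module" where
  "dual_limit_module A G Gn on =
     \<lparr>carrier = {f \<in> (\<Pi>\<^sub>E n\<in>{1..}. dual_lattice A (on n)).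
                  \<forall>n\<ge>1. restrict (f (Suc n)) (on n) = f n},
      monoid.mult = undefined, monoid.one = undefined,
      ring.zero = (\<lambda>n\<in>{1..}. \<lambda>x\<in>on n. \<zero>\<^bsub>A\<^esub>),
      ring.add = (\<lambda>f g. \<lambda>n\<in>{1..}. \<lambda>x\<in>on n. f n x \<oplus>\<^bsub>A\<^esub> g n x),
      module.smult = (\<lambda>a f. \<lambda>n\<in>{1..}. group_ring_act A G (Gn n) (on n) (a n) (f n))\<rparr>"

definition red_ideal ::
    "('a, 'b) ring_scheme \<Rightarrow> 'a \<Rightarrow> (nat \<Rightarrow> 'a set) \<Rightarrow> nat \<Rightarrow> 'a set" where
  "red_ideal F \<pi> on n = PIdl\<^bsub>F\<lparr>carrier := on n\<rparr>\<^esub> \<pi>"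

definition red_ring ::
    "('a, 'b) ring_scheme \<Rightarrow> 'a \<Rightarrow> (nat \<Rightarrow> 'a set) \<Rightarrow> nat \<Rightarrow> 'a set ring" where
  "red_ring F \<pi> on n = F\<lparr>carrier := on n\<rparr> Quot red_ideal F \<pi> on n"

text \<open>The map induced by the inclusion \<open>on m \<subseteq> on n\<close>: a union of one repeated coset.\<close>

definition red_trans ::
    "('a, 'b) ring_scheme \<Rightarrow> 'a \<Rightarrow> (nat \<Rightarrow> 'a set) \<Rightarrow> nat \<Rightarrow> nat \<Rightarrow> 'a set \<Rightarrow> 'a set" where
  "red_trans F \<pi> on m n Z = (\<Union>x\<in>Z. red_ideal F \<pi> on n +>\<^bsub>F\<lparr>carrier := on n\<rparr>\<^esub> x)"

definition red_limit ::
    "('a, 'b) ring_scheme \<Rightarrow> 'a \<Rightarrow> (nat \<Rightarrow> 'a set) \<Rightarrow> (nat \<times> 'a set) set ring" where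
  "red_limit F \<pi> on = direct_limit_ring (red_ring F \<pi> on) (red_trans F \<pi> on)"

text \<open>On the class of \<open>(n, Z)\<close>, with \<open>Z\<close> a coset of \<open>red_ideal F \<pi> on n\<close>: if \<open>\<sigma>\<close> fixes \<open>\<pi>\<close> and
  preserves every \<open>on n\<close>, then \<open>\<sigma> ` Z\<close> is again such a coset.\<close>

definition red_limit_act ::
    "('a \<Rightarrow> 'a) \<Rightarrow> (nat \<times> 'a set) set \<Rightarrow> (nat \<times> 'a set) set" where
  "red_limit_act \<sigma> c = (\<lambda>(n, Z). (n, \<sigma> ` Z)) ` c"

definition red_limit_fixed ::
    "('a, 'b) ring_scheme \<Rightarrow> 'a \<Rightarrow> (nat \<Rightarrow> 'a set) \<Rightarrow> ('a \<Rightarrow> 'a) set \<Rightarrow>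
     (nat \<times> 'a set) set ring" where
  "red_limit_fixed F \<pi> on H =
     (red_limit F \<pi> on)
       \<lparr>carrier := {c \<in> carrier (red_limit F \<pi> on). \<forall>\<sigma>\<in>H. red_limit_act \<sigma> c = c}\<rparr>"

definition red_limit_map ::
    "('a, 'b) ring_scheme \<Rightarrow> 'a \<Rightarrow> (nat \<Rightarrow> 'a set) \<Rightarrow> nat \<Rightarrow> 'a set \<Rightarrow> (nat \<times> 'a set) set"
  where
  "red_limit_map F \<pi> on n = direct_limit_map (red_ring F \<pi> on) (red_trans F \<pi> on) n"

end

theory Submission
 imports Defs
begin

text \<open>A function \<open>e : o\<^sub>n \<rightarrow> o\<^sub>L\<close> generates the dual of \<open>o\<^sub>n\<close> over the group ring iff no \<open>x\<close> outside
  \<open>\<pi> o\<^sub>n\<close> satisfies \<open>e (g\<inverse> x) \<in> \<pi> o\<^sub>L\<close> for all \<open>g\<close>; call such an \<open>e\<close> good. As the order of \<open>\<Gamma>/\<Gamma>\<^sub>1\<close> is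
  prime to \<open>p\<close>, the group ring over the residue field is reduced, and a good \<open>e\<close> exists at level 1.
  The elements violating goodness at level \<open>n\<close> form a module for a \<open>p\<close>-group, modulo \<open>\<pi>\<close>, so if there
  are any, there is one that \<open>\<Gamma>\<^sub>1/\<Gamma>\<^sub>n\<close> fixes. Hence an extension of a good \<open>e\<close> stays good at level \<open>n\<close> if the
  fixed elements of \<open>k\<^sub>n\<close> all come from \<open>k\<^sub>1\<close>. Conversely, if \<open>e\<close> is good at both levels and \<open>x\<close> is fixed
  modulo \<open>\<pi>\<close>, some \<open>y\<close> in \<open>o\<^sub>1\<close> has the same values \<open>e (g\<inverse> y)\<close>, and then \<open>x \<equiv> y\<close> modulo \<open>\<pi>\<close>.\<close>

notation monoid.mult (infixl "**\<index>" 70)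

section \<open>Linear algebra over a subfield\<close>

lemma (in abelian_monoid) finsum_remove:
 assumes "finite I" "i : I" "f : I \<rightarrow> carrier G"
 shows "finsum G f I = f i \<oplus> finsum G f (I - {i})"
proof -
 have "finsum G f (insert i (I - {i})) = f i \<oplus> finsum G f (I - {i})"
  using assms by (intro finsum_insert) auto
 then show ?thesis using assms(2) by (simp add: insert_absorb)
qed

lemma (in abelian_monoid) finsum_swap:
 assumes "finite I" "finite J" "!!i j. i : I ==> j : J ==> f i j : carrier G"
 shows "(\<Oplus>i\<in>I. \<Oplus>j\<in>J. f i j) = (\<Oplus>j\<in>J. \<Oplus>i\<in>I. f i j)"
 using assms
proof (induction I)
 case empty then show ?case by simp
next
 case (insert i I)
 have "(\<Oplus>j\<in>J. \<Oplus>i\<in>insert i I. f i j) = (\<Oplus>j\<in>J. f i j \<oplus> (\<Oplus>i\<in>I. f i j))"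
  using insert by (intro finsum_cong') (auto intro!: finsum_insert finsum_closed)
 also have "\<dots> = (\<Oplus>j\<in>J. f i j) \<oplus> (\<Oplus>j\<in>J. \<Oplus>i\<in>I. f i j)"
  using insert by (intro finsum_addf) auto
 finally show ?case using insert by (simp add: Pi_def)
qed

lemma (in abelian_monoid) finsum_fibres:
 assumes "finite I" "finite J" "!!i. i : I ==> h i : J" "f : I \<rightarrow> carrier G"
 shows "finsum G f I = (\<Oplus>j\<in>J. \<Oplus>i\<in>{i : I. h i = j}. f i)"
proof -
 have "I = (\<Union>j\<in>J. {i : I. h i = j})" using assms by auto
 then have "finsum G f I = finsum G f (\<Union>j\<in>J. {i : I. h i = j})" by simp
 also have "\<dots> = (\<Oplus>j\<in>J. \<Oplus>i\<in>{i : I. h i = j}. f i)"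
  using assms by (intro add.finprod_UN_disjoint) (auto simp: pairwise_def disjnt_def)
 finally show ?thesis .
qed

lemma (in abelian_monoid) finsum_single:
 assumes "finite I" "i : I" "f i : carrier G" "!!j. j : I ==> j ~= i ==> f j = \<zero>"
 shows "finsum G f I = f i"
proof -
 have "finsum G f I = f i \<oplus> finsum G f (I - {i})"
  using assms by (intro finsum_remove) (auto, metis zero_closed)
 moreover have "finsum G f (I - {i}) = \<zero>"
  using assms by (intro add.finprod_one_eqI) auto
 ultimately show ?thesis using assms by simp
qed

lemma (in ring) finsum_minus:
 assumes "f : I \<rightarrow> carrier R"
 shows "finsum R (%i. \<ominus> f i) I = \<ominus> finsum R f I"
 using assms by (induction I rule: infinite_finite_induct) (auto simp: minus_add Pi_def add.inv_one)

lemma (in ring) finsum_diff: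
 assumes "f : I \<rightarrow> carrier R" "g : I \<rightarrow> carrier R"
 shows "finsum R (%i. f i \<ominus> g i) I = finsum R f I \<ominus> finsum R g I"
proof -
 have "finsum R (%i. f i \<oplus> \<ominus> g i) I = finsum R f I \<oplus> finsum R (%i. \<ominus> g i) I"
  using assms by (intro finsum_addf) auto
 then show ?thesis using assms by (simp add: finsum_minus a_minus_def)
qed

lemma (in ring) finsum_in_subring:
 assumes "subring A R" "f : I \<rightarrow> A"
 shows "finsum R f I : A"
 using assms(2)
proof (induction I rule: infinite_finite_induct)
 case (insert x F)
 then show ?case using subringE[OF assms(1)] by (subst finsum_insert) auto
qed (auto simp: subringE[OF assms(1)])

lemma (in ring) finsum_subring:
 assumes "subring A R" "f : I \<rightarrow> A"
 shows "finsum (R\<lparr>carrier := A\<rparr>) f I = finsum R f I"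
proof -
 interpret A: ring "R\<lparr>carrier := A\<rparr>" using assms(1) by (rule subring_is_ring)
 show ?thesis using assms(2)
 proof (induction I rule: infinite_finite_induct)
  case (insert x F)
  then show ?case using subringE(1)[OF assms(1)]
   by (subst A.finsum_insert, simp_all) (subst finsum_insert, auto)
 next
  case (infinite F)
  then show ?case by (simp add: finsum_infinite A.finsum_infinite)
 next
  case empty
  then show ?case by (simp add: A.finsum_empty)
 qed
qed

lemma (in field) nonzero_Units: "x : carrier R ==> x ~= \<zero> ==> x : Units R"
 using field_Units by auto

lemma (in field) inv_simps:
 assumes "x : carrier R" "x ~= \<zero>"
 shows "inv x : carrier R" "x ** inv x = \<one>" "inv x ** x = \<one>" "inv x ~= \<zero>"
proof -
 show *: "inv x : carrier R" "x ** inv x = \<one>" "inv x ** x = \<one>"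
  using nonzero_Units[OF assms] by auto
 show "inv x ~= \<zero>" using * assms by force
qed

lemma (in field) subfield_closed:
 assumes "subfield K R" "x : K" "x ~= \<zero>"
 shows "inv x : K"
 using subfield_m_inv(1)[OF assms(1)] assms by auto

lemma (in field) homogeneous_system:
 assumes K: "subfield K R" and "finite J" "finite I" "card J < card I"
  and m: "!!i j. i : I ==> j : J ==> m j i : K"
 shows "EX c. (ALL i:I. c i : K) & (EX i:I. c i ~= \<zero>) & (ALL j:J. (\<Oplus>i\<in>I. m j i ** c i) = \<zero>)"
 using assms(2-)
proof (induction J arbitrary: I m)
 case empty
 then obtain i where "i : I" by fastforce
 then show ?case using subringE[OF subfieldE(1)[OF K]] by (intro exI[of _ "%_. \<one>"]) auto
next
 case (insert j0 J)
 note Ks = subringE[OF subfieldE(1)[OF K]]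
 have Kc: "x : K ==> x : carrier R" for x using Ks(1) by auto
 show ?case
 proof (cases "ALL i:I. m j0 i = \<zero>")
  case True
  obtain c where c: "ALL i:I. c i : K" "EX i:I. c i ~= \<zero>" "ALL j:J. (\<Oplus>i\<in>I. m j i ** c i) = \<zero>"
   using insert.IH[of I m] insert.prems insert.hyps by auto
  have "(\<Oplus>i\<in>I. m j0 i ** c i) = \<zero>"
   using True c(1) by (intro add.finprod_one_eqI) (simp add: Kc)
  with c show ?thesis by auto
 next
  case False
  then obtain i0 where i0: "i0 : I" "m j0 i0 ~= \<zero>" by auto
  define u where "u = inv (m j0 i0)"
  have mK: "m j0 i0 : K" using insert.prems i0 by auto
  have u: "u : K" "m j0 i0 ** u = \<one>"
   using subfield_closed[OF K] inv_simps(2) Kc mK i0 by (auto simp: u_def)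
  define I' where "I' = I - {i0}"
  have I: "I = insert i0 I'" "i0 \<notin> I'" "finite I'" "card J < card I'"
   using i0 insert by (auto simp: I'_def)
  define m' where "m' j i = m j i \<ominus> m j i0 ** (u ** m j0 i)" for j i
  have "EX c. (ALL i:I'. c i : K) & (EX i:I'. c i ~= \<zero>) & (ALL j:J. (\<Oplus>i\<in>I'. m' j i ** c i) = \<zero>)"
   using insert.prems I u Ks by (intro insert.IH) (auto simp: m'_def a_minus_def)
  then obtain c where c: "ALL i:I'. c i : K" "EX i:I'. c i ~= \<zero>"
   "ALL j:J. (\<Oplus>i\<in>I'. m' j i ** c i) = \<zero>" by auto
  define s where "s = (\<Oplus>i\<in>I'. m j0 i ** c i)"
  have mI': "m j i : K" if "j : insert j0 J" "i : I" for i j using insert.prems that by auto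
  have sK: "s : K" unfolding s_def using c mI' I Ks
   by (intro finsum_in_subring[OF subfieldE(1)[OF K]]) auto
  define d where "d = c(i0 := \<ominus> (u ** s))"
  have dK: "d i : K" if "i : I" for i using that c u sK Ks I by (auto simp: d_def)
  have expand: "(\<Oplus>i\<in>I. m j i ** d i) = \<ominus> (m j i0 ** (u ** s)) \<oplus> (\<Oplus>i\<in>I'. m j i ** c i)"
   if j: "j : insert j0 J" for j
  proof -
   have "(\<Oplus>i\<in>I. m j i ** d i) = m j i0 ** d i0 \<oplus> (\<Oplus>i\<in>I'. m j i ** d i)"
    unfolding I(1) using I mI' dK j by (intro finsum_insert) (auto simp: Kc)
   also have "m j i0 ** d i0 = \<ominus> (m j i0 ** (u ** s))"
    using j mI' i0 u sK by (simp add: d_def Kc r_minus)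
   also have "(\<Oplus>i\<in>I'. m j i ** d i) = (\<Oplus>i\<in>I'. m j i ** c i)"
    using I j mI' c by (intro finsum_cong') (auto simp: d_def Kc)
   finally show ?thesis .
  qed
  have "(\<Oplus>i\<in>I. m j i ** d i) = \<zero>" if j: "j : insert j0 J" for j
  proof (cases "j = j0")
   case True
   have "m j0 i0 ** (u ** s) = s" using u sK Kc mK by (simp add: m_assoc[symmetric])
   then show ?thesis using expand[OF j] True sK Kc by (simp add: s_def[symmetric] l_neg)
  next
   case False
   then have j': "j : J" using j by auto
   have "\<zero> = (\<Oplus>i\<in>I'. m' j i ** c i)" using c j' by auto
   also have "\<dots> = (\<Oplus>i\<in>I'. m j i ** c i \<ominus> m j i0 ** u ** (m j0 i ** c i))"
   proof (intro finsum_cong' refl)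
    fix i assume i: "i : I'"
    have h: "m j i : carrier R" "m j i0 : carrier R" "m j0 i : carrier R" "c i : carrier R" "u : carrier R"
     using Kc mI' i j I c u by auto
    then show "m' j i ** c i = m j i ** c i \<ominus> m j i0 ** u ** (m j0 i ** c i)"
     by (simp add: m'_def) algebra
   qed (use mI' I j c u Kc in auto)
   also have "\<dots> = (\<Oplus>i\<in>I'. m j i ** c i) \<ominus> (\<Oplus>i\<in>I'. m j i0 ** u ** (m j0 i ** c i))"
    using mI' I j c u Kc by (intro finsum_diff) auto
   also have "(\<Oplus>i\<in>I'. m j i0 ** u ** (m j0 i ** c i)) = m j i0 ** u ** s"
    unfolding s_def using mI' I j c u Kc by (intro finsum_rdistr[symmetric]) auto
   finally have "(\<Oplus>i\<in>I'. m j i ** c i) \<ominus> m j i0 ** u ** s = \<zero>" by simp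
   moreover have cl: "(\<Oplus>i\<in>I'. m j i ** c i) : carrier R" "m j i0 : carrier R" "u : carrier R" "s : carrier R"
    using mI' I j c u Kc sK by auto
   ultimately have "(\<Oplus>i\<in>I'. m j i ** c i) = m j i0 ** (u ** s)"
    by (simp add: r_right_minus_eq m_assoc)
   then show ?thesis unfolding expand[OF j] using cl by (simp add: l_neg)
  qed
  moreover have "EX i:I. d i ~= \<zero>" using c(2) I by (auto simp: d_def)
  ultimately show ?thesis using dK by (intro exI[of _ d]) auto
 qed
qed

lemma (in field) characters_independent:
 assumes "finite I"
  and mult: "!!i x y. i : I ==> x : E ==> y : E ==> \<chi> i (x ** y) = \<chi> i x ** \<chi> i y"
  and one: "\<one> : E" "!!i. i : I ==> \<chi> i \<one> = \<one>"
  and closed: "!!x y. x : E ==> y : E ==> x ** y : E" "!!i x. i : I ==> x : E ==> \<chi> i x : carrier R"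
  and dist: "!!i j. i : I ==> j : I ==> i ~= j ==> EX x:E. \<chi> i x ~= \<chi> j x"
  and c: "c : I \<rightarrow> carrier R"
  and zero: "!!x. x : E ==> (\<Oplus>i\<in>I. c i ** \<chi> i x) = \<zero>"
 shows "ALL i:I. c i = \<zero>"
 using assms(1,2,4,6-)
proof (induction I arbitrary: c)
 case empty then show ?case by simp
next
 case (insert i0 I)
 note chi = insert.prems(1,2,3) and c = insert.prems(5) and zero = insert.prems(6)
 have exp: "c i0 ** \<chi> i0 x \<oplus> (\<Oplus>i\<in>I. c i ** \<chi> i x) = \<zero>" if "x : E" for x
  using zero[OF that] insert.hyps c that chi(3) by (subst (asm) finsum_insert) (auto simp: Pi_def)
 have ci: "c i = \<zero>" if i: "i : I" for i
 proof -
  obtain y where y: "y : E" "\<chi> i y ~= \<chi> i0 y"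
   using insert.prems(4)[of i i0] i insert.hyps by auto
  have "ALL i:I. c i ** (\<chi> i y \<ominus> \<chi> i0 y) = \<zero>"
  proof (rule insert.IH)
   fix x assume x: "x : E"
   have cl: "c i : carrier R" "\<chi> i x : carrier R" "\<chi> i y : carrier R" if "i : insert i0 I" for i
    using c x y chi that by auto
   let ?S = "\<Oplus>i\<in>I. c i ** \<chi> i x" and ?T = "\<Oplus>i\<in>I. c i ** \<chi> i (x ** y)"
   have ST: "?S : carrier R" "?T : carrier R" using cl closed x y chi by (auto intro!: finsum_closed)
   have "(\<Oplus>i\<in>I. c i ** (\<chi> i y \<ominus> \<chi> i0 y) ** \<chi> i x)
     = (\<Oplus>i\<in>I. c i ** \<chi> i (x ** y) \<ominus> \<chi> i0 y ** (c i ** \<chi> i x))"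
   proof (intro finsum_cong' refl)
    fix i assume i: "i : I"
    then show "c i ** (\<chi> i y \<ominus> \<chi> i0 y) ** \<chi> i x = c i ** \<chi> i (x ** y) \<ominus> \<chi> i0 y ** (c i ** \<chi> i x)"
     using cl[of i] cl[of i0] chi(1)[of i x y] x y by simp algebra
   qed (use cl chi closed x y in auto)
   also have "\<dots> = ?T \<ominus> (\<Oplus>i\<in>I. \<chi> i0 y ** (c i ** \<chi> i x))"
    using cl chi closed x y by (intro finsum_diff) auto
   also have "(\<Oplus>i\<in>I. \<chi> i0 y ** (c i ** \<chi> i x)) = \<chi> i0 y ** ?S"
    using cl insert.hyps by (intro finsum_rdistr[symmetric]) auto
   also have "?T \<ominus> \<chi> i0 y ** ?S = \<zero>"
   proof -
    have "?T \<oplus> c i0 ** (\<chi> i0 x ** \<chi> i0 y) = \<zero>"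
     using exp[of "x ** y"] x y closed chi ST cl[of i0] by (simp add: a_comm)
    then have T: "?T = \<ominus> (c i0 ** (\<chi> i0 x ** \<chi> i0 y))"
     using ST cl[of i0] by (intro sum_zero_eq_neg) auto
    have "?S \<oplus> c i0 ** \<chi> i0 x = \<zero>" using exp[OF x] ST cl[of i0] by (simp add: a_comm)
    then have S: "?S = \<ominus> (c i0 ** \<chi> i0 x)"
     using ST cl[of i0] by (intro sum_zero_eq_neg) auto
    show ?thesis unfolding S T using cl[of i0] by simp algebra
   qed
   finally show "(\<Oplus>i\<in>I. c i ** (\<chi> i y \<ominus> \<chi> i0 y) ** \<chi> i x) = \<zero>" .
  qed (use insert.prems c y in \<open>auto simp: Pi_def\<close>)
  then have "c i ** (\<chi> i y \<ominus> \<chi> i0 y) = \<zero>" using i by auto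
  moreover have "\<chi> i y \<ominus> \<chi> i0 y ~= \<zero>" using y i chi by (simp add: r_right_minus_eq)
  ultimately show ?thesis using integral[of "c i" "\<chi> i y \<ominus> \<chi> i0 y"] c chi y i by (auto simp: Pi_def)
 qed
 have "(\<Oplus>i\<in>I. c i ** \<chi> i \<one>) = \<zero>"
  using ci chi one by (intro add.finprod_one_eqI) auto
 then have "c i0 = \<zero>" using exp[OF one(1)] chi c by (auto simp: Pi_def)
 then show ?case using ci by auto
qed

section \<open>Complete discrete valuation rings\<close>

declare One_nat_def [simp del]

definition scale :: "('a, 'b) ring_scheme => 'a => nat => 'a set => 'a set" where
 "scale R t n M = (%x. t [^]\<^bsub>R\<^esub> n **\<^bsub>R\<^esub> x) ` M"

locale complete_dvr = field R for R (structure) +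
 fixes A :: "'a set" and t :: 'a and K :: "'a set"
 assumes subring_A: "subring A R" and subfield_K: "subfield K R" and A_le_K: "A <= K"
  and t_A: "t : A" and t_nz: "t ~= \<zero>" and inv_t: "inv t \<notin> A"
  and unit_A: "!!x. x : A ==> x \<notin> scale R t 1 A ==> inv x : A"
  and separated_A: "!!x. (!!n. x : scale R t n A) ==> x = \<zero>"
  and complete_A: "!!x. (!!n. x n : A) ==> (!!n. x (Suc n) \<ominus> x n : scale R t n A) ==>
    EX s:A. ALL n. s \<ominus> x n : scale R t n A"
  and fraction_K: "!!x. x : K ==> EX n. t [^] (n::nat) ** x : A"
  and finite_residues: "\<exists>S\<subseteq>A. finite S & (ALL x:A. EX s:S. x \<ominus> s : scale R t 1 A)"
begin

abbreviation tp :: "nat => 'a set => 'a set" where "tp n M \<equiv> scale R t n M"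

lemmas A_closed = subringE(2,3,5,6,7)[OF subring_A]

lemma A_carrier [simp]: "x : A ==> x : carrier R" using subringE(1)[OF subring_A] by auto
lemma K_carrier [simp]: "x : K ==> x : carrier R" using subfieldE(3)[OF subfield_K] by auto
lemma A_K: "x : A ==> x : K" using A_le_K by auto
lemma t_carrier [simp]: "t : carrier R" using t_A by simp
lemma A_minus: "x : A ==> y : A ==> x \<ominus> y : A" using A_closed by (simp add: a_minus_def)
lemma A_pow: "x : A ==> x [^] (n::nat) : A" using A_closed by (induction n) auto
lemma tpow_nz: "t [^] (n::nat) ~= \<zero>" 
proof (induction n)
 case (Suc n) then show ?case using integral[of "t [^] n" t] t_nz by auto
qed simp
lemma t_cancel: "x : carrier R ==> y : carrier R ==> t [^] (n::nat) ** x = t [^] n ** y \<longleftrightarrow> x = y"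
 using m_lcancel[of "t [^] n"] tpow_nz by simp

definition amod :: "'a set => bool" where
 "amod M \<longleftrightarrow> M <= carrier R & \<zero> : M & (ALL x:M. ALL y:M. x \<oplus> y : M) & (ALL a:A. ALL x:M. a ** x : M)"

lemma amodD:
 assumes "amod M"
 shows "x : M ==> x : carrier R" "\<zero> : M" "x : M ==> y : M ==> x \<oplus> y : M"
  "a : A ==> x : M ==> a ** x : M" "x : M ==> \<ominus> x : M" "x : M ==> y : M ==> x \<ominus> y : M"
proof -
 show *: "x : M ==> x : carrier R" "\<zero> : M" "x : M ==> y : M ==> x \<oplus> y : M"
  "a : A ==> x : M ==> a ** x : M" for x y a using assms by (auto simp: amod_def)
 show **: "x : M ==> \<ominus> x : M" for x
  using *(4)[of "\<ominus> \<one>" x] *(1)[of x] A_closed by (simp add: l_minus)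
 show "x : M ==> y : M ==> x \<ominus> y : M" using *(3) ** by (simp add: a_minus_def)
qed

lemma amod_A: "amod A" using A_closed by (auto simp: amod_def)

lemma amod_finsum: "amod M ==> f : I \<rightarrow> M ==> finsum R f I : M"
proof (induction I rule: infinite_finite_induct)
 case (insert x F)
 then show ?case using amodD[of M] by (subst finsum_insert) (auto simp: Pi_def)
qed (auto simp: amodD(2))

lemma amod_scale: assumes "amod M" shows "amod (tp n M)"
proof -
 note M = amodD[OF assms]
 have "\<zero> = t [^] n ** \<zero>" by simp
 then have "\<zero> : tp n M" using M(2) by (force simp: scale_def)
 moreover have "t [^] n ** x \<oplus> t [^] n ** y : tp n M" if "x : M" "y : M" for x y
  using M that by (auto simp: scale_def r_distr[symmetric])
 moreover have "a ** (t [^] n ** x) : tp n M" if "a : A" "x : M" for a x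
 proof -
  have "a ** (t [^] n ** x) = t [^] n ** (a ** x)"
   using M(1) that by (simp add: m_lcomm)
  then show ?thesis using M that by (auto simp: scale_def)
 qed
 ultimately show ?thesis using M unfolding amod_def by (auto simp: scale_def)
qed

lemma scale_0 [simp]: "amod M ==> tp 0 M = M"
 using amodD(1)[of M] by (force simp: scale_def)

lemma scale_scale: "M <= carrier R ==> tp m (tp n M) = tp (m + n) M"
 unfolding scale_def image_image by (intro image_cong refl) (auto simp: nat_pow_mult[symmetric] m_assoc)

lemma scale_subset: assumes "amod M" shows "tp n M <= M"
proof -
 have "t [^] n ** x : M" if "x : M" for x using amodD(4)[OF assms] A_pow[OF t_A] that by auto
 then show ?thesis by (auto simp: scale_def)
qed

lemma scale_mono: "M <= N ==> tp n M <= tp n N" by (auto simp: scale_def)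

lemma scale_antimono: assumes "amod M" "m <= n" shows "tp n M <= tp m M"
proof -
 have "tp n M = tp m (tp (n - m) M)" using assms amodD(1)[OF assms(1)] by (subst scale_scale) auto
 then show ?thesis using scale_subset[OF assms(1)] scale_mono by metis
qed

lemma scaleI: "x : M ==> t [^] n ** x : tp n M" by (auto simp: scale_def)
lemma scale1I: "x : M ==> t ** x : tp 1 M" using scaleI[of x M 1] by simp
lemma scaleE: "x : tp n M ==> (!!y. y : M ==> x = t [^] n ** y ==> P) ==> P" by (auto simp: scale_def)
lemma scale1E: "x : tp 1 M ==> (!!y. y : M ==> x = t ** y ==> P) ==> P" by (auto simp: scale_def)

lemma scale_smult: "amod M ==> a : tp n A ==> x : M ==> a ** x : tp n M"
proof -
 assume *: "amod M" "a : tp n A" "x : M"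
 then obtain b where b: "b : A" "a = t [^] n ** b" by (auto simp: scale_def)
 then have "a ** x = t [^] n ** (b ** x)" using *(3) amodD(1)[OF *(1)] by (simp add: m_assoc)
 then show ?thesis using amodD(4)[OF *(1)] b * by (auto simp: scale_def)
qed

lemma one_notin: "\<one> \<notin> tp 1 A"
proof
 assume "\<one> : tp 1 A"
 then obtain y where y: "y : A" "\<one> = t ** y" by (auto elim: scale1E)
 then have "inv t = y" using t_nz by (metis A_carrier comm_inv_char t_carrier)
 then show False using y inv_t by simp
qed

lemma unit_nz: assumes "x : A" "x \<notin> tp 1 A" shows "x ~= \<zero>"
 using assms amodD(2)[OF amod_scale[OF amod_A]] by auto

lemma unit_cancel: assumes M: "amod M" and x: "x : A" "x \<notin> tp 1 A" and m: "m : carrier R" "x ** m : M"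
 shows "m : M"
proof -
 have "inv x ** (x ** m) = m" using x m unit_nz inv_simps[of x] by (simp add: m_assoc[symmetric])
 then show ?thesis using amodD(4)[OF M unit_A[OF x] m(2)] by simp
qed

lemma tp_prime: assumes "x : A" "y : A" "x ** y : tp 1 A" shows "x : tp 1 A \<or> y : tp 1 A"
 using unit_cancel[OF amod_scale[OF amod_A], of x y] assms by auto

lemma valuation:
 assumes "x : A" "x ~= \<zero>"
 shows "EX n u. x = t [^] (n::nat) ** u & u : A & u \<notin> tp 1 A"
proof -
 obtain n where n: "x \<notin> tp n A" using separated_A assms(2) by blast
 define m where "m = (LEAST n. x \<notin> tp n A)"
 have m: "x \<notin> tp m A" unfolding m_def using n by (rule LeastI)
 have "m ~= 0" using m assms(1) scale_0[OF amod_A] by metis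
 then obtain k where k: "m = Suc k" using not0_implies_Suc by blast
 then have "x : tp k A" using not_less_Least[of k "%n. x \<notin> tp n A"] by (auto simp: m_def)
 then obtain u where u: "u : A" "x = t [^] k ** u" by (auto elim: scaleE)
 moreover have "u \<notin> tp 1 A"
 proof
  assume "u : tp 1 A"
  then have "x : tp k (tp 1 A)" using u by (auto intro: scaleI)
  then show False using m k subringE(1)[OF subring_A] by (simp add: scale_scale One_nat_def)
 qed
 ultimately show ?thesis by auto
qed

lemma finite_common_denominator:
 assumes "finite V" "c : V \<rightarrow> K"
 shows "\<exists>n::nat. ALL x:V. t [^] n ** c x : A"
 using assms
proof (induction V)
 case (insert y V)
 have "c : V \<rightarrow> K" using insert.prems by auto
 then obtain n :: nat where n: "ALL x:V. t [^] n ** c x : A" using insert.IH by auto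
 obtain m where m: "t [^] (m::nat) ** c y : A" using fraction_K[of "c y"] insert by (auto simp: Pi_def)
 have "t [^] (n + m) ** c x : A" if x: "x : insert y V" for x
 proof -
  have cx: "c x : carrier R" using x insert.prems by (auto simp: Pi_def)
  have "t [^] (n + m) ** c x = t [^] n ** (t [^] m ** c x)" "t [^] (n + m) ** c x = t [^] m ** (t [^] n ** c x)"
   using cx by (simp_all add: nat_pow_mult[symmetric] m_assoc m_lcomm)
  then show ?thesis using x n m A_closed(4) A_pow[OF t_A] by (metis insertE)
 qed
 then show ?case by blast
qed auto

definition comb :: "('a => 'a) => 'a set => 'a" where "comb c V = (\<Oplus>x\<in>V. c x ** x)"

definition K_indep :: "'a set => bool" where
 "K_indep V \<longleftrightarrow> finite V & V <= carrier R & (ALL c:V \<rightarrow> K. comb c V = \<zero> --> (ALL x:V. c x = \<zero>))"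

definition t_indep :: "'a set => 'a set => bool" where
 "t_indep D V \<longleftrightarrow> finite V & V <= D & (ALL c:V \<rightarrow> A. comb c V : tp 1 D --> (ALL x:V. c x : tp 1 A))"

definition A_basis :: "'a set => 'a set => bool" where
 "A_basis D V \<longleftrightarrow> finite V & V <= D & (ALL d:D. EX c:V \<rightarrow> A. d = comb c V) & K_indep V"

lemma comb_closed [simp]: "V <= carrier R ==> c : V \<rightarrow> carrier R ==> comb c V : carrier R"
 unfolding comb_def by (intro finsum_closed) auto

lemma comb_amod: "amod D ==> V <= D ==> c : V \<rightarrow> A ==> comb c V : D"
 unfolding comb_def by (intro amod_finsum) (auto simp: amodD(4) Pi_def subset_iff)

lemma comb_scale_amod: "amod D ==> V <= D ==> c : V \<rightarrow> tp n A ==> comb c V : tp n D"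
 unfolding comb_def by (intro amod_finsum amod_scale) (auto simp: scale_smult Pi_def subset_iff)

lemma comb_smult: "finite V ==> V <= carrier R ==> c : V \<rightarrow> carrier R ==> a : carrier R ==>
 a ** comb c V = comb (%x. a ** c x) V"
 unfolding comb_def by (subst finsum_rdistr) (auto intro!: finsum_cong' simp: m_assoc Pi_def subset_iff)

lemma comb_cong: "V <= carrier R ==> d : V \<rightarrow> carrier R ==> (!!x. x : V ==> c x = d x) ==> comb c V = comb d V"
 unfolding comb_def by (intro finsum_cong') auto

lemma comb_add:
 assumes "V <= carrier R" "c : V \<rightarrow> carrier R" "d : V \<rightarrow> carrier R"
 shows "comb (%x. c x \<oplus> d x) V = comb c V \<oplus> comb d V"
proof -
 have "comb (%x. c x \<oplus> d x) V = (\<Oplus>x\<in>V. c x ** x \<oplus> d x ** x)"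
  unfolding comb_def using assms by (intro finsum_cong') (auto simp: l_distr Pi_def subset_iff)
 also have "\<dots> = comb c V \<oplus> comb d V"
  unfolding comb_def using assms by (intro finsum_addf) auto
 finally show ?thesis .
qed

lemma comb_diff:
 assumes "V <= carrier R" "c : V \<rightarrow> carrier R" "d : V \<rightarrow> carrier R"
 shows "comb (%x. c x \<ominus> d x) V = comb c V \<ominus> comb d V"
proof -
 have "comb (%x. c x \<ominus> d x) V = (\<Oplus>x\<in>V. c x ** x \<ominus> d x ** x)"
  unfolding comb_def using assms
  by (intro finsum_cong') (auto simp: l_distr Pi_def subset_iff a_minus_def l_minus)
 also have "\<dots> = comb c V \<ominus> comb d V"
  unfolding comb_def using assms by (intro finsum_diff) auto
 finally show ?thesis .
qed

lemma comb_single: "finite V ==> V <= carrier R ==> x : V ==> comb (%y. if y = x then \<one> else \<zero>) V = x"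
 unfolding comb_def by (subst finsum_single[of _ x]) (auto simp: subset_iff)

lemma comb_insert: "finite V ==> x \<notin> V ==> insert x V <= carrier R ==> c : insert x V \<rightarrow> carrier R ==>
 comb c (insert x V) = c x ** x \<oplus> comb c V"
 unfolding comb_def by (subst finsum_insert) auto

lemma t_indep_K_indep:
 assumes D: "amod D" and V: "t_indep D V"
 shows "K_indep V"
proof -
 have fin: "finite V" and XD: "V <= D" and ind: "!!c. c : V \<rightarrow> A ==> comb c V : tp 1 D ==> ALL x:V. c x : tp 1 A"
  using V by (auto simp: t_indep_def)
 have Xc: "V <= carrier R" using XD amodD(1)[OF D] by auto
 have A: "ALL x:V. c x : tp n A" if "c : V \<rightarrow> A" "comb c V = \<zero>" for n c
  using that
 proof (induction n arbitrary: c)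
  case 0 then show ?case using amod_A by auto
 next
  case (Suc n)
  have "ALL x:V. c x : tp 1 A" using ind Suc.prems amodD(2)[OF amod_scale[OF D]] by auto
  then have "ALL x:V. EX d. d : A & c x = t ** d" by (auto elim!: scale1E)
  then obtain d where d: "ALL x:V. d x : A & c x = t ** d x" by metis
  have "t ** comb d V = comb (%x. t ** d x) V" using d fin Xc by (intro comb_smult) auto
  also have "\<dots> = \<zero>" using Suc.prems(2) comb_cong[OF Xc, of "%x. t ** d x" c] d Suc.prems(1)
   by (auto simp: Pi_def)
  finally have "comb d V = \<zero>" using integral[of t "comb d V"] t_nz Xc d by auto
  then have "ALL x:V. d x : tp n A" using Suc.IH[of d] d by auto
  then have "ALL x:V. c x : tp 1 (tp n A)" using d by (auto intro: scale1I)
  then show ?case using subringE(1)[OF subring_A] by (simp add: scale_scale One_nat_def)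
 qed
 show ?thesis unfolding K_indep_def
 proof (intro conjI fin Xc ballI impI)
  fix c x assume c: "c : V \<rightarrow> K" "comb c V = \<zero>" and x: "x : V"
  obtain n where n: "ALL x:V. t [^] (n::nat) ** c x : A" using finite_common_denominator[OF fin c(1)] by auto
  have "comb (%x. t [^] n ** c x) V = t [^] n ** comb c V"
   using fin Xc c by (intro comb_smult[symmetric]) (auto simp: Pi_def)
  then have "comb (%x. t [^] n ** c x) V = \<zero>" using c by simp
  then have "t [^] n ** c x = \<zero>" using A[of "%x. t [^] n ** c x"] n x by (intro separated_A) auto
  then show "c x = \<zero>" using integral[of "t [^] n" "c x"] tpow_nz c x by (auto simp: Pi_def)
 qed
qed

lemma K_indep_unique:
 assumes "K_indep V" "c : V \<rightarrow> K" "d : V \<rightarrow> K" "comb c V = comb d V" "x : V"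
 shows "c x = d x"
proof -
 have V: "V <= carrier R" using assms by (auto simp: K_indep_def)
 have cd: "c : V \<rightarrow> carrier R" "d : V \<rightarrow> carrier R" using assms by (auto simp: Pi_def)
 have "comb (%x. c x \<ominus> d x) V = \<zero>" using comb_diff[OF V cd] assms(4) V cd by simp
 moreover have "(%x. c x \<ominus> d x) : V \<rightarrow> K" using assms subringE(5,7)[OF subfieldE(1)[OF subfield_K]]
  by (auto simp: a_minus_def Pi_def)
 ultimately have "c x \<ominus> d x = \<zero>" using assms unfolding K_indep_def by blast
 then show ?thesis using cd assms(5) by (auto simp: Pi_def)
qed

lemma A_basis_t_indep:
 assumes "amod D" "A_basis D V" shows "t_indep D V"
 unfolding t_indep_def
proof (intro conjI ballI impI)
 show "finite V" "V <= D" using assms by (auto simp: A_basis_def)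
 fix c x assume c: "c : V \<rightarrow> A" "comb c V : tp 1 D" and x: "x : V"
 have Xc: "V <= carrier R" using \<open>V <= D\<close> amodD(1)[OF assms(1)] by auto
 obtain d where d: "d : D" "comb c V = t ** d" using c by (auto elim: scale1E)
 then obtain e where e: "e : V \<rightarrow> A" "d = comb e V" using assms by (auto simp: A_basis_def)
 have "comb c V = comb (%x. t ** e x) V"
  unfolding d e using comb_smult[OF \<open>finite V\<close> Xc] e by (auto simp: Pi_def)
 moreover have "K_indep V" using assms by (auto simp: A_basis_def)
 ultimately have "c x = t ** e x"
  using K_indep_unique[of V c "%x. t ** e x" x] c(1) e(1) x A_closed(4)[OF t_A] by (auto simp: A_K Pi_def)
 then show "c x : tp 1 A" using e x by (auto intro: scale1I)
qed

lemma t_indep_extend: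
 assumes D: "amod D" and bound: "!!V. V <= D ==> K_indep V ==> card V <= N" and V: "t_indep D V"
 shows "EX Y. V <= Y & t_indep D Y & (ALL y:D - Y. \<not> t_indep D (insert y Y))"
 using V
proof (induction "N - card V" arbitrary: V rule: less_induct)
 case less
 show ?case
 proof (cases "ALL y:D - V. \<not> t_indep D (insert y V)")
  case True then show ?thesis using less.prems by auto
 next
  case False
  then obtain y where y: "y : D - V" "t_indep D (insert y V)" by auto
  have "card (insert y V) <= N" using bound[of "insert y V"] y t_indep_K_indep[OF D] by (auto simp: t_indep_def)
  moreover have "card (insert y V) = Suc (card V)" using y less.prems by (auto simp: t_indep_def)
  ultimately have "N - card (insert y V) < N - card V" by linarith
  then obtain Y where "insert y V <= Y & t_indep D Y & (ALL y:D - Y. \<not> t_indep D (insert y Y))"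
   using less.hyps[of "insert y V"] y by auto
  then show ?thesis by auto
 qed
qed

lemma maximal_t_indep_step:
 assumes D: "amod D" and Y: "t_indep D Y" and max: "!!y. y : D - Y ==> \<not> t_indep D (insert y Y)" and d: "d : D"
 shows "EX c:Y \<rightarrow> A. d \<ominus> comb c Y : tp 1 D"
proof (cases "d : Y")
 case True
 have Y': "finite Y" "Y <= carrier R" using Y amodD(1)[OF D] by (auto simp: t_indep_def)
 show ?thesis
 proof (intro bexI)
  show "d \<ominus> comb (%y. if y = d then \<one> else \<zero>) Y : tp 1 D"
   using comb_single[OF Y' True] amodD(1)[OF D d] amodD(2)[OF amod_scale[OF D]] by (simp add: a_minus_def r_neg)
  show "(%y. if y = d then \<one> else \<zero>) : Y \<rightarrow> A" using A_closed by auto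
 qed
next
 case False
 have Y': "finite Y" "Y <= carrier R" "Y <= D" using Y amodD(1)[OF D] by (auto simp: t_indep_def)
 note dc = amodD(1)[OF D d] and tD = amodD[OF amod_scale[OF D]]
 obtain a where a: "a : insert d Y \<rightarrow> A" "comb a (insert d Y) : tp 1 D" "EX x:insert d Y. a x \<notin> tp 1 A"
  using max[of d] False d Y' by (auto simp: t_indep_def)
 have ins: "comb a (insert d Y) = a d ** d \<oplus> comb a Y"
  using Y' False dc a by (intro comb_insert) (auto simp: Pi_def)
 have aY: "a : Y \<rightarrow> A" "a d : A" "a d : carrier R" and cY: "comb a Y : carrier R" using a Y' by (auto simp: Pi_def)
 have ad: "a d \<notin> tp 1 A"
 proof
  assume *: "a d : tp 1 A"
  then have "a d ** d : tp 1 D" using scale_smult[OF D] d by auto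
  then have "comb a (insert d Y) \<ominus> a d ** d : tp 1 D" using a tD(6) by auto
  moreover have "comb a (insert d Y) \<ominus> a d ** d = comb a Y" unfolding ins using cY aY dc by algebra
  ultimately have "ALL x:Y. a x : tp 1 A" using Y aY by (auto simp: t_indep_def)
  then show False using a(3) * by auto
 qed
 let ?u = "inv (a d)"
 have u: "?u : A" "?u ** a d = \<one>" using unit_A ad aY inv_simps[of "a d"] unit_nz by auto
 have "d \<ominus> comb (%x. \<ominus> (?u ** a x)) Y = ?u ** comb a (insert d Y)"
 proof -
  have "comb (%x. \<ominus> (?u ** a x)) Y = comb (%x. \<ominus> ?u ** a x) Y"
   using Y' aY u by (intro comb_cong) (auto simp: l_minus Pi_def)
  also have "\<dots> = \<ominus> ?u ** comb a Y" using Y' aY u by (intro comb_smult[symmetric]) (auto simp: Pi_def)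
  finally have 1: "comb (%x. \<ominus> (?u ** a x)) Y = \<ominus> ?u ** comb a Y" .
  have "?u ** (a d ** d \<oplus> comb a Y) = (?u ** a d) ** d \<oplus> ?u ** comb a Y"
   using u(1) aY cY dc by (simp add: r_distr m_assoc)
  then show ?thesis unfolding ins 1 u(2) using u(1) cY dc by (simp add: a_minus_def l_minus)
 qed
 moreover have "?u ** comb a (insert d Y) : tp 1 D" using tD(4) u a by auto
 moreover have "(%x. \<ominus> (?u ** a x)) : Y \<rightarrow> A" using u aY A_closed by auto
 ultimately show ?thesis by (intro bexI[of _ "%x. \<ominus> (?u ** a x)"]) auto
qed

lemma maximal_t_indep_basis:
 assumes D: "amod D" and sep: "!!x. (!!n. x : tp n D) ==> x = \<zero>"
  and Y: "t_indep D Y" and max: "!!y. y : D - Y ==> \<not> t_indep D (insert y Y)"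
 shows "A_basis D Y"
 unfolding A_basis_def
proof (intro conjI ballI)
 show fin: "finite Y" and YD: "Y <= D" using Y by (auto simp: t_indep_def)
 show "K_indep Y" using t_indep_K_indep[OF D Y] .
 have Yc: "Y <= carrier R" using YD amodD(1)[OF D] by auto
 fix d assume d: "d : D"
 have "EX c r. c : Y \<rightarrow> A & r : D & e \<ominus> comb c Y = t ** r" if "e : D" for e
  using maximal_t_indep_step[OF D Y max that] by (auto elim!: scale1E)
 then obtain c r where cr: "!!e. e : D ==> c e : Y \<rightarrow> A" "!!e. e : D ==> r e : D"
  "!!e. e : D ==> e \<ominus> comb (c e) Y = t ** r e" by metis
 define e where "e n = (r ^^ n) d" for n
 have e: "e n : D" for n by (induction n) (auto simp: e_def d cr)
 have e0: "e 0 = d" by (simp add: e_def)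
 have eS: "e n = comb (c (e n)) Y \<oplus> t ** e (Suc n)" for n
 proof -
  have "t ** e (Suc n) = e n \<ominus> comb (c (e n)) Y" using cr(3)[OF e[of n]] by (simp add: e_def)
  moreover have "e n : carrier R" "comb (c (e n)) Y : carrier R"
   using amodD(1)[OF D] e comb_amod[OF D YD cr(1)[OF e]] by auto
  ultimately show ?thesis by (simp) algebra
 qed
 define x where "x n y = (\<Oplus>k\<in>{..<n}. t [^] k ** c (e k) y)" for n :: nat and y
 have ce: "c (e k) y : A" if "y : Y" for k y using cr(1)[OF e] that by auto
 have xA: "x n y : A" if "y : Y" for n y unfolding x_def using ce[OF that] A_pow[OF t_A] A_closed
  by (intro amod_finsum amod_A) auto
 have xS: "x (Suc n) y = t [^] n ** c (e n) y \<oplus> x n y" if "y : Y" for n y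
  unfolding x_def lessThan_Suc using ce[OF that] by (intro finsum_insert) auto
 have "x (Suc n) y \<ominus> x n y : tp n A" if y: "y : Y" for n y
 proof -
  have "x (Suc n) y \<ominus> x n y = t [^] n ** c (e n) y"
   unfolding xS[OF y] using A_carrier[OF xA[OF y, of n]] A_carrier[OF ce[OF y, of n]] nat_pow_closed[OF t_carrier, of n]
   by algebra
  then show ?thesis using ce[OF y] by (auto intro: scaleI)
 qed
 then have "EX s:A. ALL n. s \<ominus> x n y : tp n A" if "y : Y" for y
  using complete_A[of "%n. x n y"] xA that by auto
 then obtain s where s: "!!y. y : Y ==> s y : A" "!!y n. y : Y ==> s y \<ominus> x n y : tp n A" by metis
 have dn: "d = comb (x n) Y \<oplus> t [^] n ** e n" for n
 proof (induction n)
  case 0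
  have "comb (x 0) Y = \<zero>" unfolding comb_def using Yc by (intro add.finprod_one_eqI) (auto simp: x_def)
  then show ?case using amodD(1)[OF D d] e0 by simp
 next
  case (Suc n)
  have cl: "comb (x n) Y : carrier R" "comb (c (e n)) Y : carrier R" "e (Suc n) : carrier R" "t [^] n : carrier R"
   using Yc xA ce amodD(1)[OF D] e by (auto simp: Pi_def)
  have "comb (x (Suc n)) Y = comb (%y. t [^] n ** c (e n) y \<oplus> x n y) Y"
   using Yc xA ce by (intro comb_cong) (auto simp: xS)
  also have "\<dots> = comb (%y. t [^] n ** c (e n) y) Y \<oplus> comb (x n) Y"
   using Yc xA ce by (intro comb_add) auto
  also have "comb (%y. t [^] n ** c (e n) y) Y = t [^] n ** comb (c (e n)) Y"
   using Yc ce fin by (intro comb_smult[symmetric]) auto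
  finally have "comb (x (Suc n)) Y \<oplus> t [^] Suc n ** e (Suc n) =
   comb (x n) Y \<oplus> t [^] n ** (comb (c (e n)) Y \<oplus> t ** e (Suc n))"
   unfolding nat_pow_Suc using cl t_carrier by simp (use cl t_carrier in algebra)
  then show ?case using Suc eS[of n] by simp
 qed
 have "d \<ominus> comb s Y : tp n D" for n
 proof -
  have cl: "comb (x n) Y : carrier R" "comb s Y : carrier R" "t [^] n ** e n : carrier R"
   using Yc xA s amodD(1)[OF D] e by (auto simp: Pi_def)
  have "comb (%y. s y \<ominus> x n y) Y = comb s Y \<ominus> comb (x n) Y"
   using Yc xA s by (intro comb_diff) auto
  moreover have "comb (%y. s y \<ominus> x n y) Y : tp n D" using s by (intro comb_scale_amod[OF D YD]) auto
  moreover have "d \<ominus> comb s Y = t [^] n ** e n \<ominus> (comb s Y \<ominus> comb (x n) Y)"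
   using cl by (subst dn[of n]) algebra
  ultimately show ?thesis using amodD(6)[OF amod_scale[OF D], of _ n] scaleI[OF e] by auto
 qed
 then have "d \<ominus> comb s Y = \<zero>" by (rule sep)
 then have "d = comb s Y" using amodD(1)[OF D d] comb_amod[OF D YD, of s] s amodD(1)[OF D] by auto
 then show "EX c:Y \<rightarrow> A. d = comb c Y" using s by (intro bexI[of _ s]) auto
qed

lemma A_basis_complete:
 assumes D: "amod D" and Y: "A_basis D Y"
  and x: "!!n. x n : D" "!!n. x (Suc n) \<ominus> x n : tp n D"
 shows "EX s:D. ALL n. s \<ominus> x n : tp n D"
proof -
 have Y': "finite Y" "Y <= D" "Y <= carrier R" "K_indep Y" using Y amodD(1)[OF D] by (auto simp: A_basis_def)
 have "ALL n. EX c:Y \<rightarrow> A. x n = comb c Y" using x Y by (auto simp: A_basis_def)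
 then obtain c where c: "!!n. c n : Y \<rightarrow> A" "!!n. x n = comb (c n) Y" by metis
 have cA: "c n y : A" if "y : Y" for n y using c(1)[of n] that by auto
 have "c (Suc n) y \<ominus> c n y : tp n A" if y: "y : Y" for n y
 proof -
  obtain d where d: "d : D" "x (Suc n) \<ominus> x n = t [^] n ** d" using x(2) by (auto elim: scaleE)
  then obtain e where e: "e : Y \<rightarrow> A" "d = comb e Y" using Y by (auto simp: A_basis_def)
  have "comb (%y. c (Suc n) y \<ominus> c n y) Y = comb (%y. t [^] n ** e y) Y"
  proof -
   have "comb (%y. c (Suc n) y \<ominus> c n y) Y = comb (c (Suc n)) Y \<ominus> comb (c n) Y"
    using Y' cA by (intro comb_diff) auto
   moreover have "comb (%y. t [^] n ** e y) Y = t [^] n ** comb e Y"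
    using Y' e by (intro comb_smult[symmetric]) (auto simp: Pi_def)
   ultimately show ?thesis using c(2) d e by simp
  qed
  then have "c (Suc n) y \<ominus> c n y = t [^] n ** e y"
   using Y' y e A_minus cA A_closed A_pow[OF t_A]
   by (intro K_indep_unique[of Y "%y. c (Suc n) y \<ominus> c n y" "%y. t [^] n ** e y"]) (auto simp: A_K Pi_def)
  then show ?thesis using e y by (auto intro: scaleI)
 qed
 then have "EX s:A. ALL n. s \<ominus> c n y : tp n A" if "y : Y" for y
  using complete_A[of "%n. c n y"] cA that by auto
 then obtain s where s: "!!y. y : Y ==> s y : A" "!!y n. y : Y ==> s y \<ominus> c n y : tp n A" by metis
 have "comb s Y \<ominus> x n : tp n D" for n
 proof -
  have "comb (%y. s y \<ominus> c n y) Y = comb s Y \<ominus> comb (c n) Y" using Y' cA s by (intro comb_diff) auto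
  moreover have "comb (%y. s y \<ominus> c n y) Y : tp n D" using s Y' by (intro comb_scale_amod[OF D]) auto
  ultimately show ?thesis using c by simp
 qed
 moreover have "comb s Y : D" using comb_amod[OF D] Y' s by auto
 ultimately show ?thesis by blast
qed

end

context complete_dvr
begin

lemma residue_representative:
 "EX \<rho>. (ALL x:A. \<rho> x : A & x \<ominus> \<rho> x : tp 1 A) & (ALL x:A. ALL y:A. \<rho> x = \<rho> y \<longleftrightarrow> x \<ominus> y : tp 1 A) & finite (\<rho> ` A)"
proof -
 note tA = amodD[OF amod_scale[OF amod_A, of 1]]
 obtain S where S: "S <= A" "finite S" "ALL x:A. EX s:S. x \<ominus> s : tp 1 A" using finite_residues by auto
 define \<rho> where "\<rho> x = (SOME s. s : S & x \<ominus> s : tp 1 A)" for x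
 have \<rho>: "\<rho> x : S & x \<ominus> \<rho> x : tp 1 A" if "x : A" for x
  unfolding \<rho>_def using someI_ex[of "%s. s : S & x \<ominus> s : tp 1 A"] S that by auto
 have tr: "x \<ominus> z : tp 1 A" if "x : A" "y : A" "z : A" "x \<ominus> y : tp 1 A" "y \<ominus> z : tp 1 A" for x y z
 proof -
  have "x \<ominus> z = (x \<ominus> y) \<oplus> (y \<ominus> z)" using A_carrier[OF that(1)] A_carrier[OF that(2)] A_carrier[OF that(3)] by algebra
  then show ?thesis using tA(3) that by auto
 qed
 have sy: "y \<ominus> x : tp 1 A" if "x : A" "y : A" "x \<ominus> y : tp 1 A" for x y
 proof -
  have "y \<ominus> x = \<ominus> (x \<ominus> y)" using A_carrier[OF that(1)] A_carrier[OF that(2)] by algebra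
  then show ?thesis using tA(5) that by auto
 qed
 have "\<rho> x = \<rho> y" if "x : A" "y : A" "x \<ominus> y : tp 1 A" for x y
 proof -
  have "(s : S & x \<ominus> s : tp 1 A) = (s : S & y \<ominus> s : tp 1 A)" for s
   using S(1) tr[of x y s] tr[of y x s] sy[of x y] that by auto
  then show ?thesis by (simp add: \<rho>_def)
 qed
 moreover have "x \<ominus> y : tp 1 A" if "x : A" "y : A" "\<rho> x = \<rho> y" for x y
  using tr[of x "\<rho> x" y] \<rho>[of x] \<rho>[of y] sy[of y "\<rho> y"] S(1) that by auto
 moreover have "finite (\<rho> ` A)" using \<rho> S(2) by (auto intro: finite_subset)
 ultimately show ?thesis using \<rho> S(1) by (intro exI[of _ \<rho>]) blast
qed

lemma A_basis_separated:
 assumes D: "amod D" and Y: "A_basis D Y" and x: "!!n. x : tp n D"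
 shows "x = \<zero>"
proof -
 have Y': "finite Y" "Y <= D" "Y <= carrier R" "K_indep Y" using Y amodD(1)[OF D] by (auto simp: A_basis_def)
 have "x : D" using x[of 0] D by simp
 then obtain c where c: "c : Y \<rightarrow> A" "x = comb c Y" using Y by (auto simp: A_basis_def)
 have "c y = \<zero>" if y: "y : Y" for y
 proof (rule separated_A)
  fix n :: nat
  obtain d where d: "d : D" "x = t [^] n ** d" using x[of n] by (auto elim: scaleE)
  obtain e where e: "e : Y \<rightarrow> A" "d = comb e Y" using Y d by (auto simp: A_basis_def)
  have "comb c Y = comb (%y. t [^] n ** e y) Y"
   using c d e comb_smult[of Y e "t [^] n"] Y' by (auto simp: Pi_def)
  then have "c y = t [^] n ** e y"
   using K_indep_unique[of Y c "%y. t [^] n ** e y" y] Y' c(1) e(1) y A_closed(4)[OF A_pow[OF t_A]]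
   by (auto simp: A_K Pi_def)
  then show "c y : tp n A" using e y by (auto intro: scaleI)
 qed
 then show ?thesis unfolding c comb_def using Y' by (intro add.finprod_one_eqI) auto
qed

definition lin :: "'a set => ('a => 'a) => bool" where
 "lin D f \<longleftrightarrow> f : D \<rightarrow> A & (ALL x:D. ALL y:D. f (x \<oplus> y) = f x \<oplus> f y) & (ALL a:A. ALL x:D. f (a ** x) = a ** f x)"

lemma linD:
 assumes "lin D f" "amod D"
 shows "x : D ==> f x : A" "x : D ==> y : D ==> f (x \<oplus> y) = f x \<oplus> f y"
  "a : A ==> x : D ==> f (a ** x) = a ** f x" "f \<zero> = \<zero>"
  "x : D ==> y : D ==> f (x \<ominus> y) = f x \<ominus> f y" "x : tp n D ==> f x : tp n A"
proof -
 show *: "x : D ==> f x : A" "x : D ==> y : D ==> f (x \<oplus> y) = f x \<oplus> f y"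
  "a : A ==> x : D ==> f (a ** x) = a ** f x" for x y a using assms by (auto simp: lin_def)
 note D = amodD[OF assms(2)]
 have "f (\<zero> ** \<zero>) = \<zero> ** f \<zero>" using *(3)[of \<zero> \<zero>] A_closed D by auto
 then show "f \<zero> = \<zero>" using *(1)[of \<zero>] D by simp
 show "x : D ==> y : D ==> f (x \<ominus> y) = f x \<ominus> f y"
 proof -
  assume xy: "x : D" "y : D"
  have "f (x \<oplus> (\<ominus> \<one>) ** y) = f x \<oplus> (\<ominus> \<one>) ** f y"
   using *(2)[of x "(\<ominus> \<one>) ** y"] *(3)[of "\<ominus> \<one>" y] xy D A_closed by auto
  then show ?thesis using xy D(1) *(1) by (simp add: l_minus a_minus_def)
 qed
 show "x : tp n D ==> f x : tp n A"
  by (auto elim!: scaleE simp: *(3) A_pow[OF t_A] *(1) intro!: scaleI)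
qed

lemma lin_comb:
 assumes "lin D f" "amod D" "finite V" "V <= D" "c : V \<rightarrow> A"
 shows "f (comb c V) = (\<Oplus>x\<in>V. c x ** f x)"
 using assms(3-)
proof (induction V)
 case empty then show ?case using linD[OF assms(1,2)] by (simp add: comb_def)
next
 case (insert x V)
 note D = amodD[OF assms(2)] and f = linD[OF assms(1,2)]
 have c: "c x : A" "c : V \<rightarrow> A" "x : D" using insert.prems by auto
 have "comb c (insert x V) = c x ** x \<oplus> comb c V"
  using insert D(1) by (intro comb_insert) (auto simp: Pi_def subset_iff)
 then have "f (comb c (insert x V)) = c x ** f x \<oplus> f (comb c V)"
  using f(2)[of "c x ** x" "comb c V"] f(3)[of "c x" x] c D(4) comb_amod[OF assms(2)] insert.prems by auto
 also have "\<dots> = c x ** f x \<oplus> (\<Oplus>x\<in>V. c x ** f x)" using insert by auto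
 also have "\<dots> = (\<Oplus>x\<in>insert x V. c x ** f x)"
  using insert f(1) c by (intro finsum_insert[symmetric]) (auto simp: Pi_def subset_iff)
 finally show ?case .
qed

text \<open>The reduction modulo \<open>t\<close> of the map \<open>x \<mapsto> (g\<^sub>i x)\<^sub>i\<close> is an injection between finite sets of
  equal cardinality, hence surjective; completeness lifts this to \<open>A\<close>.\<close>

lemma dual_system_surj_mod:
 assumes D: "amod D" and V: "A_basis D V" and I: "finite I" "card I = card V"
  and g: "!!i. i : I ==> lin D (g i)"
  and good: "!!x. x : D ==> (!!i. i : I ==> g i x : tp 1 A) ==> x : tp 1 D"
  and y: "y : I \<rightarrow> A"
 shows "EX x:D. ALL i:I. y i \<ominus> g i x : tp 1 A"
proof -
 obtain \<rho> where \<rho>: "!!x. x : A ==> \<rho> x : A" "!!x. x : A ==> x \<ominus> \<rho> x : tp 1 A"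
  "!!x y. x : A ==> y : A ==> \<rho> x = \<rho> y \<longleftrightarrow> x \<ominus> y : tp 1 A" "finite (\<rho> ` A)"
  using residue_representative by auto
 define T where "T = \<rho> ` A"
 have TA: "T <= A" using \<rho>(1) by (auto simp: T_def)
 have \<rho>T: "\<rho> s = s" if s: "s : T" for s
 proof -
  obtain a where a: "a : A" "s = \<rho> a" using s unfolding T_def by blast
  then have "\<rho> a = \<rho> s" using \<rho> by auto
  then show ?thesis using a by simp
 qed
 have V': "finite V" "V <= D" "V <= carrier R" "t_indep D V"
  using V amodD(1)[OF D] A_basis_t_indep[OF D V] by (auto simp: A_basis_def)
 define \<Phi> where "\<Phi> r = (\<lambda>i\<in>I. \<rho> (g i (comb r V)))" for r
 have cD: "comb r V : D" if "r : V \<rightarrow>\<^sub>E T" for r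
  using comb_amod[OF D V'(2), of r] that TA by auto
 have gA: "g i (comb r V) : A" if "r : V \<rightarrow>\<^sub>E T" "i : I" for r i
  using linD(1)[OF g D] cD that by auto
 have \<Phi>: "\<Phi> r : I \<rightarrow>\<^sub>E T" if "r : V \<rightarrow>\<^sub>E T" for r
  using gA that by (auto simp: \<Phi>_def T_def)
 have "inj_on \<Phi> (V \<rightarrow>\<^sub>E T)"
 proof (rule inj_onI)
  fix r s assume rs: "r : V \<rightarrow>\<^sub>E T" "s : V \<rightarrow>\<^sub>E T" "\<Phi> r = \<Phi> s"
  have rsA: "r : V \<rightarrow> A" "s : V \<rightarrow> A" using rs TA by auto
  have diff: "comb (%x. r x \<ominus> s x) V = comb r V \<ominus> comb s V"
   using rsA V' by (intro comb_diff) (auto simp: Pi_def)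
  have "comb r V \<ominus> comb s V : tp 1 D"
  proof (rule good)
   show "comb r V \<ominus> comb s V : D" using amodD(6)[OF D] cD rs by auto
   fix i assume i: "i : I"
   have "\<rho> (g i (comb r V)) = \<rho> (g i (comb s V))" using fun_cong[OF rs(3), of i] i by (simp add: \<Phi>_def)
   then have "g i (comb r V) \<ominus> g i (comb s V) : tp 1 A" using \<rho>(3) gA rs i by auto
   then show "g i (comb r V \<ominus> comb s V) : tp 1 A" using linD(5)[OF g[OF i] D] cD rs by auto
  qed
  then have "comb (%x. r x \<ominus> s x) V : tp 1 D" unfolding diff .
  moreover have "(%x. r x \<ominus> s x) : V \<rightarrow> A" using rsA A_minus by (auto simp: Pi_def)
  ultimately have "ALL x:V. r x \<ominus> s x : tp 1 A" using V'(4) unfolding t_indep_def by blast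
  then have "ALL x:V. r x = s x" using \<rho>(3) rsA \<rho>T rs by (metis PiE_mem Pi_mem)
  then show "r = s" using rs(1,2) by (auto intro: PiE_ext)
 qed
 moreover have "card (I \<rightarrow>\<^sub>E T) = card (V \<rightarrow>\<^sub>E T)" using I V' by (simp add: card_PiE)
 moreover have "finite (I \<rightarrow>\<^sub>E T)" using I \<rho>(4) by (auto intro: finite_PiE simp: T_def)
 ultimately have "\<Phi> ` (V \<rightarrow>\<^sub>E T) = I \<rightarrow>\<^sub>E T" using \<Phi> by (intro card_subset_eq) (auto simp: card_image)
 moreover have "(\<lambda>i\<in>I. \<rho> (y i)) : I \<rightarrow>\<^sub>E T" using y by (auto simp: T_def)
 ultimately obtain r where r: "r : V \<rightarrow>\<^sub>E T" "\<Phi> r = (\<lambda>i\<in>I. \<rho> (y i))" by (metis imageE)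
 have "y i \<ominus> g i (comb r V) : tp 1 A" if i: "i : I" for i
 proof -
  have "\<rho> (g i (comb r V)) = \<rho> (y i)" using fun_cong[OF r(2), of i] i by (simp add: \<Phi>_def)
  then show ?thesis using \<rho>(3)[of "y i" "g i (comb r V)"] gA r i y by auto
 qed
 then show ?thesis using cD r by auto
qed

lemma dual_system_exists:
 assumes D: "amod D" and V: "A_basis D V" and I: "finite I" "card I = card V"
  and g: "!!i. i : I ==> lin D (g i)"
  and good: "!!x. x : D ==> (!!i. i : I ==> g i x : tp 1 A) ==> x : tp 1 D"
  and y: "y : I \<rightarrow> A"
 shows "EX x:D. ALL i:I. g i x = y i"
proof -
 have step: "EX x z. x : D & z : I \<rightarrow> A & (ALL i:I. y i \<ominus> g i x = t ** z i)" if y: "y : I \<rightarrow> A" for y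
 proof -
  have "EX x:D. ALL i:I. y i \<ominus> g i x : tp 1 A"
   by (rule dual_system_surj_mod[OF D V I _ _ y]) (use g good in blast)+
  then obtain x where x: "x : D" "ALL i:I. y i \<ominus> g i x : tp 1 A" by blast
  then have "ALL i:I. EX z. z : A & y i \<ominus> g i x = t ** z" by (auto elim!: scale1E)
  then obtain z where "ALL i:I. z i : A & y i \<ominus> g i x = t ** z i" by metis
  then show ?thesis using x by (intro exI[of _ x] exI[of _ z]) auto
 qed
 then obtain \<xi> \<zeta> where st: "!!y. y : I \<rightarrow> A ==> \<xi> y : D" "!!y. y : I \<rightarrow> A ==> \<zeta> y : I \<rightarrow> A"
  "!!y i. y : I \<rightarrow> A ==> i : I ==> y i \<ominus> g i (\<xi> y) = t ** \<zeta> y i" by metis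
 define e where "e n = (\<zeta> ^^ n) y" for n
 have e: "e n : I \<rightarrow> A" for n by (induction n) (use y st in \<open>auto simp: e_def\<close>)
 have eA: "e n i : A" if "i : I" for n i using e[of n] that by auto
 define w where "w n = (\<Oplus>k\<in>{..<n}. t [^] k ** \<xi> (e k))" for n :: nat
 have xD: "\<xi> (e k) : D" for k using st(1) e by auto
 have txD: "t [^] k ** \<xi> (e k) : D" for k using amodD(4)[OF D] A_pow[OF t_A] xD by auto
 have wD: "w n : D" for n unfolding w_def using txD by (intro amod_finsum D) auto
 have wS: "w (Suc n) = t [^] n ** \<xi> (e n) \<oplus> w n" for n
  unfolding w_def lessThan_Suc using amodD(1)[OF D txD] by (intro finsum_insert) auto
 have "w (Suc n) \<ominus> w n = t [^] n ** \<xi> (e n)" for n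
  unfolding wS using amodD(1)[OF D wD[of n]] amodD(1)[OF D txD[of n]] by algebra
 then have "w (Suc n) \<ominus> w n : tp n D" for n using scaleI[OF xD] by auto
 then obtain s where s: "s : D" "!!n. s \<ominus> w n : tp n D" using A_basis_complete[of D V w, OF D V wD] by blast
 have yn: "y i \<ominus> g i (w n) = t [^] n ** e n i" if i: "i : I" for i n
 proof (induction n)
  case 0
  have "w 0 = \<zero>" by (simp add: w_def)
  then show ?case using linD(4)[OF g[OF i] D] eA[OF i, of 0] by (simp add: e_def a_minus_def)
 next
  case (Suc n)
  have "g i (w (Suc n)) = t [^] n ** g i (\<xi> (e n)) \<oplus> g i (w n)"
   unfolding wS using linD(2,3)[OF g[OF i] D] txD xD wD A_pow[OF t_A] by auto
  moreover have c: "g i (w n) : carrier R" "y i : carrier R" "g i (\<xi> (e n)) : carrier R" "e n i : carrier R"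
   "e (Suc n) i : carrier R" "t [^] n : carrier R"
   using linD(1)[OF g[OF i] D] wD xD y i eA by (auto simp: Pi_def)
  moreover have "y i \<ominus> (t [^] n ** g i (\<xi> (e n)) \<oplus> g i (w n)) = (y i \<ominus> g i (w n)) \<ominus> t [^] n ** g i (\<xi> (e n))"
   using c(1-3,6) by algebra
  moreover have "t [^] n ** e n i \<ominus> t [^] n ** g i (\<xi> (e n)) = t [^] n ** (e n i \<ominus> g i (\<xi> (e n)))"
   using c(3,4,6) by algebra
  moreover have "e n i \<ominus> g i (\<xi> (e n)) = t ** e (Suc n) i" using st(3)[OF e i] by (simp add: e_def)
  ultimately show ?case using Suc by (simp add: m_assoc)
 qed
 have "g i s = y i" if i: "i : I" for i
 proof -
  have "y i \<ominus> g i s : tp n A" for n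
  proof -
   have c: "g i (w n) : carrier R" "y i : carrier R" "g i s : carrier R"
    using linD(1)[OF g[OF i] D] wD s y i by (auto simp: Pi_def)
   have "g i s \<ominus> g i (w n) : tp n A"
    using linD(5,6)[OF g[OF i] D] s wD by metis
   moreover have "y i \<ominus> g i (w n) : tp n A" using yn[OF i] scaleI[OF eA[OF i]] by auto
   moreover have "y i \<ominus> g i s = (y i \<ominus> g i (w n)) \<ominus> (g i s \<ominus> g i (w n))" using c by algebra
   ultimately show ?thesis using amodD(6)[OF amod_scale[OF amod_A]] by auto
  qed
  then have "y i \<ominus> g i s = \<zero>" by (rule separated_A)
  then show ?thesis using linD(1)[OF g[OF i] D] s y i by (auto simp: Pi_def)
 qed
 then show ?thesis using s by auto
qed

lemma dual_system_unique:
 assumes D: "amod D" and V: "A_basis D V"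
  and g: "!!i. i : I ==> lin D (g i)"
  and good: "!!x. x : D ==> (!!i. i : I ==> g i x : tp 1 A) ==> x : tp 1 D"
  and x: "x : D" "!!i. i : I ==> g i x = \<zero>"
 shows "x = \<zero>"
proof (rule A_basis_separated[OF D V])
 fix n show "x : tp n D" using x
 proof (induction n arbitrary: x)
  case 0 then show ?case using D by simp
 next
  case (Suc n)
  have "x : tp 1 D" using good[of x] Suc.prems amodD(2)[OF amod_scale[OF amod_A]] by auto
  then obtain z where z: "z : D" "x = t ** z" by (auto elim: scale1E)
  have "g i z = \<zero>" if i: "i : I" for i
  proof -
   have "t ** g i z = \<zero>" using Suc.prems(2)[OF i] z linD(3)[OF g[OF i] D t_A] by auto
   then show ?thesis using integral[of t "g i z"] t_nz linD(1)[OF g[OF i] D z(1)] by auto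
  qed
  then have "z : tp n D" using Suc.IH z by auto
  then have "x : tp 1 (tp n D)" using z by (auto intro: scale1I)
  then show ?case using amodD(1)[OF D] by (subst (asm) scale_scale) (auto simp: One_nat_def)
 qed
qed

end

section \<open>Integral extensions\<close>

definition integral_over :: "('a, 'b) ring_scheme => 'a set => 'a => bool" where
 "integral_over R A x \<longleftrightarrow>
   (EX n c. c : {..<n::nat} \<rightarrow> A & x [^]\<^bsub>R\<^esub> n = (\<Oplus>\<^bsub>R\<^esub>i\<in>{..<n}. c i **\<^bsub>R\<^esub> x [^]\<^bsub>R\<^esub> i))"

lemma (in ring) eval_conv_finsum:
 assumes "set q <= carrier R" "x : carrier R"
 shows "eval q x = (\<Oplus>i\<in>{..<length q}. rev q ! i ** x [^] i)"
 using assms(1)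
proof (induction q)
 case (Cons a q)
 have *: "rev q ! i : carrier R" if "i < length q" for i
  using Cons.prems nth_mem[of i "rev q"] that by auto
 have "(\<Oplus>i\<in>{..<length (a # q)}. rev (a # q) ! i ** x [^] i) =
   (rev (a # q) ! length q ** x [^] length q) \<oplus> (\<Oplus>i\<in>{..<length q}. rev (a # q) ! i ** x [^] i)"
 proof -
  have "{..<length (a # q)} = insert (length q) {..<length q}" by auto
  then show ?thesis using Cons.prems assms(2) * by (simp only:, intro finsum_insert) (auto simp: nth_append)
 qed
 also have "(\<Oplus>i\<in>{..<length q}. rev (a # q) ! i ** x [^] i) = (\<Oplus>i\<in>{..<length q}. rev q ! i ** x [^] i)"
  using * assms(2) by (intro finsum_cong') (auto simp: nth_append)
 finally show ?case using Cons by (simp add: nth_append)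
qed simp

lemma (in ring) integral_over_iff_poly:
 assumes A: "subring A R" and x: "x : carrier R" and nz: "\<one> ~= \<zero>"
 shows "integral_over R A x \<longleftrightarrow>
  (EX q. polynomial A q & q ~= [] & lead_coeff q = \<one> & eval q x = \<zero>)"
proof
 note As = subringE[OF A]
 assume "integral_over R A x"
 then obtain n c where c: "c : {..<n::nat} \<rightarrow> A" "x [^] n = (\<Oplus>i\<in>{..<n}. c i ** x [^] i)"
  by (auto simp: integral_over_def)
 define q where "q = \<one> # rev (map (%i. \<ominus> c i) [0..<n])"
 have cA: "c i : A" "c i : carrier R" if "i < n" for i using c As(1) that by auto
 have q: "set q <= A" using cA As by (auto simp: q_def)
 have len: "length q = Suc n" by (simp add: q_def)
 have qi: "rev q ! i = (if i = n then \<one> else \<ominus> c i)" if "i < Suc n" for i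
  using that by (auto simp: q_def nth_append)
 have "eval q x = (\<Oplus>i\<in>{..<Suc n}. rev q ! i ** x [^] i)"
  using eval_conv_finsum[of q x] q As(1) x len by auto
 also have "\<dots> = rev q ! n ** x [^] n \<oplus> (\<Oplus>i\<in>{..<n}. rev q ! i ** x [^] i)"
  unfolding lessThan_Suc using qi cA x by (intro finsum_insert) auto
 also have "(\<Oplus>i\<in>{..<n}. rev q ! i ** x [^] i) = (\<Oplus>i\<in>{..<n}. \<ominus> (c i ** x [^] i))"
  using qi cA x by (intro finsum_cong') (auto simp: l_minus)
 also have "\<dots> = \<ominus> (x [^] n)" unfolding c(2) using cA x by (intro finsum_minus) auto
 finally have "eval q x = \<zero>" using qi[of n] x by (simp add: r_neg)
 moreover have "polynomial A q" "q ~= []" "lead_coeff q = \<one>"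
  using q nz by (auto simp: polynomial_def q_def)
 ultimately show "EX q. polynomial A q & q ~= [] & lead_coeff q = \<one> & eval q x = \<zero>" by blast
next
 note As = subringE[OF A]
 assume "EX q. polynomial A q & q ~= [] & lead_coeff q = \<one> & eval q x = \<zero>"
 then obtain q where q: "polynomial A q" "q ~= []" "lead_coeff q = \<one>" "eval q x = \<zero>" by auto
 then obtain r where r: "q = \<one> # r" by (cases q) auto
 have rA: "set r <= A" using q r by (auto simp: polynomial_def)
 have ri: "rev r ! i : A" "rev r ! i : carrier R" if "i < length r" for i
  using rA nth_mem[of i "rev r"] that As(1) by auto
 have "x [^] length r \<oplus> eval r x = \<zero>" using q r x by simp
 moreover have "eval r x = (\<Oplus>i\<in>{..<length r}. rev r ! i ** x [^] i)"
  using eval_conv_finsum[of r x] rA As(1) x by auto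
 moreover have "(\<Oplus>i\<in>{..<length r}. rev r ! i ** x [^] i) : carrier R" using ri x by (intro finsum_closed) auto
 ultimately have "x [^] length r = \<ominus> (\<Oplus>i\<in>{..<length r}. rev r ! i ** x [^] i)"
  using x by (metis minus_equality minus_minus nat_pow_closed)
 also have "\<dots> = (\<Oplus>i\<in>{..<length r}. \<ominus> (rev r ! i ** x [^] i))"
  using ri x by (intro finsum_minus[symmetric]) auto
 also have "\<dots> = (\<Oplus>i\<in>{..<length r}. \<ominus> (rev r ! i) ** x [^] i)"
  using ri x by (intro finsum_cong') (auto simp: l_minus)
 finally show "integral_over R A x" unfolding integral_over_def using ri As(5)
  by (intro exI[of _ "length r"] exI[of _ "%i. \<ominus> (rev r ! i)"]) auto
qed

lemma (in field) algebraic_imp_integral_over: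
 assumes K: "subfield K R" and x: "x : carrier R" and alg: "algebraic K x"
 shows "integral_over R K x"
proof -
 note Ks = subringE[OF subfieldE(1)[OF K]]
 obtain q where q: "q : carrier (K[X])" "q ~= []" "eval q x = \<zero>"
  using algebraicE[OF subfieldE(1)[OF K] x] alg unfolding over_def by blast
 then have qK: "set q <= K" "lead_coeff q ~= \<zero>" by (auto simp: univ_poly_carrier[symmetric] polynomial_def)
 obtain a r where ar: "q = a # r" using q by (cases q) auto
 have a: "a : K" "a ~= \<zero>" "a : carrier R" using qK ar Ks(1) by auto
 let ?u = "inv a"
 have u: "?u : K" "?u : carrier R" "?u ** a = \<one>"
  using subfield_closed[OF K a(1,2)] inv_simps[OF a(3,2)] by auto
 have rK: "set r <= K" using qK ar by auto
 have ri: "rev r ! i : K" "rev r ! i : carrier R" if "i < length r" for i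
  using rK nth_mem[of i "rev r"] that Ks(1) by auto
 let ?n = "length r"
 have er: "eval r x = (\<Oplus>i\<in>{..<?n}. rev r ! i ** x [^] i)"
  using eval_conv_finsum[of r x] rK Ks(1) x by auto
 have erc: "eval r x : carrier R" unfolding er using ri x by (intro finsum_closed) auto
 have "a ** x [^] ?n \<oplus> eval r x = \<zero>" using q ar by simp
 then have "a ** x [^] ?n = \<ominus> eval r x" using a x erc by (intro sum_zero_eq_neg) auto
 then have "?u ** (a ** x [^] ?n) = ?u ** (\<ominus> eval r x)" by simp
 then have "x [^] ?n = \<ominus> ?u ** eval r x" using u a x erc by (simp add: m_assoc[symmetric] l_minus r_minus)
 also have "\<dots> = (\<Oplus>i\<in>{..<?n}. \<ominus> ?u ** (rev r ! i ** x [^] i))"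
  unfolding er using ri x u by (intro finsum_rdistr) auto
 also have "\<dots> = (\<Oplus>i\<in>{..<?n}. (\<ominus> ?u ** rev r ! i) ** x [^] i)"
  using ri x u by (intro finsum_cong') (auto simp: m_assoc)
 finally show ?thesis unfolding integral_over_def using ri u Ks
  by (intro exI[of _ "?n"] exI[of _ "%i. (\<ominus> ?u ** rev r ! i)"]) auto
qed

context complete_dvr
begin

definition gspan :: "('i => 'a) => 'i set => 'a set" where
 "gspan p I = {\<Oplus>i\<in>I. c i ** p i | c. c : I \<rightarrow> A}"

lemma gspan_min: assumes "amod M" "!!i. i : I ==> p i : M" shows "gspan p I <= M"
 unfolding gspan_def using amodD(4)[OF assms(1)] assms(2)
 by (auto intro!: amod_finsum assms(1) simp: Pi_def)

lemma gspan_amod: assumes "finite I" "!!i. i : I ==> p i : carrier R" shows "amod (gspan p I)"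
 unfolding amod_def
proof (intro conjI ballI)
 show "gspan p I <= carrier R" using assms by (auto simp: gspan_def Pi_def intro!: finsum_closed)
 have "(\<Oplus>i\<in>I. \<zero> ** p i) = \<zero>" using assms by (intro add.finprod_one_eqI) auto
 then show "\<zero> : gspan p I" using A_closed unfolding gspan_def by (intro CollectI exI[of _ "%_. \<zero>"]) auto
 fix x assume "x : gspan p I"
 then obtain c where c: "c : I \<rightarrow> A" "x = (\<Oplus>i\<in>I. c i ** p i)" by (auto simp: gspan_def)
 { fix y assume "y : gspan p I"
  then obtain d where d: "d : I \<rightarrow> A" "y = (\<Oplus>i\<in>I. d i ** p i)" by (auto simp: gspan_def)
  have "(\<Oplus>i\<in>I. (c i \<oplus> d i) ** p i) = (\<Oplus>i\<in>I. c i ** p i \<oplus> d i ** p i)"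
   using c d assms by (intro finsum_cong') (auto simp: l_distr Pi_def)
  also have "\<dots> = x \<oplus> y" unfolding c d using c d assms by (intro finsum_addf) (auto simp: Pi_def)
  finally show "x \<oplus> y : gspan p I" using c d A_closed unfolding gspan_def
   by (intro CollectI exI[of _ "%i. c i \<oplus> d i"]) (auto simp: Pi_def) }
 { fix a assume a: "a : A"
  have "a ** x = (\<Oplus>i\<in>I. a ** (c i ** p i))"
   unfolding c using c a assms by (intro finsum_rdistr) (auto simp: Pi_def)
  also have "\<dots> = (\<Oplus>i\<in>I. (a ** c i) ** p i)"
   using c a assms by (intro finsum_cong') (auto simp: m_assoc Pi_def)
  finally show "a ** x : gspan p I" using c a A_closed unfolding gspan_def
   by (intro CollectI exI[of _ "%i. a ** c i"]) (auto simp: Pi_def) }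
qed

lemma gspan_base: assumes "finite I" "i : I" "!!i. i : I ==> p i : carrier R" shows "p i : gspan p I"
proof -
 have "(\<Oplus>j\<in>I. (if j = i then \<one> else \<zero>) ** p j) = p i"
  using assms by (subst finsum_single[of _ i]) auto
 then show ?thesis using A_closed unfolding gspan_def
  by (intro CollectI exI[of _ "%j. if j = i then \<one> else \<zero>"]) auto
qed

lemma gspan_mono: assumes "finite J" "I <= J" "!!i. i : J ==> p i : carrier R" shows "gspan p I <= gspan p J"
 using gspan_base[of J _ p] assms by (intro gspan_min gspan_amod) auto

text \<open>Noetherianity: choose an element whose coefficient at \<open>p j\<close> has minimal valuation.\<close>

lemma submodule_finitely_generated:
 assumes "finite I" "!!i. i : I ==> p i : carrier R" "amod Q" "Q <= gspan p I"
 shows "EX Y. finite Y & Y <= Q & Q <= gspan (%y. y) Y"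
 using assms
proof (induction I arbitrary: Q)
 case empty
 have "gspan p {} = {\<zero>}" by (auto simp: gspan_def)
 moreover have "\<zero> : gspan (%y. y) {}" by (simp add: gspan_def)
 ultimately show ?case using empty by (intro exI[of _ "{}"]) auto
next
 case (insert j I)
 note Q = amodD[OF insert.prems(2)]
 have aI: "amod (gspan p I)" using insert by (intro gspan_amod) auto
 have dec: "EX c v. c : A & v : gspan p I & q = c ** p j \<oplus> v" if q: "q : Q" for q
 proof -
  obtain c where c: "c : insert j I \<rightarrow> A" "q = (\<Oplus>i\<in>insert j I. c i ** p i)"
   using insert.prems(3) q by (auto simp: gspan_def)
  then have "q = c j ** p j \<oplus> (\<Oplus>i\<in>I. c i ** p i)"
   using insert by (simp, subst finsum_insert) (auto simp: Pi_def)
  then show ?thesis using c unfolding gspan_def by blast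
 qed
 show ?case
 proof (cases "Q <= gspan p I")
  case True then show ?thesis using insert by auto
 next
  case False
  define P where "P n \<longleftrightarrow> (EX u v. u : A & u \<notin> tp 1 A & v : gspan p I & (t [^] n ** u) ** p j \<oplus> v : Q)" for n :: nat
  obtain q where q: "q : Q" "q \<notin> gspan p I" using False by auto
  obtain c v where cv: "c : A" "v : gspan p I" "q = c ** p j \<oplus> v" using dec q by blast
  have "c ~= \<zero>" using cv q amodD(1)[OF aI] insert.prems(1)[of j] by auto
  then obtain n u where "c = t [^] (n::nat) ** u" "u : A" "u \<notin> tp 1 A" using valuation cv by blast
  then have "P n" using cv q unfolding P_def by (intro exI[of _ u] exI[of _ v]) auto
  define m where "m = (LEAST n. P n)"
  have "P m" unfolding m_def using \<open>P n\<close> by (rule LeastI)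
  then obtain u v where uv: "u : A" "u \<notin> tp 1 A" "v : gspan p I" "(t [^] m ** u) ** p j \<oplus> v : Q"
   by (auto simp: P_def)
  define q0 where "q0 = (t [^] m ** u) ** p j \<oplus> v"
  have pj: "p j : carrier R" using insert by auto
  have u: "inv u : A" "u ** inv u = \<one>" using unit_A uv inv_simps[of u] unit_nz by auto
  define Q' where "Q' = Q \<inter> gspan p I"
  have "amod Q'" using Q amodD[OF aI] unfolding amod_def Q'_def by auto
  then obtain Y where Y: "finite Y" "Y <= Q'" "Q' <= gspan (%y. y) Y"
   using insert.IH[of Q'] insert.prems(1) by (auto simp: Q'_def)
  have Yc: "i : insert q0 Y ==> i : carrier R" for i using Q(1) uv Y by (auto simp: q0_def Q'_def)
  have aY: "amod (gspan (%y. y) (insert q0 Y))" using Y(1) Yc by (intro gspan_amod) auto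
  have q0Y: "q0 : gspan (%y. y) (insert q0 Y)" using gspan_base[of "insert q0 Y" q0 "%y. y"] Y Yc by auto
  have "q : gspan (%y. y) (insert q0 Y)" if q: "q : Q" for q
  proof -
   obtain c w where cw: "c : A" "w : gspan p I" "q = c ** p j \<oplus> w" using dec q by blast
   have "EX b:A. c = b ** (t [^] m ** u)"
   proof (cases "c = \<zero>")
    case True then show ?thesis using A_closed uv by (intro bexI[of _ \<zero>]) auto
   next
    case False
    then obtain n e where ne: "c = t [^] (n::nat) ** e" "e : A" "e \<notin> tp 1 A" using valuation cw by blast
    then have "P n" using cw q unfolding P_def by (intro exI[of _ e] exI[of _ w]) auto
    then have "m <= n" unfolding m_def by (rule Least_le)
    then have "t [^] n = t [^] (n - m) ** t [^] m" by (simp add: nat_pow_mult)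
    then have "c = (t [^] (n - m) ** (inv u ** e)) ** (t [^] m ** u)"
    proof -
     have cl: "t [^] (n - m) : carrier R" "t [^] m : carrier R" "u : carrier R" "inv u : carrier R" "e : carrier R"
      using uv u ne by auto
     have "(t [^] (n - m) ** (inv u ** e)) ** (t [^] m ** u) = (t [^] (n - m) ** t [^] m) ** e ** (u ** inv u)"
      using cl by algebra
     then show ?thesis using ne(1) u(2) cl \<open>t [^] n = _\<close> by simp
    qed
    then show ?thesis using A_closed(4) A_pow[OF t_A] u ne
     by (intro bexI[of _ "t [^] (n - m) ** (inv u ** e)"]) auto
   qed
   then obtain b where b: "b : A" "c = b ** (t [^] m ** u)" by auto
   have wc: "w : carrier R" "v : carrier R" using amodD(1)[OF aI] cw uv by auto
   have "q \<ominus> b ** q0 = w \<ominus> b ** v"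
   proof -
    have cl: "b : carrier R" "t [^] m ** u : carrier R" using b uv by auto
    show ?thesis unfolding cw(3) q0_def b(2) using cl wc pj by algebra
   qed
   moreover have "w \<ominus> b ** v : gspan p I" using amodD(4,6)[OF aI] cw uv b(1) by blast
   moreover have "q \<ominus> b ** q0 : Q" using uv(4) b(1) Q(4,6) q unfolding q0_def by blast
   ultimately have "q \<ominus> b ** q0 : Q'" by (simp add: Q'_def)
   then have "q \<ominus> b ** q0 : gspan (%y. y) (insert q0 Y)"
    using Y gspan_mono[of "insert q0 Y" Y "%y. y"] Yc by auto
   moreover have "b ** q0 : gspan (%y. y) (insert q0 Y)" using amodD(4)[OF aY] b q0Y by auto
   moreover have "q = (q \<ominus> b ** q0) \<oplus> b ** q0"
   proof -
    have "q : carrier R" "b : carrier R" "q0 : carrier R" using Q(1) q b uv by (auto simp: q0_def)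
    then show ?thesis by algebra
   qed
   ultimately show ?thesis using amodD(3)[OF aY] by metis
  qed
  moreover have "insert q0 Y <= Q" using Y uv by (auto simp: Q'_def q0_def)
  ultimately show ?thesis using Y(1) by (intro exI[of _ "insert q0 Y"]) auto
 qed
qed

lemma integral_if_powers_bounded:
 assumes I: "finite I" "!!i. i : I ==> p i : carrier R" and z: "z : carrier R"
  and bd: "!!n::nat. z [^] n : gspan p I"
 shows "integral_over R A z"
proof -
 let ?S = "%n::nat. gspan (%i. z [^] i) {..<n}"
 have aS: "amod (?S n)" for n using z by (intro gspan_amod) auto
 have mono: "?S m <= ?S n" if "m <= n" for m n using z that by (intro gspan_mono) auto
 define Q where "Q = (\<Union>n. ?S n)"
 have "amod Q" unfolding amod_def
 proof (intro conjI ballI)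
  show "Q <= carrier R" using amodD(1)[OF aS] unfolding Q_def by blast
  show "\<zero> : Q" using amodD(2)[OF aS] unfolding Q_def by blast
  fix x y assume "x : Q" "y : Q"
  then obtain m n where mn: "x : ?S m" "y : ?S n" unfolding Q_def by blast
  have "?S m <= ?S (max m n)" "?S n <= ?S (max m n)" by (intro mono max.cobounded1 max.cobounded2)+
  then have "x \<oplus> y : ?S (max m n)" using mn by (intro amodD(3)[OF aS]) auto
  then show "x \<oplus> y : Q" unfolding Q_def by blast
 next
  fix a x assume "a : A" "x : Q"
  then show "a ** x : Q" using amodD(4)[OF aS] unfolding Q_def by blast
 qed
 moreover have "?S n <= gspan p I" for n using bd by (intro gspan_min gspan_amod I) auto
 then have "Q <= gspan p I" unfolding Q_def by blast
 ultimately obtain Y where Y: "finite Y" "Y <= Q" "Q <= gspan (%y. y) Y"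
  using submodule_finitely_generated[of I p Q] I by blast
 have "EX N. Y <= ?S N" using Y(1,2)
 proof (induction Y)
  case (insert y Y)
  then obtain N where N: "Y <= ?S N" by blast
  obtain n where n: "y : ?S n" using insert.prems unfolding Q_def by blast
  have "?S N <= ?S (max n N)" "?S n <= ?S (max n N)" by (intro mono max.cobounded1 max.cobounded2)+
  then have "insert y Y <= ?S (max n N)" using N n by blast
  then show ?case by blast
 qed blast
 then obtain N where "Y <= ?S N" by blast
 then have "gspan (%y. y) Y <= ?S N" by (intro gspan_min aS) auto
 moreover have "z [^] N : ?S (Suc N)" using gspan_base[of "{..<Suc N}" N "%i. z [^] i"] z by simp
 then have "z [^] N : Q" unfolding Q_def by blast
 ultimately have "z [^] N : ?S N" using Y by blast
 then obtain c where "c : {..<N} \<rightarrow> A" "z [^] N = (\<Oplus>i\<in>{..<N}. c i ** z [^] i)"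
  unfolding gspan_def by blast
 then show ?thesis unfolding integral_over_def by (intro exI[of _ N] exI[of _ c]) (rule conjI)
qed

lemma integral_sum_prod:
 assumes x: "x : carrier R" "integral_over R A x" and y: "y : carrier R" "integral_over R A y"
 shows "integral_over R A (x \<oplus> y)" "integral_over R A (x ** y)"
proof -
 obtain m c where m: "c : {..<m} \<rightarrow> A" "x [^] m = (\<Oplus>i\<in>{..<m::nat}. c i ** x [^] i)"
  using x by (auto simp: integral_over_def)
 obtain n d where n: "d : {..<n} \<rightarrow> A" "y [^] n = (\<Oplus>i\<in>{..<n::nat}. d i ** y [^] i)"
  using y by (auto simp: integral_over_def)
 define p where "p = (%(i::nat, j::nat). x [^] i ** y [^] j)"
 define I where "I = {..<m} \<times> {..<n}"
 have I: "finite I" "!!i. i : I ==> p i : carrier R" using x y by (auto simp: I_def p_def)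
 define P where "P = gspan p I"
 have P: "amod P" unfolding P_def using I by (intro gspan_amod) auto
 note PD = amodD[OF P]
 have pb: "x [^] i ** y [^] j : P" if "i < m" "j < n" for i j
  using gspan_base[of I "(i, j)" p] I that by (auto simp: P_def p_def I_def)
 have mult: "w ** v : P" if w: "w : carrier R" and g: "!!i j. i < m ==> j < n ==> w ** (x [^] i ** y [^] j) : P"
   and v: "v : P" for w v
 proof -
  have "amod {v : carrier R. w ** v : P}" unfolding amod_def
   using w PD by (auto simp: r_distr m_lcomm)
  then have "P <= {v : carrier R. w ** v : P}"
   unfolding P_def[of ] using g I by (intro gspan_min) (auto simp: P_def I_def p_def)
  then show ?thesis using v by auto
 qed
 have xP: "x ** v : P" if "v : P" for v
 proof (rule mult[OF x(1) _ that])
  fix i j assume ij: "i < m" "j < n"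
  show "x ** (x [^] i ** y [^] j) : P"
  proof (cases "Suc i < m")
   case True
   then show ?thesis using pb[of "Suc i" j] ij x y by (simp add: m_assoc m_lcomm m_comm)
  next
   case False
   then have "Suc i = m" using ij by simp
   then have "x ** (x [^] i ** y [^] j) = x [^] m ** y [^] j" using x y
    by (metis (no_types, lifting) m_assoc m_comm nat_pow_Suc nat_pow_closed)
   also have "\<dots> = (\<Oplus>i\<in>{..<m}. c i ** x [^] i ** y [^] j)"
    unfolding m(2) using m(1) x y by (intro finsum_ldistr) (auto simp: Pi_def)
   also have "\<dots> = (\<Oplus>i\<in>{..<m}. c i ** (x [^] i ** y [^] j))"
    using m(1) x y by (intro finsum_cong') (auto simp: Pi_def m_assoc)
   also have "\<dots> : P" using pb[OF _ ij(2)] m(1) PD(4) by (intro amod_finsum[OF P]) (auto simp: Pi_def)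
   finally show ?thesis .
  qed
 qed
 have yP: "y ** v : P" if "v : P" for v
 proof (rule mult[OF y(1) _ that])
  fix i j assume ij: "i < m" "j < n"
  show "y ** (x [^] i ** y [^] j) : P"
  proof (cases "Suc j < n")
   case True
   then show ?thesis using pb[of i "Suc j"] ij x y by (simp add: m_assoc m_lcomm m_comm)
  next
   case False
   then have "Suc j = n" using ij by simp
   then have "y ** (x [^] i ** y [^] j) = y [^] n ** x [^] i" using x y
    by (metis (no_types, lifting) m_assoc m_comm nat_pow_Suc nat_pow_closed)
   also have "\<dots> = (\<Oplus>j\<in>{..<n}. d j ** y [^] j ** x [^] i)"
    unfolding n(2) using n(1) x y by (intro finsum_ldistr) (auto simp: Pi_def)
   also have "\<dots> = (\<Oplus>j\<in>{..<n}. d j ** (x [^] i ** y [^] j))"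
    using n(1) x y by (intro finsum_cong') (auto simp: Pi_def m_ac)
   also have "\<dots> : P" using pb[OF ij(1)] n(1) PD(4) by (intro amod_finsum[OF P]) (auto simp: Pi_def)
   finally show ?thesis .
  qed
 qed
 have oneP: "\<one> : P"
 proof (cases "m = 0 \<or> n = 0")
  case True
  then have "\<one> = \<zero>" using m n by auto
  then show ?thesis by simp
 next
  case False
  then show ?thesis using pb[of 0 0] by simp
 qed
 have powP: "w [^] k : P" if w: "w : carrier R" "!!v. v : P ==> w ** v : P" for w and k :: nat
 proof (induction k)
  case (Suc k) then show ?case using w m_comm[of "w [^] k" w] by simp
 qed (simp add: oneP)
 have "(x \<oplus> y) [^] k : P" for k :: nat using x y xP yP PD(1,3) by (intro powP) (auto simp: l_distr)
 then show "integral_over R A (x \<oplus> y)"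
  using integral_if_powers_bounded[where z = "x \<oplus> y", OF I] x y by (auto simp: P_def)
 have "(x ** y) [^] k : P" for k :: nat using x y xP yP PD(1) by (intro powP) (auto simp: m_assoc)
 then show "integral_over R A (x ** y)"
  using integral_if_powers_bounded[where z = "x ** y", OF I] x y by (auto simp: P_def)
qed

lemma integral_A: assumes "x : A" shows "integral_over R A x"
proof -
 have "x [^] (1::nat) = (\<Oplus>i\<in>{..<1::nat}. x ** x [^] i)" using assms by (simp add: One_nat_def lessThan_Suc)
 then show ?thesis unfolding integral_over_def using assms by (intro exI[of _ 1] exI[of _ "%_. x"]) auto
qed

lemma inv_t_not_integral: "\<not> integral_over R A (inv t)"
proof
 let ?u = "inv t"
 have u: "?u : carrier R" "t ** ?u = \<one>" using inv_simps[OF t_carrier t_nz] by auto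
 assume "integral_over R A ?u"
 then obtain n c where c: "c : {..<n} \<rightarrow> A" "?u [^] n = (\<Oplus>i\<in>{..<n::nat}. c i ** ?u [^] i)"
  by (auto simp: integral_over_def)
 have tu: "t [^] (k::nat) ** ?u [^] k = \<one>" for k using u nat_pow_distrib[of t ?u k] by simp
 have "\<one> = t [^] n ** (\<Oplus>i\<in>{..<n::nat}. c i ** ?u [^] i)" using tu[of n] c by simp
 also have "\<dots> = (\<Oplus>i\<in>{..<n::nat}. t [^] n ** (c i ** ?u [^] i))"
  using c u by (intro finsum_rdistr) (auto simp: Pi_def)
 also have "\<dots> : tp 1 A"
 proof (intro amod_finsum amod_scale amod_A Pi_I)
  fix i assume i: "i : {..<n}"
  have ci: "c i : A" using c i by auto
  have "t [^] n = t [^] (n - i) ** t [^] i" using i by (simp add: nat_pow_mult)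
  then have "t [^] n ** (c i ** ?u [^] i) = t [^] (n - i) ** t [^] i ** (c i ** ?u [^] i)" by simp
  also have "\<dots> = t [^] (n - i) ** c i ** (t [^] i ** ?u [^] i)"
  proof -
   have "t [^] (n - i) : carrier R" "t [^] i : carrier R" "c i : carrier R" "?u [^] i : carrier R" using ci u by auto
   then show ?thesis by algebra
  qed
  also have "\<dots> = t [^] (n - i) ** c i" using tu ci by simp
  finally have "t [^] n ** (c i ** ?u [^] i) : tp (n - i) A" using ci by (auto intro: scaleI)
  then show "t [^] n ** (c i ** ?u [^] i) : tp 1 A" using scale_antimono[OF amod_A, of 1 "n - i"] i
   by (metis One_nat_def Suc_leI lessThan_iff subsetD zero_less_diff)
 qed
 finally show False using one_notin by simp
qed

lemma algebraic_scaled_integral: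
 assumes x: "x : carrier R" "integral_over R K x"
 shows "\<exists>n::nat. integral_over R A (t [^] n ** x)"
proof -
 obtain n c where c: "c : {..<n} \<rightarrow> K" "x [^] n = (\<Oplus>i\<in>{..<n::nat}. c i ** x [^] i)"
  using x by (auto simp: integral_over_def)
 have "\<exists>N::nat. ALL i:{..<n}. t [^] N ** c i : A" using c(1)
 proof (induction n)
  case (Suc n)
  then obtain N where N: "ALL i:{..<n}. t [^] (N::nat) ** c i : A" by (auto simp: Pi_def)
  obtain M where M: "t [^] (M::nat) ** c n : A" using fraction_K[of "c n"] Suc by auto
  have "t [^] (M + N) ** c i : A" if i: "i : {..<Suc n}" for i
  proof -
   have ci: "c i : carrier R" using Suc.prems i K_carrier by (auto simp: Pi_def)
   have "t [^] (M + N) ** c i = t [^] M ** (t [^] N ** c i)" "t [^] (M + N) ** c i = t [^] N ** (t [^] M ** c i)"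
    using ci by (simp_all add: nat_pow_mult[symmetric] m_assoc m_lcomm)
   then show ?thesis using N M i A_closed(4) A_pow[OF t_A] by (metis lessThan_iff less_Suc_eq)
  qed
  then show ?case by blast
 qed auto
 then obtain N :: nat where N: "!!i. i < n ==> t [^] N ** c i : A" by auto
 let ?T = "t [^] N" let ?y = "?T ** x"
 have cc: "c i : carrier R" if "i < n" for i using c(1) that K_carrier by (auto simp: Pi_def)
 define d where "d i = ?T [^] (n - i) ** c i" for i
 have dA: "d i : A" if "i < n" for i
 proof -
  obtain k where k: "n - i = Suc k" using \<open>i < n\<close> by (metis Suc_diff_Suc)
  have "d i = ?T [^] k ** (?T ** c i)" using cc[OF that] by (simp add: d_def k m_assoc)
  then show ?thesis using N[OF that] A_closed(4) A_pow t_A by auto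
 qed
 have "?y [^] n = ?T [^] n ** x [^] n" using x by (simp add: nat_pow_distrib)
 also have "\<dots> = (\<Oplus>i\<in>{..<n}. ?T [^] n ** (c i ** x [^] i))"
  unfolding c(2) using cc x by (intro finsum_rdistr) auto
 also have "\<dots> = (\<Oplus>i\<in>{..<n}. d i ** ?y [^] i)"
 proof (intro finsum_cong' refl)
  fix i assume i: "i : {..<n}"
  have "?T [^] n = ?T [^] (n - i) ** ?T [^] i" using i by (subst nat_pow_mult) auto
  moreover have "?y [^] i = ?T [^] i ** x [^] i" using x by (simp add: nat_pow_distrib)
  moreover have "?T [^] (n - i) : carrier R" "?T [^] i : carrier R" "c i : carrier R" "x [^] i : carrier R"
   using cc i x by auto
  then have "(?T [^] (n - i) ** ?T [^] i) ** (c i ** x [^] i) = (?T [^] (n - i) ** c i) ** (?T [^] i ** x [^] i)"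
   by algebra
  ultimately show "?T [^] n ** (c i ** x [^] i) = d i ** ?y [^] i" by (simp add: d_def)
 qed (use cc dA x in auto)
 finally show ?thesis unfolding integral_over_def using dA by (intro exI[of _ N] exI[of _ n] exI[of _ d]) auto
qed

end

locale dvr_extension = complete_dvr +
 fixes M B :: "'a set"
 assumes subfield_M: "subfield M R" and K_le_M: "K <= M"
  and algebraic_M: "!!x. x : M ==> integral_over R K x"
  and bounded_M: "EX N. ALL V. V <= M --> K_indep V --> card V <= N"
  and B_def: "B = {x : M. integral_over R A x}"
begin

lemma M_carrier [simp]: "x : M ==> x : carrier R" using subfieldE(3)[OF subfield_M] by auto
lemmas M_closed = subringE(2,3,5,6,7)[OF subfieldE(1)[OF subfield_M]]
lemma K_M: "x : K ==> x : M" using K_le_M by auto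
lemma A_B: "x : A ==> x : B" using A_K K_M integral_A by (auto simp: B_def)
lemma B_M: "x : B ==> x : M" by (simp add: B_def)
lemma B_carrier [simp]: "x : B ==> x : carrier R" by (simp add: B_M)

lemma subring_B: "subring B R"
proof (rule subringI)
 show "B <= carrier R" by auto
 show "\<one> : B" using A_B A_closed by auto
 show B: "x ** y : B" "x \<oplus> y : B" if "x : B" "y : B" for x y
  using that integral_sum_prod[of x y] M_closed by (auto simp: B_def)
 show "\<ominus> x : B" if "x : B" for x
  using B(1)[of "\<ominus> \<one>" x] that A_B A_closed by (simp add: l_minus)
qed

lemmas B_closed = subringE(2,3,5,6,7)[OF subring_B]

lemma amod_B: "amod B" unfolding amod_def using B_closed A_B by auto

lemma inv_t_notin_B: "inv t \<notin> B" using inv_t_not_integral by (simp add: B_def)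

lemma scaled_in_B: assumes "x : M" shows "\<exists>n::nat. t [^] n ** x : B"
proof -
 obtain n :: nat where "integral_over R A (t [^] n ** x)"
  using algebraic_scaled_integral[of x] algebraic_M[OF assms] M_carrier[OF assms] by blast
 then show ?thesis using assms M_closed(4) A_K[OF A_pow[OF t_A]] K_M by (auto simp: B_def)
qed

lemma separated_B: assumes "!!n. x : tp n B" shows "x = \<zero>"
proof (rule ccontr)
 assume nz: "x ~= \<zero>"
 have xB: "x : B" using assms[of 0] amod_B by simp
 have u: "inv x : M" "inv x ** x = \<one>" using subfield_closed[OF subfield_M] inv_simps(3)[of x] xB B_M nz by auto
 obtain n :: nat where n: "t [^] n ** inv x : B" using scaled_in_B u by auto
 obtain z where z: "z : B" "x = t [^] Suc n ** z" using assms[of "Suc n"] by (auto elim: scaleE simp del: nat_pow_Suc)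
 let ?T = "t [^] n"
 have c: "?T : carrier R" "inv x : carrier R" "z : carrier R" "t : carrier R" using z u by auto
 have "t ** ((?T ** inv x) ** z) = inv x ** ((?T ** t) ** z)" using c by algebra
 also have "\<dots> = \<one>" using z(2) u(2) by simp
 finally have "t ** ((?T ** inv x) ** z) = \<one>" .
 then have "inv t = (?T ** inv x) ** z" using c by (intro comm_inv_char) auto
 then show False using inv_t_notin_B B_closed(4) n z by auto
qed

lemma t_indep_extends_to_basis:
 assumes "t_indep B V" shows "EX Y. V <= Y & A_basis B Y"
proof -
 obtain N where N: "!!V. V <= B ==> K_indep V ==> card V <= N" using bounded_M B_M by (meson subset_iff)
 obtain Y where Y: "V <= Y" "t_indep B Y" "ALL y:B - Y. \<not> t_indep B (insert y Y)"
  using t_indep_extend[OF amod_B N assms] by auto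
 then show ?thesis using maximal_t_indep_basis[OF amod_B separated_B Y(2)] by blast
qed

lemma basis_exists: "EX Y. A_basis B Y"
proof -
 have "t_indep B {}" by (simp add: t_indep_def)
 then show ?thesis using t_indep_extends_to_basis by blast
qed

lemma basis_spans_M:
 assumes Y: "A_basis B Y" and x: "x : M"
 shows "EX c:Y \<rightarrow> K. x = comb c Y"
proof -
 have Y': "finite Y" "Y <= carrier R" using Y by (auto simp: A_basis_def)
 obtain n where n: "t [^] (n::nat) ** x : B" using scaled_in_B x by auto
 then obtain c where c: "c : Y \<rightarrow> A" "t [^] n ** x = comb c Y" using Y by (auto simp: A_basis_def)
 let ?u = "inv (t [^] n)"
 have u: "?u : carrier R" "?u ** t [^] n = \<one>" "?u : K"
  using inv_simps[of "t [^] n"] tpow_nz subfield_closed[OF subfield_K A_K[OF A_pow[OF t_A]]] by auto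
 have "x = ?u ** comb c Y" unfolding c(2)[symmetric] using u x by (simp add: m_assoc[symmetric])
 also have "\<dots> = comb (%y. ?u ** c y) Y" using c u Y' by (intro comb_smult) (auto simp: Pi_def)
 finally show ?thesis using c u subringE(6)[OF subfieldE(1)[OF subfield_K]] A_K
  by (intro bexI[of _ "%y. ?u ** c y"]) (auto simp: Pi_def)
qed

end

section \<open>The p-adic numbers\<close>

lemma padic_abs_fraction:
 assumes p: "Factorial_Ring.prime p" and ab: "a ~= 0" "b ~= 0"
 shows "padic_abs p (of_int a / of_int b) =
  real p powi (int (multiplicity (int p) b) - int (multiplicity (int p) a))"
proof -
 have pi: "prime_elem (int p)" using p by (simp add: prime_imp_prime_elem)
 define q :: rat where "q = of_int a / of_int b"
 obtain c d where cd: "quotient_of q = (c, d)" by (cases "quotient_of q")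
 have d: "d > 0" using quotient_of_denom_pos[OF cd] .
 have q: "q = of_int c / of_int d" using quotient_of_div[OF cd] .
 have q0: "q ~= 0" using ab by (simp add: q_def)
 then have c0: "c ~= 0" using q by auto
 have "(of_int (a * d) :: rat) = of_int (c * b)" using q ab d by (simp add: q_def field_simps)
 then have "a * d = c * b" by (simp only: of_int_eq_iff)
 then have "multiplicity (int p) (a * d) = multiplicity (int p) (c * b)" by simp
 then have "multiplicity (int p) a + multiplicity (int p) d = multiplicity (int p) c + multiplicity (int p) b"
  using ab c0 d pi by (simp add: prime_elem_multiplicity_mult_distrib)
 then have "int (multiplicity (int p) d) - int (multiplicity (int p) c) =
  int (multiplicity (int p) b) - int (multiplicity (int p) a)" by linarith
 then show ?thesis using q0 cd by (simp add: padic_abs_def q_def)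
qed

lemma rat_fraction:
 fixes q :: rat
 obtains a b :: int where "b ~= 0" "q = of_int a / of_int b"
proof -
 obtain a b where ab: "quotient_of q = (a, b)" by (cases "quotient_of q")
 then show ?thesis using that[of b a] quotient_of_denom_pos[OF ab] quotient_of_div[OF ab] by simp
qed

locale padic =
 fixes p :: nat
 assumes prime_p: "Factorial_Ring.prime p"
begin

lemma p_gt_1: "real p > 1" using prime_gt_1_nat[OF prime_p] by simp
lemma p_nz [simp]: "p ~= 0" using prime_gt_1_nat[OF prime_p] by simp

abbreviation pabs :: "rat => real" where "pabs \<equiv> padic_abs p"

lemma pabs_0 [simp]: "pabs 0 = 0" by (simp add: padic_abs_def)

lemma pabs_pos: "x ~= 0 ==> pabs x > 0" using p_gt_1 by (simp add: padic_abs_def zero_less_power_int)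
lemma pabs_nonneg [simp]: "pabs x >= 0" using pabs_pos[of x] by (cases "x = 0") auto
lemma pabs_eq_0 [simp]: "pabs x = 0 \<longleftrightarrow> x = 0" using pabs_pos[of x] by (cases "x = 0") auto

lemma pabs_mult: "pabs (x * y) = pabs x * pabs y"
proof (cases "x = 0 \<or> y = 0")
 case False
 obtain a b where ab: "b ~= 0" "x = of_int a / of_int b" by (rule rat_fraction)
 obtain c d where cd: "d ~= 0" "y = of_int c / of_int d" by (rule rat_fraction)
 have nz: "a ~= 0" "c ~= 0" using False ab cd by auto
 have pi: "prime_elem (int p)" using prime_p by (simp add: prime_imp_prime_elem)
 have "x * y = of_int (a * c) / of_int (b * d)" using ab cd by simp
 then have "pabs (x * y) = real p powi (int (multiplicity (int p) (b * d)) - int (multiplicity (int p) (a * c)))"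
  using padic_abs_fraction[OF prime_p, of "a * c" "b * d"] ab cd nz by simp
 also have "\<dots> = real p powi ((int (multiplicity (int p) b) - int (multiplicity (int p) a)) +
   (int (multiplicity (int p) d) - int (multiplicity (int p) c)))"
  using ab cd nz pi by (simp add: prime_elem_multiplicity_mult_distrib algebra_simps)
 also have "\<dots> = pabs x * pabs y"
  using padic_abs_fraction[OF prime_p, of a b] padic_abs_fraction[OF prime_p, of c d] ab cd nz p_gt_1
  by (simp add: power_int_add)
 finally show ?thesis .
qed auto

lemma pabs_1 [simp]: "pabs 1 = 1"
 using padic_abs_fraction[OF prime_p, of 1 1] by simp

lemma pabs_minus [simp]: "pabs (- x) = pabs x"
proof -
 have "pabs (- 1) * pabs (- 1) = 1" using pabs_mult[of "- 1" "- 1"] by simp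
 then have "pabs (- 1) = 1" using pabs_nonneg[of "- 1"] by (auto simp: square_eq_1_iff)
 then show ?thesis using pabs_mult[of "-1" x] by simp
qed

lemma pabs_minus_commute: "pabs (x - y) = pabs (y - x)" using pabs_minus[of "x - y"] by simp

lemma pabs_int: "pabs (of_int a) <= (1 / real p) ^ n \<longleftrightarrow> int p ^ n dvd a"
proof (cases "a = 0")
 case False
 have "pabs (of_int a) = real p powi (- int (multiplicity (int p) a))"
  using padic_abs_fraction[OF prime_p, of a 1] False by simp
 also have "\<dots> = (1 / real p) ^ multiplicity (int p) a"
  by (simp add: power_int_minus power_one_over inverse_eq_divide)
 finally have "pabs (of_int a) = (1 / real p) ^ multiplicity (int p) a" .
 moreover have "(1 / real p) ^ multiplicity (int p) a <= (1 / real p) ^ n \<longleftrightarrow> n <= multiplicity (int p) a"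
  using p_gt_1 by (intro power_decreasing_iff) auto
 moreover have "n <= multiplicity (int p) a \<longleftrightarrow> int p ^ n dvd a"
  using False p_gt_1 by (intro power_dvd_iff_le_multiplicity[symmetric]) (auto)
 ultimately show ?thesis by simp
qed (use p_gt_1 in auto)

lemma pabs_int_le: "pabs (of_int a) <= 1" using pabs_int[of a 0] by simp

lemma pabs_p_power: "pabs (of_nat p ^ n) = (1 / real p) ^ n"
proof -
 have "pabs (of_int (int p ^ n) / of_int 1) = real p powi (- int n)"
  using padic_abs_fraction[OF prime_p, of "int p ^ n" 1] prime_p by (simp add: prime_elem_multiplicity_power_distrib multiplicity_same_power)
 then show ?thesis by (simp add: power_int_minus power_one_over inverse_eq_divide)
qed

lemma pabs_inverse: "pabs (1 / x) = 1 / pabs x"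
proof (cases "x = 0")
 case False
 have "pabs x * pabs (1 / x) = 1" using pabs_mult[of x "1 / x"] False by simp
 then show ?thesis using False pabs_eq_0[of x] by (simp add: field_simps)
qed simp

lemma pabs_divide: "pabs (x / y) = pabs x / pabs y"
 using pabs_mult[of x "1 / y"] pabs_inverse[of y] by simp

lemma pabs_add: "pabs (x + y) <= max (pabs x) (pabs y)"
proof -
 have one: "pabs (1 + z) <= 1" if z: "pabs z <= 1" for z
 proof -
  obtain a b where ab: "b ~= 0" "z = of_int a / of_int b" by (rule rat_fraction)
  define n where "n = multiplicity (int p) b"
  have b: "int p ^ n dvd b" "pabs (of_int b) = (1 / real p) ^ n"
   using padic_abs_fraction[OF prime_p, of b 1] ab
   by (auto simp: n_def multiplicity_dvd power_int_minus power_one_over inverse_eq_divide)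
  have "pabs (of_int a) = pabs z * pabs (of_int b)" using pabs_divide[of "of_int a" "of_int b"] ab pabs_eq_0 by simp
  also have "\<dots> <= 1 * (1 / real p) ^ n" unfolding b(2) using z by (intro mult_right_mono) auto
  finally have "int p ^ n dvd a" using pabs_int by simp
  then have "int p ^ n dvd a + b" using b(1) by (rule dvd_add)
  then have "pabs (of_int (a + b)) <= (1 / real p) ^ n" by (simp only: pabs_int)
  moreover have "1 + z = of_int (a + b) / of_int b" using ab by (simp add: field_simps)
  moreover have "(1 / real p) ^ n > 0" using p_gt_1 by simp
  ultimately show ?thesis using pabs_divide[of "of_int (a + b)" "of_int b"] b(2) by (simp add: divide_le_eq)
 qed
 have wlog: "pabs (x + y) <= pabs x" if "pabs y <= pabs x" for x y
 proof (cases "x = 0")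
  case True
  then show ?thesis using that by (metis add_0 pabs_0 pabs_eq_0 pabs_nonneg order_antisym)
 next
  case False
  have "pabs (y / x) <= 1" using that False pabs_pos[of x] by (simp add: pabs_divide)
  then have "pabs (1 + y / x) <= 1" by (rule one)
  moreover have "x + y = x * (1 + y / x)" using False by (simp add: field_simps)
  ultimately show ?thesis using pabs_mult[of x "1 + y / x"] by (simp add: mult_left_le)
 qed
 show ?thesis using wlog[of y x] wlog[of x y] by (cases "pabs y <= pabs x") (auto simp: add.commute)
qed

lemma pabs_add_le: "pabs x <= c ==> pabs y <= c ==> pabs (x + y) <= c"
 using pabs_add[of x y] by (auto simp: max_def split: if_splits)

lemma pabs_diff_le: "pabs x <= c ==> pabs y <= c ==> pabs (x - y) <= c"
 using pabs_add_le[of x c "- y"] by simp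

lemma pabs_trans: "pabs (x - y) <= c ==> pabs (y - z) <= c ==> pabs (x - z) <= c"
 using pabs_add_le[of "x - y" c "y - z"] by simp

lemma pabs_integral_residue:
 assumes "pabs x <= 1" shows "\<exists>k<p. pabs (x - of_nat k) <= 1 / real p"
proof -
 obtain c d where cd: "quotient_of x = (c, d)" by (cases "quotient_of x")
 have d: "d > 0" "x = of_int c / of_int d" "coprime c d"
  using quotient_of_denom_pos[OF cd] quotient_of_div[OF cd] quotient_of_coprime[OF cd] by auto
 have "\<not> int p dvd d"
 proof
  assume *: "int p dvd d"
  then have "pabs (of_int d) <= 1 / real p" using pabs_int[of d 1] by simp
  moreover have "pabs (of_int c) = pabs x * pabs (of_int d)"
   using pabs_divide[of "of_int c" "of_int d"] d pabs_eq_0[of "of_int d"] by simp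
  ultimately have "pabs (of_int c) <= 1 / real p" using assms mult_mono[of "pabs x" 1 "pabs (of_int d)" "1 / real p"] by simp
  then have "int p dvd c" using pabs_int[of c 1] by simp
  then show False using * d(3) prime_p by (metis coprime_common_divisor not_prime_unit prime_nat_int_transfer)
 qed
 then have cop: "coprime d (int p)" using prime_p by (metis coprime_commute prime_imp_coprime prime_nat_int_transfer)
 then obtain e f where ef: "d * e + int p * f = 1" by (metis bezout_int coprime_iff_gcd_eq_1 mult.commute)
 define k where "k = nat ((c * e) mod int p)"
 have k: "int k = (c * e) mod int p" using prime_p by (simp add: k_def prime_gt_0_nat)
 have "int p dvd c * e - int k" unfolding k by (simp add: mod_eq_dvd_iff[symmetric])
 then obtain h where h: "c * e - int k = int p * h" by auto
 have "c - d * int k = c * (d * e + int p * f) - d * (c * e - int p * h)" using ef h by (simp add: algebra_simps)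
 then have "c - d * int k = int p * (c * f + d * h)" by (simp add: algebra_simps)
 then have "pabs (of_int (c - d * int k)) <= 1 / real p" using pabs_int[of "c - d * int k" 1] by simp
 moreover have "x - of_nat k = of_int (c - d * int k) / of_int d" using d by (simp add: field_simps)
 moreover have "pabs (of_int d) = 1"
  using \<open>\<not> int p dvd d\<close> padic_abs_fraction[OF prime_p, of d 1] d by (simp add: not_dvd_imp_multiplicity_0)
 ultimately have "pabs (x - of_nat k) <= 1 / real p" using pabs_divide by simp
 moreover have "k < p" using prime_p by (simp add: k_def prime_gt_0_nat nat_less_iff)
 ultimately show ?thesis by blast
qed

abbreviation "CC \<equiv> padic_cauchy p"

lemma small_power: "e > 0 ==> EX n. (1 / real p) ^ n < e"
 using real_arch_pow_inv[of e "1 / real p"] p_gt_1 by simp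

lemma cauchyD: "x : CC ==> e > 0 ==> EX N. \<forall>m\<ge>N. \<forall>n\<ge>N. pabs (x m - x n) <= e"
 unfolding padic_cauchy_def by (auto intro: less_imp_le) (meson less_imp_le)

lemma cauchyI: assumes "!!e. e > 0 ==> EX N. \<forall>m\<ge>N. pabs (x m - x N) <= e" shows "x : CC"
 unfolding padic_cauchy_def
proof (intro CollectI allI impI)
 fix e :: real assume e: "e > 0"
 then obtain N where N: "\<forall>m\<ge>N. pabs (x m - x N) <= e / 2" using assms[of "e / 2"] by auto
 have "pabs (x m - x n) <= e / 2" if "m >= N" "n >= N" for m n
  using pabs_trans[of "x m" "x N" "e / 2" "x n"] N that pabs_minus_commute by metis
 then show "EX N. \<forall>m\<ge>N. \<forall>n\<ge>N. pabs (x m - x n) < e" using e by (intro exI[of _ N]) fastforce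
qed

lemma nullD: "x : padic_null p ==> e > 0 ==> EX N. \<forall>m\<ge>N. pabs (x m) <= e"
 unfolding padic_null_def LIMSEQ_def by (auto simp: dist_real_def) (meson less_imp_le)

lemma nullI: assumes "!!e. e > 0 ==> EX N. \<forall>m\<ge>N. pabs (x m) <= e" shows "x : padic_null p"
 unfolding padic_null_def LIMSEQ_def
proof (intro CollectI allI impI)
 fix r :: real assume "r > 0"
 then obtain N where N: "\<forall>m\<ge>N. pabs (x m) <= r / 2" using assms[of "r / 2"] by auto
 have "dist (pabs (x n)) 0 < r" if "n >= N" for n
 proof -
  have "pabs (x n) <= r / 2" using N that by auto
  then show ?thesis using \<open>r > 0\<close> by (simp add: dist_real_def)
 qed
 then show "EX no. \<forall>n\<ge>no. dist (pabs (x n)) 0 < r" by blast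
qed

lemma null_cauchy: "x : padic_null p ==> x : CC"
proof (rule cauchyI)
 fix e :: real assume "x : padic_null p" "e > 0"
 then obtain N where "\<forall>m\<ge>N. pabs (x m) <= e" using nullD by blast
 then show "EX N. \<forall>m\<ge>N. pabs (x m - x N) <= e" by (intro exI[of _ N]) (auto intro: pabs_diff_le)
qed

lemma cauchy_bounded: assumes "x : CC" shows "\<exists>C>0. ALL n. pabs (x n) <= C"
proof -
 obtain N where N: "\<forall>m\<ge>N. pabs (x m - x N) <= 1" using cauchyD[OF assms, of 1] by auto
 define C where "C = Max (insert 1 ((%n. pabs (x n)) ` {..N}))"
 have C: "1 <= C" "!!n. n <= N ==> pabs (x n) <= C" unfolding C_def by (auto intro!: Max_ge simp del: Max_insert)
 have "pabs (x n) <= C" for n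
 proof (cases "n <= N")
  case False
  then have "pabs (x n - x N) <= C" using N C(1) by (meson nle_le order_trans)
  then have "pabs ((x n - x N) + x N) <= C" using C(2)[of N] by (intro pabs_add_le) auto
  then show ?thesis by simp
 qed (use C in auto)
 then show ?thesis using C(1) by (intro exI[of _ C]) auto
qed

lemma cauchy_add: assumes "x : CC" "y : CC" shows "(%n. x n + y n) : CC"
proof (rule cauchyI)
 fix e :: real assume "e > 0"
 then obtain N M where "\<forall>m\<ge>N. \<forall>n\<ge>N. pabs (x m - x n) <= e" "\<forall>m\<ge>M. \<forall>n\<ge>M. pabs (y m - y n) <= e"
  using cauchyD assms by meson
 then have "pabs ((x m - x (max N M)) + (y m - y (max N M))) <= e" if "m >= max N M" for m
  using that by (intro pabs_add_le) auto
 then show "EX N. \<forall>m\<ge>N. pabs (x m + y m - (x N + y N)) <= e"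
  by (intro exI[of _ "max N M"]) (auto simp: algebra_simps)
qed

lemma cauchy_mult: assumes "x : CC" "y : CC" shows "(%n. x n * y n) : CC"
proof (rule cauchyI)
 fix e :: real assume e: "e > 0"
 obtain C D where C: "C > 0" "ALL n. pabs (x n) <= C" and D: "D > 0" "ALL n. pabs (y n) <= D"
  using cauchy_bounded assms by metis
 obtain N M where N: "\<forall>m\<ge>N. \<forall>n\<ge>N. pabs (x m - x n) <= e / D" and M: "\<forall>m\<ge>M. \<forall>n\<ge>M. pabs (y m - y n) <= e / C"
  using cauchyD[OF assms(1), of "e / D"] cauchyD[OF assms(2), of "e / C"] e C D by auto
 let ?k = "max N M"
 have "pabs ((x m - x ?k) * y m + x ?k * (y m - y ?k)) <= e" if m: "m >= ?k" for m
 proof (rule pabs_add_le)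
  have "pabs (x m - x ?k) * pabs (y m) <= (e / D) * D" using N D m e by (intro mult_mono) auto
  then show "pabs ((x m - x ?k) * y m) <= e" using D by (simp add: pabs_mult)
  have "pabs (x ?k) * pabs (y m - y ?k) <= C * (e / C)" using M C m e by (intro mult_mono) auto
  then show "pabs (x ?k * (y m - y ?k)) <= e" using C by (simp add: pabs_mult)
 qed
 then show "EX N. \<forall>m\<ge>N. pabs (x m * y m - (x N * y N)) <= e"
  by (intro exI[of _ ?k]) (auto simp: algebra_simps)
qed

lemma cauchy_const [simp]: "(%_. c) : CC" by (rule cauchyI) auto

lemma cauchy_minus: "x : CC ==> (%n. - x n) : CC" using cauchy_mult[of "%_. - 1" x] by simp
lemma cauchy_diff: "x : CC ==> y : CC ==> (%n. x n - y n) : CC"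
 using cauchy_add[OF _ cauchy_minus, of x y] by simp

lemma cauchy_nonnull_away:
 assumes x: "x : CC" "x \<notin> padic_null p" shows "\<exists>c>0. EX N. \<forall>n\<ge>N. pabs (x n) >= c"
proof -
 obtain e where e: "e > 0" "!!N. \<exists>m\<ge>N. pabs (x m) > e" using nullI[of x] x(2) by (meson not_less)
 obtain N where N: "\<forall>m\<ge>N. \<forall>n\<ge>N. pabs (x m - x n) <= e" using cauchyD[OF x(1) e(1)] by auto
 obtain m where m: "m >= N" "pabs (x m) > e" using e(2) by auto
 have "pabs (x n) >= e" if "n >= N" for n
 proof (rule ccontr)
  assume "\<not> pabs (x n) >= e"
  then have "pabs ((x m - x n) + x n) <= e" using N m that by (intro pabs_add_le) auto
  then show False using m by simp
 qed
 then show ?thesis using e(1) by blast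
qed

lemma cauchy_inverse:
 assumes x: "x : CC" and c: "c > 0" "!!n. pabs (x n) >= c" shows "(%n. 1 / x n) : CC"
proof (rule cauchyI)
 fix e :: real assume e: "e > 0"
 obtain N where N: "\<forall>m\<ge>N. \<forall>n\<ge>N. pabs (x m - x n) <= e * (c * c)" using cauchyD[OF x, of "e * (c * c)"] e c by auto
 have "pabs (1 / x m - 1 / x N) <= e" if m: "m >= N" for m
 proof -
  have nz: "x m ~= 0" "x N ~= 0" using c(1) c(2)[of m] c(2)[of N] by auto
  have "1 / x m - 1 / x N = (x N - x m) / (x m * x N)" using nz by (simp add: field_simps)
  then have "pabs (1 / x m - 1 / x N) = pabs (x N - x m) / (pabs (x m) * pabs (x N))"
   by (simp add: pabs_divide pabs_mult)
  also have "\<dots> <= (e * (c * c)) / (c * c)" using N m c e by (intro frac_le mult_mono) auto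
  finally show ?thesis using c by simp
 qed
 then show "EX N. \<forall>m\<ge>N. pabs (1 / x m - 1 / x N) <= e" by blast
qed

lemma cauchy_shift: assumes "x : CC" shows "(%n. x (max n N)) : CC"
proof (rule cauchyI)
 fix e :: real assume "e > 0"
 then obtain M where "\<forall>m\<ge>M. \<forall>n\<ge>M. pabs (x m - x n) <= e" using cauchyD[OF assms] by blast
 then show "EX M. \<forall>m\<ge>M. pabs (x (max m N) - x (max M N)) <= e" by (intro exI[of _ M]) (auto simp: max_def)
qed

lemma cauchy_ring: "cring (padic_cauchy_ring p)"
proof -
 have neg: "EX y:CC. (%n. x n + y n) = (%n. 0)" if "x : CC" for x
  using that by (intro bexI[of _ "%n. - x n"]) (auto intro: cauchy_minus)
 show ?thesis unfolding padic_cauchy_ring_def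
  by (intro cringI abelian_groupI comm_monoidI)
   (auto simp: cauchy_add cauchy_mult algebra_simps neg)
qed

lemma null_ideal: "ideal (padic_null p) (padic_cauchy_ring p)"
proof -
 interpret C: cring "padic_cauchy_ring p" by (rule cauchy_ring)
 have cC: "carrier (padic_cauchy_ring p) = CC" by (simp add: padic_cauchy_ring_def)
 have mult: "(%n. x n * a n) : padic_null p" if a: "a : padic_null p" and x: "x : CC" for a x
 proof (rule nullI)
  fix e :: real assume e: "e > 0"
  obtain C where C: "C > 0" "ALL n. pabs (x n) <= C" using cauchy_bounded x by auto
  obtain N where N: "\<forall>m\<ge>N. pabs (a m) <= e / C" using nullD[OF a, of "e / C"] e C by auto
  have "pabs (x m * a m) <= e" if "m >= N" for m
  proof -
   have "pabs (x m) * pabs (a m) <= C * (e / C)" using N C e that by (intro mult_mono) auto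
   then show ?thesis using C by (simp add: pabs_mult)
  qed
  then show "EX N. \<forall>m\<ge>N. pabs (x m * a m) <= e" by blast
 qed
 have add: "(%n. a n + b n) : padic_null p" if ab: "a : padic_null p" "b : padic_null p" for a b
 proof (rule nullI)
  fix e :: real assume "e > 0"
  obtain N where "\<forall>m\<ge>N. pabs (a m) <= e" using nullD[OF ab(1) \<open>e > 0\<close>] by blast
  moreover obtain M where "\<forall>m\<ge>M. pabs (b m) <= e" using nullD[OF ab(2) \<open>e > 0\<close>] by blast
  ultimately show "EX N. \<forall>m\<ge>N. pabs (a m + b m) <= e"
   by (intro exI[of _ "max N M"]) (auto intro!: pabs_add_le)
 qed
 have minus: "\<ominus>\<^bsub>padic_cauchy_ring p\<^esub> a = (%n. - a n)" if "a : CC" for a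
 proof (rule C.minus_equality)
  show "(%n. - a n) \<oplus>\<^bsub>padic_cauchy_ring p\<^esub> a = \<zero>\<^bsub>padic_cauchy_ring p\<^esub>" by (simp add: padic_cauchy_ring_def)
 qed (simp_all add: cC that cauchy_minus)
 show ?thesis
 proof (rule idealI)
  show "ring (padic_cauchy_ring p)" by (rule C.ring_axioms)
  show "subgroup (padic_null p) (add_monoid (padic_cauchy_ring p))"
  proof (rule C.add.subgroupI)
   show "padic_null p <= carrier (padic_cauchy_ring p)" using null_cauchy by (auto simp: cC)
   have "(%_. 0) : padic_null p" by (rule nullI) auto
   then show "padic_null p ~= {}" by blast
   show "\<ominus>\<^bsub>padic_cauchy_ring p\<^esub> a : padic_null p" if "a : padic_null p" for a
    using mult[OF that, of "%_. - 1"] minus[OF null_cauchy[OF that]] by simp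
   show "a \<oplus>\<^bsub>padic_cauchy_ring p\<^esub> b : padic_null p" if "a : padic_null p" "b : padic_null p" for a b
    using add that by (simp add: padic_cauchy_ring_def)
  qed
  fix a x assume "a : padic_null p" "x : carrier (padic_cauchy_ring p)"
  then show "x **\<^bsub>padic_cauchy_ring p\<^esub> a : padic_null p" "a **\<^bsub>padic_cauchy_ring p\<^esub> x : padic_null p"
   using mult by (auto simp: padic_cauchy_ring_def mult.commute)
 qed
qed

end

locale padic_embedding = padic p + field R for p :: nat and R :: "('a, 'b) ring_scheme" (structure) +
 fixes \<iota> :: "(nat => rat) set => 'a" and L :: "'a set"
 assumes subfield_L: "subfield L R"
  and iota: "\<iota> : ring_hom (padic_field p) (R\<lparr>carrier := L\<rparr>)"
begin

definition j :: "(nat => rat) => 'a" where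
 "j x = \<iota> (padic_null p +>\<^bsub>padic_cauchy_ring p\<^esub> x)"

definition Zp :: "'a set" where "Zp = \<iota> ` padic_ints p"
definition Qp :: "'a set" where "Qp = \<iota> ` carrier (padic_field p)"
abbreviation pp :: "'a" where "pp \<equiv> j (%_. of_nat p)"

lemma L_carrier: "x : L ==> x : carrier R" using subfieldE(3)[OF subfield_L] by auto

lemma j_hom: "j : ring_hom (padic_cauchy_ring p) (R\<lparr>carrier := L\<rparr>)"
proof -
 have "(\<iota> \<circ> (+>\<^bsub>padic_cauchy_ring p\<^esub>) (padic_null p)) : ring_hom (padic_cauchy_ring p) (R\<lparr>carrier := L\<rparr>)"
  by (rule ring_hom_trans[OF _ iota]) (auto simp: padic_field_def intro: ideal.rcos_ring_hom null_ideal)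
 then show ?thesis by (simp add: j_def[abs_def] o_def)
qed

lemma j_L: "x : CC ==> j x : L"
 using ring_hom_closed[OF j_hom, of x] by (simp add: padic_cauchy_ring_def)
lemma j_closed [simp]: "x : CC ==> j x : carrier R" using j_L L_carrier by auto
lemma j_add: "x : CC ==> y : CC ==> j (%n. x n + y n) = j x \<oplus> j y"
 using ring_hom_add[OF j_hom, of x y] by (simp add: padic_cauchy_ring_def)
lemma j_mult: "x : CC ==> y : CC ==> j (%n. x n * y n) = j x ** j y"
 using ring_hom_mult[OF j_hom, of x y] by (simp add: padic_cauchy_ring_def)
lemma j_one [simp]: "j (%n. 1) = \<one>"
 using ring_hom_one[OF j_hom] by (simp add: padic_cauchy_ring_def)
lemma j_zero [simp]: "j (%n. 0) = \<zero>"
 using j_add[of "%_. 0" "%_. 0"] by (simp add: add.r_cancel_one')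

lemma j_minus: "x : CC ==> j (%n. - x n) = \<ominus> j x"
 using j_add[of "%n. - x n" x] by (intro minus_equality[symmetric]) (auto simp: cauchy_minus)
lemma j_diff: "x : CC ==> y : CC ==> j (%n. x n - y n) = j x \<ominus> j y"
 using j_add[of x "%n. - y n"] by (simp add: cauchy_minus j_minus a_minus_def)

lemma j_null: assumes "x : padic_null p" shows "j x = \<zero>"
proof -
 interpret I: ideal "padic_null p" "padic_cauchy_ring p" by (rule null_ideal)
 have "padic_null p +>\<^bsub>padic_cauchy_ring p\<^esub> x = padic_null p"
  using assms by (rule I.a_rcos_const)
 moreover have "padic_null p +>\<^bsub>padic_cauchy_ring p\<^esub> (%n. 0) = padic_null p"
  by (rule I.a_rcos_const) (auto intro!: nullI)
 ultimately have "j x = j (%n. 0)" unfolding j_def by simp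
 then show ?thesis by simp
qed

lemma j_cong: assumes "x : CC" "y : CC" "!!n. n >= N ==> x n = y n" shows "j x = j y"
proof -
 have "(%n. x n - y n) : padic_null p" by (rule nullI) (auto intro!: exI[of _ N] simp: assms(3))
 then have "j x \<ominus> j y = \<zero>" using j_null j_diff assms by metis
 then show ?thesis using assms by simp
qed

lemma j_inverse:
 assumes x: "x : CC" "x \<notin> padic_null p"
 obtains y N where "y : CC" "j x ** j y = \<one>" "!!n. n >= N ==> x n ~= 0 & y n = 1 / x n"
proof -
 obtain c N where c: "c > 0" "\<forall>n\<ge>N. pabs (x n) >= c" using cauchy_nonnull_away[OF x] by auto
 define y where "y n = 1 / x (max n N)" for n
 have yC: "y : CC" unfolding y_def[abs_def]
  using c by (intro cauchy_inverse[of "%n. x (max n N)" c] cauchy_shift x) auto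
 have nz: "x n ~= 0" if "n >= N" for n using c(1) c(2)[rule_format, OF that] by auto
 have "j x ** j y = j (%n. x n * y n)" using j_mult[OF x(1) yC] by simp
 also have "\<dots> = j (%n. 1)"
  using cauchy_mult[OF x(1) yC] nz by (intro j_cong[of _ _ N]) (simp_all add: y_def max_def)
 finally show ?thesis using that[of y N] yC nz by (auto simp: y_def max_def)
qed

lemma j_nonnull: assumes "x : CC" "x \<notin> padic_null p" shows "j x ~= \<zero>"
proof
 assume 0: "j x = \<zero>"
 obtain y N where "y : CC" "j x ** j y = \<one>" using j_inverse[OF assms] by metis
 then show False using 0 one_not_zero by simp
qed

lemma Qp_iff: "z : Qp \<longleftrightarrow> (EX x:CC. z = j x)"
 by (auto simp: Qp_def padic_field_def FactRing_def A_RCOSETS_def' j_def padic_cauchy_ring_def image_iff)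

lemma Zp_iff: "z : Zp \<longleftrightarrow> (EX x:CC. (ALL n. pabs (x n) <= 1) & z = j x)"
proof -
 interpret I: ideal "padic_null p" "padic_cauchy_ring p" by (rule null_ideal)
 have c: "carrier (padic_cauchy_ring p) = CC" by (simp add: padic_cauchy_ring_def)
 show ?thesis
 proof
  assume "z : Zp"
  then obtain C x where C: "C : carrier (padic_field p)" "x : C" "ALL n. pabs (x n) <= 1" "z = \<iota> C"
   by (auto simp: Zp_def padic_ints_def)
  then obtain y where y: "y : CC" "C = padic_null p +>\<^bsub>padic_cauchy_ring p\<^esub> y"
   by (auto simp: padic_field_def FactRing_def A_RCOSETS_def' padic_cauchy_ring_def)
  then have "C = padic_null p +>\<^bsub>padic_cauchy_ring p\<^esub> x"
   using I.a_repr_independence'[of x y] C(2) c by simp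
  moreover have "x : CC" using I.a_elemrcos_carrier[of y x] y C c by auto
  ultimately show "EX x:CC. (ALL n. pabs (x n) <= 1) & z = j x" using C by (intro bexI[of _ x]) (auto simp: j_def)
 next
  assume "EX x:CC. (ALL n. pabs (x n) <= 1) & z = j x"
  then obtain x where x: "x : CC" "ALL n. pabs (x n) <= 1" "z = j x" by auto
  have "padic_null p +>\<^bsub>padic_cauchy_ring p\<^esub> x : padic_ints p"
   using x I.a_rcos_self[of x] c unfolding padic_ints_def padic_field_def FactRing_def
   by (auto simp: A_RCOSETS_def' padic_cauchy_ring_def)
  then show "z : Zp" using x by (auto simp: Zp_def j_def)
 qed
qed

lemma pp_power: "pp [^] (n::nat) = j (%_. of_nat p ^ n)"
proof (induction n)
 case (Suc n)
 then show ?case using j_mult[of "%_. of_nat p ^ n" "%_. of_nat p"] by (simp add: mult.commute)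
qed simp

lemma scale_Zp_iff:
 assumes x: "x : CC"
 shows "j x : scale R pp n Zp \<longleftrightarrow> (EX N. \<forall>m\<ge>N. pabs (x m) <= (1 / real p) ^ n)"
proof
 assume "j x : scale R pp n Zp"
 then obtain z where z: "z : Zp" "j x = pp [^] n ** z" by (auto simp: scale_def)
 then obtain y where y: "y : CC" "ALL n. pabs (y n) <= 1" "z = j y" using Zp_iff by auto
 have "j x = j (%m. of_nat p ^ n * y m)" using z y j_mult[of "%_. of_nat p ^ n" y] by (simp add: pp_power)
 moreover have c: "(%m. of_nat p ^ n * y m) : CC" using cauchy_mult[of "%_. of_nat p ^ n" y] y by simp
 ultimately have "j (%m. x m - of_nat p ^ n * y m) = \<zero>" using j_diff[OF x c] x c by simp
 then have "(%m. x m - of_nat p ^ n * y m) : padic_null p" using j_nonnull cauchy_diff[OF x c] by blast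
 moreover have pos: "(1 / real p) ^ n > 0" using p_gt_1 by simp
 ultimately obtain N where N: "\<forall>m\<ge>N. pabs (x m - of_nat p ^ n * y m) <= (1 / real p) ^ n" using nullD by blast
 have "pabs (x m) <= (1 / real p) ^ n" if "m >= N" for m
 proof -
  have "pabs (of_nat p ^ n * y m) <= (1 / real p) ^ n"
   using y(2) mult_left_mono[of "pabs (y m)" 1 "(1 / real p) ^ n"] by (simp add: pabs_mult pabs_p_power)
  then have "pabs ((x m - of_nat p ^ n * y m) + of_nat p ^ n * y m) <= (1 / real p) ^ n"
   using N that by (intro pabs_add_le) auto
  then show ?thesis by simp
 qed
 then show "EX N. \<forall>m\<ge>N. pabs (x m) <= (1 / real p) ^ n" by blast
next
 assume "EX N. \<forall>m\<ge>N. pabs (x m) <= (1 / real p) ^ n"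
 then obtain N where N: "\<forall>m\<ge>N. pabs (x m) <= (1 / real p) ^ n" by auto
 define y where "y m = (1 / of_nat p ^ n) * x (max m N)" for m
 have yC: "y : CC" unfolding y_def[abs_def] by (intro cauchy_mult cauchy_const cauchy_shift x)
 have "pabs (y m) <= 1" for m
 proof -
  have "pabs (y m) = pabs (x (max m N)) / (1 / real p) ^ n"
   unfolding y_def by (simp add: pabs_divide pabs_p_power)
  also have "\<dots> <= 1" using N p_gt_1 by (simp add: divide_le_eq)
  finally show ?thesis .
 qed
 then have "j y : Zp" using yC Zp_iff by auto
 moreover have "j x = pp [^] n ** j y"
 proof -
  have "j x = j (%m. of_nat p ^ n * y m)"
  proof (rule j_cong[of _ _ N])
   show "x m = of_nat p ^ n * y m" if "m >= N" for m using that by (simp add: y_def max_def)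
  qed (use x cauchy_mult[OF cauchy_const yC] in simp_all)
  then show ?thesis using j_mult[of "%_. of_nat p ^ n" y] yC by (simp add: pp_power)
 qed
 ultimately show "j x : scale R pp n Zp" by (auto simp: scale_def)
qed

lemma Zp_carrier: "Zp <= carrier R" using Zp_iff by auto

lemma j_in_Zp_iff: "x : CC ==> j x : Zp \<longleftrightarrow> (EX N. \<forall>m\<ge>N. pabs (x m) <= 1)"
proof -
 assume x: "x : CC"
 have "scale R pp 0 Zp = Zp" using Zp_carrier by (force simp: scale_def)
 then show ?thesis using scale_Zp_iff[OF x, of 0] by simp
qed

lemma subring_Zp: "subring Zp R"
proof (rule subringI)
 show "Zp <= carrier R" by (rule Zp_carrier)
 show "\<one> : Zp" using j_in_Zp_iff[of "%_. 1"] by simp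
 fix h assume "h : Zp"
 then obtain x where x: "x : CC" "ALL n. pabs (x n) <= 1" "h = j x" using Zp_iff by auto
 show "\<ominus> h : Zp" using j_in_Zp_iff[of "%n. - x n"] x by (simp add: cauchy_minus j_minus)
 fix g assume "g : Zp"
 then obtain y where y: "y : CC" "ALL n. pabs (y n) <= 1" "g = j y" using Zp_iff by auto
 have "pabs (x n * y n) <= 1" for n using x(2) y(2) by (simp add: pabs_mult mult_le_one)
 then show "h ** g : Zp" using j_in_Zp_iff[of "%n. x n * y n"] x y by (simp add: cauchy_mult j_mult)
 have "pabs (x n + y n) <= 1" for n using x(2) y(2) by (simp add: pabs_add_le)
 then show "h \<oplus> g : Zp" using j_in_Zp_iff[of "%n. x n + y n"] x y by (simp add: cauchy_add j_add)
qed

lemma subfield_Qp: "subfield Qp R"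
proof (rule subfieldI')
 show "subring Qp R"
 proof (rule subringI)
  show "Qp <= carrier R" using Qp_iff by auto
  show "\<one> : Qp" using Qp_iff j_one cauchy_const by metis
  show "\<ominus> h : Qp" if "h : Qp" for h using that Qp_iff j_minus cauchy_minus by metis
  show "h ** g : Qp" "h \<oplus> g : Qp" if hg: "h : Qp" "g : Qp" for h g
  proof -
   obtain x y where xy: "x : CC" "h = j x" "y : CC" "g = j y" using hg Qp_iff by auto
   show "h ** g : Qp" unfolding Qp_iff xy j_mult[OF xy(1,3), symmetric] using cauchy_mult[OF xy(1,3)] by blast
   show "h \<oplus> g : Qp" unfolding Qp_iff xy j_add[OF xy(1,3), symmetric] using cauchy_add[OF xy(1,3)] by blast
  qed
 qed
 fix k assume k: "k : Qp - {\<zero>}"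
 then obtain x where x: "x : CC" "k = j x" using Qp_iff by auto
 then have "x \<notin> padic_null p" using k j_null by auto
 then obtain y N where y: "y : CC" "j x ** j y = \<one>" using j_inverse x by metis
 then have "inv k = j y" using x by (intro comm_inv_char) auto
 then show "inv k : Qp" using y Qp_iff by auto
qed

lemma pp_nz: "pp ~= \<zero>"
proof (rule j_nonnull)
 show "(%_. of_nat p) \<notin> padic_null p"
 proof
  assume "(%_. of_nat p) : padic_null p"
  then obtain N :: nat where "\<forall>m\<ge>N. pabs (of_nat p) <= (1 / real p) / 2"
   using nullD[of "%_. of_nat p" "(1 / real p) / 2"] p_gt_1 by auto
  then show False using pabs_p_power[of 1] p_gt_1 by (auto simp: divide_simps)
 qed
qed simp

theorem complete_dvr_Zp: "complete_dvr R Zp pp Qp"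
proof (intro_locales, rule complete_dvr_axioms.intro)
 have half: "(1 / real p) ^ n > 0" for n using p_gt_1 by simp
 show "subring Zp R" "subfield Qp R" by (rule subring_Zp, rule subfield_Qp)
 show ZQ: "Zp <= Qp" using Zp_iff Qp_iff by auto
 show "pp : Zp" using j_in_Zp_iff[of "%_. of_nat p"] pabs_p_power[of 1] p_gt_1 by simp
 show "pp ~= \<zero>" by (rule pp_nz)
 show "inv pp \<notin> Zp"
 proof -
  have "pp ** j (%_. 1 / of_nat p) = \<one>" using j_mult[of "%_. of_nat p" "%_. 1 / of_nat p"] by simp
  then have "inv pp = j (%_. 1 / of_nat p)" by (intro comm_inv_char) auto
  moreover have "\<not> pabs (1 / of_nat p) <= 1" using pabs_p_power[of 1] p_gt_1 by (simp add: pabs_inverse)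
  ultimately show ?thesis using j_in_Zp_iff[of "%_. 1 / of_nat p"] by auto
 qed
 show "inv x : Zp" if x: "x : Zp" "x \<notin> scale R pp 1 Zp" for x
 proof -
  obtain a where a: "a : CC" "ALL n. pabs (a n) <= 1" "x = j a" using x Zp_iff by auto
  have inf: "\<exists>m\<ge>N. pabs (a m) > 1 / real p" for N
   using scale_Zp_iff[OF a(1), of 1] x(2) a(3) by (auto simp: not_le)
  obtain N where N: "\<forall>m\<ge>N. \<forall>n\<ge>N. pabs (a m - a n) <= 1 / real p" using cauchyD[OF a(1), of "1 / real p"] p_gt_1 by auto
  have big: "pabs (a n) >= 1 / real p" if n: "n >= N" for n
  proof (rule ccontr)
   assume *: "\<not> pabs (a n) >= 1 / real p"
   obtain m where m: "m >= N" "pabs (a m) > 1 / real p" using inf by auto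
   have "pabs ((a m - a n) + a n) <= 1 / real p" using * N m n by (intro pabs_add_le) auto
   then show False using m by simp
  qed
  have one: "pabs (a n) >= 1" if n: "n >= N" for n
  proof (rule ccontr)
   assume *: "\<not> pabs (a n) >= 1"
   obtain m where m: "m >= N" "pabs (a m) > 1 / real p" using inf by auto
   have an: "a n ~= 0" using big[OF n] p_gt_1 by (auto simp: divide_le_0_iff)
   obtain k where k: "k < p" "pabs (a n - of_nat k) <= 1 / real p" using pabs_integral_residue a(2) by blast
   have "pabs (of_int (int k)) <= 1 / real p"
   proof (cases "k = 0")
    case False
    then have "\<not> int p dvd int k" using k(1) by (metis dvd_imp_le int_dvd_int_iff neq0_conv not_le)
    then have "pabs (of_int (int k)) = 1"
     using padic_abs_fraction[OF prime_p, of "int k" 1] False by (simp add: not_dvd_imp_multiplicity_0)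
    moreover have "pabs ((of_nat k - a n) + a n) < 1"
    proof (rule le_less_trans[OF pabs_add])
     have "1 / real p < 1" using p_gt_1 by simp
     then show "max (pabs (of_nat k - a n)) (pabs (a n)) < 1"
      using * k(2) pabs_minus_commute[of "of_nat k" "a n"] by simp
    qed
    ultimately show ?thesis by simp
   qed (use p_gt_1 in simp)
   then have "pabs ((a n - of_nat k) + of_int (int k)) <= 1 / real p" using k by (intro pabs_add_le) auto
   then have "pabs (a n) <= 1 / real p" by simp
   then have "pabs ((a m - a n) + a n) <= 1 / real p" using N m n by (intro pabs_add_le) auto
   then show False using m by simp
  qed
  have "a \<notin> padic_null p"
  proof
   assume "a : padic_null p"
   then obtain M where "\<forall>m\<ge>M. pabs (a m) <= 1 / 2" using nullD[of a "1 / 2"] by auto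
   then have "pabs (a (max N M)) <= 1 / 2" by simp
   then show False using one[of "max N M"] by simp
  qed
  then obtain b M where b: "b : CC" "j a ** j b = \<one>" "!!n. n >= M ==> a n ~= 0 & b n = 1 / a n"
   using j_inverse a(1) by metis
  have "pabs (b n) <= 1" if "n >= max N M" for n
   using b(3)[of n] one[of n] that by (simp add: pabs_inverse divide_le_eq)
  then have "j b : Zp" using j_in_Zp_iff[OF b(1)] by blast
  moreover have "inv x = j b" using b a by (intro comm_inv_char) auto
  ultimately show ?thesis by simp
 qed
 show "x = \<zero>" if x: "!!n. x : scale R pp n Zp" for x
 proof -
  obtain z where z: "z : Zp" "x = pp [^] (0::nat) ** z" using x[of 0] unfolding scale_def by blast
  then obtain a where a: "a : CC" "x = j a" using Zp_iff by auto
  have "a : padic_null p"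
  proof (rule nullI)
   fix e :: real assume "e > 0"
   then obtain n where n: "(1 / real p) ^ n < e" using small_power by blast
   obtain N where "\<forall>m\<ge>N. pabs (a m) <= (1 / real p) ^ n" using scale_Zp_iff[OF a(1)] x a by metis
   then show "EX N. \<forall>m\<ge>N. pabs (a m) <= e" using n by (meson less_imp_le order_trans)
  qed
  then show ?thesis using a j_null by simp
 qed
 show "EX s:Zp. ALL n. s \<ominus> x n : scale R pp n Zp"
  if x: "!!n. x n : Zp" "!!n. x (Suc n) \<ominus> x n : scale R pp n Zp" for x
 proof -
  have "EX a. a : CC & x n = j a" for n using x(1)[of n] Zp_iff by auto
  then obtain a where a: "!!n. a n : CC" "!!n. x n = j (a n)" by metis
  have "EX r N. \<forall>m\<ge>N. pabs (a n m - r) <= (1 / real p) ^ n" for n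
  proof -
   obtain N where "\<forall>m\<ge>N. \<forall>k\<ge>N. pabs (a n m - a n k) <= (1 / real p) ^ n"
    using cauchyD[OF a(1) half] by blast
   then show ?thesis by (intro exI[of _ "a n N"] exI[of _ N]) auto
  qed
  then obtain r N where r: "!!n m. m >= N n ==> pabs (a n m - r n) <= (1 / real p) ^ n" by metis
  have step: "pabs (r (Suc n) - r n) <= (1 / real p) ^ n" for n
  proof -
   have "j (%m. a (Suc n) m - a n m) : scale R pp n Zp" using x(2)[of n] a j_diff by simp
   then obtain M where M: "\<forall>m\<ge>M. pabs (a (Suc n) m - a n m) <= (1 / real p) ^ n"
    using scale_Zp_iff[OF cauchy_diff[OF a(1) a(1)], of "Suc n" n n] by auto
   define m where "m = max M (max (N n) (N (Suc n)))"
   have "(1 / real p) ^ Suc n <= (1 / real p) ^ n" using p_gt_1 by (intro power_decreasing) auto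
   moreover have "N (Suc n) <= m" by (simp add: m_def)
   ultimately have "pabs (a (Suc n) m - r (Suc n)) <= (1 / real p) ^ n" using r[of "Suc n" m] by linarith
   then have 1: "pabs (r (Suc n) - a (Suc n) m) <= (1 / real p) ^ n" by (simp add: pabs_minus_commute)
   have "pabs (a (Suc n) m - a n m) <= (1 / real p) ^ n" using M by (simp add: m_def)
   then have "pabs (r (Suc n) - a n m) <= (1 / real p) ^ n" using 1 by (rule pabs_trans[rotated])
   then show ?thesis using r[of n m] by (auto intro: pabs_trans simp: m_def)
  qed
  have far: "pabs (r m - r n) <= (1 / real p) ^ n" if "m >= n" for m n using that
  proof (induction m rule: dec_induct)
   case (step m)
   have "(1 / real p) ^ m <= (1 / real p) ^ n" using p_gt_1 step by (intro power_decreasing) auto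
   then have "pabs (r (Suc m) - r m) <= (1 / real p) ^ n" using \<open>!!n. pabs (r (Suc n) - r n) <= (1 / real p) ^ n\<close>[of m] by linarith
   then show ?case using step.IH by (rule pabs_trans)
  qed (use p_gt_1 in auto)
  have rC: "r : CC"
  proof (rule cauchyI)
   fix e :: real assume "e > 0"
   then obtain n where n: "(1 / real p) ^ n < e" using small_power by blast
   then show "EX N. \<forall>m\<ge>N. pabs (r m - r N) <= e" using far by (meson less_imp_le order_trans)
  qed
  have key: "j r \<ominus> x n : scale R pp n Zp" for n
  proof -
   have "pabs (r m - a n m) <= (1 / real p) ^ n" if "m >= max n (N n)" for m
    using far[of n m] r[of n m] that pabs_trans[of "r m" "r n" _ "a n m"] pabs_minus_commute[of "r n" "a n m"] by auto
   then have "j (%m. r m - a n m) : scale R pp n Zp"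
    using scale_Zp_iff[OF cauchy_diff[OF rC a(1)], of n n] by blast
   then show ?thesis using j_diff[OF rC a(1)] a by simp
  qed
  have "j r : Zp"
  proof -
   have "j r \<ominus> x 0 : Zp" using key[of 0] Zp_carrier by (auto simp: scale_def)
   then have "(j r \<ominus> x 0) \<oplus> x 0 : Zp" using subringE(7)[OF subring_Zp] x by blast
   moreover have "(j r \<ominus> x 0) \<oplus> x 0 = j r" using rC x(1)[of 0] Zp_carrier by (simp add: a_minus_def a_assoc l_neg subset_iff)
   ultimately show ?thesis by simp
  qed
  then show ?thesis using key by blast
 qed
 show "EX n. pp [^] (n::nat) ** x : Zp" if x: "x : Qp" for x
 proof -
  obtain a where a: "a : CC" "x = j a" using x Qp_iff by auto
  obtain C where C: "C > 0" "ALL n. pabs (a n) <= C" using cauchy_bounded[OF a(1)] by auto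
  obtain n where n: "(1 / real p) ^ n < 1 / C" using small_power[of "1 / C"] C by auto
  have "pabs (of_nat p ^ n * a m) <= 1" for m
  proof -
   have "pabs (of_nat p ^ n * a m) <= (1 / C) * C"
    unfolding pabs_mult pabs_p_power using n C by (intro mult_mono) auto
   then show ?thesis using C by simp
  qed
  then have "j (%m. of_nat p ^ n * a m) : Zp"
   using j_in_Zp_iff[OF cauchy_mult[OF cauchy_const a(1)]] by blast
  then show ?thesis using j_mult[OF cauchy_const a(1)] a by (intro exI[of _ n]) (simp add: pp_power)
 qed
 show "\<exists>S\<subseteq>Zp. finite S & (ALL x:Zp. EX s:S. x \<ominus> s : scale R pp 1 Zp)"
 proof (intro exI[of _ "(%k. j (%_. of_nat k)) ` {..<p}"] conjI ballI)
  have "pabs (of_nat k) <= 1" for k using pabs_int_le[of "int k"] by simp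
  then show "(%k. j (%_. of_nat k)) ` {..<p} <= Zp" using j_in_Zp_iff by auto
  fix x assume "x : Zp"
  then obtain a where a: "a : CC" "ALL n. pabs (a n) <= 1" "x = j a" using Zp_iff by auto
  obtain N where N: "\<forall>m\<ge>N. \<forall>n\<ge>N. pabs (a m - a n) <= 1 / real p" using cauchyD[OF a(1), of "1 / real p"] p_gt_1 by auto
  obtain k where k: "k < p" "pabs (a N - of_nat k) <= 1 / real p" using pabs_integral_residue a(2) by blast
  have "pabs (a m - of_nat k) <= 1 / real p" if "m >= N" for m using N that k pabs_trans by blast
  then have "j (%m. a m - of_nat k) : scale R pp 1 Zp"
   using scale_Zp_iff[OF cauchy_diff[OF a(1) cauchy_const], of "of_nat k" 1] by auto
  then have "x \<ominus> j (%_. of_nat k) : scale R pp 1 Zp" using j_diff[OF a(1) cauchy_const] a by simp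
  then show "EX s:(%k. j (%_. of_nat k)) ` {..<p}. x \<ominus> s : scale R pp 1 Zp" using k by auto
 qed simp
qed

end

section \<open>The valuation ring of a finite extension\<close>

lemma (in cring) idempotent_lifting:
 fixes F :: "nat => 'a set"
 assumes B: "subring B R"
  and FB: "!!n. F n <= B"
  and add: "!!n x y. x : F n ==> y : F n ==> x \<oplus> y : F n"
  and smult: "!!n b x. b : B ==> x : F n ==> b ** x : F n"
  and mult: "!!m n x y. x : F m ==> y : F n ==> x ** y : F (m + n)"
  and anti: "!!m n. m <= n ==> F n <= F m"
  and sep: "!!x. (!!n. x : F n) ==> x = \<zero>"
  and compl: "!!x. (!!n. x n : B) ==> (!!n. x (Suc n) \<ominus> x n : F n) ==> EX s:B. ALL n. s \<ominus> x n : F n"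
  and h: "h : B" "h ** h \<ominus> h : F 1"
 shows "EX e:B. e ** e = e & e \<ominus> h : F 1"
proof -
 note Bs = subringE[OF B]
 have Bc [simp]: "x : B ==> x : carrier R" for x using Bs(1) by auto
 have Fc [simp]: "x : F n ==> x : carrier R" for x n using FB[of n] by auto
 have neg: "\<ominus> x : F n" if "x : F n" for x n using smult[of "\<ominus> \<one>" x n] that Bs by (simp add: l_minus)
 have diff: "x \<ominus> y : F n" if "x : F n" "y : F n" for x y n using add neg that by (simp add: a_minus_def)
 define f where "f x = x ** x \<ominus> x" for x
 define g where "g x = x \<oplus> (f x \<ominus> (x \<oplus> x) ** f x)" for x
 have fB: "f x : B" if "x : B" for x using that Bs by (simp add: f_def a_minus_def)
 have gB: "g x : B" if "x : B" for x using that Bs fB by (simp add: g_def a_minus_def)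
 have fg: "f (g x) = (f x ** f x) ** (f x \<oplus> f x \<oplus> f x \<oplus> f x \<ominus> (\<one> \<oplus> \<one> \<oplus> \<one>))" if "x : B" for x
 proof -
  define z where "z = f x"
  define w where "w = x \<oplus> x \<ominus> \<one>"
  have xc: "x : carrier R" using Bc[OF that] .
  have c: "z : carrier R" "w : carrier R" using xc by (auto simp: z_def f_def w_def)
  have ww: "w ** w = z \<oplus> z \<oplus> z \<oplus> z \<oplus> \<one>" unfolding w_def z_def f_def using xc by algebra
  have gx: "g x = x \<ominus> w ** z" unfolding g_def z_def[symmetric] w_def using xc c(1) by algebra
  have "f (x \<ominus> d) = f x \<ominus> d ** w \<oplus> d ** d" if "d : carrier R" for d
   unfolding f_def w_def using xc that by algebra
  then have "f (g x) = z \<ominus> w ** z ** w \<oplus> w ** z ** (w ** z)" unfolding gx z_def[symmetric] using c by simp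
  also have "\<dots> = z \<ominus> (w ** w) ** z \<oplus> (w ** w) ** (z ** z)" using c by algebra
  also have "\<dots> = (z ** z) ** (z \<oplus> z \<oplus> z \<oplus> z \<ominus> (\<one> \<oplus> \<one> \<oplus> \<one>))" unfolding ww using c(1) by algebra
  finally show ?thesis unfolding z_def .
 qed
 define y where "y n = (g ^^ n) h" for n
 have yB: "y n : B" for n by (induction n) (auto simp: y_def h gB)
 have yS: "y (Suc n) = g (y n)" for n by (simp add: y_def)
 have fy: "f (y n) : F (Suc n)" for n
 proof (induction n)
  case 0 then show ?case using h by (simp add: y_def f_def One_nat_def)
 next
  case (Suc n)
  let ?z = "f (y n)"
  have "?z ** ?z : F (Suc (Suc n))" using mult[OF Suc Suc] anti[of "Suc (Suc n)" "Suc n + Suc n"] by auto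
  moreover have "?z \<oplus> ?z \<oplus> ?z \<oplus> ?z \<ominus> (\<one> \<oplus> \<one> \<oplus> \<one>) : B" using fB[OF yB] Bs by (simp add: a_minus_def)
  ultimately have "(?z \<oplus> ?z \<oplus> ?z \<oplus> ?z \<ominus> (\<one> \<oplus> \<one> \<oplus> \<one>)) ** (?z ** ?z) : F (Suc (Suc n))" by (rule smult[rotated])
  moreover have "f (y (Suc n)) = (?z \<oplus> ?z \<oplus> ?z \<oplus> ?z \<ominus> (\<one> \<oplus> \<one> \<oplus> \<one>)) ** (?z ** ?z)"
   unfolding yS fg[OF yB] using Bc[OF fB[OF yB[of n]]] by (intro m_comm) auto
  ultimately show ?case by simp
 qed
 have step: "y (Suc n) \<ominus> y n : F (Suc n)" for n
 proof -
  let ?z = "f (y n)"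
  have "?z \<ominus> (y n \<oplus> y n) ** ?z : F (Suc n)" using fy[of n] smult[of "y n \<oplus> y n" ?z] yB Bs by (intro diff) auto
  moreover have "y (Suc n) \<ominus> y n = ?z \<ominus> (y n \<oplus> y n) ** ?z"
   unfolding yS g_def using Bc[OF yB[of n]] Bc[OF fB[OF yB[of n]]] by algebra
  ultimately show ?thesis by simp
 qed
 have "y (Suc n) \<ominus> y n : F n" for n using step[of n] anti[of n "Suc n"] by auto
 then obtain e where e: "e : B" "!!n. e \<ominus> y n : F n" using compl[of y] yB by blast
 have "e ** e \<ominus> e : F n" for n
 proof -
  have "e ** e \<ominus> e = ((e \<oplus> y n) ** (e \<ominus> y n) \<ominus> (e \<ominus> y n)) \<oplus> f (y n)"
   unfolding f_def using Bc[OF e(1)] Bc[OF yB[of n]] by algebra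
  moreover have "(e \<oplus> y n) ** (e \<ominus> y n) : F n" using smult[OF _ e(2)] e(1) yB Bs by auto
  moreover have "f (y n) : F n" using fy[of n] anti[of n "Suc n"] by auto
  ultimately show ?thesis using e(2)[of n] add diff by auto
 qed
 then have "e ** e \<ominus> e = \<zero>" by (rule sep)
 moreover have "e \<ominus> h : F 1"
 proof -
  have "e \<ominus> h = (e \<ominus> y 1) \<oplus> (y 1 \<ominus> y 0)"
   using Bc[OF e(1)] Bc[OF yB[of 1]] Bc[OF h(1)] unfolding y_def funpow_0 by algebra
  then show ?thesis using e(2)[of 1] step[of 0] add by (auto simp: One_nat_def)
 qed
 ultimately show ?thesis using e(1) by (intro bexI[of _ e]) auto
qed

lemma (in cring) power_idempotent_mod:
 fixes P :: "'a set"
 assumes B: "subring B R" and PB: "P <= B"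
  and add: "!!x y. x : P ==> y : P ==> x \<oplus> y : P"
  and smult: "!!b x. b : B ==> x : P ==> b ** x : P"
  and fin: "S <= B" "finite S" "!!x. x : B ==> EX s:S. x \<ominus> s : P"
  and x: "x : B"
 shows "\<exists>r>0. x [^] (r::nat) ** x [^] r \<ominus> x [^] r : P"
proof -
 note Bs = subringE[OF B]
 have Bc [simp]: "x : B ==> x : carrier R" for x using Bs(1) by auto
 have pB: "x [^] (n::nat) : B" for n using x Bs by (induction n) auto
 have neg: "\<ominus> y : P" if "y : P" for y using smult[of "\<ominus> \<one>" y] that Bs PB by (auto simp: l_minus)
 obtain \<rho> where \<rho>: "!!y. y : B ==> \<rho> y : S" "!!y. y : B ==> y \<ominus> \<rho> y : P" using fin(3) by metis
 have "range (%n::nat. \<rho> (x [^] n)) <= S" using \<rho>(1) pB by auto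
 then have "finite (range (%n::nat. \<rho> (x [^] n)))" using fin(2) finite_subset by blast
 then have "\<not> inj (%n::nat. \<rho> (x [^] n))" using finite_imageD infinite_UNIV_nat by blast
 then obtain i j :: nat where ij: "i < j" "\<rho> (x [^] i) = \<rho> (x [^] j)"
  unfolding inj_def by (metis linorder_neqE_nat)
 define d where "d = j - i"
 have d: "d > 0" "j = i + d" using ij by (auto simp: d_def)
 have 1: "x [^] (i + d) \<ominus> x [^] i : P"
 proof -
  have s: "\<rho> (x [^] i) : carrier R" using \<rho>(1)[OF pB[of i]] fin(1) by auto
  have "x [^] j \<ominus> x [^] i = (x [^] j \<ominus> \<rho> (x [^] j)) \<oplus> \<ominus> (x [^] i \<ominus> \<rho> (x [^] i))"
   unfolding ij(2)[symmetric] using s Bc[OF pB[of i]] Bc[OF pB[of j]] by algebra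
  then show ?thesis using \<rho>(2)[OF pB] add neg d by auto
 qed
 have 2: "x [^] (n + d) \<ominus> x [^] n : P" if n: "n >= i" for n
 proof -
  have "x [^] (n + d) = x [^] (n - i) ** x [^] (i + d)" "x [^] n = x [^] (n - i) ** x [^] i"
   using n x by (simp_all add: nat_pow_mult)
  then have "x [^] (n + d) \<ominus> x [^] n = x [^] (n - i) ** (x [^] (i + d) \<ominus> x [^] i)"
   using Bc[OF pB[of "n - i"]] Bc[OF pB[of "i + d"]] Bc[OF pB[of i]] by (simp, algebra)
  then show ?thesis using smult[OF pB 1] by simp
 qed
 have 3: "x [^] (n + k * d) \<ominus> x [^] n : P" if n: "n >= i" for n k
 proof (induction k)
  case 0
  have "\<zero> : P" using smult[OF Bs(2) 1] Bc[OF pB] by simp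
  then show ?case using Bc[OF pB] by (simp add: a_minus_def r_neg)
 next
  case (Suc k)
  have "x [^] (n + Suc k * d) \<ominus> x [^] n =
   (x [^] ((n + k * d) + d) \<ominus> x [^] (n + k * d)) \<oplus> (x [^] (n + k * d) \<ominus> x [^] n)"
  proof -
   have e: "n + Suc k * d = (n + k * d) + d" by simp
   show ?thesis unfolding e using Bc[OF pB[of "(n + k * d) + d"]] Bc[OF pB[of "n + k * d"]] Bc[OF pB[of n]] by algebra
  qed
  then show ?case using 2[of "n + k * d"] Suc n add by auto
 qed
 define r where "r = Suc i * d"
 have "r >= i" using d(1) by (cases d) (auto simp: r_def)
 then have "x [^] (r + Suc i * d) \<ominus> x [^] r : P" by (rule 3)
 then show ?thesis using d x by (intro exI[of _ r]) (simp add: nat_pow_mult r_def)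
qed

context dvr_extension
begin

lemma B_complete:
 assumes "!!n. x n : B" "!!n. x (Suc n) \<ominus> x n : tp n B"
 shows "EX s:B. ALL n. s \<ominus> x n : tp n B"
 using basis_exists A_basis_complete[OF amod_B _ assms] by blast

lemma B_residues: "\<exists>S\<subseteq>B. finite S & (ALL x:B. EX s:S. x \<ominus> s : tp 1 B)"
proof -
 obtain Y where Y: "A_basis B Y" using basis_exists by auto
 then have Y': "finite Y" "Y <= B" "Y <= carrier R" by (auto simp: A_basis_def)
 obtain S where S: "S <= A" "finite S" "ALL x:A. EX s:S. x \<ominus> s : tp 1 A" using finite_residues by auto
 show ?thesis
 proof (intro exI[of _ "(%c. comb c Y) ` (Y \<rightarrow>\<^sub>E S)"] conjI ballI)
  show "(%c. comb c Y) ` (Y \<rightarrow>\<^sub>E S) <= B" using S(1) by (auto intro!: comb_amod amod_B Y')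
  show "finite ((%c. comb c Y) ` (Y \<rightarrow>\<^sub>E S))" using Y' S by (intro finite_imageI finite_PiE) auto
  fix x assume "x : B"
  then obtain c where c: "c : Y \<rightarrow> A" "x = comb c Y" using Y by (auto simp: A_basis_def)
  then have "ALL y:Y. EX s. s : S & c y \<ominus> s : tp 1 A" using S(3) by (auto simp: Pi_def)
  then obtain s where s: "ALL y:Y. s y : S & c y \<ominus> s y : tp 1 A" by metis
  define s' where "s' = restrict s Y"
  have s': "s' : Y \<rightarrow>\<^sub>E S" "!!y. y : Y ==> c y \<ominus> s' y : tp 1 A" using s by (auto simp: s'_def)
  have "x \<ominus> comb s' Y = comb (%y. c y \<ominus> s' y) Y"
   unfolding c(2) using c s' S(1) Y' by (intro comb_diff[symmetric]) (auto simp: Pi_def PiE_def subset_iff)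
  also have "\<dots> : tp 1 B" using s' by (intro comb_scale_amod amod_B Y') auto
  finally show "EX s:(%c. comb c Y) ` (Y \<rightarrow>\<^sub>E S). x \<ominus> s : tp 1 B" using s'(1) by blast
 qed
qed

lemma tp_ideal_B: "b : B ==> x : tp n B ==> b ** x : tp n B"
proof -
 assume b: "b : B" and "x : tp n B"
 then obtain y where y: "y : B" "x = t [^] n ** y" by (auto elim: scaleE)
 then have "b ** x = t [^] n ** (b ** y)" using b by (simp add: m_lcomm)
 then show ?thesis using B_closed(4) b y by (auto intro: scaleI)
qed

lemma tp_mult_B: "x : tp m B ==> y : tp n B ==> x ** y : tp (m + n) B"
proof -
 assume "x : tp m B" "y : tp n B"
 then obtain a b where ab: "a : B" "x = t [^] m ** a" "b : B" "y = t [^] n ** b" by (auto elim!: scaleE)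
 then have "x ** y = t [^] (m + n) ** (a ** b)" by (simp add: nat_pow_mult[symmetric] m_ac)
 then show ?thesis using B_closed(4) ab by (auto intro: scaleI)
qed

lemma one_minus_tp_unit:
 assumes y: "y : B" shows "EX s:B. (\<one> \<ominus> t ** y) ** s = \<one>"
proof -
 define x where "x n = ((%z. \<one> \<oplus> t ** y ** z) ^^ n) \<zero>" for n
 have tyB: "t ** y : B" using B_closed A_B[OF t_A] y by auto
 have xB: "x n : B" for n by (induction n) (use B_closed tyB in \<open>auto simp: x_def\<close>)
 have xS: "x (Suc n) = \<one> \<oplus> t ** y ** x n" for n by (simp add: x_def)
 have step: "x (Suc n) \<ominus> x n : tp n B" for n
 proof (induction n)
  case 0 then show ?case using amodD(6)[OF amod_B xB xB] amod_B by simp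
 next
  case (Suc n)
  have "x (Suc (Suc n)) \<ominus> x (Suc n) = t ** y ** (x (Suc n) \<ominus> x n)"
   unfolding xS[of "Suc n"] using B_carrier[OF xB[of n]] B_carrier[OF xB[of "Suc n"]] B_carrier[OF tyB]
   by (subst (2) xS) algebra
  moreover have "t ** y : tp 1 B" using y by (rule scale1I)
  ultimately show ?case using tp_mult_B[OF _ Suc, of "t ** y" 1] by (simp add: One_nat_def)
 qed
 obtain s where s: "s : B" "!!n. s \<ominus> x n : tp n B" using B_complete[of x, OF xB step] by blast
 have "s \<ominus> (\<one> \<oplus> t ** y ** s) : tp n B" for n
 proof -
  have "s \<ominus> (\<one> \<oplus> t ** y ** s) = (s \<ominus> x (Suc n)) \<ominus> t ** y ** (s \<ominus> x n)"
   unfolding xS using B_carrier[OF s(1)] B_carrier[OF tyB] B_carrier[OF xB[of n]] by algebra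
  moreover have "s \<ominus> x (Suc n) : tp n B" using s(2)[of "Suc n"] scale_antimono[OF amod_B, of n "Suc n"] by auto
  ultimately show ?thesis using tp_ideal_B[OF tyB s(2)] amodD(6)[OF amod_scale[OF amod_B]] by auto
 qed
 then have z: "s \<ominus> (\<one> \<oplus> t ** y ** s) = \<zero>" by (rule separated_B)
 have "(\<one> \<ominus> t ** y) ** s = \<one> \<oplus> (s \<ominus> (\<one> \<oplus> t ** y ** s))"
  using B_carrier[OF s(1)] B_carrier[OF tyB] t_carrier B_carrier[OF y] by algebra
 then show ?thesis using z s(1) by (intro bexI[of _ s]) auto
qed

text \<open>Some power of \<open>x\<close> is idempotent modulo \<open>t\<close>, and the domain \<open>B\<close> has only trivial idempotents.\<close>

lemma nilpotent_or_unit: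
 assumes x: "x : B" shows "(\<exists>r>0. x [^] (r::nat) : tp 1 B) \<or> (EX s:B. x ** s = \<one>)"
proof -
 obtain S where S: "S <= B" "finite S" "!!x. x : B ==> EX s:S. x \<ominus> s : tp 1 B" using B_residues by auto
 note tB = amodD[OF amod_scale[OF amod_B]]
 obtain r :: nat where r: "r > 0" "x [^] r ** x [^] r \<ominus> x [^] r : tp 1 B"
  using power_idempotent_mod[of B "tp 1 B" S x, OF subring_B scale_subset[OF amod_B] tB(3) tp_ideal_B S x] by blast
 have pB: "x [^] (n::nat) : B" for n using x B_closed by (induction n) auto
 have "EX e:B. e ** e = e & e \<ominus> x [^] r : tp 1 B"
  using subring_B scale_subset[OF amod_B] tB(3) tp_ideal_B tp_mult_B scale_antimono[OF amod_B] separated_B B_complete pB r(2)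
  by (rule idempotent_lifting[where F = "%n. tp n B"])
 then obtain e where e: "e : B" "e ** e = e" "e \<ominus> x [^] r : tp 1 B" by auto
 have ec: "e : carrier R" "x [^] r : carrier R" using e pB by auto
 have "e ** (e \<ominus> \<one>) = e ** e \<ominus> e" using ec by algebra
 then have "e ** (e \<ominus> \<one>) = \<zero>" using e(2) ec by simp
 then have "e = \<zero> \<or> e = \<one>" using integral[of e "e \<ominus> \<one>"] ec by auto
 then show ?thesis
 proof
  assume "e = \<zero>"
  then have "\<ominus> (x [^] r) : tp 1 B" using e(3) ec by (simp add: a_minus_def)
  from tB(5)[OF this] have "x [^] r : tp 1 B" using ec by simp
  then show ?thesis using r by auto
 next
  assume "e = \<one>"
  then obtain y where y: "y : B" "\<one> \<ominus> x [^] r = t ** y" using e(3) by (auto elim: scale1E)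
  then have "x [^] r = \<one> \<ominus> t ** y" using ec(2) unfolding y(2)[symmetric] by algebra
  then obtain s where s: "s : B" "x [^] r ** s = \<one>" using one_minus_tp_unit[OF y(1)] by auto
  obtain k where k: "r = Suc k" using r(1) gr0_conv_Suc by auto
  have "x ** (x [^] k ** s) = x [^] r ** s" unfolding k nat_pow_Suc using x pB[of k] s(1) by (simp add: m_ac)
  then show ?thesis using s B_closed(4)[OF pB s(1)] by metis
 qed
qed

lemma uniformizer_complete_dvr:
 assumes \<pi>: "uniformizer (R\<lparr>carrier := B\<rparr>) \<pi>"
 shows "complete_dvr R B \<pi> M" "\<pi> : B" "t : scale R \<pi> 1 B"
proof -
 let ?RB = "R\<lparr>carrier := B\<rparr>"
 interpret RB: domain ?RB using subring_B by (rule subring_is_domain)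
 define P where "P = PIdl\<^bsub>?RB\<^esub> \<pi>"
 have max: "maximalideal P ?RB" and \<pi>B: "\<pi> : B" using \<pi> by (auto simp: uniformizer_def P_def)
 show "\<pi> : B" by fact
 interpret P: maximalideal P ?RB by (rule max)
 interpret P: primeideal P ?RB using max by (rule RB.maximalideal_prime)
 have \<pi>c: "\<pi> : carrier R" using \<pi>B by simp
 have P: "P = scale R \<pi> 1 B"
  unfolding P_def cgenideal_def scale_def using \<pi>c by (auto simp: m_comm)
 have oneP: "\<one> \<notin> P"
  using P.I_notcarr P.one_imp_carrier by auto
 have max2: "EX u:B. EX v:P. \<one> = u ** x \<oplus> v" if x: "x : B" "x \<notin> P" for x
 proof -
  let ?J = "PIdl\<^bsub>?RB\<^esub> x <+>\<^bsub>?RB\<^esub> P"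
  have iJ: "ideal ?J ?RB" using x P.ideal_axioms by (intro RB.add_ideals RB.cgenideal_ideal) auto
  have J: "!!z. z : ?J \<longleftrightarrow> (EX u:B. EX v:P. z = u ** x \<oplus> v)"
   by (auto simp: set_add_def' cgenideal_def)
  have "P <= ?J"
  proof
   fix v assume v: "v : P"
   then have "v = \<zero> ** x \<oplus> v" using x P.Icarr[OF v] by simp
   then show "v : ?J" unfolding J using v B_closed(1) by blast
  qed
  moreover have "?J <= carrier ?RB" using ideal.Icarr[OF iJ] by auto
  ultimately have "?J = P \<or> ?J = carrier ?RB" using P.I_maximal[OF iJ] by auto
  moreover have "x : ?J"
  proof -
   have "\<zero> : P" using P.zero_closed by simp
   moreover have "x = \<one> ** x \<oplus> \<zero>" using x by simp
   ultimately show ?thesis unfolding J using B_closed(2) by blast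
  qed
  ultimately have "\<one> : ?J" using x B_closed(2) by auto
  then show ?thesis unfolding J .
 qed
 have tB: "t : B" using A_B t_A by auto
 have tP: "t : P"
 proof (rule ccontr)
  assume "t \<notin> P"
  then obtain u v where uv: "u : B" "v : P" "\<one> = u ** t \<oplus> v" using max2 tB by blast
  have vB: "v : B" using P.Icarr[OF uv(2)] by simp
  have "\<one> \<ominus> t ** u = v" unfolding uv(3) using uv(1) vB t_carrier B_carrier[OF uv(1)] B_carrier[OF vB] by algebra
  then obtain s where s: "s : B" "v ** s = \<one>" using one_minus_tp_unit[OF uv(1)] by auto
  then have "\<one> : P" using P.I_r_closed[OF uv(2), of s] by simp
  then show False using oneP by simp
 qed
 then show "t : scale R \<pi> 1 B" by (simp add: P)
 obtain w where w: "w : B" "t = \<pi> ** w" using tP \<pi>c unfolding P by (auto simp: scale_def)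
 have wc: "w : carrier R" using w by simp
 have \<pi>nz: "\<pi> ~= \<zero>" using w t_nz wc by auto
 have no_unit: "x ** s ~= \<one>" if "x : P" "s : B" for x s
  using P.I_r_closed[OF that(1), of s] that oneP by auto
 have \<pi>P: "\<pi> : P" unfolding P scale_def using \<pi>c B_closed(2) by (intro image_eqI[of _ _ \<one>]) auto
 have powP: "x : P" if "x : B" "x [^] (r::nat) : P" for x r using that(2)
 proof (induction r)
  case 0 then show ?case using oneP by simp
 next
  case (Suc r)
  have "x [^] r : B" using that(1) B_closed by (induction r) auto
  then show ?case using P.I_prime[of "x [^] r" x] Suc that(1) by auto
 qed
 have tp_P: "tp 1 B <= P"
  using P.I_r_closed[OF tP] by (auto simp: scale_def)
 have nonunit: "EX s:B. x ** s = \<one>" if "x : B" "x \<notin> P" for x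
  using nilpotent_or_unit[OF that(1)] powP that tp_P by blast
 obtain r :: nat where r: "r > 0" "\<pi> [^] r : tp 1 B"
  using nilpotent_or_unit[OF \<pi>B] no_unit[OF \<pi>P] by blast
 obtain c where c: "c : B" "\<pi> [^] r = t ** c" using r(2) by (rule scale1E)
 have cc: "c : carrier R" using c by simp
 have bpow: "x [^] (n::nat) : B" if "x : B" for x n using that B_closed by (induction n) auto
 have sub1: "tp n B <= scale R \<pi> n B" for n
 proof
  fix x assume "x : tp n B"
  then obtain b where b: "b : B" "x = t [^] n ** b" by (rule scaleE)
  have "t [^] n = \<pi> [^] n ** w [^] n" unfolding w(2) using \<pi>c wc by (simp add: nat_pow_distrib)
  then have "x = \<pi> [^] n ** (w [^] n ** b)" using b \<pi>c wc by (simp add: m_assoc)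
  then show "x : scale R \<pi> n B" unfolding scale_def using B_closed(4)[OF bpow[OF w(1)] b(1)] by blast
 qed
 have \<pi>r: "\<pi> [^] (r * n) = t [^] n ** c [^] n" for n
  using c(2) \<pi>c cc by (metis nat_pow_distrib nat_pow_pow t_carrier)
 have sub2: "scale R \<pi> (r * n) B <= tp n B" for n
 proof
  fix x assume "x : scale R \<pi> (r * n) B"
  then obtain b where b: "b : B" "x = \<pi> [^] (r * n) ** b" by (auto simp: scale_def)
  then have "x = t [^] n ** (c [^] n ** b)" unfolding \<pi>r using cc by (simp add: m_assoc)
  then show "x : tp n B" using B_closed(4)[OF bpow[OF c(1)] b(1)] by (auto intro: scaleI)
 qed
 have anti: "scale R \<pi> n B <= scale R \<pi> m B" if "m <= n" for m n
 proof
  fix x assume "x : scale R \<pi> n B"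
  then obtain b where b: "b : B" "x = \<pi> [^] n ** b" by (auto simp: scale_def)
  have "\<pi> [^] n = \<pi> [^] m ** \<pi> [^] (n - m)" using that \<pi>c by (simp add: nat_pow_mult)
  then have "x = \<pi> [^] m ** (\<pi> [^] (n - m) ** b)" using b \<pi>c by (simp add: m_assoc)
  then show "x : scale R \<pi> m B" unfolding scale_def using B_closed(4)[OF bpow[OF \<pi>B] b(1)] by blast
 qed
 have padd: "x \<oplus> y : scale R \<pi> n B" if xy: "x : scale R \<pi> n B" "y : scale R \<pi> n B" for x y n
 proof -
  obtain a b where "a : B" "b : B" "x = \<pi> [^] n ** a" "y = \<pi> [^] n ** b" using xy by (auto simp: scale_def)
  then show ?thesis using \<pi>c B_closed(5) by (auto simp: scale_def r_distr[symmetric])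
 qed
 show "complete_dvr R B \<pi> M"
 proof (intro_locales, rule complete_dvr_axioms.intro)
  show "subring B R" "subfield M R" by (rule subring_B, rule subfield_M)
  show "B <= M" using B_M by auto
  show "\<pi> : B" "\<pi> ~= \<zero>" by fact+
  show "inv \<pi> \<notin> B" using no_unit[OF \<pi>P] inv_simps(2)[OF \<pi>c \<pi>nz] by auto
  show "inv x : B" if x: "x : B" "x \<notin> scale R \<pi> 1 B" for x
  proof -
   obtain s where s: "s : B" "x ** s = \<one>" using nonunit x P by auto
   then have "inv x = s" using x by (intro comm_inv_char) auto
   then show ?thesis using s by simp
  qed
  show "x = \<zero>" if "!!n. x : scale R \<pi> n B" for x
   using separated_B[of x] sub2 that by blast
  show "EX s:B. ALL n. s \<ominus> x n : scale R \<pi> n B"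
   if x: "!!n. x n : B" "!!n. x (Suc n) \<ominus> x n : scale R \<pi> n B" for x
  proof -
   have far: "x m \<ominus> x n : scale R \<pi> n B" if "m >= n" for m n using that
   proof (induction m rule: dec_induct)
    case base
    have "\<pi> [^] n ** \<zero> = \<zero>" using \<pi>c by simp
    then have "\<zero> : scale R \<pi> n B" unfolding scale_def using B_closed(1) by (metis imageI)
    then show ?case using x(1)[of n] by (simp add: a_minus_def r_neg)
   next
    case (step m)
    have "x (Suc m) \<ominus> x n = (x (Suc m) \<ominus> x m) \<oplus> (x m \<ominus> x n)"
     using B_carrier[OF x(1)[of m]] B_carrier[OF x(1)[of n]] B_carrier[OF x(1)[of "Suc m"]] by algebra
    moreover have "x (Suc m) \<ominus> x m : scale R \<pi> n B" using x(2)[of m] anti[of n m] step by auto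
    ultimately show ?case using step padd by auto
   qed
   have "x (r * Suc n) \<ominus> x (r * n) : tp n B" for n
    using far[of "r * n" "r * Suc n"] sub2[of n] by auto
   then obtain s where s: "s : B" "!!n. s \<ominus> x (r * n) : tp n B"
    using B_complete[of "%n. x (r * n)"] x(1) by auto
   have "s \<ominus> x n : scale R \<pi> n B" for n
   proof -
    have "s \<ominus> x n = (s \<ominus> x (r * n)) \<oplus> (x (r * n) \<ominus> x n)"
     using B_carrier[OF x(1)[of n]] B_carrier[OF x(1)[of "r * n"]] B_carrier[OF s(1)] by algebra
    moreover have "x (r * n) \<ominus> x n : scale R \<pi> n B" using r(1) by (intro far) simp
    ultimately show ?thesis using s(2)[of n] sub1[of n] padd by auto
   qed
   then show ?thesis using s(1) by blast
  qed
  show "EX n. \<pi> [^] (n::nat) ** x : B" if x: "x : M" for x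
  proof -
   obtain n :: nat where n: "t [^] n ** x : B" using scaled_in_B x by auto
   have "\<pi> [^] (r * n) ** x = c [^] n ** (t [^] n ** x)" unfolding \<pi>r using cc x by (simp add: m_ac)
   then show ?thesis using B_closed(4)[OF bpow[OF c(1)] n] by (intro exI[of _ "r * n"]) simp
  qed
  show "\<exists>S\<subseteq>B. finite S & (ALL x:B. EX s:S. x \<ominus> s : scale R \<pi> 1 B)"
  proof -
   obtain S where S: "S <= B" "finite S" "ALL x:B. EX s:S. x \<ominus> s : tp 1 B" using B_residues by auto
   then have "ALL x:B. EX s:S. x \<ominus> s : scale R \<pi> 1 B" using subsetD[OF sub1] by fast
   then show ?thesis using S by blast
  qed
 qed
qed

end

section \<open>Group rings\<close>

context cring
begin

lemma binomial_expansion: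
 assumes x: "x : carrier R" and y: "y : carrier R"
 shows "(x \<oplus> y) [^] n = (\<Oplus>k\<in>{..n}. [(n choose k)] \<cdot> (x [^] k ** y [^] (n - k)))"
proof (induction n)
 case 0 then show ?case by simp
next
 case (Suc n)
 define b where "b n k = [(n choose k)] \<cdot> (x [^] k ** y [^] (n - k))" for n k
 have bc [simp]: "b n k : carrier R" for n k using x y by (simp add: b_def)
 have yb: "y ** b n (Suc k) = [(n choose Suc k)] \<cdot> (x [^] Suc k ** y [^] (n - k))" for k
 proof (cases "Suc k <= n")
  case True
  then have "y [^] (n - k) = y [^] (n - Suc k) ** y" by (metis Suc_diff_Suc Suc_le_lessD nat_pow_Suc)
  then show ?thesis using x y unfolding b_def by (simp add: add_pow_rdistr m_ac del: nat_pow_Suc)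
 next
  case False
  then have "n choose Suc k = 0" by (simp add: binomial_eq_0)
  then show ?thesis unfolding b_def \<open>n choose Suc k = 0\<close> using y by simp
 qed
 have xb: "x ** b n k = [(n choose k)] \<cdot> (x [^] Suc k ** y [^] (n - k))" for k
  using x y by (simp add: b_def add_pow_rdistr m_ac)
 have S: "b (Suc n) (Suc k) = x ** b n k \<oplus> y ** b n (Suc k)" for k
  unfolding xb yb using x y by (simp add: b_def add.nat_pow_mult del: nat_pow_Suc)
 have 0: "b (Suc n) 0 = y ** b n 0" using x y by (simp add: b_def m_comm)
 have "(x \<oplus> y) [^] Suc n = (\<Oplus>k\<in>{..n}. b n k) ** (x \<oplus> y)" by (simp add: Suc.IH b_def)
 also have "\<dots> = x ** (\<Oplus>k\<in>{..n}. b n k) \<oplus> y ** (\<Oplus>k\<in>{..n}. b n k)"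
  using x y by (subst m_comm) (auto simp: l_distr)
 also have e: "(\<Oplus>k\<in>{..n}. b n k) = (\<Oplus>k\<in>{..Suc n}. b n k)"
 proof -
  have "b n (Suc n) = \<zero>" using x y by (simp add: b_def binomial_eq_0)
  then show ?thesis by (simp add: Pi_def)
 qed
 also have "x ** (\<Oplus>k\<in>{..Suc n}. b n k) = x ** (\<Oplus>k\<in>{..n}. b n k)" unfolding e ..
 also have "\<dots> = (\<Oplus>k\<in>{..n}. x ** b n k)" using x by (intro finsum_rdistr) auto
 also have "y ** (\<Oplus>k\<in>{..Suc n}. b n k) = (\<Oplus>k\<in>{..Suc n}. y ** b n k)" using y by (intro finsum_rdistr) auto
 also have "\<dots> = (\<Oplus>k\<in>{..n}. y ** b n (Suc k)) \<oplus> y ** b n 0" using y by (intro finsum_Suc2) auto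
 also have "(\<Oplus>k\<in>{..n}. x ** b n k) \<oplus> ((\<Oplus>k\<in>{..n}. y ** b n (Suc k)) \<oplus> y ** b n 0)
  = ((\<Oplus>k\<in>{..n}. x ** b n k) \<oplus> (\<Oplus>k\<in>{..n}. y ** b n (Suc k))) \<oplus> b (Suc n) 0"
  unfolding 0 using x y by (intro a_assoc[symmetric]) auto
 also have "(\<Oplus>k\<in>{..n}. x ** b n k) \<oplus> (\<Oplus>k\<in>{..n}. y ** b n (Suc k)) = (\<Oplus>k\<in>{..n}. b (Suc n) (Suc k))"
  unfolding S using x y by (intro finsum_addf[symmetric]) auto
 also have "\<dots> \<oplus> b (Suc n) 0 = (\<Oplus>k\<in>{..Suc n}. b (Suc n) k)" by (intro finsum_Suc2[symmetric]) auto
 finally show ?case by (simp only: b_def)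
qed

lemma frobenius_add:
 assumes p: "Factorial_Ring.prime (p::nat)" "[p] \<cdot> \<one> = \<zero>" and xy: "x : carrier R" "y : carrier R"
 shows "(x \<oplus> y) [^] p = x [^] p \<oplus> y [^] p"
proof -
 let ?b = "%k. [(p choose k)] \<cdot> (x [^] k ** y [^] (p - k))"
 have p0: "p ~= 0" using p(1) by auto
 have z: "[(p * m)] \<cdot> w = \<zero>" if w: "w : carrier R" for m w
 proof -
  have "[p] \<cdot> w = [p] \<cdot> \<one> ** w" using w by (simp add: add_pow_ldistr)
  then have "[p] \<cdot> w = \<zero>" using p(2) w by simp
  then show ?thesis using w by (metis add.nat_pow_one add.nat_pow_pow)
 qed
 have "?b k = \<zero>" if k: "0 < k" "k < p" for k
 proof -
  have "p dvd p choose k" using p(1) k by (intro dvd_choose_prime) auto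
  then show ?thesis using z xy by (auto elim!: dvdE)
 qed
 then have "(\<Oplus>k\<in>{..p}. ?b k) = (\<Oplus>k\<in>{0, p}. ?b k)"
  using xy by (intro add.finprod_mono_neutral_cong_right) (auto simp: Pi_def)
 also have "\<dots> = y [^] p \<oplus> x [^] p" using xy p0 by simp
 finally show ?thesis using binomial_expansion[OF xy] xy by (simp add: a_comm)
qed

lemma frobenius_power_add:
 assumes p: "Factorial_Ring.prime (p::nat)" "[p] \<cdot> \<one> = \<zero>" and xy: "x : carrier R" "y : carrier R"
 shows "(x \<oplus> y) [^] (p ^ m) = x [^] (p ^ m) \<oplus> y [^] (p ^ m)"
proof (induction m)
 case (Suc m)
 have "(x \<oplus> y) [^] (p ^ Suc m) = ((x \<oplus> y) [^] (p ^ m)) [^] p" using xy by (simp add: nat_pow_pow mult.commute)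
 also have "\<dots> = (x [^] (p ^ m)) [^] p \<oplus> (y [^] (p ^ m)) [^] p" unfolding Suc using xy by (intro frobenius_add p) auto
 finally show ?case using xy by (simp add: nat_pow_pow mult.commute)
qed (use xy in simp)

lemma frobenius_power_finsum:
 assumes p: "Factorial_Ring.prime (p::nat)" "[p] \<cdot> \<one> = \<zero>" and I: "finite I" "f : I \<rightarrow> carrier R"
 shows "(\<Oplus>i\<in>I. f i) [^] (p ^ m) = (\<Oplus>i\<in>I. f i [^] (p ^ m))"
 using I
proof (induction I)
 case empty
 have "p ^ m ~= 0" using p(1) by auto
 then show ?case by (simp add: nat_pow_zero)
next
 case (insert i I)
 then have "(f i \<oplus> (\<Oplus>i\<in>I. f i)) [^] (p ^ m) = f i [^] (p ^ m) \<oplus> (\<Oplus>i\<in>I. f i) [^] (p ^ m)"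
  by (intro frobenius_power_add p) auto
 then show ?case using insert by (simp add: Pi_def)
qed

lemma frobenius_power_diff:
 assumes p: "Factorial_Ring.prime (p::nat)" "[p] \<cdot> \<one> = \<zero>" and xy: "x : carrier R" "y : carrier R"
 shows "(x \<ominus> y) [^] (p ^ m) = x [^] (p ^ m) \<ominus> y [^] (p ^ m)"
proof -
 have "(x \<ominus> y \<oplus> y) [^] (p ^ m) = (x \<ominus> y) [^] (p ^ m) \<oplus> y [^] (p ^ m)" using xy by (intro frobenius_power_add p) auto
 moreover have "x \<ominus> y \<oplus> y = x" using xy by algebra
 ultimately have e: "x [^] (p ^ m) = (x \<ominus> y) [^] (p ^ m) \<oplus> y [^] (p ^ m)" by simp
 have "(x \<ominus> y) [^] (p ^ m) : carrier R" "y [^] (p ^ m) : carrier R" using xy by auto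
 then show ?thesis unfolding e by algebra
qed

end

lemma (in comm_group) power_coprime_order_inj:
 assumes fin: "finite (carrier G)" and cop: "coprime q (order G)"
  and gh: "g : carrier G" "h : carrier G" "g [^] (q::nat) = h [^] q"
 shows "g = h"
proof -
 let ?x = "g ** inv h"
 have xc: "?x : carrier G" using gh by simp
 have "?x [^] q = g [^] q ** inv (h [^] q)" using gh by (simp add: nat_pow_distrib nat_pow_inv)
 then have "?x [^] q = \<one>" using gh by simp
 then have "ord ?x dvd q" using pow_eq_id[OF xc] by simp
 moreover have "ord ?x dvd order G" using ord_dvd_group_order[OF xc] .
 ultimately have "ord ?x = 1" using cop by (metis coprime_common_divisor_nat)
 then have "?x = \<one>" using ord_eq_1[OF xc] by simp
 then show ?thesis using gh by (metis inv_equality inv_inv inv_closed)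
qed

locale group_ring = R: cring R + G: comm_group G
 for R :: "('a, 'b) ring_scheme" (structure) and G :: "('g, 'm) monoid_scheme" (structure) +
 assumes finite_G: "finite (carrier G)"
begin

abbreviation "S \<equiv> finite_group_ring R G"

lemma S_carrier: "carrier S = carrier G \<rightarrow>\<^sub>E carrier R" by (simp add: finite_group_ring_def)
lemma S_mult: "g : carrier G ==> (a **\<^bsub>S\<^esub> b) g = (\<Oplus>h\<in>carrier G. a h ** b (inv\<^bsub>G\<^esub> h **\<^bsub>G\<^esub> g))"
 by (simp add: finite_group_ring_def)
lemma S_add: "g : carrier G ==> (a \<oplus>\<^bsub>S\<^esub> b) g = a g \<oplus> b g" by (simp add: finite_group_ring_def)
lemma S_one: "g : carrier G ==> \<one>\<^bsub>S\<^esub> g = (if g = \<one>\<^bsub>G\<^esub> then \<one> else \<zero>)" by (simp add: finite_group_ring_def)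
lemma S_zero: "g : carrier G ==> \<zero>\<^bsub>S\<^esub> g = \<zero>" by (simp add: finite_group_ring_def)

lemma S_closed: "a : carrier S ==> g : carrier G ==> a g : carrier R" by (auto simp: S_carrier)

lemma S_eqI: "a : carrier S ==> b : carrier S ==> (!!g. g : carrier G ==> a g = b g) ==> a = b"
 by (auto simp: S_carrier intro: PiE_ext)

lemma sum_translate:
 assumes "f : carrier G \<rightarrow> carrier R" "k : carrier G"
 shows "(\<Oplus>h\<in>carrier G. f (k **\<^bsub>G\<^esub> h)) = (\<Oplus>h\<in>carrier G. f h)"
proof -
 have "(\<Oplus>h\<in>(%h. k **\<^bsub>G\<^esub> h) ` carrier G. f h) = (\<Oplus>h\<in>carrier G. f (k **\<^bsub>G\<^esub> h))"
  using assms by (intro R.finsum_reindex) (auto simp: inj_on_def)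
 moreover have "(%h. k **\<^bsub>G\<^esub> h) ` carrier G = carrier G" using assms(2) by (rule G.surj_const_mult)
 ultimately show ?thesis by simp
qed

lemma sum_inverse:
 assumes "f : carrier G \<rightarrow> carrier R"
 shows "(\<Oplus>h\<in>carrier G. f (inv\<^bsub>G\<^esub> h)) = (\<Oplus>h\<in>carrier G. f h)"
proof -
 have "(%h. inv\<^bsub>G\<^esub> h) ` carrier G = carrier G" by (force intro: image_eqI[of _ _ "inv\<^bsub>G\<^esub> _"])
 moreover have "(\<Oplus>h\<in>(%h. inv\<^bsub>G\<^esub> h) ` carrier G. f h) = (\<Oplus>h\<in>carrier G. f (inv\<^bsub>G\<^esub> h))"
  using assms by (intro R.finsum_reindex) (auto simp: inj_on_def)
 ultimately show ?thesis by simp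
qed

lemma S_mult_closed: "a : carrier S ==> b : carrier S ==> a **\<^bsub>S\<^esub> b : carrier S"
 unfolding S_carrier by (auto simp: finite_group_ring_def Pi_def PiE_def extensional_def intro!: R.finsum_closed)

lemma S_mult_comm: assumes a: "a : carrier S" and b: "b : carrier S" shows "a **\<^bsub>S\<^esub> b = b **\<^bsub>S\<^esub> a"
proof (rule S_eqI)
 fix g assume g: "g : carrier G"
 note ac = S_closed[OF a] S_closed[OF b]
 have "(a **\<^bsub>S\<^esub> b) g = (\<Oplus>h\<in>carrier G. a h ** b (inv\<^bsub>G\<^esub> h **\<^bsub>G\<^esub> g))" by (simp add: S_mult g)
 also have "\<dots> = (\<Oplus>h\<in>carrier G. a (g **\<^bsub>G\<^esub> h) ** b (inv\<^bsub>G\<^esub> (g **\<^bsub>G\<^esub> h) **\<^bsub>G\<^esub> g))"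
  using ac g by (intro sum_translate[symmetric]) auto
 also have "\<dots> = (\<Oplus>h\<in>carrier G. a (g **\<^bsub>G\<^esub> inv\<^bsub>G\<^esub> h) ** b (inv\<^bsub>G\<^esub> (g **\<^bsub>G\<^esub> inv\<^bsub>G\<^esub> h) **\<^bsub>G\<^esub> g))"
  using ac g by (intro sum_inverse[symmetric]) auto
 also have "\<dots> = (\<Oplus>h\<in>carrier G. b h ** a (inv\<^bsub>G\<^esub> h **\<^bsub>G\<^esub> g))"
 proof (intro R.finsum_cong' refl)
  fix h assume h: "h : carrier G"
  have "inv\<^bsub>G\<^esub> (g **\<^bsub>G\<^esub> inv\<^bsub>G\<^esub> h) **\<^bsub>G\<^esub> g = h" using g h by (simp add: G.inv_mult_group G.m_assoc)
  moreover have "g **\<^bsub>G\<^esub> inv\<^bsub>G\<^esub> h = inv\<^bsub>G\<^esub> h **\<^bsub>G\<^esub> g" using g h by (simp add: G.m_comm)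
  ultimately show "a (g **\<^bsub>G\<^esub> inv\<^bsub>G\<^esub> h) ** b (inv\<^bsub>G\<^esub> (g **\<^bsub>G\<^esub> inv\<^bsub>G\<^esub> h) **\<^bsub>G\<^esub> g)
   = b h ** a (inv\<^bsub>G\<^esub> h **\<^bsub>G\<^esub> g)" using ac g h by (simp add: R.m_comm)
 qed (use ac g in auto)
 finally show "(a **\<^bsub>S\<^esub> b) g = (b **\<^bsub>S\<^esub> a) g" by (simp add: S_mult g)
qed (use S_mult_closed a b in auto)

text \<open>A weighted sum turns convolution into a double sum; both associativity and the
  compatibility with group actions are instances.\<close>

lemma sum_mult:
 assumes a: "a : carrier S" and b: "b : carrier S" and w: "w : carrier G \<rightarrow> carrier R"
 shows "(\<Oplus>g\<in>carrier G. (a **\<^bsub>S\<^esub> b) g ** w g)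
  = (\<Oplus>h\<in>carrier G. a h ** (\<Oplus>k\<in>carrier G. b k ** w (h **\<^bsub>G\<^esub> k)))"
proof -
 note ac = S_closed[OF a] S_closed[OF b] funcset_mem[OF w]
 have "(\<Oplus>g\<in>carrier G. (a **\<^bsub>S\<^esub> b) g ** w g)
  = (\<Oplus>g\<in>carrier G. \<Oplus>h\<in>carrier G. a h ** (b (inv\<^bsub>G\<^esub> h **\<^bsub>G\<^esub> g) ** w g))"
 proof (intro R.finsum_cong' refl)
  fix g assume g: "g : carrier G"
  have "(a **\<^bsub>S\<^esub> b) g ** w g = (\<Oplus>h\<in>carrier G. (a h ** b (inv\<^bsub>G\<^esub> h **\<^bsub>G\<^esub> g)) ** w g)"
   unfolding S_mult[OF g] using ac g finite_G by (intro R.finsum_ldistr) auto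
  also have "\<dots> = (\<Oplus>h\<in>carrier G. a h ** (b (inv\<^bsub>G\<^esub> h **\<^bsub>G\<^esub> g) ** w g))"
   using ac g by (intro R.finsum_cong') (auto simp: R.m_assoc)
  finally show "(a **\<^bsub>S\<^esub> b) g ** w g = \<dots>" .
 qed (use ac in \<open>auto intro!: R.finsum_closed\<close>)
 also have "\<dots> = (\<Oplus>h\<in>carrier G. \<Oplus>g\<in>carrier G. a h ** (b (inv\<^bsub>G\<^esub> h **\<^bsub>G\<^esub> g) ** w g))"
  using ac finite_G by (intro R.finsum_swap) auto
 also have "\<dots> = (\<Oplus>h\<in>carrier G. a h ** (\<Oplus>k\<in>carrier G. b k ** w (h **\<^bsub>G\<^esub> k)))"
 proof (intro R.finsum_cong' refl)
  fix h assume h: "h : carrier G"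
  have "(\<Oplus>g\<in>carrier G. a h ** (b (inv\<^bsub>G\<^esub> h **\<^bsub>G\<^esub> g) ** w g))
   = a h ** (\<Oplus>g\<in>carrier G. b (inv\<^bsub>G\<^esub> h **\<^bsub>G\<^esub> g) ** w g)"
   using ac h finite_G by (intro R.finsum_rdistr[symmetric]) auto
  also have "(\<Oplus>g\<in>carrier G. b (inv\<^bsub>G\<^esub> h **\<^bsub>G\<^esub> g) ** w g)
   = (\<Oplus>k\<in>carrier G. b (inv\<^bsub>G\<^esub> h **\<^bsub>G\<^esub> (h **\<^bsub>G\<^esub> k)) ** w (h **\<^bsub>G\<^esub> k))"
   using ac h by (intro sum_translate[symmetric]) auto
  also have "\<dots> = (\<Oplus>k\<in>carrier G. b k ** w (h **\<^bsub>G\<^esub> k))"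
   using ac h by (intro R.finsum_cong') (auto simp: G.m_assoc[symmetric])
  finally show "(\<Oplus>g\<in>carrier G. a h ** (b (inv\<^bsub>G\<^esub> h **\<^bsub>G\<^esub> g) ** w g))
   = a h ** (\<Oplus>k\<in>carrier G. b k ** w (h **\<^bsub>G\<^esub> k))" .
 qed (use ac in \<open>auto intro!: R.finsum_closed\<close>)
 finally show ?thesis .
qed

lemma S_mult_assoc:
 assumes a: "a : carrier S" and b: "b : carrier S" and c: "c : carrier S"
 shows "(a **\<^bsub>S\<^esub> b) **\<^bsub>S\<^esub> c = a **\<^bsub>S\<^esub> (b **\<^bsub>S\<^esub> c)"
proof (rule S_eqI)
 fix g assume g: "g : carrier G"
 note ac = S_closed[OF a] S_closed[OF b] S_closed[OF c]
 have "((a **\<^bsub>S\<^esub> b) **\<^bsub>S\<^esub> c) g = (\<Oplus>h\<in>carrier G. (a **\<^bsub>S\<^esub> b) h ** c (inv\<^bsub>G\<^esub> h **\<^bsub>G\<^esub> g))"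
  by (simp add: S_mult[of _ "a **\<^bsub>S\<^esub> b"] g)
 also have "\<dots> = (\<Oplus>h\<in>carrier G. a h ** (\<Oplus>k\<in>carrier G. b k ** c (inv\<^bsub>G\<^esub> (h **\<^bsub>G\<^esub> k) **\<^bsub>G\<^esub> g)))"
  using ac g by (intro sum_mult a b) auto
 also have "\<dots> = (\<Oplus>h\<in>carrier G. a h ** (b **\<^bsub>S\<^esub> c) (inv\<^bsub>G\<^esub> h **\<^bsub>G\<^esub> g))"
 proof (intro R.finsum_cong' refl)
  fix h assume h: "h : carrier G"
  have "(\<Oplus>k\<in>carrier G. b k ** c (inv\<^bsub>G\<^esub> (h **\<^bsub>G\<^esub> k) **\<^bsub>G\<^esub> g))
   = (\<Oplus>k\<in>carrier G. b k ** c (inv\<^bsub>G\<^esub> k **\<^bsub>G\<^esub> (inv\<^bsub>G\<^esub> h **\<^bsub>G\<^esub> g)))"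
   using ac g h by (intro R.finsum_cong') (auto simp: G.inv_mult_group G.m_assoc)
  then show "a h ** (\<Oplus>k\<in>carrier G. b k ** c (inv\<^bsub>G\<^esub> (h **\<^bsub>G\<^esub> k) **\<^bsub>G\<^esub> g))
   = a h ** (b **\<^bsub>S\<^esub> c) (inv\<^bsub>G\<^esub> h **\<^bsub>G\<^esub> g)" using g h by (simp add: S_mult)
 qed (use ac g S_closed[OF S_mult_closed[OF b c]] in auto)
 also have "\<dots> = (a **\<^bsub>S\<^esub> (b **\<^bsub>S\<^esub> c)) g" by (simp add: S_mult[of _ a] g)
 finally show "((a **\<^bsub>S\<^esub> b) **\<^bsub>S\<^esub> c) g = (a **\<^bsub>S\<^esub> (b **\<^bsub>S\<^esub> c)) g" .
qed (use S_mult_closed a b c in auto)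

lemma S_add_closed: "a : carrier S ==> b : carrier S ==> a \<oplus>\<^bsub>S\<^esub> b : carrier S"
 by (auto simp: finite_group_ring_def PiE_def Pi_def extensional_def)
lemma S_zero_closed: "\<zero>\<^bsub>S\<^esub> : carrier S" by (auto simp: finite_group_ring_def)
lemma S_one_closed: "\<one>\<^bsub>S\<^esub> : carrier S" by (auto simp: finite_group_ring_def)

lemma S_one_mult: assumes a: "a : carrier S" shows "\<one>\<^bsub>S\<^esub> **\<^bsub>S\<^esub> a = a"
proof (rule S_eqI)
 fix g assume g: "g : carrier G"
 have "(\<one>\<^bsub>S\<^esub> **\<^bsub>S\<^esub> a) g = \<one>\<^bsub>S\<^esub> \<one>\<^bsub>G\<^esub> ** a (inv\<^bsub>G\<^esub> \<one>\<^bsub>G\<^esub> **\<^bsub>G\<^esub> g)"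
  unfolding S_mult[OF g] using g finite_G S_closed[OF a]
  by (intro R.finsum_single) (auto simp: S_one)
 then show "(\<one>\<^bsub>S\<^esub> **\<^bsub>S\<^esub> a) g = a g" using g S_closed[OF a] by (simp add: S_one)
qed (use S_mult_closed S_one_closed a in auto)

lemma S_distr:
 assumes a: "a : carrier S" and b: "b : carrier S" and c: "c : carrier S"
 shows "(a \<oplus>\<^bsub>S\<^esub> b) **\<^bsub>S\<^esub> c = a **\<^bsub>S\<^esub> c \<oplus>\<^bsub>S\<^esub> b **\<^bsub>S\<^esub> c"
proof (rule S_eqI)
 fix g assume g: "g : carrier G"
 note ac = S_closed[OF a] S_closed[OF b] S_closed[OF c]
 have "((a \<oplus>\<^bsub>S\<^esub> b) **\<^bsub>S\<^esub> c) g = (\<Oplus>h\<in>carrier G. a h ** c (inv\<^bsub>G\<^esub> h **\<^bsub>G\<^esub> g) \<oplus> b h ** c (inv\<^bsub>G\<^esub> h **\<^bsub>G\<^esub> g))"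
  unfolding S_mult[OF g] using ac g by (intro R.finsum_cong') (auto simp: S_add R.l_distr)
 also have "\<dots> = (a **\<^bsub>S\<^esub> c) g \<oplus> (b **\<^bsub>S\<^esub> c) g"
  unfolding S_mult[OF g] using ac g by (intro R.finsum_addf) auto
 finally show "((a \<oplus>\<^bsub>S\<^esub> b) **\<^bsub>S\<^esub> c) g = (a **\<^bsub>S\<^esub> c \<oplus>\<^bsub>S\<^esub> b **\<^bsub>S\<^esub> c) g" using g by (simp add: S_add)
qed (use S_mult_closed S_add_closed a b c in auto)

theorem S_cring: "cring S"
proof (rule cringI)
 show "abelian_group S"
 proof (rule abelian_groupI)
  fix x assume x: "x : carrier S"
  have "(\<lambda>g\<in>carrier G. \<ominus> x g) : carrier S" using S_closed[OF x] by (auto simp: S_carrier)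
  moreover have "(\<lambda>g\<in>carrier G. \<ominus> x g) \<oplus>\<^bsub>S\<^esub> x = \<zero>\<^bsub>S\<^esub>"
   using S_closed[OF x] by (auto simp: finite_group_ring_def R.l_neg)
  ultimately show "EX y:carrier S. y \<oplus>\<^bsub>S\<^esub> x = \<zero>\<^bsub>S\<^esub>" by blast
  show "\<zero>\<^bsub>S\<^esub> \<oplus>\<^bsub>S\<^esub> x = x"
   using x by (intro S_eqI S_add_closed S_zero_closed) (auto simp: S_add S_zero S_closed)
  fix y assume y: "y : carrier S"
  show "x \<oplus>\<^bsub>S\<^esub> y = y \<oplus>\<^bsub>S\<^esub> x"
   using x y by (intro S_eqI S_add_closed) (auto simp: S_add S_closed R.a_comm)
  fix z assume z: "z : carrier S"
  show "x \<oplus>\<^bsub>S\<^esub> y \<oplus>\<^bsub>S\<^esub> z = x \<oplus>\<^bsub>S\<^esub> (y \<oplus>\<^bsub>S\<^esub> z)"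
   using x y z by (intro S_eqI S_add_closed) (auto simp: S_add S_closed R.a_assoc)
 qed (auto intro: S_add_closed S_zero_closed)
 show "comm_monoid S"
  by (rule comm_monoidI) (auto intro: S_mult_closed S_one_closed S_mult_assoc S_one_mult S_mult_comm)
qed (auto intro: S_distr)

definition single :: "'a => 'g => 'g => 'a" where
 "single r g = (\<lambda>h\<in>carrier G. if h = g then r else \<zero>)"

lemma single_closed [simp]: "r : carrier R ==> single r g : carrier S"
 by (auto simp: single_def S_carrier)

lemma single_mult:
 assumes "r : carrier R" "s : carrier R" "g : carrier G" "h : carrier G"
 shows "single r g **\<^bsub>S\<^esub> single s h = single (r ** s) (g **\<^bsub>G\<^esub> h)"
proof (rule S_eqI)
 fix k assume k: "k : carrier G"
 have "(single r g **\<^bsub>S\<^esub> single s h) k = single r g g ** single s h (inv\<^bsub>G\<^esub> g **\<^bsub>G\<^esub> k)"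
  unfolding S_mult[OF k] using k finite_G assms
  by (intro R.finsum_single) (auto simp: single_def)
 moreover have "inv\<^bsub>G\<^esub> g **\<^bsub>G\<^esub> k = h \<longleftrightarrow> k = g **\<^bsub>G\<^esub> h"
  using assms k by (metis G.inv_solve_left)
 ultimately show "(single r g **\<^bsub>S\<^esub> single s h) k = single (r ** s) (g **\<^bsub>G\<^esub> h) k"
  using assms k by (auto simp: single_def)
qed (use assms S_mult_closed in auto)

lemma single_one: "single \<one> \<one>\<^bsub>G\<^esub> = \<one>\<^bsub>S\<^esub>"
 by (auto simp: single_def finite_group_ring_def)

lemma single_power:
 assumes "r : carrier R" "g : carrier G"
 shows "single r g [^]\<^bsub>S\<^esub> (n::nat) = single (r [^] n) (g [^]\<^bsub>G\<^esub> n)"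
proof -
 interpret S: cring S by (rule S_cring)
 show ?thesis by (induction n) (use assms in \<open>auto simp: single_one single_mult\<close>)
qed

lemma S_finsum:
 assumes "finite I" "f : I \<rightarrow> carrier S" "g : carrier G"
 shows "(\<Oplus>\<^bsub>S\<^esub>i\<in>I. f i) g = (\<Oplus>i\<in>I. f i g)"
proof -
 interpret S: cring S by (rule S_cring)
 show ?thesis using assms(1,2)
 proof (induction I)
  case empty then show ?case using assms(3) by (simp add: S_zero)
 next
  case (insert x I)
  then have "f x : carrier S" "f : I \<rightarrow> carrier S" by auto
  then show ?case using insert assms(3) by (simp add: S_add S_closed Pi_def)
 qed
qed

lemma S_decompose: assumes a: "a : carrier S" shows "a = (\<Oplus>\<^bsub>S\<^esub>g\<in>carrier G. single (a g) g)"
proof -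
 interpret S: cring S by (rule S_cring)
 have cl: "(%g. single (a g) g) : carrier G \<rightarrow> carrier S" using S_closed[OF a] by auto
 show ?thesis
 proof (rule S_eqI)
  fix h assume h: "h : carrier G"
  have "(\<Oplus>\<^bsub>S\<^esub>g\<in>carrier G. single (a g) g) h = (\<Oplus>g\<in>carrier G. single (a g) g h)"
   using finite_G cl h by (rule S_finsum)
  also have "\<dots> = single (a h) h h"
   using finite_G h S_closed[OF a] by (intro R.finsum_single) (auto simp: single_def)
  finally show "a h = (\<Oplus>\<^bsub>S\<^esub>g\<in>carrier G. single (a g) g) h" using h by (simp add: single_def)
 qed (use a cl in \<open>auto intro: S.finsum_closed\<close>)
qed

end

section \<open>Galois lattices\<close>

lemma (in complete_dvr) lin_sum:
 assumes D: "amod D" and I: "finite I" "!!i. i : I ==> lin D (\<phi> i)" "!!i. i : I ==> a i : A"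
 shows "lin D (%d. \<Oplus>i\<in>I. a i ** \<phi> i d)"
 unfolding lin_def
proof (intro conjI ballI)
 have l: "\<phi> i x : A" if "i : I" "x : D" for i x using linD(1)[OF I(2) D] that by auto
 show "(%d. \<Oplus>i\<in>I. a i ** \<phi> i d) : D \<rightarrow> A"
  using l I(3) A_closed by (auto intro!: amod_finsum amod_A)
 fix x y assume xy: "x : D" "y : D"
 have "(\<Oplus>i\<in>I. a i ** \<phi> i (x \<oplus> y)) = (\<Oplus>i\<in>I. a i ** \<phi> i x \<oplus> a i ** \<phi> i y)"
  using l I(3) xy linD(2)[OF I(2) D] by (intro finsum_cong') (auto simp: r_distr)
 also have "\<dots> = (\<Oplus>i\<in>I. a i ** \<phi> i x) \<oplus> (\<Oplus>i\<in>I. a i ** \<phi> i y)"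
  using l I(3) xy by (intro finsum_addf) auto
 finally show "(\<Oplus>i\<in>I. a i ** \<phi> i (x \<oplus> y)) = \<dots>" .
next
 have l: "\<phi> i x : A" if "i : I" "x : D" for i x using linD(1)[OF I(2) D] that by auto
 fix b x assume b: "b : A" and x: "x : D"
 have "(\<Oplus>i\<in>I. a i ** \<phi> i (b ** x)) = (\<Oplus>i\<in>I. b ** (a i ** \<phi> i x))"
  using l I(3) b x linD(3)[OF I(2) D] by (intro finsum_cong') (auto simp: m_lcomm)
 also have "\<dots> = b ** (\<Oplus>i\<in>I. a i ** \<phi> i x)"
  using l I b x by (intro finsum_rdistr[symmetric]) auto
 finally show "(\<Oplus>i\<in>I. a i ** \<phi> i (b ** x)) = \<dots>" .
qed

locale galois_action = complete_dvr R A t K + G: comm_group G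
 for R :: "('a, 'b) ring_scheme" (structure) and A :: "'a set" and t :: 'a and K :: "'a set"
  and G :: "('g, 'm) monoid_scheme" +
 fixes M B :: "'a set" and \<rho> :: "'g => 'a => 'a"
 assumes subfield_M': "subfield M R" and K_le_M': "K <= M"
  and algebraic_M': "!!x. x : M ==> integral_over R K x"
  and B_def': "B = {x : M. integral_over R A x}"
  and finite_G: "finite (carrier G)"
  and \<rho>_closed: "!!g x. g : carrier G ==> x : M ==> \<rho> g x : M"
  and \<rho>_add: "!!g x y. g : carrier G ==> x : M ==> y : M ==> \<rho> g (x \<oplus> y) = \<rho> g x \<oplus> \<rho> g y"
  and \<rho>_mult: "!!g x y. g : carrier G ==> x : M ==> y : M ==> \<rho> g (x ** y) = \<rho> g x ** \<rho> g y"
  and \<rho>_comp: "!!g h x. g : carrier G ==> h : carrier G ==> x : M ==> \<rho> (g **\<^bsub>G\<^esub> h) x = \<rho> g (\<rho> h x)"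
  and \<rho>_id: "!!x. x : M ==> \<rho> \<one>\<^bsub>G\<^esub> x = x"
  and \<rho>_K: "!!g x. g : carrier G ==> x : K ==> \<rho> g x = x"
  and fixed_K: "!!x. x : M ==> (!!g. g : carrier G ==> \<rho> g x = x) ==> x : K"
  and faithful: "!!g h. g : carrier G ==> h : carrier G ==> g ~= h ==> EX x:M. \<rho> g x ~= \<rho> h x"
begin

lemma M_car: "x : M ==> x : carrier R" using subfieldE(3)[OF subfield_M'] by auto
lemmas M_cl = subringE(2,3,5,6,7)[OF subfieldE(1)[OF subfield_M']]
lemma K_in_M: "x : K ==> x : M" using K_le_M' by auto
lemma A_in_M: "x : A ==> x : M" using A_K K_in_M by auto

lemma \<rho>_car [simp]: "g : carrier G ==> x : M ==> \<rho> g x : carrier R" using \<rho>_closed M_car by auto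

lemma \<rho>_zero: "g : carrier G ==> \<rho> g \<zero> = \<zero>"
 using \<rho>_K[of g \<zero>] subringE(2)[OF subfieldE(1)[OF subfield_K]] by simp
lemma \<rho>_one: "g : carrier G ==> \<rho> g \<one> = \<one>"
 using \<rho>_K[of g \<one>] subringE(3)[OF subfieldE(1)[OF subfield_K]] by simp

lemma \<rho>_minus: "g : carrier G ==> x : M ==> y : M ==> \<rho> g (x \<ominus> y) = \<rho> g x \<ominus> \<rho> g y"
proof -
 assume g: "g : carrier G" and x: "x : M" and y: "y : M"
 have m: "\<ominus> \<one> : K" using subringE(3,5)[OF subfieldE(1)[OF subfield_K]] by auto
 have "\<rho> g (x \<oplus> (\<ominus> \<one>) ** y) = \<rho> g x \<oplus> (\<ominus> \<one>) ** \<rho> g y"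
  using g x y m K_in_M[OF m] M_cl(4) by (simp add: \<rho>_add \<rho>_mult \<rho>_K)
 then show ?thesis using x y M_car g by (simp add: l_minus a_minus_def)
qed

lemma \<rho>_finsum: "g : carrier G ==> finite I ==> f : I \<rightarrow> M ==> \<rho> g (\<Oplus>i\<in>I. f i) = (\<Oplus>i\<in>I. \<rho> g (f i))"
proof (induction I rule: infinite_finite_induct)
 case (insert x F)
 have f: "f x : M" "f : F \<rightarrow> M" using insert by auto
 have s: "(\<Oplus>i\<in>F. f i) : M" using f by (intro finsum_in_subring[OF subfieldE(1)[OF subfield_M']])
 have "\<rho> g (\<Oplus>i\<in>insert x F. f i) = \<rho> g (f x \<oplus> (\<Oplus>i\<in>F. f i))"
  using insert f M_car by (subst finsum_insert) auto
 also have "\<dots> = \<rho> g (f x) \<oplus> (\<Oplus>i\<in>F. \<rho> g (f i))" using insert f s by (simp add: \<rho>_add)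
 also have "\<dots> = (\<Oplus>i\<in>insert x F. \<rho> g (f i))" using insert f by (intro finsum_insert[symmetric]) (auto simp: Pi_def)
 finally show ?case .
qed (auto simp: \<rho>_zero)

lemma \<rho>_pow: "g : carrier G ==> x : M ==> \<rho> g (x [^] (n::nat)) = \<rho> g x [^] n"
proof (induction n)
 case (Suc n)
 have "x [^] n : M" using Suc.prems(2) M_cl by (induction n) auto
 then show ?case using Suc by (simp add: \<rho>_mult)
qed (simp add: \<rho>_one)

lemma \<rho>_independent:
 assumes c: "c : carrier G \<rightarrow> carrier R" and z: "!!x. x : M ==> (\<Oplus>g\<in>carrier G. c g ** \<rho> g x) = \<zero>"
 shows "ALL g:carrier G. c g = \<zero>"
 by (rule characters_independent[where E = M and \<chi> = \<rho>])
  (use c z finite_G \<rho>_mult \<rho>_one M_cl \<rho>_closed M_car faithful in auto)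

text \<open>Artin: a nontrivial solution of the system \<open>\<Sum>\<^sub>x c\<^sub>x g(x) = 0\<close> is averaged over \<open>G\<close>, after
  scaling it so that the average of one of its coefficients does not vanish.\<close>

lemma artin_bound:
 assumes V: "V <= M" "K_indep V" shows "card V <= card (carrier G)"
proof (rule ccontr)
 assume "\<not> card V <= card (carrier G)"
 then have lt: "card (carrier G) < card V" by simp
 have fin: "finite V" using V by (simp add: K_indep_def)
 have Vc: "x : V ==> x : carrier R" for x using V M_car by auto
 obtain c where c: "ALL x:V. c x : M" "EX x:V. c x ~= \<zero>" "ALL g:carrier G. (\<Oplus>x\<in>V. \<rho> g x ** c x) = \<zero>"
  using homogeneous_system[OF subfield_M' finite_G fin lt, of \<rho>] \<rho>_closed V by blast
 obtain x0 where x0: "x0 : V" "c x0 ~= \<zero>" using c by auto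
 obtain y where y: "y : M" "(\<Oplus>g\<in>carrier G. \<one> ** \<rho> g y) ~= \<zero>"
  using \<rho>_independent[of "%_. \<one>"] one_not_zero by (auto simp: Pi_def) 
 define z where "z = y ** inv (c x0)"
 have z: "z : M" "z ** c x0 = y"
  using y x0 c subfield_closed[OF subfield_M', of "c x0"] inv_simps[of "c x0"] M_cl(4) M_car
  by (auto simp: z_def m_assoc)
 define T where "T x = (\<Oplus>g\<in>carrier G. \<rho> g (z ** c x))" for x
 have zc: "z ** c x : M" if "x : V" for x using z c M_cl(4) that by auto
 have TM: "T x : M" if "x : V" for x
  unfolding T_def using zc[OF that] \<rho>_closed by (intro finsum_in_subring[OF subfieldE(1)[OF subfield_M']]) auto
 have TK: "T x : K" if x: "x : V" for x
 proof (rule fixed_K[OF TM[OF x]])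
  fix h assume h: "h : carrier G"
  have "\<rho> h (T x) = (\<Oplus>g\<in>carrier G. \<rho> h (\<rho> g (z ** c x)))"
   unfolding T_def using zc[OF x] h finite_G \<rho>_closed by (intro \<rho>_finsum) auto
  also have "\<dots> = (\<Oplus>g\<in>carrier G. \<rho> (h **\<^bsub>G\<^esub> g) (z ** c x))"
   using zc[OF x] h \<rho>_closed by (intro finsum_cong') (auto simp: \<rho>_comp)
  also have "\<dots> = (\<Oplus>g\<in>(%g. h **\<^bsub>G\<^esub> g) ` carrier G. \<rho> g (z ** c x))"
   using zc[OF x] h by (intro finsum_reindex[symmetric]) (auto simp: inj_on_def)
  also have "(%g. h **\<^bsub>G\<^esub> g) ` carrier G = carrier G" using h by (rule G.surj_const_mult)
  finally show "\<rho> h (T x) = T x" by (simp add: T_def)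
 qed
 have "comb T V = (\<Oplus>x\<in>V. \<Oplus>g\<in>carrier G. \<rho> g (z ** c x) ** x)"
  unfolding comb_def T_def using zc Vc finite_G
  by (intro finsum_cong' finsum_ldistr) (auto intro!: finsum_closed)
 also have "\<dots> = (\<Oplus>g\<in>carrier G. \<Oplus>x\<in>V. \<rho> g (z ** c x) ** x)"
  using zc Vc finite_G fin by (intro finsum_swap) auto
 also have "\<dots> = \<zero>"
 proof (rule add.finprod_one_eqI)
  fix g assume g: "g : carrier G"
  let ?i = "inv\<^bsub>G\<^esub> g"
  have i: "?i : carrier G" using g by simp
  have "(\<Oplus>x\<in>V. \<rho> g (z ** c x) ** x) = (\<Oplus>x\<in>V. \<rho> g (z ** (\<rho> ?i x ** c x)))"
  proof (intro finsum_cong' refl)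
   fix x assume x: "x : V"
   have xM: "x : M" "c x : M" using x V c by auto
   have "\<rho> g (z ** (\<rho> ?i x ** c x)) = \<rho> g ((z ** c x) ** \<rho> ?i x)"
    using z xM i M_car \<rho>_closed by (simp add: m_ac)
   also have "\<dots> = \<rho> g (z ** c x) ** \<rho> g (\<rho> ?i x)" using zc[OF x] xM g i \<rho>_closed by (simp add: \<rho>_mult)
   also have "\<rho> g (\<rho> ?i x) = x" using \<rho>_comp[OF g i xM(1)] g xM \<rho>_id by simp
   finally show "\<rho> g (z ** c x) ** x = \<rho> g (z ** (\<rho> ?i x ** c x))" by simp
  next
   show "(%x. \<rho> g (z ** (\<rho> ?i x ** c x))) : V \<rightarrow> carrier R"
    using z c V i g M_cl(4) \<rho>_closed by (auto intro!: \<rho>_car)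
  qed
  also have "\<dots> = \<rho> g (\<Oplus>x\<in>V. z ** (\<rho> ?i x ** c x))"
   using z c V i g M_cl(4) \<rho>_closed fin by (intro \<rho>_finsum[symmetric]) auto
  also have "(\<Oplus>x\<in>V. z ** (\<rho> ?i x ** c x)) = z ** (\<Oplus>x\<in>V. \<rho> ?i x ** c x)"
   using z c V i M_car fin by (intro finsum_rdistr[symmetric]) auto
  also have "\<dots> = \<zero>" using c(3) i z M_car by simp
  finally show "(\<Oplus>x\<in>V. \<rho> g (z ** c x) ** x) = \<zero>" using g by (simp add: \<rho>_zero)
 qed
 finally have "comb T V = \<zero>" .
 then have "T x0 = \<zero>" using V(2) TK x0(1) unfolding K_indep_def by blast
 moreover have "T x0 = (\<Oplus>g\<in>carrier G. \<one> ** \<rho> g y)"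
  unfolding T_def z(2) using y by (intro finsum_cong') auto
 ultimately show False using y(2) by simp
qed

end

sublocale galois_action \<subseteq> dvr_extension R A t K M B
proof (intro_locales, rule dvr_extension_axioms.intro)
 show "subfield M R" "K <= M" "B = {x : M. integral_over R A x}" by (fact subfield_M' K_le_M' B_def')+
 show "integral_over R K x" if "x : M" for x using that by (rule algebraic_M')
 show "EX N. ALL V. V <= M --> K_indep V --> card V <= N" using artin_bound by blast
qed

context galois_action
begin

lemma \<rho>_A: "g : carrier G ==> x : A ==> \<rho> g x = x" using \<rho>_K A_K by auto

lemma \<rho>_smult: "g : carrier G ==> a : A ==> x : M ==> \<rho> g (a ** x) = a ** \<rho> g x"
 using \<rho>_mult A_in_M \<rho>_A by simp

lemma \<rho>_B: assumes g: "g : carrier G" and x: "x : B" shows "\<rho> g x : B"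
proof -
 obtain n c where c: "c : {..<n::nat} \<rightarrow> A" "x [^] n = (\<Oplus>i\<in>{..<n}. c i ** x [^] i)"
  using x by (auto simp: B_def integral_over_def)
 have xM: "x : M" using x B_M by simp
 have pM: "x [^] (i::nat) : M" for i using xM M_cl by (induction i) auto
 have "\<rho> g x [^] n = \<rho> g (\<Oplus>i\<in>{..<n}. c i ** x [^] i)" using c(2) \<rho>_pow[OF g xM, of n] by simp
 also have "\<dots> = (\<Oplus>i\<in>{..<n}. \<rho> g (c i ** x [^] i))"
  using c(1) pM g M_cl(4) A_in_M by (intro \<rho>_finsum) (auto simp: Pi_def)
 also have "\<dots> = (\<Oplus>i\<in>{..<n}. c i ** \<rho> g x [^] i)"
  using c(1) pM g xM by (intro finsum_cong') (auto simp: \<rho>_smult \<rho>_pow Pi_def)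
 finally have "integral_over R A (\<rho> g x)" unfolding integral_over_def using c(1) by blast
 then show ?thesis using \<rho>_closed[OF g xM] by (simp add: B_def)
qed

lemma \<rho>_tp: "g : carrier G ==> x : tp n B ==> \<rho> g x : tp n B"
proof -
 assume g: "g : carrier G" and "x : tp n B"
 then obtain y where y: "y : B" "x = t [^] n ** y" by (auto elim: scaleE)
 then have "\<rho> g x = t [^] n ** \<rho> g y" using g B_M \<rho>_smult[OF g A_pow[OF t_A]] by simp
 then show ?thesis using \<rho>_B[OF g y(1)] by (auto intro: scaleI)
qed

lemma \<rho>_inv: "g : carrier G ==> x : M ==> \<rho> g (\<rho> (inv\<^bsub>G\<^esub> g) x) = x"
 using \<rho>_comp[of g "inv\<^bsub>G\<^esub> g" x] \<rho>_id by simp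
lemma \<rho>_inv': "g : carrier G ==> x : M ==> \<rho> (inv\<^bsub>G\<^esub> g) (\<rho> g x) = x"
 using \<rho>_comp[of "inv\<^bsub>G\<^esub> g" g x] \<rho>_id by simp

lemma basis_card: assumes Y: "A_basis B Y" shows "card Y = card (carrier G)"
proof (rule antisym)
 have Y': "finite Y" "Y <= B" "Y <= carrier R" "Y <= M" "K_indep Y" using Y B_M by (auto simp: A_basis_def)
 show "card Y <= card (carrier G)" using artin_bound Y' by auto
 show "card (carrier G) <= card Y"
 proof (rule ccontr)
  assume "\<not> ?thesis"
  then have lt: "card Y < card (carrier G)" by simp
  obtain c where c: "ALL g:carrier G. c g : carrier R" "EX g:carrier G. c g ~= \<zero>"
   "ALL y:Y. (\<Oplus>g\<in>carrier G. \<rho> g y ** c g) = \<zero>"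
   using homogeneous_system[OF carrier_is_subfield Y'(1) finite_G lt, of "%y g. \<rho> g y"] Y' \<rho>_car by blast
  have "(\<Oplus>g\<in>carrier G. c g ** \<rho> g x) = \<zero>" if x: "x : M" for x
  proof -
   obtain k where k: "k : Y \<rightarrow> K" "x = comb k Y" using basis_spans_M[OF Y x] by auto
   have kc: "k y : K" "k y : carrier R" "y : M" "k y : M" "y : carrier R" if "y : Y" for y
    using k(1) that Y' K_in_M K_carrier by (auto simp: Pi_def)
   have "(\<Oplus>g\<in>carrier G. c g ** \<rho> g x) = (\<Oplus>g\<in>carrier G. \<Oplus>y\<in>Y. k y ** (\<rho> g y ** c g))"
   proof (intro finsum_cong' refl)
    fix g assume g: "g : carrier G"
    have "\<rho> g x = (\<Oplus>y\<in>Y. \<rho> g (k y ** y))"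
     unfolding k(2) comb_def using g Y' kc M_cl(4) by (intro \<rho>_finsum) auto
    also have "\<dots> = (\<Oplus>y\<in>Y. k y ** \<rho> g y)" using g kc by (intro finsum_cong') (auto simp: \<rho>_mult \<rho>_K)
    finally have "c g ** \<rho> g x = (\<Oplus>y\<in>Y. c g ** (k y ** \<rho> g y))"
     using c(1) g kc Y' by (simp add: finsum_rdistr Pi_def)
    also have "\<dots> = (\<Oplus>y\<in>Y. k y ** (\<rho> g y ** c g))"
     using c(1) g kc by (intro finsum_cong') (auto simp: m_ac)
    finally show "c g ** \<rho> g x = (\<Oplus>y\<in>Y. k y ** (\<rho> g y ** c g))" .
   qed (use c(1) kc in \<open>auto intro!: finsum_closed\<close>)
   also have "\<dots> = (\<Oplus>y\<in>Y. \<Oplus>g\<in>carrier G. k y ** (\<rho> g y ** c g))"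
    using c(1) kc Y' finite_G by (intro finsum_swap) auto
   also have "\<dots> = \<zero>"
   proof (rule add.finprod_one_eqI)
    fix y assume y: "y : Y"
    have "(\<Oplus>g\<in>carrier G. k y ** (\<rho> g y ** c g)) = k y ** (\<Oplus>g\<in>carrier G. \<rho> g y ** c g)"
     using c(1) kc[OF y] finite_G by (intro finsum_rdistr[symmetric]) auto
    then show "(\<Oplus>g\<in>carrier G. k y ** (\<rho> g y ** c g)) = \<zero>" using c(3) y kc[OF y] by simp
   qed
   finally show ?thesis .
  qed
  then have "ALL g:carrier G. c g = \<zero>" using c(1) by (intro \<rho>_independent) auto
  then show False using c(2) by auto
 qed
qed

lemma t_indep_full_basis:
 assumes V: "t_indep B V" and card: "card V = card (carrier G)" shows "A_basis B V"
proof -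
 obtain Y where Y: "V <= Y" "A_basis B Y" using t_indep_extends_to_basis[OF V] by auto
 then have "V = Y" using card basis_card[OF Y(2)] by (intro card_subset_eq) (auto simp: A_basis_def)
 then show ?thesis using Y by simp
qed

definition good :: "('a => 'a) => bool" where
 "good e \<longleftrightarrow> lin B e & (ALL x:B. (ALL g:carrier G. e (\<rho> (inv\<^bsub>G\<^esub> g) x) : tp 1 A) --> x : tp 1 B)"

lemma lin_translate: assumes "lin B e" "g : carrier G" shows "lin B (%x. e (\<rho> (inv\<^bsub>G\<^esub> g) x))"
proof -
 have g: "inv\<^bsub>G\<^esub> g : carrier G" using assms(2) by simp
 note e = linD[OF assms(1) amod_B]
 show ?thesis unfolding lin_def using e(1-3) \<rho>_B[OF g] \<rho>_add[OF g B_M B_M] \<rho>_smult[OF g _ B_M] by auto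
qed

lemma good_dual_system:
 assumes e: "good e" and y: "y : carrier G \<rightarrow> A"
 shows "EX x:B. ALL g:carrier G. e (\<rho> (inv\<^bsub>G\<^esub> g) x) = y g"
proof -
 obtain Y where Y: "A_basis B Y" using basis_exists by auto
 show ?thesis
  using dual_system_exists[OF amod_B Y finite_G basis_card[OF Y, symmetric], of "%g x. e (\<rho> (inv\<^bsub>G\<^esub> g) x)" y]
   lin_translate e y unfolding good_def by blast
qed

lemma good_zero:
 assumes e: "good e" and x: "x : B" "!!g. g : carrier G ==> e (\<rho> (inv\<^bsub>G\<^esub> g) x) = \<zero>"
 shows "x = \<zero>"
proof -
 obtain Y where Y: "A_basis B Y" using basis_exists by auto
 show ?thesis
  using dual_system_unique[OF amod_B Y, of "carrier G" "%g x. e (\<rho> (inv\<^bsub>G\<^esub> g) x)" x]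
   lin_translate e x unfolding good_def by blast
qed

lemma good_generates:
 assumes e: "good e" and f: "lin B f"
 shows "\<exists>!a. a : carrier G \<rightarrow>\<^sub>E A & (ALL x:B. f x = (\<Oplus>g\<in>carrier G. a g ** e (\<rho> (inv\<^bsub>G\<^esub> g) x)))"
proof -
 let ?e = "%g x. e (\<rho> (inv\<^bsub>G\<^esub> g) x)"
 have le: "lin B (?e g)" if "g : carrier G" for g using lin_translate e that by (auto simp: good_def)
 have eA: "?e g x : A" if "g : carrier G" "x : B" for g x using linD(1)[OF le[OF that(1)] amod_B that(2)] .
 note fD = linD[OF f amod_B]
 have "ALL h:carrier G. EX x. x : B & (ALL g:carrier G. ?e g x = (if g = h then \<one> else \<zero>))"
 proof
  fix h show "EX x. x : B & (ALL g:carrier G. ?e g x = (if g = h then \<one> else \<zero>))"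
   using good_dual_system[OF e, of "%g. if g = h then \<one> else \<zero>"] A_closed by auto
 qed
 then obtain x where x: "!!h. h : carrier G ==> x h : B"
  "!!g h. h : carrier G ==> g : carrier G ==> ?e g (x h) = (if g = h then \<one> else \<zero>)" by metis
 have expand: "(\<Oplus>g\<in>carrier G. a g ** ?e g (x h)) = a h" if h: "h : carrier G" and a: "a : carrier G \<rightarrow> A" for a h
 proof -
  have "(\<Oplus>g\<in>carrier G. a g ** ?e g (x h)) = a h ** ?e h (x h)"
   using finite_G h a x by (intro finsum_single) (auto simp: Pi_def)
  then show ?thesis using a h x by (auto simp: Pi_def)
 qed
 have lin_sum: "lin B (%z. \<Oplus>g\<in>carrier G. a g ** ?e g z)" if a: "a : carrier G \<rightarrow> A" for a
  by (rule lin_sum[OF amod_B finite_G le]) (use a in auto)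
 have decomp: "z = (\<Oplus>h\<in>carrier G. ?e h z ** x h)" if z: "z : B" for z
 proof -
  let ?w = "\<Oplus>h\<in>carrier G. ?e h z ** x h"
  have wB: "?w : B" using eA z x amodD(4)[OF amod_B] by (intro amod_finsum amod_B) auto
  have "z \<ominus> ?w = \<zero>"
  proof (rule good_zero[OF e])
   show "z \<ominus> ?w : B" using amodD(6)[OF amod_B z wB] .
   fix g assume g: "g : carrier G"
   have "?e g ?w = (\<Oplus>h\<in>carrier G. ?e g (?e h z ** x h))"
   proof -
    have "?e g (\<Oplus>h\<in>I. ?e h z ** x h) = (\<Oplus>h\<in>I. ?e g (?e h z ** x h))" if "finite I" "I <= carrier G" for I
     using that
    proof (induction I)
     case empty then show ?case using linD(4)[OF le[OF g] amod_B] by simp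
    next
     case (insert h I)
     have c: "?e h z ** x h : B" if "h : carrier G" for h using eA z x amodD(4)[OF amod_B] that by auto
     have cI: "(\<Oplus>h\<in>I. ?e h z ** x h) : B" using c insert by (intro amod_finsum amod_B) auto
     have "(\<Oplus>h\<in>insert h I. ?e h z ** x h) = ?e h z ** x h \<oplus> (\<Oplus>h\<in>I. ?e h z ** x h)"
      using insert c by (intro finsum_insert) (auto simp: subset_iff)
     then have "?e g (\<Oplus>h\<in>insert h I. ?e h z ** x h) = ?e g (?e h z ** x h) \<oplus> (\<Oplus>h\<in>I. ?e g (?e h z ** x h))"
      using linD(2)[OF le[OF g] amod_B] c cI insert by simp
     also have "\<dots> = (\<Oplus>h\<in>insert h I. ?e g (?e h z ** x h))"
      using insert c eA[OF g] by (intro finsum_insert[symmetric]) (auto simp: subset_iff)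
     finally show ?case .
    qed
    then show ?thesis using finite_G by blast
   qed
   also have "\<dots> = (\<Oplus>h\<in>carrier G. ?e h z ** ?e g (x h))"
    using linD(3)[OF le[OF g] amod_B] eA z x g by (intro finsum_cong') auto
   also have "\<dots> = ?e g z ** ?e g (x g)"
    using finite_G g eA z x by (intro finsum_single) auto
   also have "\<dots> = ?e g z" using x(2)[OF g g] eA[OF g z] by simp
   finally show "?e g (z \<ominus> ?w) = \<zero>" using linD(5)[OF le[OF g] amod_B z wB] eA[OF g z] by simp
  qed
  then show ?thesis using z wB by simp
 qed
 show ?thesis
 proof (rule ex1I[of _ "\<lambda>g\<in>carrier G. f (x g)"])
  let ?a = "\<lambda>g\<in>carrier G. f (x g)"
  have fx: "f (x g) : A" if "g : carrier G" for g using fD(1) x that by auto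
  have "f z = (\<Oplus>g\<in>carrier G. ?a g ** ?e g z)" if z: "z : B" for z
  proof -
   define c where "c h = ?e h z" for h
   have cA: "c h : A" if "h : carrier G" for h using eA z that by (simp add: c_def)
   have "f (\<Oplus>h\<in>I. c h ** x h) = (\<Oplus>h\<in>I. f (x h) ** c h)" if "finite I" "I <= carrier G" for I
    using that
   proof (induction I)
    case empty then show ?case using fD(4) by simp
   next
    case (insert h I)
    have c: "c h ** x h : B" if "h : carrier G" for h using cA x amodD(4)[OF amod_B] that by auto
    have cI: "(\<Oplus>h\<in>I. c h ** x h) : B" using c insert by (intro amod_finsum amod_B) auto
    have "(\<Oplus>h\<in>insert h I. c h ** x h) = c h ** x h \<oplus> (\<Oplus>h\<in>I. c h ** x h)"
     using insert c by (intro finsum_insert) (auto simp: subset_iff)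
    then have "f (\<Oplus>h\<in>insert h I. c h ** x h) = c h ** f (x h) \<oplus> (\<Oplus>h\<in>I. f (x h) ** c h)"
     using fD(2,3) c cI insert cA x by simp
    also have "\<dots> = (\<Oplus>h\<in>insert h I. f (x h) ** c h)"
     using insert cA fx by (subst finsum_insert) (auto simp: subset_iff m_comm)
    finally show ?case .
   qed
   then have "f (\<Oplus>h\<in>carrier G. c h ** x h) = (\<Oplus>h\<in>carrier G. f (x h) ** c h)" using finite_G by blast
   moreover have "(\<Oplus>h\<in>carrier G. c h ** x h) = z" using decomp[OF z] by (simp add: c_def)
   moreover have "(\<Oplus>h\<in>carrier G. f (x h) ** c h) = (\<Oplus>g\<in>carrier G. ?a g ** ?e g z)"
    using fx cA by (intro finsum_cong') (auto simp: c_def)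
   ultimately show ?thesis by simp
  qed
  then show "?a : carrier G \<rightarrow>\<^sub>E A & (ALL z:B. f z = (\<Oplus>g\<in>carrier G. ?a g ** ?e g z))" using fx by auto
  fix a assume a: "a : carrier G \<rightarrow>\<^sub>E A & (ALL z:B. f z = (\<Oplus>g\<in>carrier G. a g ** ?e g z))"
  have "a : carrier G \<rightarrow> A" using a by (simp add: PiE_def)
  then have "a h = f (x h)" if h: "h : carrier G" for h
   using expand[OF h, of a] a x(1)[OF h] by auto
  then show "a = ?a" using a by (intro ext) (auto simp: PiE_def extensional_def)
 qed
qed

lemma coordinate_functional:
 assumes Y: "A_basis B Y" and y: "y : Y"
 shows "EX f. lin B f & (ALL c:Y \<rightarrow> A. f (comb c Y) = c y)"
proof -
 have Y': "finite Y" "Y <= B" "Y <= carrier R" "K_indep Y" using Y by (auto simp: A_basis_def)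
 have "ALL d:B. EX c. c : Y \<rightarrow> A & d = comb c Y" using Y unfolding A_basis_def by blast
 then obtain c where c: "!!d. d : B ==> c d : Y \<rightarrow> A" "!!d. d : B ==> d = comb (c d) Y" by metis
 have cA: "c d z : A" if "d : B" "z : Y" for d z using c(1) that by auto
 have u: "c d y = k y" if "d : B" "k : Y \<rightarrow> A" "d = comb k Y" for d k
  using K_indep_unique[OF Y'(4), of "c d" k y] c that y by (auto simp: A_K Pi_def)
 have "lin B (%d. c d y)" unfolding lin_def
 proof (intro conjI ballI)
  show "(%d. c d y) : B \<rightarrow> A" using cA y by auto
  fix d e assume de: "d : B" "e : B"
  have "comb (%z. c d z \<oplus> c e z) Y = d \<oplus> e"
   using comb_add[of Y "c d" "c e"] Y' cA de c(2)[OF de(1), symmetric] c(2)[OF de(2), symmetric] by auto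
  then show "c (d \<oplus> e) y = c d y \<oplus> c e y"
   using cA de A_closed amodD(3)[OF amod_B] by (intro u[of _ "%z. c d z \<oplus> c e z"]) auto
 next
  fix a d assume ad: "a : A" "d : B"
  have "comb (%z. a ** c d z) Y = a ** d"
   using comb_smult[of Y "c d" a] Y' cA ad c(2)[OF ad(2), symmetric] by auto
  then show "c (a ** d) y = a ** c d y"
   using cA ad A_closed amodD(4)[OF amod_B] by (intro u[of _ "%z. a ** c d z"]) auto
 qed
 moreover have "c (comb k Y) y = k y" if "k : Y \<rightarrow> A" for k
  using u[of "comb k Y" k] that comb_amod[OF amod_B Y'(2)] by auto
 ultimately show ?thesis by blast
qed

lemma generating_good:
 assumes e: "lin B e"
  and gen: "!!f. lin B f ==> EX a:carrier G \<rightarrow> A. ALL x:B. f x = (\<Oplus>g\<in>carrier G. a g ** e (\<rho> (inv\<^bsub>G\<^esub> g) x))"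
 shows "good e"
 unfolding good_def
proof (intro conjI ballI impI e)
 fix x assume x: "x : B" and ex: "ALL g:carrier G. e (\<rho> (inv\<^bsub>G\<^esub> g) x) : tp 1 A"
 obtain Y where Y: "A_basis B Y" using basis_exists by auto
 have Y': "finite Y" "Y <= B" using Y by (auto simp: A_basis_def)
 obtain c where c: "c : Y \<rightarrow> A" "x = comb c Y" using Y x by (auto simp: A_basis_def)
 have "c y : tp 1 A" if y: "y : Y" for y
 proof -
  obtain f where f: "lin B f" "f (comb c Y) = c y" using coordinate_functional[OF Y y] c by blast
  obtain a where a: "a : carrier G \<rightarrow> A" "f x = (\<Oplus>g\<in>carrier G. a g ** e (\<rho> (inv\<^bsub>G\<^esub> g) x))"
   using gen[OF f(1)] x by blast
  have "f x : tp 1 A" unfolding a(2) using ex a(1) amodD(4)[OF amod_scale[OF amod_A]]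
   by (intro amod_finsum amod_scale amod_A) (auto simp: Pi_def)
  then show ?thesis using f c by simp
 qed
 then show "x : tp 1 B" unfolding c(2) by (intro comb_scale_amod amod_B Y') auto
qed

end

lemma (in ring_hom_cring) hom_add_pow_nat: "x : carrier R ==> h ([(n::nat)] \<cdot>\<^bsub>R\<^esub> x) = [n] \<cdot>\<^bsub>S\<^esub> h x"
 by (induction n) auto

lemma (in ring_hom_cring) hom_nat_power: "x : carrier R ==> h (x [^]\<^bsub>R\<^esub> (n::nat)) = h x [^]\<^bsub>S\<^esub> n"
 by (induction n) auto

lemma (in ring) subring_minus:
 assumes "subring B R" "x : B" shows "\<ominus>\<^bsub>R\<lparr>carrier := B\<rparr>\<^esub> x = \<ominus> x"
proof -
 interpret B: ring "R\<lparr>carrier := B\<rparr>" using assms(1) by (rule subring_is_ring)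
 show ?thesis by (rule B.minus_equality) (use assms subringE[OF assms(1)] in \<open>auto simp: l_neg\<close>)
qed

lemma nat_pow_subring: "x [^]\<^bsub>R\<lparr>carrier := B\<rparr>\<^esub> (n::nat) = x [^]\<^bsub>R\<^esub> n"
 by (induction n) (auto simp: nat_pow_def)

lemma add_pow_subring: "[(n::nat)] \<cdot>\<^bsub>R\<lparr>carrier := B\<rparr>\<^esub> x = [n] \<cdot>\<^bsub>R\<^esub> x"
 by (simp add: add_pow_def nat_pow_def)

context galois_action
begin

definition SR :: "('g => 'a) ring" where "SR = finite_group_ring R G"
definition AG :: "('g => 'a) set" where "AG = carrier G \<rightarrow>\<^sub>E A"
definition tAG :: "nat => ('g => 'a) set" where "tAG n = carrier G \<rightarrow>\<^sub>E tp n A"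
definition act :: "('g => 'a) => 'a => 'a" where "act a x = (\<Oplus>g\<in>carrier G. a g ** \<rho> g x)"

lemma GR: "group_ring R G" by unfold_locales (rule finite_G)

lemma SR_cring: "cring SR" unfolding SR_def by (rule group_ring.S_cring[OF GR])

lemma AG_sub: "AG <= carrier SR"
 unfolding AG_def SR_def group_ring.S_carrier[OF GR] by (auto simp: PiE_iff)

lemma AG_A: "a : AG ==> g : carrier G ==> a g : A" by (auto simp: AG_def)

lemma AG_I: "a : carrier SR ==> (!!g. g : carrier G ==> a g : A) ==> a : AG"
 unfolding AG_def SR_def group_ring.S_carrier[OF GR] by (auto simp: PiE_iff)
lemma tAG_I: "a : carrier SR ==> (!!g. g : carrier G ==> a g : tp n A) ==> a : tAG n"
 unfolding tAG_def SR_def group_ring.S_carrier[OF GR] by (auto simp: PiE_iff)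
lemma tAG_tp: "a : tAG n ==> g : carrier G ==> a g : tp n A" by (auto simp: tAG_def)

lemma SR_add: "g : carrier G ==> (a \<oplus>\<^bsub>SR\<^esub> b) g = a g \<oplus> b g"
 unfolding SR_def by (rule group_ring.S_add[OF GR])
lemma SR_mult: "g : carrier G ==> (a **\<^bsub>SR\<^esub> b) g = (\<Oplus>h\<in>carrier G. a h ** b (inv\<^bsub>G\<^esub> h **\<^bsub>G\<^esub> g))"
 unfolding SR_def by (rule group_ring.S_mult[OF GR])
lemma SR_eqI: "a : carrier SR ==> b : carrier SR ==> (!!g. g : carrier G ==> a g = b g) ==> a = b"
 unfolding SR_def by (rule group_ring.S_eqI[OF GR])
lemma SR_closed: "a : carrier SR ==> g : carrier G ==> a g : carrier R"
 unfolding SR_def by (rule group_ring.S_closed[OF GR])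

lemma SR_one: "g : carrier G ==> \<one>\<^bsub>SR\<^esub> g = (if g = \<one>\<^bsub>G\<^esub> then \<one> else \<zero>)"
 unfolding SR_def by (rule group_ring.S_one[OF GR])
lemma SR_zero: "g : carrier G ==> \<zero>\<^bsub>SR\<^esub> g = \<zero>"
 unfolding SR_def by (rule group_ring.S_zero[OF GR])

lemma SR_minus: assumes "a : carrier SR" "g : carrier G" shows "(\<ominus>\<^bsub>SR\<^esub> a) g = \<ominus> a g"
proof -
 interpret S: cring SR by (rule SR_cring)
 have "(\<ominus>\<^bsub>SR\<^esub> a \<oplus>\<^bsub>SR\<^esub> a) g = \<zero>\<^bsub>SR\<^esub> g" using assms by (simp add: S.l_neg)
 then have "(\<ominus>\<^bsub>SR\<^esub> a) g \<oplus> a g = \<zero>"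
  using assms(2) by (simp add: SR_add SR_zero)
 then show ?thesis using assms SR_closed by (intro sum_zero_eq_neg) auto
qed

lemma SR_diff: "a : carrier SR ==> b : carrier SR ==> g : carrier G ==> (a \<ominus>\<^bsub>SR\<^esub> b) g = a g \<ominus> b g"
 using SR_add SR_minus by (simp add: a_minus_def)

lemma AG_subring: "subring AG SR"
proof -
 interpret S: cring SR by (rule SR_cring)
 have c: "a : AG ==> a : carrier SR" for a using AG_sub by auto
 show ?thesis
 proof (rule S.subringI)
  show "AG <= carrier SR" by (rule AG_sub)
  show "\<one>\<^bsub>SR\<^esub> : AG" using A_closed by (intro AG_I) (auto simp: SR_one)
  show "\<ominus>\<^bsub>SR\<^esub> a : AG" if "a : AG" for a using that c A_closed AG_A by (intro AG_I) (auto simp: SR_minus)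
  show "a **\<^bsub>SR\<^esub> b : AG" if "a : AG" "b : AG" for a b
   using that c A_closed AG_A by (intro AG_I) (auto simp: SR_mult intro!: amod_finsum amod_A)
  show "a \<oplus>\<^bsub>SR\<^esub> b : AG" if "a : AG" "b : AG" for a b
   using that c A_closed AG_A by (intro AG_I) (auto simp: SR_add)
 qed
qed

lemma tAG_sub: "tAG n <= AG" using scale_subset[OF amod_A] by (auto simp: tAG_def AG_def PiE_iff)

lemma tAG_add: "a : tAG n ==> b : tAG n ==> a \<oplus>\<^bsub>SR\<^esub> b : tAG n"
proof -
 interpret S: cring SR by (rule SR_cring)
 assume ab: "a : tAG n" "b : tAG n"
 then have "a : carrier SR" "b : carrier SR" using tAG_sub[of n] AG_sub by auto
 then show ?thesis using ab amodD(3)[OF amod_scale[OF amod_A]] by (intro tAG_I) (auto simp: SR_add tAG_tp)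
qed

lemma tp_mult_A: "x : tp m A ==> y : tp n A ==> x ** y : tp (m + n) A"
proof -
 assume "x : tp m A" "y : tp n A"
 then obtain a b where ab: "a : A" "x = t [^] m ** a" "b : A" "y = t [^] n ** b" by (auto elim!: scaleE)
 then have "x ** y = t [^] (m + n) ** (a ** b)" by (simp add: nat_pow_mult[symmetric] m_ac)
 then show ?thesis using A_closed(4) ab by (auto intro: scaleI)
qed

lemma tAG_mult: "a : tAG m ==> b : tAG n ==> a **\<^bsub>SR\<^esub> b : tAG (m + n)"
proof -
 interpret S: cring SR by (rule SR_cring)
 assume ab: "a : tAG m" "b : tAG n"
 then have "a : carrier SR" "b : carrier SR" using tAG_sub AG_sub by blast+
 then show ?thesis using ab tp_mult_A
  by (intro tAG_I) (auto simp: SR_mult tAG_tp intro!: amod_finsum amod_scale amod_A)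
qed

lemma tAG_0: "tAG 0 = AG" using amod_A by (simp add: tAG_def AG_def)

lemma tAG_smult: "b : AG ==> a : tAG n ==> b **\<^bsub>SR\<^esub> a : tAG n"
 using tAG_mult[of b 0 a n] tAG_0 by simp

lemma tAG_antimono: "m <= n ==> tAG n <= tAG m"
 unfolding tAG_def using scale_antimono[OF amod_A, of m n] by (auto simp: PiE_iff)

lemma tAG_separated: assumes "!!n. a : tAG n" shows "a = \<zero>\<^bsub>SR\<^esub>"
proof -
 interpret S: cring SR by (rule SR_cring)
 have "a : carrier SR" using assms[of 0] tAG_0 AG_sub by auto
 then show ?thesis
 proof (rule SR_eqI)
  fix g assume g: "g : carrier G"
  have "a g = \<zero>" using assms g tAG_tp by (intro separated_A) blast
  then show "a g = \<zero>\<^bsub>SR\<^esub> g" using g by (simp add: SR_zero)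
 qed simp
qed

lemma AG_complete:
 assumes x: "!!n. x n : AG" "!!n. x (Suc n) \<ominus>\<^bsub>SR\<^esub> x n : tAG n"
 shows "EX s:AG. ALL n. s \<ominus>\<^bsub>SR\<^esub> x n : tAG n"
proof -
 interpret S: cring SR by (rule SR_cring)
 have xc: "x n : carrier SR" for n using x(1) AG_sub by auto
 have "EX s:A. ALL n. s \<ominus> x n g : tp n A" if g: "g : carrier G" for g
  using complete_A[of "%n. x n g"] AG_A[OF x(1) g] tAG_tp[OF x(2) g] SR_diff[OF xc xc g] by auto
 then obtain s where s: "!!g. g : carrier G ==> s g : A" "!!g n. g : carrier G ==> s g \<ominus> x n g : tp n A" by metis
 have sAG: "restrict s (carrier G) : AG" using s by (auto simp: AG_def)
 moreover have "restrict s (carrier G) \<ominus>\<^bsub>SR\<^esub> x n : tAG n" for n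
  using sAG AG_sub xc s by (intro tAG_I) (auto simp: SR_diff subset_iff)
 ultimately show ?thesis by blast
qed

lemma AG_residues: "\<exists>S\<subseteq>AG. finite S & (ALL a:AG. EX s:S. a \<ominus>\<^bsub>SR\<^esub> s : tAG 1)"
proof -
 interpret S: cring SR by (rule SR_cring)
 obtain S where S: "S <= A" "finite S" "ALL x:A. EX s:S. x \<ominus> s : tp 1 A" using finite_residues by auto
 show ?thesis
 proof (intro exI[of _ "carrier G \<rightarrow>\<^sub>E S"] conjI ballI)
  show sub: "carrier G \<rightarrow>\<^sub>E S <= AG" using S(1) by (auto simp: AG_def PiE_iff)
  show "finite (carrier G \<rightarrow>\<^sub>E S)" using finite_G S by (intro finite_PiE) auto
  fix a assume a: "a : AG"
  then have "ALL g:carrier G. EX s. s : S & a g \<ominus> s : tp 1 A" using S(3) AG_A by blast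
  then obtain s where s: "ALL g:carrier G. s g : S & a g \<ominus> s g : tp 1 A" by metis
  have s': "restrict s (carrier G) : carrier G \<rightarrow>\<^sub>E S" using s by auto
  have "a \<ominus>\<^bsub>SR\<^esub> restrict s (carrier G) : tAG 1"
  proof (rule tAG_I)
   have c: "a : carrier SR" "restrict s (carrier G) : carrier SR" using a s' sub AG_sub by blast+
   then show "a \<ominus>\<^bsub>SR\<^esub> restrict s (carrier G) : carrier SR" by simp
   show "(a \<ominus>\<^bsub>SR\<^esub> restrict s (carrier G)) g : tp 1 A" if "g : carrier G" for g
    using SR_diff[OF c that] s that by simp
  qed
  then show "EX s:carrier G \<rightarrow>\<^sub>E S. a \<ominus>\<^bsub>SR\<^esub> s : tAG 1" using s' by blast
 qed
qed

lemma act_closed: "a : AG ==> x : M ==> act a x : M"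
 unfolding act_def using AG_A A_in_M M_cl(4) \<rho>_closed by (intro finsum_in_subring[OF subfieldE(1)[OF subfield_M]]) auto

lemma act_amod:
 assumes W: "amod W" "!!g x. g : carrier G ==> x : W ==> \<rho> g x : W" and "a : AG" "x : W"
 shows "act a x : W"
 unfolding act_def using assms AG_A amodD(4)[OF W(1)] by (intro amod_finsum W(1)) auto

lemma act_B: "a : AG ==> x : B ==> act a x : B" using act_amod[OF amod_B \<rho>_B] by auto
lemma act_tpB: "a : AG ==> x : tp n B ==> act a x : tp n B"
 using act_amod[OF amod_scale[OF amod_B] \<rho>_tp] by auto

lemma act_tAG: "a : tAG n ==> x : B ==> act a x : tp n B"
 unfolding act_def using tAG_tp scale_smult[OF amod_B] \<rho>_B by (intro amod_finsum amod_scale amod_B) auto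

lemma act_diff: assumes "a : AG" "b : AG" "x : M" shows "act (a \<ominus>\<^bsub>SR\<^esub> b) x = act a x \<ominus> act b x"
proof -
 have c: "a : carrier SR" "b : carrier SR" using assms AG_sub by auto
 have "act (a \<ominus>\<^bsub>SR\<^esub> b) x = (\<Oplus>g\<in>carrier G. a g ** \<rho> g x \<ominus> b g ** \<rho> g x)"
 proof -
  have "(u \<ominus> v) ** w = u ** w \<ominus> v ** w" if "u : carrier R" "v : carrier R" "w : carrier R" for u v w
   using that by algebra
  then show ?thesis unfolding act_def using assms AG_A c by (intro finsum_cong') (auto simp: SR_diff)
 qed
 also have "\<dots> = act a x \<ominus> act b x" unfolding act_def using assms AG_A by (intro finsum_diff) auto
 finally show ?thesis .
qed

lemma act_add_right: assumes "a : AG" "x : M" "y : M" shows "act a (x \<oplus> y) = act a x \<oplus> act a y"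
proof -
 have "act a (x \<oplus> y) = (\<Oplus>g\<in>carrier G. a g ** \<rho> g x \<oplus> a g ** \<rho> g y)"
  unfolding act_def using assms AG_A by (intro finsum_cong') (auto simp: \<rho>_add r_distr)
 also have "\<dots> = act a x \<oplus> act a y" unfolding act_def using assms AG_A by (intro finsum_addf) auto
 finally show ?thesis .
qed

lemma act_smult_right: assumes "a : AG" "b : A" "x : M" shows "act a (b ** x) = b ** act a x"
proof -
 have "act a (b ** x) = (\<Oplus>g\<in>carrier G. b ** (a g ** \<rho> g x))"
  unfolding act_def using assms AG_A by (intro finsum_cong') (auto simp: \<rho>_smult m_lcomm)
 also have "\<dots> = b ** act a x"
  unfolding act_def using assms AG_A finite_G by (intro finsum_rdistr[symmetric]) auto
 finally show ?thesis .
qed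

lemma act_mult: assumes a: "a : AG" and b: "b : AG" and x: "x : M"
 shows "act (a **\<^bsub>SR\<^esub> b) x = act a (act b x)"
proof -
 have "act (a **\<^bsub>SR\<^esub> b) x = (\<Oplus>h\<in>carrier G. a h ** (\<Oplus>k\<in>carrier G. b k ** \<rho> (h **\<^bsub>G\<^esub> k) x))"
  unfolding act_def SR_def
  by (rule group_ring.sum_mult[OF GR]) (use a b x AG_sub in \<open>auto simp: SR_def\<close>)
 also have "\<dots> = (\<Oplus>h\<in>carrier G. a h ** \<rho> h (act b x))"
 proof (intro finsum_cong' refl)
  fix h assume h: "h : carrier G"
  have "\<rho> h (act b x) = (\<Oplus>k\<in>carrier G. \<rho> h (b k ** \<rho> k x))"
   unfolding act_def using h finite_G AG_A[OF b] A_in_M M_cl(4) \<rho>_closed x by (intro \<rho>_finsum) auto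
  also have "\<dots> = (\<Oplus>k\<in>carrier G. b k ** \<rho> (h **\<^bsub>G\<^esub> k) x)"
   using h AG_A[OF b] \<rho>_closed x by (intro finsum_cong') (auto simp: \<rho>_smult \<rho>_comp)
  finally show "a h ** (\<Oplus>k\<in>carrier G. b k ** \<rho> (h **\<^bsub>G\<^esub> k) x) = a h ** \<rho> h (act b x)" by simp
 qed (use a b x AG_A act_closed[OF b x] in auto)
 finally show ?thesis by (simp add: act_def)
qed

abbreviation single :: "'a => 'g => 'g => 'a" where "single \<equiv> group_ring.single R G"

lemma single_AG: "r : A ==> single r g : AG"
 using A_closed by (auto simp: group_ring.single_def[OF GR] AG_def)
lemma single_tAG: "r : tp n A ==> single r g : tAG n"
 using amodD(2)[OF amod_scale[OF amod_A]] by (auto simp: group_ring.single_def[OF GR] tAG_def)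

lemma act_single: assumes "r : A" "g : carrier G" "x : M" shows "act (single r g) x = r ** \<rho> g x"
proof -
 have "act (single r g) x = single r g g ** \<rho> g x"
  unfolding act_def using assms finite_G by (intro finsum_single) (auto simp: group_ring.single_def[OF GR])
 then show ?thesis using assms by (simp add: group_ring.single_def[OF GR])
qed

lemma act_one: "x : M ==> act \<one>\<^bsub>SR\<^esub> x = x"
 using act_single[of \<one> "\<one>\<^bsub>G\<^esub>" x] A_closed(2) M_car \<rho>_id
 by (simp add: group_ring.single_one[OF GR] SR_def)

lemma act_zero_imp_zero: assumes a: "a : AG" and z: "!!x. x : B ==> act a x = \<zero>" shows "a = \<zero>\<^bsub>SR\<^esub>"
proof -
 interpret S: cring SR by (rule SR_cring)
 have zM: "(\<Oplus>g\<in>carrier G. a g ** \<rho> g x) = \<zero>" if x: "x : M" for x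
 proof -
  obtain n :: nat where n: "t [^] n ** x : B" using scaled_in_B x by auto
  then have "t [^] n ** act a x = \<zero>" using z[OF n] act_smult_right[OF a A_pow[OF t_A] x] by simp
  then have "act a x = \<zero>" using integral[of "t [^] n" "act a x"] tpow_nz act_closed[OF a x] M_car by auto
  then show ?thesis by (simp add: act_def)
 qed
 have "ALL g:carrier G. a g = \<zero>" using AG_A[OF a] zM by (intro \<rho>_independent) auto
 then show ?thesis using a AG_sub by (intro SR_eqI) (auto simp: SR_zero)
qed

definition QR :: "('g => 'a) set ring" where "QR = SR\<lparr>carrier := AG\<rparr> Quot tAG 1"
definition q :: "('g => 'a) => ('g => 'a) set" where "q a = tAG 1 +>\<^bsub>SR\<lparr>carrier := AG\<rparr>\<^esub> a"

lemma AG_cring: "cring (SR\<lparr>carrier := AG\<rparr>)"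
proof -
 interpret S: cring SR by (rule SR_cring)
 show ?thesis using AG_subring S.subcring_iff[OF AG_sub] S.subcringI'[OF AG_subring] by simp
qed

lemma tAG_ideal: "ideal (tAG 1) (SR\<lparr>carrier := AG\<rparr>)"
proof -
 interpret SA: cring "SR\<lparr>carrier := AG\<rparr>" by (rule AG_cring)
 interpret S: cring SR by (rule SR_cring)
 have neg: "\<ominus>\<^bsub>SR\<^esub> a : tAG 1" if "a : tAG 1" for a
 proof -
  have "a : carrier SR" using that tAG_sub AG_sub by blast
  then show ?thesis using that amodD(5)[OF amod_scale[OF amod_A]] by (intro tAG_I) (auto simp: SR_minus tAG_tp)
 qed
 show ?thesis
 proof (rule idealI)
  show "ring (SR\<lparr>carrier := AG\<rparr>)" by (rule SA.ring_axioms)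
  show "subgroup (tAG 1) (add_monoid (SR\<lparr>carrier := AG\<rparr>))"
  proof (rule SA.add.subgroupI)
   show "tAG 1 <= carrier (SR\<lparr>carrier := AG\<rparr>)" using tAG_sub by simp
   show "tAG 1 ~= {}" using single_tAG[of \<zero> 1] amodD(2)[OF amod_scale[OF amod_A]] by blast
   show "\<ominus>\<^bsub>SR\<lparr>carrier := AG\<rparr>\<^esub> a : tAG 1" if "a : tAG 1" for a
    using S.subring_minus[OF AG_subring subsetD[OF tAG_sub that]] neg[OF that] by simp
   show "a \<oplus>\<^bsub>SR\<lparr>carrier := AG\<rparr>\<^esub> b : tAG 1" if "a : tAG 1" "b : tAG 1" for a b
    using tAG_add that by simp
  qed
  fix a x assume "a : tAG 1" "x : carrier (SR\<lparr>carrier := AG\<rparr>)"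
  then have *: "x **\<^bsub>SR\<^esub> a : tAG 1" "a : carrier SR" "x : carrier SR"
   using tAG_smult tAG_sub AG_sub by (simp, blast, auto)
  then show "x **\<^bsub>SR\<lparr>carrier := AG\<rparr>\<^esub> a : tAG 1" "a **\<^bsub>SR\<lparr>carrier := AG\<rparr>\<^esub> x : tAG 1"
   using S.m_comm by auto
 qed
qed

lemma q_hom: "ring_hom_cring (SR\<lparr>carrier := AG\<rparr>) QR q"
 unfolding QR_def q_def[abs_def] by (rule ideal.rcos_ring_hom_cring[OF tAG_ideal AG_cring])

lemma q_zero_iff: assumes "a : AG" shows "q a = \<zero>\<^bsub>QR\<^esub> \<longleftrightarrow> a : tAG 1"
proof -
 interpret I: ideal "tAG 1" "SR\<lparr>carrier := AG\<rparr>" by (rule tAG_ideal)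
 have "\<zero>\<^bsub>QR\<^esub> = tAG 1" by (simp add: QR_def FactRing_def)
 then show ?thesis using I.a_rcos_const[of a] I.a_rcos_self[of a] assms by (auto simp: q_def)
qed

lemma q_power: "a : AG ==> q (a [^]\<^bsub>SR\<^esub> (n::nat)) = q a [^]\<^bsub>QR\<^esub> n"
 using ring_hom_cring.hom_nat_power[OF q_hom, of a n] by (simp add: nat_pow_subring)

lemma AG_pow: "a : AG ==> a [^]\<^bsub>SR\<^esub> (n::nat) : AG"
 using subringE(3,6)[OF AG_subring] by (induction n) auto

lemma QR_char: assumes p: "[p] \<cdot> \<one> : tp 1 A" shows "[(p::nat)] \<cdot>\<^bsub>QR\<^esub> \<one>\<^bsub>QR\<^esub> = \<zero>\<^bsub>QR\<^esub>"
proof -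
 interpret h: ring_hom_cring "SR\<lparr>carrier := AG\<rparr>" QR q by (rule q_hom)
 interpret S: cring SR by (rule SR_cring)
 have pow: "[n] \<cdot> \<one> : A" for n :: nat using A_closed by (induction n) auto
 have e: "[n] \<cdot>\<^bsub>SR\<^esub> \<one>\<^bsub>SR\<^esub> = single ([n] \<cdot> \<one>) \<one>\<^bsub>G\<^esub>" for n :: nat
 proof (induction n)
  case 0
  have "single \<zero> \<one>\<^bsub>G\<^esub> = \<zero>\<^bsub>SR\<^esub>"
   by (auto simp: group_ring.single_def[OF GR] SR_def finite_group_ring_def)
  then show ?case by simp
 next
  case (Suc n)
  have "single ([n] \<cdot> \<one>) \<one>\<^bsub>G\<^esub> \<oplus>\<^bsub>SR\<^esub> \<one>\<^bsub>SR\<^esub> = single ([Suc n] \<cdot> \<one>) \<one>\<^bsub>G\<^esub>"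
  proof (rule SR_eqI)
   have "single ([n] \<cdot> \<one>) \<one>\<^bsub>G\<^esub> : carrier SR" "single ([Suc n] \<cdot> \<one>) \<one>\<^bsub>G\<^esub> : carrier SR"
    using single_AG pow AG_sub by blast+
   then show "single ([n] \<cdot> \<one>) \<one>\<^bsub>G\<^esub> \<oplus>\<^bsub>SR\<^esub> \<one>\<^bsub>SR\<^esub> : carrier SR" "single ([Suc n] \<cdot> \<one>) \<one>\<^bsub>G\<^esub> : carrier SR" by auto
   fix g assume "g : carrier G"
   then show "(single ([n] \<cdot> \<one>) \<one>\<^bsub>G\<^esub> \<oplus>\<^bsub>SR\<^esub> \<one>\<^bsub>SR\<^esub>) g = single ([Suc n] \<cdot> \<one>) \<one>\<^bsub>G\<^esub> g"
    unfolding SR_add[OF \<open>g : carrier G\<close>] by (simp add: SR_one group_ring.single_def[OF GR])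
  qed
  then show ?case using Suc by simp
 qed
 have "[p] \<cdot>\<^bsub>QR\<^esub> \<one>\<^bsub>QR\<^esub> = q ([p] \<cdot>\<^bsub>SR\<^esub> \<one>\<^bsub>SR\<^esub>)"
  using h.hom_add_pow_nat[of "\<one>\<^bsub>SR\<^esub>" p] h.hom_one subringE(3)[OF AG_subring] by (simp add: add_pow_subring)
 also have "\<dots> = \<zero>\<^bsub>QR\<^esub>" unfolding e using q_zero_iff[OF single_AG[OF pow]] single_tAG[OF p] by simp
 finally show ?thesis .
qed

lemma tp_power: "x : A ==> x [^] (n::nat) : tp 1 A ==> x : tp 1 A"
proof (induction n)
 case 0 then show ?case using one_notin by simp
next
 case (Suc n) then show ?case using tp_prime[of "x [^] n" x] A_pow by auto
qed

lemma AG_reduced: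
 assumes p: "Factorial_Ring.prime (p::nat)" "[p] \<cdot> \<one> : tp 1 A" "coprime p (order G)"
  and a: "a : AG" "a [^]\<^bsub>SR\<^esub> (n::nat) : tAG 1"
 shows "a : tAG 1"
proof -
 interpret h: ring_hom_cring "SR\<lparr>carrier := AG\<rparr>" QR q by (rule q_hom)
 interpret S: cring SR by (rule SR_cring)
 define N where "N = p ^ n"
 have "n < N" unfolding N_def using prime_gt_Suc_0_nat[OF p(1)] by (rule power_gt_expt)
 then have "a [^]\<^bsub>SR\<^esub> N = a [^]\<^bsub>SR\<^esub> (N - n) **\<^bsub>SR\<^esub> a [^]\<^bsub>SR\<^esub> n"
  using a AG_sub by (subst S.nat_pow_mult) auto
 then have aN: "a [^]\<^bsub>SR\<^esub> N : tAG 1" using tAG_smult[OF AG_pow[OF a(1)] a(2)] by simp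
 let ?s = "%g. single (a g) g"
 let ?c = "%g. single (a g [^] N) (g [^]\<^bsub>G\<^esub> N)"
 have sAG: "?s : carrier G \<rightarrow> AG" using AG_A[OF a(1)] single_AG by auto
 have cAG: "?c : carrier G \<rightarrow> AG" using AG_A[OF a(1)] single_AG A_pow by auto
 have cc: "(\<Oplus>\<^bsub>SR\<^esub>g\<in>carrier G. ?c g) : AG" using cAG by (rule S.finsum_in_subring[OF AG_subring])
 have as: "a = (\<Oplus>\<^bsub>SR\<^esub>g\<in>carrier G. ?s g)"
  using group_ring.S_decompose[OF GR, of a] a AG_sub by (auto simp: SR_def)
 have "q a = (\<Oplus>\<^bsub>QR\<^esub>g\<in>carrier G. q (?s g))"
  using h.hom_finsum[of ?s "carrier G"] sAG S.finsum_subring[OF AG_subring sAG] as by simp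
 then have "q a [^]\<^bsub>QR\<^esub> N = (\<Oplus>\<^bsub>QR\<^esub>g\<in>carrier G. q (?s g) [^]\<^bsub>QR\<^esub> N)"
 proof -
  have "(%g. q (?s g)) : carrier G \<rightarrow> carrier QR" using sAG by (auto simp: Pi_def)
  then show ?thesis unfolding N_def \<open>q a = _\<close>
   by (rule h.S.frobenius_power_finsum[OF p(1) QR_char[OF p(2)] finite_G])
 qed
 also have "\<dots> = (\<Oplus>\<^bsub>QR\<^esub>g\<in>carrier G. q (?c g))"
 proof (intro h.S.finsum_cong' refl)
  fix g assume g: "g : carrier G"
  have "?s g [^]\<^bsub>SR\<^esub> N = ?c g"
   unfolding SR_def using group_ring.single_power[OF GR, of "a g" g N] AG_A[OF a(1) g] g by simp
  then show "q (?s g) [^]\<^bsub>QR\<^esub> N = q (?c g)" using q_power[of "?s g" N] sAG g by (auto simp: Pi_def)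
 qed (use cAG in \<open>auto simp: Pi_def\<close>)
 also have "\<dots> = q (\<Oplus>\<^bsub>SR\<^esub>g\<in>carrier G. ?c g)"
  using h.hom_finsum[of ?c "carrier G"] cAG S.finsum_subring[OF AG_subring cAG] by simp
 finally have "q (\<Oplus>\<^bsub>SR\<^esub>g\<in>carrier G. ?c g) = \<zero>\<^bsub>QR\<^esub>"
  using q_power[OF a(1), of N] q_zero_iff[OF AG_pow[OF a(1), of N]] aN by metis
 then have ct: "(\<Oplus>\<^bsub>SR\<^esub>g\<in>carrier G. ?c g) : tAG 1" using q_zero_iff[OF cc] by simp
 show ?thesis
 proof (rule tAG_I)
  show "a : carrier SR" using a AG_sub by auto
  fix g assume g: "g : carrier G"
  let ?h = "g [^]\<^bsub>G\<^esub> N"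
  have h: "?h : carrier G" using g by simp
  have "coprime N (order G)" using p(3) by (simp add: N_def)
  then have inj: "k [^]\<^bsub>G\<^esub> N = ?h ==> k : carrier G ==> k = g" for k
   using G.power_coprime_order_inj[OF finite_G, of N k g] g by simp
  have "(\<Oplus>\<^bsub>SR\<^esub>g\<in>carrier G. ?c g) ?h = (\<Oplus>k\<in>carrier G. ?c k ?h)"
   unfolding SR_def using finite_G cAG AG_sub h by (intro group_ring.S_finsum[OF GR]) (auto simp: SR_def)
  also have "\<dots> = ?c g ?h"
   using finite_G g AG_A[OF a(1)] inj h by (intro finsum_single) (auto simp: group_ring.single_def[OF GR] A_pow)
  also have "\<dots> = a g [^] N" using h by (simp add: group_ring.single_def[OF GR])
  finally have "a g [^] N : tp 1 A" using tAG_tp[OF ct h] by simp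
  then show "a g : tp 1 A" using tp_power AG_A[OF a(1) g] by blast
 qed
qed

text \<open>For \<open>p\<close> prime to the group order, \<open>A[G]/tA[G]\<close> is a finite reduced ring, so every element is
  a multiple of an idempotent power of itself.\<close>

lemma AG_idempotent_power:
 assumes p: "Factorial_Ring.prime (p::nat)" "[p] \<cdot> \<one> : tp 1 A" "coprime p (order G)" and a: "a : AG"
 shows "\<exists>r>0. let e = a [^]\<^bsub>SR\<^esub> (r::nat) in e **\<^bsub>SR\<^esub> e \<ominus>\<^bsub>SR\<^esub> e : tAG 1 & a \<ominus>\<^bsub>SR\<^esub> e **\<^bsub>SR\<^esub> a : tAG 1"
proof -
 interpret S: cring SR by (rule SR_cring)
 obtain T where T: "T <= AG" "finite T" "!!a. a : AG ==> EX s:T. a \<ominus>\<^bsub>SR\<^esub> s : tAG 1" using AG_residues by auto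
 obtain r :: nat where r: "r > 0" "a [^]\<^bsub>SR\<^esub> r **\<^bsub>SR\<^esub> a [^]\<^bsub>SR\<^esub> r \<ominus>\<^bsub>SR\<^esub> a [^]\<^bsub>SR\<^esub> r : tAG 1"
  using S.power_idempotent_mod[of AG "tAG 1" T a, OF AG_subring tAG_sub tAG_add tAG_smult T a] by blast
 define e where "e = a [^]\<^bsub>SR\<^esub> r"
 have ac: "a : carrier SR" "e : carrier SR" "e : AG" using a AG_sub AG_pow[OF a] by (auto simp: e_def)
 define d where "d = a \<ominus>\<^bsub>SR\<^esub> e **\<^bsub>SR\<^esub> a"
 define f where "f = \<one>\<^bsub>SR\<^esub> \<ominus>\<^bsub>SR\<^esub> e"
 have AGs: "x : AG ==> y : AG ==> x \<ominus>\<^bsub>SR\<^esub> y : AG" for x y using subringE(5,7)[OF AG_subring] by (simp add: a_minus_def)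
 have fA: "f : AG" "f : carrier SR" using AGs[OF subringE(3)[OF AG_subring] ac(3)] AG_sub by (auto simp: f_def)
 have dA: "d : AG" using AGs[OF a subringE(6)[OF AG_subring ac(3) a]] by (simp add: d_def)
 have "d = a **\<^bsub>SR\<^esub> f" unfolding d_def f_def using ac by (simp add: S.r_distr S.m_comm a_minus_def S.r_minus)
 then have "d [^]\<^bsub>SR\<^esub> r = e **\<^bsub>SR\<^esub> f [^]\<^bsub>SR\<^esub> r" using ac fA by (simp add: S.nat_pow_distrib e_def)
 also obtain k where k: "r = Suc k" using r(1) gr0_conv_Suc by auto
 have "e **\<^bsub>SR\<^esub> f [^]\<^bsub>SR\<^esub> r = f [^]\<^bsub>SR\<^esub> k **\<^bsub>SR\<^esub> (e **\<^bsub>SR\<^esub> f)"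
  unfolding k using ac fA by (simp add: S.m_ac)
 also have "e **\<^bsub>SR\<^esub> f = \<ominus>\<^bsub>SR\<^esub> (e **\<^bsub>SR\<^esub> e \<ominus>\<^bsub>SR\<^esub> e)"
  unfolding f_def using ac by (simp add: S.r_distr a_minus_def S.r_minus S.minus_add S.a_comm)
 finally have "d [^]\<^bsub>SR\<^esub> r = f [^]\<^bsub>SR\<^esub> k **\<^bsub>SR\<^esub> (\<ominus>\<^bsub>SR\<^esub> \<one>\<^bsub>SR\<^esub> **\<^bsub>SR\<^esub> (e **\<^bsub>SR\<^esub> e \<ominus>\<^bsub>SR\<^esub> e))"
  using ac by (simp add: S.l_minus)
 moreover have "\<dots> : tAG 1"
  using r(2) subringE(3,5)[OF AG_subring] by (intro tAG_smult AG_pow fA) (auto simp: e_def)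
 ultimately have "d : tAG 1" using AG_reduced[OF p dA, of r] by simp
 then show ?thesis using r by (intro exI[of _ r]) (simp add: Let_def d_def e_def)
qed

end

context galois_action
begin

lemma act_minus_mod:
 assumes "a \<ominus>\<^bsub>SR\<^esub> b : tAG 1" "a : AG" "b : AG" "x : B" "act b x : tp 1 B"
 shows "act a x : tp 1 B"
proof -
 have "act a x \<ominus> act b x : tp 1 B" using act_tAG[OF assms(1,4)] act_diff[OF assms(2,3)] assms(4) B_M by simp
 then have "(act a x \<ominus> act b x) \<oplus> act b x : tp 1 B" using assms(5) amodD(3)[OF amod_scale[OF amod_B]] by blast
 moreover have "(act a x \<ominus> act b x) \<oplus> act b x = act a x"
  using B_carrier[OF act_B[OF assms(2,4)]] B_carrier[OF act_B[OF assms(3,4)]] by algebra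
 ultimately show ?thesis by simp
qed

lemma tAG_diff: "a : tAG n ==> b : tAG n ==> a \<ominus>\<^bsub>SR\<^esub> b : tAG n"
proof -
 interpret S: cring SR by (rule SR_cring)
 assume ab: "a : tAG n" "b : tAG n"
 then have "a : carrier SR" "b : carrier SR" using tAG_sub AG_sub by blast+
 then show ?thesis using ab amodD(6)[OF amod_scale[OF amod_A]] by (intro tAG_I) (auto simp: SR_diff tAG_tp)
qed

text \<open>An element killing \<open>B/tB\<close> has an idempotent power modulo \<open>t\<close>; the lifted idempotent kills \<open>B\<close>,
  hence vanishes by the independence of characters.\<close>

lemma faithful_mod:
 assumes p: "Factorial_Ring.prime (p::nat)" "[p] \<cdot> \<one> : tp 1 A" "coprime p (order G)"
  and a: "a : AG" "!!x. x : B ==> act a x : tp 1 B"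
 shows "a : tAG 1"
proof -
 interpret S: cring SR by (rule SR_cring)
 note AGs = subringE[OF AG_subring]
 obtain r :: nat where r: "r > 0"
  "a [^]\<^bsub>SR\<^esub> r **\<^bsub>SR\<^esub> a [^]\<^bsub>SR\<^esub> r \<ominus>\<^bsub>SR\<^esub> a [^]\<^bsub>SR\<^esub> r : tAG 1" "a \<ominus>\<^bsub>SR\<^esub> a [^]\<^bsub>SR\<^esub> r **\<^bsub>SR\<^esub> a : tAG 1"
  using AG_idempotent_power[OF p a(1)] by (auto simp: Let_def)
 define h where "h = a [^]\<^bsub>SR\<^esub> r"
 have hA: "h : AG" unfolding h_def by (rule AG_pow[OF a(1)])
 have hx: "act h x : tp 1 B" if x: "x : B" for x
 proof -
  obtain k where k: "r = Suc k" using r(1) gr0_conv_Suc by auto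
  have "act h x = act (a [^]\<^bsub>SR\<^esub> k) (act a x)"
   unfolding h_def k using act_mult[OF AG_pow[OF a(1)] a(1) B_M[OF x]] by simp
  then show ?thesis using act_tpB[OF AG_pow[OF a(1)] a(2)[OF x]] by simp
 qed
 have "EX e:AG. e **\<^bsub>SR\<^esub> e = e & e \<ominus>\<^bsub>SR\<^esub> h : tAG 1"
  using AG_subring tAG_sub tAG_add tAG_smult tAG_mult tAG_antimono tAG_separated AG_complete hA r(2)[folded h_def]
  by (rule S.idempotent_lifting[where F = tAG])
 then obtain e where e: "e : AG" "e **\<^bsub>SR\<^esub> e = e" "e \<ominus>\<^bsub>SR\<^esub> h : tAG 1" by auto
 have ec: "e : carrier SR" "h : carrier SR" "a : carrier SR" using e(1) hA a(1) AG_sub by auto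
 have e1: "act e x : tp 1 B" if "x : B" for x using act_minus_mod[OF e(3,1) hA that hx[OF that]] .
 have "act e x : tp n B" if "x : B" for x n using that
 proof (induction n arbitrary: x)
  case 0 then show ?case using act_B[OF e(1)] amod_B by simp
 next
  case (Suc n)
  obtain z where z: "z : B" "act e x = t ** z" using e1[OF Suc.prems] by (rule scale1E)
  have "act e x = act e (act e x)" using act_mult[OF e(1,1) B_M[OF Suc.prems]] e(2) by simp
  also have "\<dots> = t ** act e z" unfolding z(2) by (rule act_smult_right[OF e(1) t_A B_M[OF z(1)]])
  also have "\<dots> : tp 1 (tp n B)" using Suc.IH[OF z(1)] by (rule scale1I)
  finally show ?case using amodD(1)[OF amod_B] by (subst (asm) scale_scale) (auto simp: One_nat_def)
 qed
 then have "act e x = \<zero>" if "x : B" for x using separated_B that by blast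
 then have e0: "e = \<zero>\<^bsub>SR\<^esub>" by (rule act_zero_imp_zero[OF e(1)])
 have "\<zero>\<^bsub>SR\<^esub> : tAG 1" using e(3) tAG_diff[OF e(3) e(3)] ec by (simp add: a_minus_def S.r_neg)
 then have "\<zero>\<^bsub>SR\<^esub> \<ominus>\<^bsub>SR\<^esub> (e \<ominus>\<^bsub>SR\<^esub> h) : tAG 1" using e(3) by (rule tAG_diff)
 then have "h : tAG 1" unfolding e0 using ec by (simp add: a_minus_def)
 then have "h **\<^bsub>SR\<^esub> a : tAG 1" using tAG_smult[OF a(1), of h] S.m_comm[OF ec(2,3)] by simp
 then have "(a \<ominus>\<^bsub>SR\<^esub> h **\<^bsub>SR\<^esub> a) \<oplus>\<^bsub>SR\<^esub> h **\<^bsub>SR\<^esub> a : tAG 1" using r(3)[folded h_def] tAG_add by blast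
 then show ?thesis using ec by (simp add: a_minus_def S.a_assoc S.l_neg)
qed

text \<open>Choose \<open>v\<close> with as few annihilating residue classes as possible. If \<open>a v = 0\<close> with \<open>a \<noteq> 0\<close>
  modulo \<open>t\<close>, take an idempotent \<open>\<epsilon>\<close> in the ideal of \<open>a\<close> and \<open>w\<close> with \<open>\<epsilon> w \<noteq> 0\<close>: then
  \<open>v + \<epsilon> w\<close> has a smaller annihilator.\<close>

lemma cyclic_vector:
 assumes p: "Factorial_Ring.prime (p::nat)" "[p] \<cdot> \<one> : tp 1 A" "coprime p (order G)"
 shows "EX v:B. ALL a:AG. act a v : tp 1 B --> a : tAG 1"
proof -
 interpret S: cring SR by (rule SR_cring)
 note AGs = subringE[OF AG_subring]
 note tB = amodD[OF amod_scale[OF amod_B, of 1]]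
 obtain T where T: "T <= AG" "finite T" "!!a. a : AG ==> EX s:T. a \<ominus>\<^bsub>SR\<^esub> s : tAG 1" using AG_residues by auto
 define Ann where "Ann v = {s : T. act s v : tp 1 B}" for v
 have "EX v. v : B & (ALL w. w : B --> card (Ann v) <= card (Ann w))"
  using ex_has_least_nat[of "%v. v : B" \<zero> "%v. card (Ann v)"] B_closed(1) by blast
 then obtain v where v: "v : B" "!!w. w : B ==> card (Ann v) <= card (Ann w)" by auto
 have "a : tAG 1" if a: "a : AG" "act a v : tp 1 B" for a
 proof (rule ccontr)
  assume na: "a \<notin> tAG 1"
  obtain r :: nat where r: "r > 0"
   "a [^]\<^bsub>SR\<^esub> r **\<^bsub>SR\<^esub> a [^]\<^bsub>SR\<^esub> r \<ominus>\<^bsub>SR\<^esub> a [^]\<^bsub>SR\<^esub> r : tAG 1" "a \<ominus>\<^bsub>SR\<^esub> a [^]\<^bsub>SR\<^esub> r **\<^bsub>SR\<^esub> a : tAG 1"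
   using AG_idempotent_power[OF p a(1)] by (auto simp: Let_def)
  define e where "e = a [^]\<^bsub>SR\<^esub> r"
  have eA: "e : AG" unfolding e_def by (rule AG_pow[OF a(1)])
  have ac: "a : carrier SR" "e : carrier SR" using a(1) eA AG_sub by auto
  have ee: "e **\<^bsub>SR\<^esub> e \<ominus>\<^bsub>SR\<^esub> e : tAG 1" using r(2) by (simp add: e_def)
  have eeA: "e **\<^bsub>SR\<^esub> e : AG" using AGs(6) eA by blast
  have ev: "act e v : tp 1 B"
  proof -
   obtain k where k: "r = Suc k" using r(1) gr0_conv_Suc by auto
   have "act e v = act (a [^]\<^bsub>SR\<^esub> k) (act a v)"
    unfolding e_def k using act_mult[OF AG_pow[OF a(1)] a(1) B_M[OF v(1)]] by simp
   then show ?thesis using act_tpB[OF AG_pow[OF a(1)] a(2)] by simp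
  qed
  have ne: "e \<notin> tAG 1"
  proof
   assume "e : tAG 1"
   then have "e **\<^bsub>SR\<^esub> a : tAG 1" using tAG_smult[OF a(1), of e] S.m_comm[OF ac(2,1)] by simp
   then have "(a \<ominus>\<^bsub>SR\<^esub> e **\<^bsub>SR\<^esub> a) \<oplus>\<^bsub>SR\<^esub> e **\<^bsub>SR\<^esub> a : tAG 1" using r(3) tAG_add unfolding e_def by blast
   then show False using ac na by (simp add: a_minus_def S.a_assoc S.l_neg)
  qed
  obtain w where w: "w : B" "act e w \<notin> tp 1 B" using faithful_mod[OF p eA] ne by blast
  have ewB: "act e w : B" using act_B[OF eA w(1)] .
  define u where "u = v \<oplus> act e w"
  have uB: "u : B" using B_closed(5) v(1) ewB by (simp add: u_def)
  have act_u: "act b u = act b v \<oplus> act b (act e w)" if "b : AG" for b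
   unfolding u_def using that B_M v(1) ewB by (intro act_add_right) auto
  have sub: "act b v : tp 1 B" if b: "b : AG" "act b u : tp 1 B" for b
  proof -
   have bc: "b : carrier SR" using b AG_sub by auto
   have be: "b **\<^bsub>SR\<^esub> e : AG" "b **\<^bsub>SR\<^esub> (e **\<^bsub>SR\<^esub> e) : AG" "e **\<^bsub>SR\<^esub> b : AG" using AGs(6) b eA eeA by auto
   have 1: "act (e **\<^bsub>SR\<^esub> b) v : tp 1 B"
   proof -
    have "act (b **\<^bsub>SR\<^esub> e) v = act b (act e v)" using act_mult b(1) eA B_M v(1) by auto
    then show ?thesis using act_tpB[OF b(1) ev] S.m_comm[OF ac(2) bc] by simp
   qed
   have 2: "act (e **\<^bsub>SR\<^esub> b) u : tp 1 B" using act_mult[OF eA b(1) B_M[OF uB]] act_tpB[OF eA b(2)] by simp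
   have "act (e **\<^bsub>SR\<^esub> b) u = act (e **\<^bsub>SR\<^esub> b) v \<oplus> act (e **\<^bsub>SR\<^esub> b) (act e w)" using act_u[OF be(3)] .
   also have "act (e **\<^bsub>SR\<^esub> b) (act e w) = act (b **\<^bsub>SR\<^esub> (e **\<^bsub>SR\<^esub> e)) w"
    using act_mult[OF be(3) eA B_M[OF w(1)]] ac bc by (simp add: S.m_ac)
   finally have "act (b **\<^bsub>SR\<^esub> (e **\<^bsub>SR\<^esub> e)) w = act (e **\<^bsub>SR\<^esub> b) u \<ominus> act (e **\<^bsub>SR\<^esub> b) v"
    using B_carrier[OF act_B[OF be(3) v(1)]] B_carrier[OF act_B[OF be(2) w(1)]]
    by (simp add: a_minus_def) algebra
   then have 3: "act (b **\<^bsub>SR\<^esub> (e **\<^bsub>SR\<^esub> e)) w : tp 1 B" using 1 2 tB(6) by simp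
   have "b **\<^bsub>SR\<^esub> e \<ominus>\<^bsub>SR\<^esub> b **\<^bsub>SR\<^esub> (e **\<^bsub>SR\<^esub> e) = (\<ominus>\<^bsub>SR\<^esub> b) **\<^bsub>SR\<^esub> (e **\<^bsub>SR\<^esub> e \<ominus>\<^bsub>SR\<^esub> e)"
    using ac bc by (simp add: a_minus_def S.r_distr S.l_minus S.r_minus S.minus_add S.a_comm)
   then have "b **\<^bsub>SR\<^esub> e \<ominus>\<^bsub>SR\<^esub> b **\<^bsub>SR\<^esub> (e **\<^bsub>SR\<^esub> e) : tAG 1" using tAG_smult[OF AGs(5)[OF b(1)] ee] by simp
   then have "act (b **\<^bsub>SR\<^esub> e) w : tp 1 B" using act_minus_mod[OF _ be(1,2) w(1) 3] by blast
   then have 4: "act b (act e w) : tp 1 B" using act_mult[OF b(1) eA B_M[OF w(1)]] by simp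
   have "act b v = act b u \<ominus> act b (act e w)" unfolding act_u[OF b(1)]
    using B_carrier[OF act_B[OF b(1) v(1)]] B_carrier[OF act_B[OF b(1) ewB]] by algebra
   then show ?thesis using b(2) 4 tB(6) by simp
  qed
  have "Ann u <= Ann v" unfolding Ann_def using sub T(1) by auto
  moreover obtain s where s: "s : T" "e \<ominus>\<^bsub>SR\<^esub> s : tAG 1" using T(3) eA by blast
  have sA: "s : AG" "s : carrier SR" using s(1) T(1) AG_sub by auto
  have se: "s \<ominus>\<^bsub>SR\<^esub> e : tAG 1"
  proof -
   have "\<ominus>\<^bsub>SR\<^esub> \<one>\<^bsub>SR\<^esub> **\<^bsub>SR\<^esub> (e \<ominus>\<^bsub>SR\<^esub> s) : tAG 1" using tAG_smult[OF AGs(5)[OF AGs(3)] s(2)] .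
   moreover have "\<ominus>\<^bsub>SR\<^esub> \<one>\<^bsub>SR\<^esub> **\<^bsub>SR\<^esub> (e \<ominus>\<^bsub>SR\<^esub> s) = s \<ominus>\<^bsub>SR\<^esub> e"
    using sA ac by (simp add: S.l_minus a_minus_def S.minus_add S.a_comm)
   ultimately show ?thesis by simp
  qed
  have "s : Ann v" unfolding Ann_def using s(1) act_minus_mod[OF se sA(1) eA v(1) ev] by simp
  moreover have "s \<notin> Ann u"
  proof
   assume "s : Ann u"
   then have "act e u : tp 1 B" using act_minus_mod[OF s(2) eA sA(1) uB] by (simp add: Ann_def)
   then have "act e u \<ominus> act e v : tp 1 B" using ev tB(6) by blast
   moreover have "act e u \<ominus> act e v = act e (act e w)" unfolding act_u[OF eA]
    using B_carrier[OF act_B[OF eA v(1)]] B_carrier[OF act_B[OF eA ewB]] by algebra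
   ultimately have "act (e **\<^bsub>SR\<^esub> e) w : tp 1 B" using act_mult[OF eA eA B_M[OF w(1)]] by simp
   moreover have "e \<ominus>\<^bsub>SR\<^esub> e **\<^bsub>SR\<^esub> e : tAG 1"
   proof -
    have "\<ominus>\<^bsub>SR\<^esub> \<one>\<^bsub>SR\<^esub> **\<^bsub>SR\<^esub> (e **\<^bsub>SR\<^esub> e \<ominus>\<^bsub>SR\<^esub> e) : tAG 1" using tAG_smult[OF AGs(5)[OF AGs(3)] ee] .
    moreover have "\<ominus>\<^bsub>SR\<^esub> \<one>\<^bsub>SR\<^esub> **\<^bsub>SR\<^esub> (e **\<^bsub>SR\<^esub> e \<ominus>\<^bsub>SR\<^esub> e) = e \<ominus>\<^bsub>SR\<^esub> e **\<^bsub>SR\<^esub> e"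
     using ac by (simp add: S.l_minus a_minus_def S.minus_add S.a_comm)
    ultimately show ?thesis by simp
   qed
   ultimately have "act e w : tp 1 B" using act_minus_mod[OF _ eA eeA w(1)] by blast
   then show False using w(2) by simp
  qed
  moreover have "finite (Ann v)" using T(2) by (simp add: Ann_def)
  ultimately have "card (Ann u) < card (Ann v)" by (metis psubset_card_mono psubsetI)
  then show False using v(2)[OF uB] by simp
 qed
 then show ?thesis using v(1) by blast
qed

lemma good_exists:
 assumes p: "Factorial_Ring.prime (p::nat)" "[p] \<cdot> \<one> : tp 1 A" "coprime p (order G)"
 shows "EX e. good e"
proof -
 interpret S: cring SR by (rule SR_cring)
 obtain v where v: "v : B" "!!a. a : AG ==> act a v : tp 1 B ==> a : tAG 1" using cyclic_vector[OF p] by blast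
 have vM: "v : M" using v B_M by simp
 have inj: "inj_on (%g. \<rho> g v) (carrier G)"
 proof (rule inj_onI, rule ccontr)
  fix g h assume gh: "g : carrier G" "h : carrier G" "\<rho> g v = \<rho> h v" "g ~= h"
  let ?a = "single \<one> g \<ominus>\<^bsub>SR\<^esub> single \<one> h"
  have s: "single \<one> g : AG" "single \<one> h : AG" using single_AG A_closed by auto
  then have sc: "single \<one> g : carrier SR" "single \<one> h : carrier SR" using AG_sub by auto
  have "act ?a v = \<zero>" using act_diff[OF s vM] act_single gh vM A_closed by simp
  then have "act ?a v : tp 1 B" using amodD(2)[OF amod_scale[OF amod_B]] by simp
  moreover have "?a : AG" using s subringE(5,7)[OF AG_subring] by (simp add: a_minus_def)
  ultimately have "?a g : tp 1 A" using v(2) tAG_tp gh(1) by blast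
  moreover have "?a g = \<one>" using SR_diff[OF sc gh(1)] gh by (simp add: group_ring.single_def[OF GR] a_minus_def)
  ultimately show False using one_notin by simp
 qed
 define V where "V = (%g. \<rho> g v) ` carrier G"
 have VB: "V <= B" "finite V" "V <= carrier R" using \<rho>_B v(1) finite_G by (auto simp: V_def)
 have comb_act: "comb c V = act (\<lambda>g\<in>carrier G. c (\<rho> g v)) v" if c: "c : V \<rightarrow> A" for c
 proof -
  have "comb c V = (\<Oplus>g\<in>carrier G. c (\<rho> g v) ** \<rho> g v)"
   unfolding comb_def V_def using c inj vM by (intro finsum_reindex) (auto simp: V_def Pi_def)
  also have "\<dots> = act (\<lambda>g\<in>carrier G. c (\<rho> g v)) v"
   unfolding act_def using c vM by (intro finsum_cong') (auto simp: V_def Pi_def)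
  finally show ?thesis .
 qed
 have "t_indep B V" unfolding t_indep_def
 proof (intro conjI ballI impI VB)
  fix c x assume c: "c : V \<rightarrow> A" "comb c V : tp 1 B" and x: "x : V"
  obtain g where g: "g : carrier G" "x = \<rho> g v" using x by (auto simp: V_def)
  have "(\<lambda>g\<in>carrier G. c (\<rho> g v)) : AG" using c(1) by (auto simp: AG_def V_def)
  then have "(\<lambda>g\<in>carrier G. c (\<rho> g v)) : tAG 1" using v(2) c comb_act by auto
  then show "c x : tp 1 A" using tAG_tp[of _ 1 g] g by fastforce
 qed
 moreover have "card V = card (carrier G)" using inj by (simp add: V_def card_image)
 ultimately have basis: "A_basis B V" by (rule t_indep_full_basis)
 have vV: "v : V" unfolding V_def using \<rho>_id[OF vM] G.one_closed by (metis imageI)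
 obtain e where e: "lin B e" "!!c. c : V \<rightarrow> A ==> e (comb c V) = c v"
  using coordinate_functional[OF basis vV] by blast
 have "good e" unfolding good_def
 proof (intro conjI ballI impI e(1))
  fix x assume x: "x : B" and ex: "ALL g:carrier G. e (\<rho> (inv\<^bsub>G\<^esub> g) x) : tp 1 A"
  obtain c where c: "c : V \<rightarrow> A" "x = comb c V" using basis x by (auto simp: A_basis_def)
  have "c y : tp 1 A" if y: "y : V" for y
  proof -
   obtain g where g: "g : carrier G" "y = \<rho> g v" using y by (auto simp: V_def)
   let ?i = "inv\<^bsub>G\<^esub> g"
   have i: "?i : carrier G" using g by simp
   have perm: "\<rho> g z : V" if z: "z : V" for z
   proof -
    obtain h where "h : carrier G" "z = \<rho> h v" using z by (auto simp: V_def)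
    then have "\<rho> g z = \<rho> (g **\<^bsub>G\<^esub> h) v" using \<rho>_comp[OF g(1) _ vM] by simp
    then show ?thesis using \<open>h : carrier G\<close> g(1) by (auto simp: V_def)
   qed
   have VM: "z : V ==> z : M" for z using VB B_M by auto
   have injg: "inj_on (\<rho> g) V" using \<rho>_inv'[OF g(1)] VM by (metis inj_on_inverseI)
   have "\<rho> g ` V <= V" using perm by auto
   then have img: "\<rho> g ` V = V" using injg VB(2) by (simp add: endo_inj_surj)
   have "\<rho> ?i x = (\<Oplus>z\<in>V. \<rho> ?i (c z ** z))"
    unfolding c(2) comb_def using i VB(2) c(1) VM A_in_M M_cl(4) by (intro \<rho>_finsum) (auto simp: Pi_def)
   also have "\<dots> = (\<Oplus>z\<in>\<rho> g ` V. \<rho> ?i (c z ** z))" unfolding img ..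
   also have "\<dots> = (\<Oplus>z\<in>V. \<rho> ?i (c (\<rho> g z) ** \<rho> g z))"
    using injg perm c(1) VM A_in_M M_cl(4) i by (intro finsum_reindex) (auto simp: Pi_def)
   also have "\<dots> = comb (%z. c (\<rho> g z)) V"
    unfolding comb_def using perm c(1) VM i VB(3) \<rho>_inv'[OF g(1)]
    by (intro finsum_cong') (auto simp: Pi_def \<rho>_smult)
   finally have "e (\<rho> ?i x) = c (\<rho> g v)" using e(2)[of "%z. c (\<rho> g z)"] perm c(1) by (auto simp: Pi_def)
   then show ?thesis using ex g by auto
  qed
  then show "x : tp 1 B" unfolding c(2) by (intro comb_scale_amod amod_B VB) auto
 qed
 then show ?thesis by blast
qed

text \<open>Modulo \<open>t\<close>, the operators \<open>\<sigma> - 1\<close> for \<open>\<sigma>\<close> of \<open>p\<close>-power order are commuting and nilpotent.\<close>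

lemma p_group_fixed_vector:
 assumes p: "Factorial_Ring.prime (p::nat)" "[p] \<cdot> \<one> : tp 1 A"
  and H: "finite H" "H <= carrier G" "!!g. g : H ==> EX k. g [^]\<^bsub>G\<^esub> (p ^ k) = \<one>\<^bsub>G\<^esub>"
  and W: "amod W" "W <= B" "!!g x. g : carrier G ==> x : W ==> \<rho> g x : W"
  and w: "w : W" "w \<notin> tp 1 B"
 shows "EX u:W. u \<notin> tp 1 B & (ALL g:H. \<rho> g u \<ominus> u : tp 1 B)"
 using H
proof (induction H)
 case empty then show ?case using w by auto
next
 case (insert \<sigma> H)
 interpret S: cring SR by (rule SR_cring)
 interpret h: ring_hom_cring "SR\<lparr>carrier := AG\<rparr>" QR q by (rule q_hom)
 note AGs = subringE[OF AG_subring]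
 obtain u where u: "u : W" "u \<notin> tp 1 B" "ALL g:H. \<rho> g u \<ominus> u : tp 1 B" using insert by auto
 have \<sigma>: "\<sigma> : carrier G" using insert by auto
 obtain k where k: "\<sigma> [^]\<^bsub>G\<^esub> (p ^ k) = \<one>\<^bsub>G\<^esub>" using insert.prems(2)[of \<sigma>] by auto
 define N where "N = p ^ k"
 let ?s = "single \<one> \<sigma>" and ?o = "\<one>\<^bsub>SR\<^esub>"
 have s: "?s : AG" "?o : AG" using single_AG[of \<one> \<sigma>] A_closed AGs(3) by auto
 then have sc: "?s : carrier SR" "?o : carrier SR" using AG_sub by auto
 define \<tau> where "\<tau> = ?s \<ominus>\<^bsub>SR\<^esub> ?o"
 have \<tau>: "\<tau> : AG" using s AGs(5,7) by (simp add: \<tau>_def a_minus_def)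
 have \<tau>M: "act \<tau> x = \<rho> \<sigma> x \<ominus> x" if "x : M" for x
  unfolding \<tau>_def using act_diff[OF s that] act_single[OF A_closed(2) \<sigma> that] act_one[OF that] \<sigma> that by simp
 have "\<tau> [^]\<^bsub>SR\<^esub> N : tAG 1"
 proof -
  have "q \<tau> = q ?s \<ominus>\<^bsub>QR\<^esub> q ?o"
  proof -
   have "\<tau> = ?s \<oplus>\<^bsub>SR\<lparr>carrier := AG\<rparr>\<^esub> (\<ominus>\<^bsub>SR\<lparr>carrier := AG\<rparr>\<^esub> ?o)"
    using S.subring_minus[OF AG_subring s(2)] by (simp add: \<tau>_def a_minus_def)
   then show ?thesis using h.hom_add[of ?s "\<ominus>\<^bsub>SR\<lparr>carrier := AG\<rparr>\<^esub> ?o"] s h.R.a_inv_closed[of ?o]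
    by (simp add: a_minus_def)
  qed
  then have "q (\<tau> [^]\<^bsub>SR\<^esub> N) = q ?s [^]\<^bsub>QR\<^esub> N \<ominus>\<^bsub>QR\<^esub> q ?o [^]\<^bsub>QR\<^esub> N"
   unfolding N_def q_power[OF \<tau>] using h.S.frobenius_power_diff[OF p(1) QR_char[OF p(2)], of "q ?s" "q ?o" k] s by simp
  also have "q ?s [^]\<^bsub>QR\<^esub> N = q (?s [^]\<^bsub>SR\<^esub> N)" using q_power[OF s(1)] by simp
  also have "?s [^]\<^bsub>SR\<^esub> N = ?o"
   unfolding SR_def using group_ring.single_power[OF GR, of \<one> \<sigma> N] \<sigma> k
   by (simp add: N_def group_ring.single_one[OF GR])
  also have "q ?o [^]\<^bsub>QR\<^esub> N = q ?o" using h.hom_one by simp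
  finally have "q (\<tau> [^]\<^bsub>SR\<^esub> N) = \<zero>\<^bsub>QR\<^esub>" using s h.hom_closed[of ?o] by (simp add: a_minus_def h.S.r_neg)
  then show ?thesis using q_zero_iff[OF AG_pow[OF \<tau>]] by simp
 qed
 then have uN: "act (\<tau> [^]\<^bsub>SR\<^esub> N) u : tp 1 B" using act_tAG u(1) W(2) by auto
 define m where "m = (LEAST i::nat. act (\<tau> [^]\<^bsub>SR\<^esub> i) u : tp 1 B)"
 have m: "act (\<tau> [^]\<^bsub>SR\<^esub> m) u : tp 1 B" unfolding m_def using uN by (rule LeastI)
 have uB: "u : B" "u : M" using u(1) W(2) B_M by auto
 have "m ~= 0" using m u(2) act_one[OF uB(2)] by (metis S.nat_pow_0)
 then obtain i where i: "m = Suc i" using not0_implies_Suc by blast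
 define u' where "u' = act (\<tau> [^]\<^bsub>SR\<^esub> i) u"
 have \<tau>i: "\<tau> [^]\<^bsub>SR\<^esub> i : AG" using AG_pow[OF \<tau>] .
 have \<tau>c: "\<tau> : carrier SR" "\<tau> [^]\<^bsub>SR\<^esub> i : carrier SR" using \<tau> \<tau>i AG_sub by auto
 have u'W: "u' : W" unfolding u'_def by (rule act_amod[OF W(1,3) \<tau>i u(1)])
 have u'n: "u' \<notin> tp 1 B" using not_less_Least[of i "%i::nat. act (\<tau> [^]\<^bsub>SR\<^esub> i) u : tp 1 B"] i by (auto simp: m_def u'_def)
 have u'M: "u' : M" using u'W W(2) B_M by auto
 have "\<rho> \<sigma> u' \<ominus> u' : tp 1 B"
 proof -
  have "act \<tau> u' = act (\<tau> **\<^bsub>SR\<^esub> \<tau> [^]\<^bsub>SR\<^esub> i) u" unfolding u'_def using act_mult[OF \<tau> \<tau>i uB(2)] by simp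
  also have "\<tau> **\<^bsub>SR\<^esub> \<tau> [^]\<^bsub>SR\<^esub> i = \<tau> [^]\<^bsub>SR\<^esub> m" unfolding i using \<tau>c by (simp add: S.m_comm)
  finally show ?thesis using m \<tau>M[OF u'M] by simp
 qed
 moreover have "\<rho> g u' \<ominus> u' : tp 1 B" if g: "g : H" for g
 proof -
  have gG: "g : carrier G" using g insert.prems by auto
  have sg: "single \<one> g : AG" using single_AG A_closed by auto
  have "\<rho> g u' = act (single \<one> g) u'" using act_single[OF A_closed(2) gG u'M] gG u'M by simp
  also have "\<dots> = act (single \<one> g **\<^bsub>SR\<^esub> \<tau> [^]\<^bsub>SR\<^esub> i) u" unfolding u'_def using act_mult[OF sg \<tau>i uB(2)] by simp
  also have "\<dots> = act (\<tau> [^]\<^bsub>SR\<^esub> i **\<^bsub>SR\<^esub> single \<one> g) u" using S.m_comm[of "single \<one> g"] sg \<tau>c AG_sub by auto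
  also have "\<dots> = act (\<tau> [^]\<^bsub>SR\<^esub> i) (\<rho> g u)"
   using act_mult[OF \<tau>i sg uB(2)] act_single[OF A_closed(2) gG uB(2)] gG uB by simp
  finally have e: "\<rho> g u' = act (\<tau> [^]\<^bsub>SR\<^esub> i) (\<rho> g u)" .
  have d: "\<rho> g u \<ominus> u : M" using \<rho>_closed[OF gG uB(2)] uB(2) M_cl(3,5) by (simp add: a_minus_def)
  have "\<rho> g u = (\<rho> g u \<ominus> u) \<oplus> u" using M_car[OF uB(2)] \<rho>_car[OF gG uB(2)] by algebra
  then have "act (\<tau> [^]\<^bsub>SR\<^esub> i) (\<rho> g u) = act (\<tau> [^]\<^bsub>SR\<^esub> i) (\<rho> g u \<ominus> u) \<oplus> u'"
   unfolding u'_def using act_add_right[OF \<tau>i d uB(2)] by simp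
  then have "\<rho> g u' = act (\<tau> [^]\<^bsub>SR\<^esub> i) (\<rho> g u \<ominus> u) \<oplus> u'" using e by simp
  moreover have "act (\<tau> [^]\<^bsub>SR\<^esub> i) (\<rho> g u \<ominus> u) : tp 1 B" using act_tpB[OF \<tau>i] u(3) g by blast
  moreover have "act (\<tau> [^]\<^bsub>SR\<^esub> i) (\<rho> g u \<ominus> u) : carrier R" using act_closed[OF \<tau>i d] M_car by simp
  moreover have "a \<oplus> u' \<ominus> u' = a" if "a : carrier R" for a using that M_car[OF u'M] by algebra
  ultimately show ?thesis by simp
 qed
 ultimately show ?case using u'W u'n by blast
qed

end

section \<open>Towers\<close>

locale galois_tower = low: galois_action R A t K G M B \<rho> + high: galois_action R A t K G' M' B' \<rho>'
 for R :: "('a, 'b) ring_scheme" (structure) and A :: "'a set" and t :: 'a and K :: "'a set"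
  and G :: "('g, 'm) monoid_scheme" and M B :: "'a set" and \<rho> :: "'g => 'a => 'a"
  and G' :: "('h, 'n) monoid_scheme" and M' B' :: "'a set" and \<rho>' :: "'h => 'a => 'a" +
 fixes \<theta> :: "'h => 'g"
 assumes M_le: "M <= M'"
  and \<theta>_hom: "!!g h. g : carrier G' ==> h : carrier G' ==> \<theta> (g **\<^bsub>G'\<^esub> h) = \<theta> g **\<^bsub>G\<^esub> \<theta> h"
  and \<theta>_surj: "\<theta> ` carrier G' = carrier G"
  and \<rho>_compat: "!!g x. g : carrier G' ==> x : M ==> \<rho>' g x = \<rho> (\<theta> g) x"
begin

lemma \<theta>_closed: "g : carrier G' ==> \<theta> g : carrier G" using \<theta>_surj by auto

lemma \<theta>_one: "\<theta> \<one>\<^bsub>G'\<^esub> = \<one>\<^bsub>G\<^esub>"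
 using \<theta>_hom[of "\<one>\<^bsub>G'\<^esub>" "\<one>\<^bsub>G'\<^esub>"] \<theta>_closed[of "\<one>\<^bsub>G'\<^esub>"] by (metis high.G.one_closed high.G.r_one low.G.r_cancel_one')

lemma \<theta>_inv: "g : carrier G' ==> \<theta> (inv\<^bsub>G'\<^esub> g) = inv\<^bsub>G\<^esub> (\<theta> g)"
 using \<theta>_hom[of "inv\<^bsub>G'\<^esub> g" g] \<theta>_one \<theta>_closed by (intro low.G.inv_equality[symmetric]) auto

lemma B_le: "B <= B'" using M_le by (auto simp: low.B_def high.B_def)

lemma B_eq: "x : M ==> x : B' ==> x : B" by (auto simp: low.B_def high.B_def)

lemma tp_eq: assumes "x : M" "x : scale R t 1 B'" shows "x : scale R t 1 B"
proof -
 obtain z where z: "z : B'" "x = t ** z" using assms(2) by (rule low.scale1E)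
 have it: "inv t : carrier R" "inv t ** t = \<one>" "inv t : M"
  using low.inv_simps[OF low.t_carrier low.t_nz] low.subfield_closed[OF low.subfield_M'] low.A_in_M low.t_A low.t_nz by auto
 have "z = inv t ** x" unfolding z(2) using it z(1) by (simp add: low.m_assoc[symmetric])
 then have "z : M" using it assms(1) low.M_cl(4) by simp
 then show ?thesis unfolding z(2) using B_eq z(1) by (intro low.scale1I) auto
qed

lemma tp_le: "scale R t n B <= scale R t n B'" using B_le by (rule low.scale_mono)

lemma restrict_lin: "low.lin B' f ==> low.lin B f" using B_le unfolding low.lin_def by blast

lemma extend_lin:
 assumes f: "low.lin B f" shows "EX f'. low.lin B' f' & (ALL x:B. f' x = f x)"
proof -
 obtain Y where Y: "low.A_basis B Y" using low.basis_exists by auto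
 have Yt: "low.t_indep B Y" using low.A_basis_t_indep[OF low.amod_B Y] .
 have Y': "finite Y" "Y <= B" "Y <= carrier R" using Y by (auto simp: low.A_basis_def)
 have "low.t_indep B' Y" unfolding low.t_indep_def
 proof (intro conjI allI impI ballI)
  show "finite Y" "Y <= B'" using Y' B_le by auto
  fix c y assume c: "c : Y \<rightarrow> A" "low.comb c Y : scale R t 1 B'" and y: "y : Y"
  have "low.comb c Y : M" using low.comb_amod[OF low.amod_B Y'(2) c(1)] low.B_M by auto
  then have "low.comb c Y : scale R t 1 B" using tp_eq c(2) by auto
  then show "c y : scale R t 1 A" using Yt c(1) y by (auto simp: low.t_indep_def)
 qed
 then obtain Z where Z: "Y <= Z" "low.A_basis B' Z" using high.t_indep_extends_to_basis by auto
 have Z': "finite Z" "Z <= B'" "Z <= carrier R" using Z by (auto simp: low.A_basis_def)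
 have "ALL z:Z. EX \<phi>. low.lin B' \<phi> & (ALL c:Z \<rightarrow> A. \<phi> (low.comb c Z) = c z)"
  using high.coordinate_functional[OF Z(2)] by blast
 then obtain \<phi> where \<phi>: "!!z. z : Z ==> low.lin B' (\<phi> z)" "!!z c. z : Z ==> c : Z \<rightarrow> A ==> \<phi> z (low.comb c Z) = c z" by metis
 have fY: "f y : A" if "y : Y" for y using low.linD(1)[OF f low.amod_B] Y' that by auto
 define f' where "f' d = (\<Oplus>y\<in>Y. f y ** \<phi> y d)" for d
 have "low.lin B' f'" unfolding f'_def[abs_def]
  using Y' Z \<phi>(1) fY by (intro low.lin_sum high.amod_B) auto
 moreover have "f' x = f x" if x: "x : B" for x
 proof -
  obtain k where k: "k : Y \<rightarrow> A" "x = low.comb k Y" using Y x by (auto simp: low.A_basis_def)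
  define k' where "k' z = (if z : Y then k z else \<zero>)" for z
  have k': "k' : Z \<rightarrow> A" using k(1) low.A_closed(1) by (auto simp: k'_def)
  have "low.comb k' Z = low.comb k Y"
   unfolding low.comb_def using k(1) Z' Z(1) Y'
   by (intro low.add.finprod_mono_neutral_cong_right) (auto simp: k'_def Pi_def subset_iff)
  then have "\<phi> y x = k y" if "y : Y" for y using \<phi>(2)[OF _ k', of y] Z(1) that k(2) by (auto simp: k'_def)
  then have "f' x = (\<Oplus>y\<in>Y. k y ** f y)"
   unfolding f'_def using fY k(1) by (intro low.finsum_cong') (auto simp: low.m_comm Pi_def)
  then show ?thesis unfolding k(2) using low.lin_comb[OF f low.amod_B Y'(1,2) k(1)] by simp
 qed
 ultimately show ?thesis by blast
qed

definition fixed_mod :: bool where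
 "fixed_mod \<longleftrightarrow> (ALL x:B'. (ALL g:carrier G'. \<theta> g = \<one>\<^bsub>G\<^esub> --> \<rho>' g x \<ominus> x : scale R t 1 B') -->
   (EX y:B. x \<ominus> y : scale R t 1 B'))"

lemma good_lift:
 assumes p: "Factorial_Ring.prime (p::nat)" "[p] \<cdot> \<one> : scale R t 1 A"
  and H: "!!g. g : carrier G' ==> \<theta> g = \<one>\<^bsub>G\<^esub> ==> EX k. g [^]\<^bsub>G'\<^esub> (p ^ k) = \<one>\<^bsub>G'\<^esub>"
  and e: "low.lin B' e" "low.good e" and fm: "fixed_mod"
 shows "high.good e"
 unfolding high.good_def
proof (intro conjI ballI impI e(1))
 fix x assume x: "x : B'" and ex: "ALL g:carrier G'. e (\<rho>' (inv\<^bsub>G'\<^esub> g) x) : scale R t 1 A"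
 note eD = low.linD[OF e(1) high.amod_B] and tA = low.amodD[OF low.amod_scale[OF low.amod_A, of 1]]
 show "x : scale R t 1 B'"
 proof (rule ccontr)
  assume nx: "x \<notin> scale R t 1 B'"
  define W where "W = {x : B'. ALL g:carrier G'. e (\<rho>' (inv\<^bsub>G'\<^esub> g) x) : scale R t 1 A}"
  have aW: "low.amod W" unfolding low.amod_def
  proof (intro conjI ballI)
   show "W <= carrier R" by (auto simp: W_def)
   show "\<zero> : W" using high.B_closed(1) tA(2) eD(4) by (auto simp: W_def high.\<rho>_zero)
   fix y z assume yz: "y : W" "z : W"
   have "e (\<rho>' (inv\<^bsub>G'\<^esub> g) (y \<oplus> z)) : scale R t 1 A" if "g : carrier G'" for g
    using yz that tA(3) high.\<rho>_B eD(2) high.B_M by (auto simp: W_def high.\<rho>_add)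
   then show "y \<oplus> z : W" using yz high.B_closed(5) by (auto simp: W_def)
  next
   fix a y assume ay: "a : A" "y : W"
   have "e (\<rho>' (inv\<^bsub>G'\<^esub> g) (a ** y)) : scale R t 1 A" if "g : carrier G'" for g
    using ay that tA(4) high.\<rho>_B eD(3) high.B_M by (auto simp: W_def high.\<rho>_smult)
   then show "a ** y : W" using ay low.amodD(4)[OF high.amod_B] by (auto simp: W_def)
  qed
  have sW: "\<rho>' h y : W" if h: "h : carrier G'" and y: "y : W" for h y
  proof -
   have yB: "y : B'" using y by (simp add: W_def)
   have "e (\<rho>' (inv\<^bsub>G'\<^esub> g) (\<rho>' h y)) : scale R t 1 A" if g: "g : carrier G'" for g
   proof -
    have "inv\<^bsub>G'\<^esub> (inv\<^bsub>G'\<^esub> h **\<^bsub>G'\<^esub> g) = inv\<^bsub>G'\<^esub> g **\<^bsub>G'\<^esub> h" using g h by (simp add: high.G.inv_mult_group)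
    then have "\<rho>' (inv\<^bsub>G'\<^esub> g) (\<rho>' h y) = \<rho>' (inv\<^bsub>G'\<^esub> (inv\<^bsub>G'\<^esub> h **\<^bsub>G'\<^esub> g)) y"
     using high.\<rho>_comp[of "inv\<^bsub>G'\<^esub> g" h y] g h high.B_M[OF yB] by simp
    then show ?thesis using y g h by (auto simp: W_def)
   qed
   then show ?thesis using high.\<rho>_B[OF h yB] by (simp add: W_def)
  qed
  define H' where "H' = {g : carrier G'. \<theta> g = \<one>\<^bsub>G\<^esub>}"
  have H': "finite H'" "H' <= carrier G'" using high.finite_G by (auto simp: H'_def)
  have "EX u:W. u \<notin> scale R t 1 B' & (ALL g:H'. \<rho>' g u \<ominus> u : scale R t 1 B')"
   by (rule high.p_group_fixed_vector[OF p H' _ aW _ sW])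
    (use H x ex nx in \<open>auto simp: W_def H'_def\<close>)
  then obtain u where u: "u : W" "u \<notin> scale R t 1 B'" "ALL g:H'. \<rho>' g u \<ominus> u : scale R t 1 B'" by auto
  have uB: "u : B'" using u by (simp add: W_def)
  then obtain y where y: "y : B" "u \<ominus> y : scale R t 1 B'" using fm u(3) unfolding fixed_mod_def H'_def by blast
  have yB': "y : B'" using y B_le by auto
  have uy: "u \<ominus> y : B'" using low.amodD(6)[OF high.amod_B uB yB'] .
  have "y : scale R t 1 B"
  proof -
   have "e (\<rho> (inv\<^bsub>G\<^esub> g) y) : scale R t 1 A" if g: "g : carrier G" for g
   proof -
    obtain h where h: "h : carrier G'" "\<theta> h = g" using g \<theta>_surj by (metis imageE)
    let ?i = "inv\<^bsub>G'\<^esub> h"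
    have i: "?i : carrier G'" using h by simp
    have "\<rho> (inv\<^bsub>G\<^esub> g) y = \<rho>' ?i y" using \<rho>_compat[OF i low.B_M[OF y(1)]] \<theta>_inv h by simp
    also have "\<dots> = \<rho>' ?i u \<ominus> \<rho>' ?i (u \<ominus> y)"
    proof -
     have "y = u \<ominus> (u \<ominus> y)" using high.B_carrier[OF uB] high.B_carrier[OF yB'] by algebra
     then show ?thesis using high.\<rho>_minus[OF i high.B_M[OF uB] high.B_M[OF uy]] by simp
    qed
    finally have "e (\<rho> (inv\<^bsub>G\<^esub> g) y) = e (\<rho>' ?i u) \<ominus> e (\<rho>' ?i (u \<ominus> y))"
     using eD(5) high.\<rho>_B[OF i] uB uy by simp
    moreover have "e (\<rho>' ?i u) : scale R t 1 A" using u(1) h by (auto simp: W_def)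
    moreover have "e (\<rho>' ?i (u \<ominus> y)) : scale R t 1 A" using eD(6)[OF high.\<rho>_tp[OF i y(2)]] .
    ultimately show ?thesis using tA(6) by simp
   qed
   then show ?thesis using e(2) y(1) unfolding low.good_def by blast
  qed
  then have "(u \<ominus> y) \<oplus> y : scale R t 1 B'"
   using y(2) tp_le low.amodD(3)[OF low.amod_scale[OF high.amod_B]] by blast
  moreover have "(u \<ominus> y) \<oplus> y = u" using high.B_carrier[OF uB] high.B_carrier[OF yB'] by algebra
  ultimately show False using u(2) by simp
 qed
qed

lemma good_fixed_mod:
 assumes e: "high.good e" "low.good e"
 shows fixed_mod
 unfolding fixed_mod_def
proof (intro ballI impI)
 fix x assume x: "x : B'" and fx: "ALL g:carrier G'. \<theta> g = \<one>\<^bsub>G\<^esub> --> \<rho>' g x \<ominus> x : scale R t 1 B'"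
 have el: "low.lin B' e" using e(1) by (simp add: high.good_def)
 note eD = low.linD[OF el high.amod_B] and tA = low.amodD[OF low.amod_scale[OF low.amod_A, of 1]]
 define \<sigma> where "\<sigma> c = (SOME g. g : carrier G' & \<theta> g = c)" for c
 have \<sigma>: "\<sigma> c : carrier G'" "\<theta> (\<sigma> c) = c" if "c : carrier G" for c
 proof -
  have "EX g. g : carrier G' & \<theta> g = c" using that \<theta>_surj by (metis imageE)
  then have "\<sigma> c : carrier G' & \<theta> (\<sigma> c) = c" unfolding \<sigma>_def by (rule someI_ex)
  then show "\<sigma> c : carrier G'" "\<theta> (\<sigma> c) = c" by auto
 qed
 have "(%c. e (\<rho>' (inv\<^bsub>G'\<^esub> (\<sigma> c)) x)) : carrier G \<rightarrow> A" using \<sigma>(1) eD(1) high.\<rho>_B x by auto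
 then obtain y where y: "y : B" "!!c. c : carrier G ==> e (\<rho> (inv\<^bsub>G\<^esub> c) y) = e (\<rho>' (inv\<^bsub>G'\<^esub> (\<sigma> c)) x)"
  using low.good_dual_system[OF e(2)] by blast
 have yB': "y : B'" using y B_le by auto
 have xy: "x \<ominus> y : B'" using low.amodD(6)[OF high.amod_B x yB'] .
 have "e (\<rho>' (inv\<^bsub>G'\<^esub> g) (x \<ominus> y)) : scale R t 1 A" if g: "g : carrier G'" for g
 proof -
  define g' where "g' = \<sigma> (\<theta> g)"
  have g': "g' : carrier G'" "\<theta> g' = \<theta> g" using \<sigma> \<theta>_closed[OF g] by (auto simp: g'_def)
  define h where "h = inv\<^bsub>G'\<^esub> g **\<^bsub>G'\<^esub> g'"
  have h: "h : carrier G'" "\<theta> h = \<one>\<^bsub>G\<^esub>" using g g' \<theta>_closed[OF g] by (auto simp: h_def \<theta>_hom \<theta>_inv)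
  let ?i = "inv\<^bsub>G'\<^esub> g" and ?j = "inv\<^bsub>G'\<^esub> g'"
  have ij: "?i : carrier G'" "?j : carrier G'" using g g' by auto
  have i: "?i = ?j **\<^bsub>G'\<^esub> h" unfolding h_def using g g' ij
   by (metis high.G.inv_closed high.G.l_inv high.G.m_assoc high.G.m_comm high.G.r_one)
  have "\<rho>' ?i x = \<rho>' ?j (\<rho>' h x)" unfolding i using high.\<rho>_comp[OF ij(2) h(1) high.B_M[OF x]] .
  have 1: "e (\<rho>' ?i x) \<ominus> e (\<rho>' ?j x) : scale R t 1 A"
  proof -
   have "\<rho>' ?j (\<rho>' h x \<ominus> x) : scale R t 1 B'" using fx h by (intro high.\<rho>_tp ij) auto
   moreover have "\<rho>' ?j (\<rho>' h x \<ominus> x) = \<rho>' ?i x \<ominus> \<rho>' ?j x"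
    using high.\<rho>_minus[OF ij(2) high.\<rho>_closed[OF h(1) high.B_M[OF x]] high.B_M[OF x]] \<open>\<rho>' ?i x = _\<close> by simp
   ultimately have "e (\<rho>' ?i x \<ominus> \<rho>' ?j x) : scale R t 1 A" using eD(6) by simp
   then show ?thesis using eD(5)[OF high.\<rho>_B[OF ij(1) x] high.\<rho>_B[OF ij(2) x]] by simp
  qed
  have "\<rho>' ?i y = \<rho> (inv\<^bsub>G\<^esub> (\<theta> g)) y" using \<rho>_compat[OF ij(1) low.B_M[OF y(1)]] \<theta>_inv[OF g] by simp
  then have "e (\<rho>' ?i y) = e (\<rho>' ?j x)" using y(2)[OF \<theta>_closed[OF g]] by (simp add: g'_def)
  moreover have "\<rho>' ?i (x \<ominus> y) = \<rho>' ?i x \<ominus> \<rho>' ?i y" using high.\<rho>_minus ij(1) high.B_M x yB' by auto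
  ultimately show ?thesis using 1 eD(5)[OF high.\<rho>_B[OF ij(1) x] high.\<rho>_B[OF ij(1) yB']] by simp
 qed
 then have "x \<ominus> y : scale R t 1 B'" using e(1) xy unfolding high.good_def by blast
 then show "EX y:B. x \<ominus> y : scale R t 1 B'" using y(1) by blast
qed

end

section \<open>The Iwasawa algebra and the dual lattices\<close>

lemma inverse_limit_cring:
 assumes R: "!!n. n >= 1 ==> cring (R n)" and \<phi>: "!!n. n >= 1 ==> \<phi> n : ring_hom (R (Suc n)) (R n)"
 shows "cring (inverse_limit_ring R \<phi>)"
proof -
 let ?L = "inverse_limit_ring R \<phi>"
 have Lc: "x : carrier ?L \<longleftrightarrow> x : (\<Pi>\<^sub>E n\<in>{1..}. carrier (R n)) & (\<forall>n\<ge>1. \<phi> n (x (Suc n)) = x n)" for x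
  by (simp add: inverse_limit_ring_def)
 have comp: "x n : carrier (R n)" if "x : carrier ?L" "n >= 1" for x n using that by (auto simp: Lc)
 have eqI: "x = y" if "x : carrier ?L" "y : carrier ?L" "!!n. n >= 1 ==> x n = y n" for x y
  using that by (auto simp: Lc intro!: PiE_ext[of x "{1..}" "%n. carrier (R n)" y])
 have add: "x \<oplus>\<^bsub>?L\<^esub> y = (\<lambda>n\<in>{1..}. x n \<oplus>\<^bsub>R n\<^esub> y n)" for x y by (simp add: inverse_limit_ring_def)
 have mult: "x **\<^bsub>?L\<^esub> y = (\<lambda>n\<in>{1..}. x n **\<^bsub>R n\<^esub> y n)" for x y by (simp add: inverse_limit_ring_def)
 have zero: "\<zero>\<^bsub>?L\<^esub> = (\<lambda>n\<in>{1..}. \<zero>\<^bsub>R n\<^esub>)" by (simp add: inverse_limit_ring_def)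
 have one: "\<one>\<^bsub>?L\<^esub> = (\<lambda>n\<in>{1..}. \<one>\<^bsub>R n\<^esub>)" by (simp add: inverse_limit_ring_def)
 have hom: "ring_hom_cring (R (Suc n)) (R n) (\<phi> n)" if "n >= 1" for n
  using that R \<phi> by (intro ring_hom_cringI ring_hom_ringI2 cring.axioms(1)) auto
 have cr: "ring (R n)" if "n >= 1" for n using R[OF that] by (rule cring.axioms(1))
 have ac: "x \<oplus>\<^bsub>?L\<^esub> y : carrier ?L" if xy: "x : carrier ?L" "y : carrier ?L" for x y
 proof -
  have "\<phi> n (x (Suc n) \<oplus>\<^bsub>R (Suc n)\<^esub> y (Suc n)) = x n \<oplus>\<^bsub>R n\<^esub> y n" if n: "n >= 1" for n
   using ring_hom_add[OF \<phi>[OF n] comp[OF xy(1), of "Suc n"] comp[OF xy(2), of "Suc n"]] xy n by (auto simp: Lc)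
  then show ?thesis unfolding add Lc using comp xy ring.ring_simprules(1)[OF cr] by auto
 qed
 have mc: "x **\<^bsub>?L\<^esub> y : carrier ?L" if xy: "x : carrier ?L" "y : carrier ?L" for x y
 proof -
  have "\<phi> n (x (Suc n) **\<^bsub>R (Suc n)\<^esub> y (Suc n)) = x n **\<^bsub>R n\<^esub> y n" if n: "n >= 1" for n
   using ring_hom_mult[OF \<phi>[OF n] comp[OF xy(1), of "Suc n"] comp[OF xy(2), of "Suc n"]] xy n by (auto simp: Lc)
  then show ?thesis unfolding mult Lc using comp xy ring.ring_simprules(5)[OF cr] by auto
 qed
 have zc: "\<zero>\<^bsub>?L\<^esub> : carrier ?L"
  unfolding zero Lc using cr ring_hom_zero[OF \<phi> cr cr] by (auto simp: ring.ring_simprules(2))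
 have oc: "\<one>\<^bsub>?L\<^esub> : carrier ?L"
  unfolding one Lc using cr ring_hom_one[OF \<phi>] by (auto simp: ring.ring_simprules(6))
 have neg: "EX y:carrier ?L. y \<oplus>\<^bsub>?L\<^esub> x = \<zero>\<^bsub>?L\<^esub>" if x: "x : carrier ?L" for x
 proof (intro bexI)
  let ?y = "\<lambda>n\<in>{1..}. \<ominus>\<^bsub>R n\<^esub> x n"
  show "?y \<oplus>\<^bsub>?L\<^esub> x = \<zero>\<^bsub>?L\<^esub>"
   unfolding add zero using comp[OF x] cr by (auto simp: ring.ring_simprules(9))
  have "\<phi> n (\<ominus>\<^bsub>R (Suc n)\<^esub> x (Suc n)) = \<ominus>\<^bsub>R n\<^esub> x n" if n: "n >= 1" for n
  proof -
   interpret h: ring_hom_cring "R (Suc n)" "R n" "\<phi> n" by (rule hom[OF n])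
   show ?thesis using h.hom_a_inv[of "x (Suc n)"] comp[OF x, of "Suc n"] x n by (auto simp: Lc)
  qed
  then show "?y : carrier ?L" unfolding Lc using comp[OF x] cr by (auto simp: ring.ring_simprules(3))
 qed
 note rs = ring.ring_simprules[OF cr]
 show ?thesis
 proof (rule cringI)
  show "abelian_group ?L"
  proof (rule abelian_groupI)
   fix x y z assume x: "x : carrier ?L" and y: "y : carrier ?L" and z: "z : carrier ?L"
   show "x \<oplus>\<^bsub>?L\<^esub> y : carrier ?L" by (rule ac[OF x y])
   show "x \<oplus>\<^bsub>?L\<^esub> y \<oplus>\<^bsub>?L\<^esub> z = x \<oplus>\<^bsub>?L\<^esub> (y \<oplus>\<^bsub>?L\<^esub> z)"
    unfolding add using comp x y z cr by (auto simp: ring.ring_simprules(7))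
   show "x \<oplus>\<^bsub>?L\<^esub> y = y \<oplus>\<^bsub>?L\<^esub> x"
    unfolding add using comp x y cr by (auto simp: ring.ring_simprules(10))
   show "\<zero>\<^bsub>?L\<^esub> \<oplus>\<^bsub>?L\<^esub> x = x"
    using x by (intro eqI ac zc) (auto simp: add zero comp ring.ring_simprules(8)[OF cr])
  qed (auto intro: zc neg)
  show "comm_monoid ?L"
  proof (rule comm_monoidI)
   fix x y z assume x: "x : carrier ?L" and y: "y : carrier ?L" and z: "z : carrier ?L"
   show "x **\<^bsub>?L\<^esub> y : carrier ?L" by (rule mc[OF x y])
   show "x **\<^bsub>?L\<^esub> y **\<^bsub>?L\<^esub> z = x **\<^bsub>?L\<^esub> (y **\<^bsub>?L\<^esub> z)"
    unfolding mult using comp x y z cr by (auto simp: ring.ring_simprules(11))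
   show "x **\<^bsub>?L\<^esub> y = y **\<^bsub>?L\<^esub> x"
    unfolding mult using comp x y R by (auto simp: cring.cring_simprules(14))
   show "\<one>\<^bsub>?L\<^esub> **\<^bsub>?L\<^esub> x = x"
    using x by (intro eqI mc oc) (auto simp: mult one comp ring.ring_simprules(12)[OF cr] cring.cring_simprules(12)[OF R])
  qed (rule oc)
  fix x y z assume x: "x : carrier ?L" and y: "y : carrier ?L" and z: "z : carrier ?L"
  show "(x \<oplus>\<^bsub>?L\<^esub> y) **\<^bsub>?L\<^esub> z = x **\<^bsub>?L\<^esub> z \<oplus>\<^bsub>?L\<^esub> y **\<^bsub>?L\<^esub> z"
   unfolding add mult using comp x y z R by (auto simp: cring.cring_simprules(13))
 qed
qed

locale group_tower = comm_group G for G :: "('g, 'm) monoid_scheme" (structure) +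
 fixes N :: "nat => 'g set"
 assumes N_normal: "!!n. n >= 1 ==> N n \<lhd> G"
  and N_Suc: "!!n. n >= 1 ==> N (Suc n) <= N n"
  and finite_quotient: "!!n. n >= 1 ==> finite (carrier (G Mod N n))"
begin

abbreviation Q :: "nat => 'g set monoid" where "Q n \<equiv> G Mod N n"

definition \<theta> :: "nat => 'g set => 'g set" where "\<theta> n D = N n <#> D"

lemma N_mono: assumes "1 <= m" "m <= n" shows "N n <= N m"
 using assms(2)
proof (induction n rule: dec_induct)
 case (step n)
 then show ?case using N_Suc[of n] assms(1) by auto
qed simp

lemma N_sub: "n >= 1 ==> subgroup (N n) G" using N_normal normal_imp_subgroup by blast

lemma Q_group: "n >= 1 ==> comm_group (Q n)" using abelian_FactGroup N_sub by blast

lemma Q_elem: "C : carrier (Q n) \<longleftrightarrow> (EX g:carrier G. C = N n #> g)" by (auto simp: carrier_FactGroup)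

lemma \<theta>_coset: "1 <= m ==> m <= n ==> g : carrier G ==> \<theta> m (N n #> g) = N m #> g"
proof -
 assume m: "1 <= m" "m <= n" and g: "g : carrier G"
 then have n: "1 <= n" by simp
 interpret Nm: subgroup "N m" G using N_sub m by simp
 interpret Nn: subgroup "N n" G using N_sub n by simp
 have "N m <#> N n = N m"
 proof
  show "N m <#> N n <= N m" using N_mono[OF m] by (auto simp: set_mult_def)
  show "N m <= N m <#> N n"
  proof
   fix x assume x: "x : N m"
   then have "x = x ** \<one>" using Nm.mem_carrier by simp
   then show "x : N m <#> N n" using x Nn.one_closed unfolding set_mult_def by blast
  qed
 qed
 then show "\<theta> m (N n #> g) = N m #> g"
  using setmult_rcos_assoc[OF Nm.subset Nn.subset g] by (simp add: \<theta>_def)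
qed

lemma Q_mult: "n >= 1 ==> g : carrier G ==> h : carrier G ==> (N n #> g) **\<^bsub>Q n\<^esub> (N n #> h) = N n #> (g ** h)"
 using normal.rcos_sum[OF N_normal] by simp

lemma Q_inv: "n >= 1 ==> g : carrier G ==> inv\<^bsub>Q n\<^esub> (N n #> g) = N n #> inv g"
 using normal.inv_FactGroup[OF N_normal] normal.rcos_inv[OF N_normal] by (auto simp: carrier_FactGroup)

lemma \<theta>_closed: "1 <= m ==> m <= n ==> C : carrier (Q n) ==> \<theta> m C : carrier (Q m)"
 unfolding Q_elem using \<theta>_coset by blast

lemma \<theta>_hom: "1 <= m ==> m <= n ==> C : carrier (Q n) ==> D : carrier (Q n) ==>
 \<theta> m (C **\<^bsub>Q n\<^esub> D) = \<theta> m C **\<^bsub>Q m\<^esub> \<theta> m D"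
proof -
 assume m: "1 <= m" "m <= n" and "C : carrier (Q n)" "D : carrier (Q n)"
 then obtain g h where gh: "g : carrier G" "h : carrier G" "C = N n #> g" "D = N n #> h" by (auto simp: Q_elem)
 have n: "1 <= n" using m by simp
 show "\<theta> m (C **\<^bsub>Q n\<^esub> D) = \<theta> m C **\<^bsub>Q m\<^esub> \<theta> m D"
  unfolding gh(3,4) Q_mult[OF n gh(1,2)] \<theta>_coset[OF m gh(1)] \<theta>_coset[OF m gh(2)] Q_mult[OF m(1) gh(1,2)]
  using \<theta>_coset[OF m] gh by simp
qed

lemma \<theta>_surj: "1 <= m ==> m <= n ==> \<theta> m ` carrier (Q n) = carrier (Q m)"
proof
 assume m: "1 <= m" "m <= n"
 show "\<theta> m ` carrier (Q n) <= carrier (Q m)" using \<theta>_closed[OF m] by auto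
 show "carrier (Q m) <= \<theta> m ` carrier (Q n)"
 proof
  fix C assume "C : carrier (Q m)"
  then obtain g where g: "g : carrier G" "C = N m #> g" by (auto simp: Q_elem)
  then have "N n #> g : carrier (Q n)" by (auto simp: Q_elem)
  then show "C : \<theta> m ` carrier (Q n)" using \<theta>_coset[OF m g(1)] g(2) by (metis imageI)
 qed
qed

lemma \<theta>_inv: "1 <= m ==> m <= n ==> C : carrier (Q n) ==> \<theta> m (inv\<^bsub>Q n\<^esub> C) = inv\<^bsub>Q m\<^esub> (\<theta> m C)"
proof -
 assume m: "1 <= m" "m <= n" and "C : carrier (Q n)"
 then obtain g where g: "g : carrier G" "C = N n #> g" by (auto simp: Q_elem)
 then show ?thesis using m by (simp add: Q_inv \<theta>_coset)
qed

lemma subset_iff_\<theta>: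
 assumes n: "n >= 1" and C: "C : carrier (Q n)" and D: "D : carrier (Q (Suc n))"
 shows "D <= C \<longleftrightarrow> \<theta> n D = C"
proof -
 obtain g where g: "g : carrier G" "D = N (Suc n) #> g" using D by (auto simp: Q_elem)
 have gD: "g : D" unfolding g(2) using rcos_self[OF g(1) N_sub] by simp
 have th: "\<theta> n D = N n #> g" unfolding g(2) using \<theta>_coset[of n "Suc n" g] n g(1) by simp
 show ?thesis
 proof
  assume "D <= C"
  then have "g : C" using gD by auto
  moreover obtain h where h: "h : carrier G" "C = N n #> h" using C by (auto simp: Q_elem)
  ultimately show "\<theta> n D = C" unfolding th using repr_independence[of g "N n" h] N_sub[OF n] by simp
 next
  assume "\<theta> n D = C"
  then have "C = N n #> g" using th by simp
  then show "D <= C" using N_Suc[OF n] unfolding g(2) by (auto simp: r_coset_def)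
 qed
qed

lemma group_ring_Q: "cring A ==> n >= 1 ==> group_ring A (Q n)"
 unfolding group_ring_def group_ring_axioms_def using Q_group finite_quotient by simp

lemma trans_eval:
 assumes n: "n >= 1" and C: "C : carrier (Q n)"
 shows "iwasawa_trans A G N n a C = (\<Oplus>\<^bsub>A\<^esub>D\<in>{D : carrier (Q (Suc n)). \<theta> n D = C}. a D)"
proof -
 have "{D : carrier (Q (Suc n)). D <= C} = {D : carrier (Q (Suc n)). \<theta> n D = C}"
  using subset_iff_\<theta>[OF n C] by blast
 then show ?thesis using C by (simp add: iwasawa_trans_def)
qed

text \<open>Summation against a weight on the quotient does not see the difference between an element
  and its image at the lower level.\<close>

lemma trans_sum:
 assumes A: "cring A" and n: "n >= 1" and a: "a : carrier (finite_group_ring A (Q (Suc n)))"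
  and B: "cring A'" and h: "!!x y. x : carrier A ==> y : carrier A' ==> m x y : carrier A'"
  and add: "!!(I :: 'g set set) f y. finite I ==> f : I \<rightarrow> carrier A ==> y : carrier A' ==> m (\<Oplus>\<^bsub>A\<^esub>i\<in>I. f i) y = (\<Oplus>\<^bsub>A'\<^esub>i\<in>I. m (f i) y)"
  and w: "w : carrier (Q n) \<rightarrow> carrier A'"
 shows "(\<Oplus>\<^bsub>A'\<^esub>C\<in>carrier (Q n). m (iwasawa_trans A G N n a C) (w C))
  = (\<Oplus>\<^bsub>A'\<^esub>D\<in>carrier (Q (Suc n)). m (a D) (w (\<theta> n D)))"
proof -
 interpret A': cring A' by (rule B)
 have ac: "a D : carrier A" if "D : carrier (Q (Suc n))" for D
  using a that by (auto simp: finite_group_ring_def)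
 have fin: "finite (carrier (Q (Suc n)))" "finite (carrier (Q n))" using finite_quotient n by auto
 have wc: "w (\<theta> n D) : carrier A'" if "D : carrier (Q (Suc n))" for D using w \<theta>_closed[of n "Suc n" D] n that by auto
 have "(\<Oplus>\<^bsub>A'\<^esub>D\<in>carrier (Q (Suc n)). m (a D) (w (\<theta> n D)))
  = (\<Oplus>\<^bsub>A'\<^esub>C\<in>carrier (Q n). \<Oplus>\<^bsub>A'\<^esub>D\<in>{D : carrier (Q (Suc n)). \<theta> n D = C}. m (a D) (w (\<theta> n D)))"
  using fin \<theta>_closed[of n "Suc n"] n ac wc h by (intro A'.finsum_fibres) auto
 also have "\<dots> = (\<Oplus>\<^bsub>A'\<^esub>C\<in>carrier (Q n). m (iwasawa_trans A G N n a C) (w C))"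
 proof (intro A'.finsum_cong' refl)
  fix C assume C: "C : carrier (Q n)"
  have wC: "w C : carrier A'" using w C by auto
  have "m (iwasawa_trans A G N n a C) (w C) = (\<Oplus>\<^bsub>A'\<^esub>D\<in>{D : carrier (Q (Suc n)). \<theta> n D = C}. m (a D) (w C))"
   unfolding trans_eval[OF n C] using fin ac wC by (intro add) auto
  also have "\<dots> = (\<Oplus>\<^bsub>A'\<^esub>D\<in>{D : carrier (Q (Suc n)). \<theta> n D = C}. m (a D) (w (\<theta> n D)))"
   using ac wC h by (intro A'.finsum_cong') auto
  finally show "(\<Oplus>\<^bsub>A'\<^esub>D\<in>{D : carrier (Q (Suc n)). \<theta> n D = C}. m (a D) (w (\<theta> n D)))
   = m (iwasawa_trans A G N n a C) (w C)" by simp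
 next
  interpret A: cring A by (rule A)
  show "(%C. m (iwasawa_trans A G N n a C) (w C)) : carrier (Q n) \<rightarrow> carrier A'"
   using w ac h by (auto simp: trans_eval[OF n] intro!: h A.finsum_closed)
 qed
 finally show ?thesis by simp
qed

lemma trans_hom:
 assumes A: "cring A" and n: "n >= 1"
 shows "iwasawa_trans A G N n : ring_hom (finite_group_ring A (Q (Suc n))) (finite_group_ring A (Q n))"
proof -
 interpret A: cring A by (rule A)
 interpret hi: group_ring A "Q (Suc n)" using group_ring_Q[OF A, of "Suc n"] by simp
 interpret lo: group_ring A "Q n" using group_ring_Q[OF A n] .
 let ?\<phi> = "iwasawa_trans A G N n"
 have nn: "1 <= n" "n <= Suc n" using n by auto
 have closed: "?\<phi> a : carrier lo.S" if a: "a : carrier hi.S" for a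
  unfolding lo.S_carrier
 proof (rule PiE_I)
  show "?\<phi> a C : carrier A" if "C : carrier (Q n)" for C
   unfolding trans_eval[OF n that] using hi.S_closed[OF a] by (intro A.finsum_closed) auto
 qed (auto simp: iwasawa_trans_def)
 show ?thesis
 proof (rule ring_hom_memI)
  fix a b assume a: "a : carrier hi.S" and b: "b : carrier hi.S"
  show "?\<phi> a : carrier lo.S" by (rule closed[OF a])
  have fin: "finite {D : carrier (Q (Suc n)). P D}" for P using hi.finite_G by auto
  show "?\<phi> (a \<oplus>\<^bsub>hi.S\<^esub> b) = ?\<phi> a \<oplus>\<^bsub>lo.S\<^esub> ?\<phi> b"
  proof (rule lo.S_eqI)
   fix C assume C: "C : carrier (Q n)"
   have "?\<phi> (a \<oplus>\<^bsub>hi.S\<^esub> b) C = (\<Oplus>\<^bsub>A\<^esub>D\<in>{D : carrier (Q (Suc n)). \<theta> n D = C}. a D \<oplus>\<^bsub>A\<^esub> b D)"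
    unfolding trans_eval[OF n C] using hi.S_closed[OF a] hi.S_closed[OF b] by (intro A.finsum_cong') (auto simp: hi.S_add)
   also have "\<dots> = ?\<phi> a C \<oplus>\<^bsub>A\<^esub> ?\<phi> b C"
    unfolding trans_eval[OF n C] using hi.S_closed[OF a] hi.S_closed[OF b] by (intro A.finsum_addf) auto
   finally show "?\<phi> (a \<oplus>\<^bsub>hi.S\<^esub> b) C = (?\<phi> a \<oplus>\<^bsub>lo.S\<^esub> ?\<phi> b) C" using C by (simp add: lo.S_add)
  qed (use closed a b hi.S_add_closed lo.S_add_closed in auto)
  show "?\<phi> (a **\<^bsub>hi.S\<^esub> b) = ?\<phi> a **\<^bsub>lo.S\<^esub> ?\<phi> b"
  proof (rule lo.S_eqI)
   fix C assume C: "C : carrier (Q n)"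
   define w where "w E = (if E = C then \<one>\<^bsub>A\<^esub> else \<zero>\<^bsub>A\<^esub>)" for E
   have wc [simp]: "w E : carrier A" for E by (simp add: w_def)
   have ext: "c C = (\<Oplus>\<^bsub>A\<^esub>E\<in>carrier (Q n). c E **\<^bsub>A\<^esub> w E)" if "c : carrier lo.S" for c
   proof -
    have "(\<Oplus>\<^bsub>A\<^esub>E\<in>carrier (Q n). c E **\<^bsub>A\<^esub> w E) = c C **\<^bsub>A\<^esub> w C"
     using lo.finite_G C lo.S_closed[OF that] by (intro A.finsum_single) (auto simp: w_def)
    then show ?thesis using lo.S_closed[OF that C] by (simp add: w_def)
   qed
   have ts: "(\<Oplus>\<^bsub>A\<^esub>E\<in>carrier (Q n). ?\<phi> c E **\<^bsub>A\<^esub> v E) = (\<Oplus>\<^bsub>A\<^esub>D\<in>carrier (Q (Suc n)). c D **\<^bsub>A\<^esub> v (\<theta> n D))"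
    if "c : carrier hi.S" "v : carrier (Q n) \<rightarrow> carrier A" for c v
    by (rule trans_sum[OF A n that(1) A _ _ that(2)]) (auto intro: A.finsum_ldistr)
   note cl = closed[OF a] closed[OF b] closed[OF hi.S_mult_closed[OF a b]]
   have tw: "\<theta> n (D **\<^bsub>Q (Suc n)\<^esub> E) = \<theta> n D **\<^bsub>Q n\<^esub> \<theta> n E" if "D : carrier (Q (Suc n))" "E : carrier (Q (Suc n))" for D E
    using \<theta>_hom[OF nn that] .
   have "?\<phi> (a **\<^bsub>hi.S\<^esub> b) C = (\<Oplus>\<^bsub>A\<^esub>D\<in>carrier (Q (Suc n)). (a **\<^bsub>hi.S\<^esub> b) D **\<^bsub>A\<^esub> w (\<theta> n D))"
    unfolding ext[OF cl(3)] by (rule ts[OF hi.S_mult_closed[OF a b]]) simp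
   also have "\<dots> = (\<Oplus>\<^bsub>A\<^esub>D\<in>carrier (Q (Suc n)). a D **\<^bsub>A\<^esub>
     (\<Oplus>\<^bsub>A\<^esub>E\<in>carrier (Q (Suc n)). b E **\<^bsub>A\<^esub> w (\<theta> n (D **\<^bsub>Q (Suc n)\<^esub> E))))"
    by (rule hi.sum_mult[OF a b]) simp
   also have "\<dots> = (\<Oplus>\<^bsub>A\<^esub>D\<in>carrier (Q (Suc n)). a D **\<^bsub>A\<^esub>
     (\<Oplus>\<^bsub>A\<^esub>E\<in>carrier (Q n). ?\<phi> b E **\<^bsub>A\<^esub> w (\<theta> n D **\<^bsub>Q n\<^esub> E)))"
   proof (intro A.finsum_cong' refl)
    fix D assume D: "D : carrier (Q (Suc n))"
    have "(\<Oplus>\<^bsub>A\<^esub>E\<in>carrier (Q (Suc n)). b E **\<^bsub>A\<^esub> w (\<theta> n (D **\<^bsub>Q (Suc n)\<^esub> E)))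
     = (\<Oplus>\<^bsub>A\<^esub>E\<in>carrier (Q (Suc n)). b E **\<^bsub>A\<^esub> w (\<theta> n D **\<^bsub>Q n\<^esub> \<theta> n E))"
     using D tw hi.S_closed[OF b] by (intro A.finsum_cong') auto
    also have "\<dots> = (\<Oplus>\<^bsub>A\<^esub>E\<in>carrier (Q n). ?\<phi> b E **\<^bsub>A\<^esub> w (\<theta> n D **\<^bsub>Q n\<^esub> E))"
     by (rule ts[OF b, symmetric]) simp
    finally show "a D **\<^bsub>A\<^esub> (\<Oplus>\<^bsub>A\<^esub>E\<in>carrier (Q (Suc n)). b E **\<^bsub>A\<^esub> w (\<theta> n (D **\<^bsub>Q (Suc n)\<^esub> E)))
     = a D **\<^bsub>A\<^esub> (\<Oplus>\<^bsub>A\<^esub>E\<in>carrier (Q n). ?\<phi> b E **\<^bsub>A\<^esub> w (\<theta> n D **\<^bsub>Q n\<^esub> E))" by simp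
   qed (use hi.S_closed[OF a] lo.S_closed[OF cl(2)] in \<open>auto intro!: A.m_closed A.finsum_closed\<close>)
   also have "\<dots> = (\<Oplus>\<^bsub>A\<^esub>D\<in>carrier (Q n). ?\<phi> a D **\<^bsub>A\<^esub>
     (\<Oplus>\<^bsub>A\<^esub>E\<in>carrier (Q n). ?\<phi> b E **\<^bsub>A\<^esub> w (D **\<^bsub>Q n\<^esub> E)))"
    by (rule ts[OF a, symmetric]) (use lo.S_closed[OF cl(2)] in \<open>auto intro!: A.finsum_closed\<close>)
   also have "\<dots> = (?\<phi> a **\<^bsub>lo.S\<^esub> ?\<phi> b) C"
    unfolding ext[OF lo.S_mult_closed[OF cl(1,2)]] by (rule lo.sum_mult[OF cl(1,2), symmetric]) simp
   finally show "?\<phi> (a **\<^bsub>hi.S\<^esub> b) C = (?\<phi> a **\<^bsub>lo.S\<^esub> ?\<phi> b) C" .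
  qed (use closed a b hi.S_mult_closed lo.S_mult_closed in auto)
 next
  show "?\<phi> \<one>\<^bsub>hi.S\<^esub> = \<one>\<^bsub>lo.S\<^esub>"
  proof (rule lo.S_eqI)
   fix C assume C: "C : carrier (Q n)"
   have o: "\<one>\<^bsub>Q (Suc n)\<^esub> : carrier (Q (Suc n))" by (rule hi.G.one_closed)
   have to: "\<theta> n \<one>\<^bsub>Q (Suc n)\<^esub> = \<one>\<^bsub>Q n\<^esub>"
    using \<theta>_coset[OF nn one_closed] N_sub[of n] N_sub[of "Suc n"] n
     coset_mult_one[OF subgroup.subset[OF N_sub[of n]]] coset_mult_one[OF subgroup.subset[OF N_sub[of "Suc n"]]] by simp
   show "?\<phi> \<one>\<^bsub>hi.S\<^esub> C = \<one>\<^bsub>lo.S\<^esub> C"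
   proof (cases "C = \<one>\<^bsub>Q n\<^esub>")
    case True
    have "?\<phi> \<one>\<^bsub>hi.S\<^esub> C = \<one>\<^bsub>hi.S\<^esub> \<one>\<^bsub>Q (Suc n)\<^esub>"
     unfolding trans_eval[OF n C] using hi.finite_G o to True
     by (intro A.finsum_single) (auto simp: hi.S_one simp del: one_FactGroup)
    then show ?thesis using C True o by (simp add: hi.S_one lo.S_one del: one_FactGroup)
   next
    case False
    have "?\<phi> \<one>\<^bsub>hi.S\<^esub> C = \<zero>\<^bsub>A\<^esub>"
     unfolding trans_eval[OF n C] using to False
     by (intro A.add.finprod_one_eqI) (auto simp: hi.S_one simp del: one_FactGroup)
    then show ?thesis using C False by (simp add: lo.S_one del: one_FactGroup)
   qed
  qed (use closed hi.S_one_closed lo.S_one_closed in auto)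
 qed
qed

lemma iwasawa_cring: "cring A ==> cring (iwasawa_algebra A G N)"
 unfolding iwasawa_algebra_def
 by (rule inverse_limit_cring) (auto intro: group_ring.S_cring group_ring_Q trans_hom)

end

definition coset_act :: "('a => 'a) set => 'a => 'a" where
 "coset_act C x = the_elem ((%\<sigma>. \<sigma> x) ` C)"

lemma the_elem_constant: "a : C ==> (!!b. b : C ==> f b = f a) ==> the_elem (f ` C) = f a"
proof -
 assume a: "a : C" and f: "!!b. b : C ==> f b = f a"
 have "f ` C = {f a}"
 proof (intro equalityI subsetI)
  show "y : {f a}" if y: "y : f ` C" for y using y by (rule imageE) (simp only: f singleton_iff)
  show "y : f ` C" if y: "y : {f a}" for y
   using y a by (simp only: singleton_iff imageI)
 qed
 then show ?thesis by (simp only: the_elem_eq)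
qed

lemma free_module_of_rank_1:
 assumes M: "module \<Lambda> M"
 shows "free_module_of_rank \<Lambda> M 1 \<longleftrightarrow>
  (EX e:carrier M. ALL m:carrier M. \<exists>!a. a : carrier \<Lambda> & m = a \<odot>\<^bsub>M\<^esub> e)"
proof -
 interpret M: module \<Lambda> M by (rule M)
 have sum: "(\<Oplus>\<^bsub>M\<^esub>b\<in>{e}. c b \<odot>\<^bsub>M\<^esub> b) = c e \<odot>\<^bsub>M\<^esub> e"
  if "e : carrier M" "c : {e} \<rightarrow>\<^sub>E carrier \<Lambda>" for e c
 proof -
  have "c e \<odot>\<^bsub>M\<^esub> e : carrier M" using that by (intro M.smult_closed) (auto simp: PiE_iff)
  then show ?thesis using M.M.finsum_insert[of "{}" e "%b. c b \<odot>\<^bsub>M\<^esub> b"] by simp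
 qed
 have key: "(\<exists>!c. c : {e} \<rightarrow>\<^sub>E carrier \<Lambda> & m = (\<Oplus>\<^bsub>M\<^esub>b\<in>{e}. c b \<odot>\<^bsub>M\<^esub> b)) \<longleftrightarrow>
   (\<exists>!a. a : carrier \<Lambda> & m = a \<odot>\<^bsub>M\<^esub> e)" if e: "e : carrier M" for e m
 proof -
  have "(\<exists>!c. c : {e} \<rightarrow>\<^sub>E carrier \<Lambda> & m = (\<Oplus>\<^bsub>M\<^esub>b\<in>{e}. c b \<odot>\<^bsub>M\<^esub> b)) \<longleftrightarrow>
   (\<exists>!c. c : {e} \<rightarrow>\<^sub>E carrier \<Lambda> & m = c e \<odot>\<^bsub>M\<^esub> e)"
   by (rule arg_cong[of _ _ Ex1], intro ext conj_cong refl) (simp only: sum[OF e])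
  also have "\<dots> \<longleftrightarrow> (\<exists>!a. a : carrier \<Lambda> & m = a \<odot>\<^bsub>M\<^esub> e)"
  proof
   assume "\<exists>!c. c : {e} \<rightarrow>\<^sub>E carrier \<Lambda> & m = c e \<odot>\<^bsub>M\<^esub> e"
   then obtain c where c0: "c : {e} \<rightarrow>\<^sub>E carrier \<Lambda> & m = c e \<odot>\<^bsub>M\<^esub> e"
    and u0: "ALL d. d : {e} \<rightarrow>\<^sub>E carrier \<Lambda> & m = d e \<odot>\<^bsub>M\<^esub> e --> d = c" by (rule ex1E)
   note c = conjunct1[OF c0] conjunct2[OF c0] and u = u0[rule_format]
   show "\<exists>!a. a : carrier \<Lambda> & m = a \<odot>\<^bsub>M\<^esub> e"
   proof (rule ex1I[of _ "c e"])
    show "c e : carrier \<Lambda> & m = c e \<odot>\<^bsub>M\<^esub> e" by (rule conjI[OF PiE_mem[OF c(1) singletonI] c(2)])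
    fix a assume a: "a : carrier \<Lambda> & m = a \<odot>\<^bsub>M\<^esub> e"
    have "(\<lambda>x\<in>{e}. a) = c" using a by (intro u) (simp add: PiE_iff)
    from fun_cong[OF this, of e] show "a = c e" by simp
   qed
  next
   assume "\<exists>!a. a : carrier \<Lambda> & m = a \<odot>\<^bsub>M\<^esub> e"
   then obtain a where a: "a : carrier \<Lambda> & m = a \<odot>\<^bsub>M\<^esub> e"
    and u0: "ALL b. b : carrier \<Lambda> & m = b \<odot>\<^bsub>M\<^esub> e --> b = a" by (rule ex1E)
   note u = u0[rule_format]
   show "\<exists>!c. c : {e} \<rightarrow>\<^sub>E carrier \<Lambda> & m = c e \<odot>\<^bsub>M\<^esub> e"
   proof (rule ex1I[of _ "\<lambda>x\<in>{e}. a"])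
    show "(\<lambda>x\<in>{e}. a) : {e} \<rightarrow>\<^sub>E carrier \<Lambda> & m = (\<lambda>x\<in>{e}. a) e \<odot>\<^bsub>M\<^esub> e"
     using a by (simp add: PiE_iff)
    fix c assume c: "c : {e} \<rightarrow>\<^sub>E carrier \<Lambda> & m = c e \<odot>\<^bsub>M\<^esub> e"
    have ce: "c e = a" by (rule u) (rule conjI[OF PiE_mem[OF conjunct1[OF c] singletonI] conjunct2[OF c]])
    show "c = (\<lambda>x\<in>{e}. a)"
    proof
     fix x show "c x = (\<lambda>x\<in>{e}. a) x"
      using ce PiE_arb[OF conjunct1[OF c], of x] by (cases "x = e") simp_all
    qed
   qed
  qed
  finally show ?thesis .
 qed
 have card1: "(B <= carrier M & finite B & card B = 1) \<longleftrightarrow> (EX e:carrier M. B = {e})" for B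
  by (auto simp: card_1_singleton_iff One_nat_def)
 have "free_module_of_rank \<Lambda> M 1 \<longleftrightarrow> (EX B. (B <= carrier M & finite B & card B = 1) &
   (ALL m:carrier M. \<exists>!c. c : B \<rightarrow>\<^sub>E carrier \<Lambda> & m = (\<Oplus>\<^bsub>M\<^esub>b\<in>B. c b \<odot>\<^bsub>M\<^esub> b)))"
  using M by (auto simp: free_module_of_rank_def)
 also have "\<dots> \<longleftrightarrow> (EX e:carrier M. ALL m:carrier M. \<exists>!c. c : {e} \<rightarrow>\<^sub>E carrier \<Lambda> & m = (\<Oplus>\<^bsub>M\<^esub>b\<in>{e}. c b \<odot>\<^bsub>M\<^esub> b))"
  unfolding card1 by blast
 also have "\<dots> \<longleftrightarrow> (EX e:carrier M. ALL m:carrier M. \<exists>!a. a : carrier \<Lambda> & m = a \<odot>\<^bsub>M\<^esub> e)"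
  using key by (simp cong: bex_cong)
 finally show ?thesis .
qed

locale galois_limit = complete_dvr R A t K + T: group_tower \<Gamma> N
 for R :: "('a, 'b) ring_scheme" (structure) and A :: "'a set" and t :: 'a and K :: "'a set"
  and \<Gamma> :: "('a => 'a) monoid" and N :: "nat => ('a => 'a) set" +
 fixes Mn D :: "nat => 'a set" and p :: nat
 assumes level: "!!n. n >= 1 ==> galois_action R A t K (\<Gamma> Mod N n) (Mn n) (D n) coset_act"
  and coset_act: "!!n C \<sigma> x. n >= 1 ==> C : carrier (\<Gamma> Mod N n) ==> \<sigma> : C ==> x : Mn n ==> coset_act C x = \<sigma> x"
  and Mn_mono: "!!n. n >= 1 ==> Mn n <= Mn (Suc n)"
  and prime_p: "Factorial_Ring.prime p" and p_tA: "[p] \<cdot> \<one> : scale R t 1 A"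
  and p_coprime: "coprime p (order (\<Gamma> Mod N 1))"
  and p_kernel: "!!n C. n >= 1 ==> C : carrier (\<Gamma> Mod N n) ==> T.\<theta> 1 C = \<one>\<^bsub>\<Gamma> Mod N 1\<^esub> ==>
   EX k. C [^]\<^bsub>\<Gamma> Mod N n\<^esub> (p ^ k) = \<one>\<^bsub>\<Gamma> Mod N n\<^esub>"
begin

abbreviation "RA \<equiv> R\<lparr>carrier := A\<rparr>"
abbreviation "\<Lambda> \<equiv> iwasawa_algebra RA \<Gamma> N"
abbreviation "DM \<equiv> dual_limit_module RA \<Gamma> N D"
abbreviation Q where "Q \<equiv> T.Q"
abbreviation "\<theta> \<equiv> T.\<theta>"
abbreviation \<rho> :: "('a => 'a) set => 'a => 'a" where "\<rho> \<equiv> coset_act"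

lemma RA_cring: "cring RA"
 using subring_is_domain[OF subring_A] by (simp add: domain_def)

lemma coset_nonempty: "C : carrier (Q n) ==> n >= 1 ==> EX \<sigma>:carrier \<Gamma>. \<sigma> : C & C = N n #>\<^bsub>\<Gamma>\<^esub> \<sigma>"
 using T.rcos_self[OF _ T.N_sub] by (auto simp: T.Q_elem)

lemma Mn_le: assumes "1 <= m" "m <= n" shows "Mn m <= Mn n"
 using assms(2)
proof (induction n rule: dec_induct)
 case (step n)
 then show ?case using Mn_mono[of n] assms(1) by auto
qed simp

lemma tower: assumes m: "1 <= m" "m <= n"
 shows "galois_tower R A t K (Q m) (Mn m) (D m) \<rho> (Q n) (Mn n) (D n) \<rho> (\<theta> m)"
proof -
 have n: "1 <= n" using m by simp
 have compat: "\<rho> C x = \<rho> (\<theta> m C) x" if C: "C : carrier (Q n)" and x: "x : Mn m" for C x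
 proof -
  obtain \<sigma> where s: "\<sigma> : carrier \<Gamma>" "\<sigma> : C" "C = N n #>\<^bsub>\<Gamma>\<^esub> \<sigma>" using coset_nonempty[OF C n] by blast
  have "\<theta> m C = N m #>\<^bsub>\<Gamma>\<^esub> \<sigma>" unfolding s(3) using T.\<theta>_coset[OF m s(1)] .
  then have "\<sigma> : \<theta> m C" using T.rcos_self[OF s(1) T.N_sub[OF m(1)]] by simp
  then show ?thesis using coset_act[OF n C s(2)] coset_act[OF m(1) T.\<theta>_closed[OF m C]] x Mn_le[OF m] by auto
 qed
 show ?thesis
  unfolding galois_tower_def galois_tower_axioms_def
  using level[OF m(1)] level[OF n] Mn_le[OF m] T.\<theta>_hom[OF m] T.\<theta>_surj[OF m] compat by auto
qed

lemma D_le: "1 <= m ==> m <= n ==> D m <= D n" using galois_tower.B_le[OF tower] .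

lemma amod_D: "n >= 1 ==> amod (D n)"
proof -
 assume n: "n >= 1"
 interpret L: galois_action R A t K "Q n" "Mn n" "D n" \<rho> using level[OF n] .
 show ?thesis by (rule L.amod_B)
qed

lemma \<rho>_D: "n >= 1 ==> C : carrier (Q n) ==> x : D n ==> \<rho> C x : D n"
 using galois_action.\<rho>_B[OF level] .

lemma \<rho>_inv_D: "n >= 1 ==> C : carrier (Q n) ==> x : D n ==> \<rho> (inv\<^bsub>Q n\<^esub> C) x : D n"
 using \<rho>_D comm_group.axioms(2)[OF T.Q_group] by (simp add: group.inv_closed)

lemma \<rho>_tower: assumes m: "1 <= m" "m <= n" and C: "C : carrier (Q n)" and x: "x : D m"
 shows "\<rho> (inv\<^bsub>Q n\<^esub> C) x = \<rho> (inv\<^bsub>Q m\<^esub> (\<theta> m C)) x"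
proof -
 interpret tw: galois_tower R A t K "Q m" "Mn m" "D m" \<rho> "Q n" "Mn n" "D n" \<rho> "\<theta> m" using tower[OF m] .
 show ?thesis using tw.\<rho>_compat[of "inv\<^bsub>Q n\<^esub> C" x] tw.\<theta>_inv[OF C] C x tw.low.B_M by simp
qed

lemma dual_lattice_iff: "f : dual_lattice RA B \<longleftrightarrow> f : extensional B & lin B f"
 by (auto simp: dual_lattice_def lin_def PiE_def)

lemma DM_carrier: "f : carrier DM \<longleftrightarrow> f : extensional {1..} &
  (\<forall>n\<ge>1. f n : extensional (D n) & lin (D n) (f n) & (ALL x:D n. f (Suc n) x = f n x))"
proof -
 have "restrict (f (Suc n)) (D n) = f n \<longleftrightarrow> (ALL x:D n. f (Suc n) x = f n x)" if "f n : extensional (D n)" for n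
  using that by (auto simp: fun_eq_iff extensional_def restrict_def)
 then show ?thesis by (auto simp: dual_limit_module_def PiE_def Pi_def dual_lattice_iff)
qed

lemma DM_lin: "f : carrier DM ==> n >= 1 ==> lin (D n) (f n)" by (auto simp: DM_carrier)

lemma DM_compat: assumes f: "f : carrier DM" and m: "1 <= m" "m <= n" and x: "x : D m" shows "f n x = f m x"
 using m(2)
proof (induction n rule: dec_induct)
 case (step n)
 then have "x : D n" "1 <= n" using x D_le[of m n] m(1) by auto
 then show ?case using f step by (simp add: DM_carrier)
qed simp

lemma DM_eqI:
 assumes f: "f : carrier DM" and g: "g : carrier DM" and "!!n x. n >= 1 ==> x : D n ==> f n x = g n x"
 shows "f = g"
proof
 fix n show "f n = g n"
 proof (cases "n >= 1")
  case True
  then show ?thesis using f g assms(3) unfolding DM_carrier by (intro extensionalityI[of _ "D n"]) auto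
 next
  case False
  then show ?thesis using f g by (auto simp: DM_carrier extensional_def)
 qed
qed

lemma \<Lambda>_closed: "a : carrier \<Lambda> ==> n >= 1 ==> a n : carrier (Q n) \<rightarrow>\<^sub>E A"
 by (auto simp: iwasawa_algebra_def inverse_limit_ring_def finite_group_ring_def)

lemma \<Lambda>_A: "a : carrier \<Lambda> ==> n >= 1 ==> C : carrier (Q n) ==> a n C : A"
 using \<Lambda>_closed by (auto simp: PiE_iff)

lemma \<Lambda>_trans: "a : carrier \<Lambda> ==> n >= 1 ==> iwasawa_trans RA \<Gamma> N n (a (Suc n)) = a n"
 by (auto simp: iwasawa_algebra_def inverse_limit_ring_def)

lemma \<Lambda>_iff: "a : carrier \<Lambda> \<longleftrightarrow> a : extensional {1..} & (\<forall>n\<ge>1. a n : carrier (Q n) \<rightarrow>\<^sub>E A) &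
  (\<forall>n\<ge>1. iwasawa_trans RA \<Gamma> N n (a (Suc n)) = a n)"
 by (auto simp: iwasawa_algebra_def inverse_limit_ring_def finite_group_ring_def PiE_def)

lemma smult_eval:
 assumes n: "n >= 1" and a: "a n : carrier (Q n) \<rightarrow>\<^sub>E A" and f: "lin (D n) (f n)" and x: "x : D n"
 shows "(a \<odot>\<^bsub>DM\<^esub> f) n x = (\<Oplus>C\<in>carrier (Q n). a n C ** f n (\<rho> (inv\<^bsub>Q n\<^esub> C) x))"
proof -
 interpret L: galois_action R A t K "Q n" "Mn n" "D n" \<rho> using level[OF n] .
 have the: "the_elem ((%\<sigma>. f n ((inv\<^bsub>\<Gamma>\<^esub> \<sigma>) x)) ` C) = f n (\<rho> (inv\<^bsub>Q n\<^esub> C) x)" if C: "C : carrier (Q n)" for C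
 proof -
  have *: "(inv\<^bsub>\<Gamma>\<^esub> \<sigma>) x = \<rho> (inv\<^bsub>Q n\<^esub> C) x" if s: "\<sigma> : C" for \<sigma>
  proof -
   obtain \<tau> where t: "\<tau> : carrier \<Gamma>" "C = N n #>\<^bsub>\<Gamma>\<^esub> \<tau>" using coset_nonempty[OF C n] by blast
   have sc: "\<sigma> : carrier \<Gamma>" using s t subgroup.subset[OF T.N_sub[OF n]] by (auto simp: r_coset_def)
   have "C = N n #>\<^bsub>\<Gamma>\<^esub> \<sigma>" using T.repr_independence[of \<sigma> "N n" \<tau>] s t T.N_sub[OF n] by simp
   then have i: "inv\<^bsub>Q n\<^esub> C = N n #>\<^bsub>\<Gamma>\<^esub> inv\<^bsub>\<Gamma>\<^esub> \<sigma>" using T.Q_inv[OF n sc] by simp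
   have "inv\<^bsub>\<Gamma>\<^esub> \<sigma> : inv\<^bsub>Q n\<^esub> C" unfolding i using sc T.N_sub[OF n] by (intro T.rcos_self) auto
   then show ?thesis using coset_act[OF n, of "inv\<^bsub>Q n\<^esub> C" "inv\<^bsub>\<Gamma>\<^esub> \<sigma>" x] C x L.B_M by simp
  qed
  obtain \<sigma> where "\<sigma> : C" using coset_nonempty[OF C n] by blast
  then show ?thesis using the_elem_constant[of \<sigma> C "%\<sigma>. f n ((inv\<^bsub>\<Gamma>\<^esub> \<sigma>) x)"] * by simp
 qed
 have cl: "a n C ** f n (\<rho> (inv\<^bsub>Q n\<^esub> C) x) : A" if "C : carrier (Q n)" for C
  using a linD(1)[OF f amod_D[OF n] \<rho>_inv_D[OF n that x]] that A_closed by auto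
 have "(a \<odot>\<^bsub>DM\<^esub> f) n x = (\<Oplus>\<^bsub>RA\<^esub>C\<in>carrier (Q n). a n C ** the_elem ((%\<sigma>. f n ((inv\<^bsub>\<Gamma>\<^esub> \<sigma>) x)) ` C))"
  using n x by (simp add: dual_limit_module_def group_ring_act_def)
 also have "\<dots> = (\<Oplus>\<^bsub>RA\<^esub>C\<in>carrier (Q n). a n C ** f n (\<rho> (inv\<^bsub>Q n\<^esub> C) x))"
 proof -
  interpret RA: cring RA by (rule RA_cring)
  show ?thesis using the cl by (intro RA.finsum_cong') auto
 qed
 also have "\<dots> = (\<Oplus>C\<in>carrier (Q n). a n C ** f n (\<rho> (inv\<^bsub>Q n\<^esub> C) x))"
  using cl by (intro finsum_subring subring_A) auto
 finally show ?thesis .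
qed

lemma sum_mult_A:
 assumes n: "n >= 1" and a: "a : carrier (Q n) \<rightarrow>\<^sub>E A" and b: "b : carrier (Q n) \<rightarrow>\<^sub>E A" and w: "w : carrier (Q n) \<rightarrow> A"
 shows "(\<Oplus>C\<in>carrier (Q n). (a **\<^bsub>finite_group_ring RA (Q n)\<^esub> b) C ** w C)
  = (\<Oplus>C\<in>carrier (Q n). a C ** (\<Oplus>D\<in>carrier (Q n). b D ** w (C **\<^bsub>Q n\<^esub> D)))"
proof -
 interpret g: group_ring RA "Q n" using T.group_ring_Q[OF RA_cring n] .
 have ab: "a : carrier g.S" "b : carrier g.S" using a b by (auto simp: g.S_carrier)
 have aA: "a C : A" "b C : A" "w C : A" if "C : carrier (Q n)" for C using a b w that by auto
 have mA: "(a **\<^bsub>g.S\<^esub> b) C : A" if "C : carrier (Q n)" for C using g.S_closed[OF g.S_mult_closed[OF ab] that] by simp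
 have in1: "(\<Oplus>\<^bsub>RA\<^esub>D\<in>carrier (Q n). b D ** w (C **\<^bsub>Q n\<^esub> D)) = (\<Oplus>D\<in>carrier (Q n). b D ** w (C **\<^bsub>Q n\<^esub> D))"
  if "C : carrier (Q n)" for C
  using that aA A_closed g.G.m_closed by (intro finsum_subring subring_A) auto
 have in2: "(\<Oplus>D\<in>carrier (Q n). b D ** w (C **\<^bsub>Q n\<^esub> D)) : A" if "C : carrier (Q n)" for C
  using that aA A_closed g.G.m_closed by (intro finsum_in_subring subring_A) auto
 have "(\<Oplus>C\<in>carrier (Q n). (a **\<^bsub>g.S\<^esub> b) C ** w C) = (\<Oplus>\<^bsub>RA\<^esub>C\<in>carrier (Q n). (a **\<^bsub>g.S\<^esub> b) C ** w C)"
  using mA aA A_closed by (intro finsum_subring[symmetric] subring_A) auto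
 also have "\<dots> = (\<Oplus>\<^bsub>RA\<^esub>C\<in>carrier (Q n). a C ** (\<Oplus>\<^bsub>RA\<^esub>D\<in>carrier (Q n). b D ** w (C **\<^bsub>Q n\<^esub> D)))"
  using g.sum_mult[OF ab, of w] w by simp
 also have "\<dots> = (\<Oplus>\<^bsub>RA\<^esub>C\<in>carrier (Q n). a C ** (\<Oplus>D\<in>carrier (Q n). b D ** w (C **\<^bsub>Q n\<^esub> D)))"
  using in1 in2 aA A_closed by (intro g.R.finsum_cong') auto
 also have "\<dots> = (\<Oplus>C\<in>carrier (Q n). a C ** (\<Oplus>D\<in>carrier (Q n). b D ** w (C **\<^bsub>Q n\<^esub> D)))"
  using in2 aA A_closed by (intro finsum_subring subring_A) auto
 finally show ?thesis .
qed

lemma level_sum: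
 assumes n: "n >= 1" and a: "a : carrier (Q (Suc n)) \<rightarrow>\<^sub>E A" and f: "lin (D n) f"
  and f': "!!x. x : D n ==> f' x = f x" and x: "x : D n"
 shows "(\<Oplus>C\<in>carrier (Q (Suc n)). a C ** f' (\<rho> (inv\<^bsub>Q (Suc n)\<^esub> C) x)) =
  (\<Oplus>C\<in>carrier (Q n). iwasawa_trans RA \<Gamma> N n a C ** f (\<rho> (inv\<^bsub>Q n\<^esub> C) x))"
proof -
 have nn: "1 <= n" "n <= Suc n" using n by auto
 define w where "w C = f (\<rho> (inv\<^bsub>Q n\<^esub> C) x)" for C
 have wA: "w C : A" if "C : carrier (Q n)" for C
  unfolding w_def using linD(1)[OF f amod_D[OF n] \<rho>_inv_D[OF n that x]] .
 have "(\<Oplus>C\<in>carrier (Q (Suc n)). a C ** f' (\<rho> (inv\<^bsub>Q (Suc n)\<^esub> C) x)) = (\<Oplus>C\<in>carrier (Q (Suc n)). a C ** w (\<theta> n C))"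
 proof (intro finsum_cong' refl)
  fix C assume C: "C : carrier (Q (Suc n))"
  show "a C ** f' (\<rho> (inv\<^bsub>Q (Suc n)\<^esub> C) x) = a C ** w (\<theta> n C)"
   unfolding w_def \<rho>_tower[OF nn C x] using f' \<rho>_inv_D[OF n T.\<theta>_closed[OF nn C] x] by simp
 qed (use a wA T.\<theta>_closed[OF nn] A_closed in \<open>auto simp: PiE_iff\<close>)
 also have "\<dots> = (\<Oplus>C\<in>carrier (Q n). iwasawa_trans RA \<Gamma> N n a C ** w C)"
 proof (rule T.trans_sum[OF RA_cring n _ cring_axioms, symmetric])
  show "a : carrier (finite_group_ring RA (Q (Suc n)))" using a by (simp add: finite_group_ring_def)
  show "x ** y : carrier R" if "x : carrier RA" "y : carrier R" for x y using that by simp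
  show "w : carrier (Q n) \<rightarrow> carrier R" using wA by auto
  show "(\<Oplus>\<^bsub>RA\<^esub>i\<in>I. f i) ** y = (\<Oplus>i\<in>I. f i ** y)"
   if "finite I" "f : I \<rightarrow> carrier RA" "y : carrier R" for I :: "('a => 'a) set set" and f y
  proof -
   have "f : I \<rightarrow> A" "f : I \<rightarrow> carrier R" using that(2) by (auto simp: Pi_def)
   then show ?thesis by (simp only: finsum_subring[OF subring_A] finsum_ldistr[OF that(1,3)])
  qed
 qed
 finally show ?thesis by (simp add: w_def)
qed

lemma lin_dact: assumes n: "n >= 1" and a: "a : carrier (Q n) \<rightarrow>\<^sub>E A" and f: "lin (D n) f"
 shows "lin (D n) (%x. \<Oplus>C\<in>carrier (Q n). a C ** f (\<rho> (inv\<^bsub>Q n\<^esub> C) x))"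
proof -
 interpret L: galois_action R A t K "Q n" "Mn n" "D n" \<rho> using level[OF n] .
 show ?thesis by (rule lin_sum[OF amod_D[OF n] L.finite_G L.lin_translate[OF f]]) (use a in auto)
qed

lemma lin_cong: "amod B ==> lin B f ==> (!!x. x : B ==> g x = f x) ==> lin B g"
 using amodD(3,4)[of B] by (auto simp: lin_def)

lemma DM_I:
 assumes "f : extensional {1..}" "!!n. n >= 1 ==> f n : extensional (D n)"
  and "!!n. n >= 1 ==> lin (D n) (g n)" "!!n x. n >= 1 ==> x : D n ==> f n x = g n x"
  and "!!n x. n >= 1 ==> x : D n ==> g (Suc n) x = g n x"
 shows "f : carrier DM"
 unfolding DM_carrier
proof (intro conjI allI impI ballI)
 fix n :: nat assume n: "1 <= n"
 show "f n : extensional (D n)" by (rule assms(2)[OF n])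
 show "lin (D n) (f n)" by (rule lin_cong[OF amod_D[OF n] assms(3)[OF n] assms(4)[OF n]])
 fix x assume x: "x : D n"
 have "x : D (Suc n)" using x D_le[of n "Suc n"] n by auto
 then show "f (Suc n) x = f n x" using assms(4)[of "Suc n" x] assms(4)[OF n x] assms(5)[OF n x] by simp
qed (rule assms(1))

lemma DM_smult_closed: assumes a: "a : carrier \<Lambda>" and f: "f : carrier DM" shows "a \<odot>\<^bsub>DM\<^esub> f : carrier DM"
proof (rule DM_I)
 show "a \<odot>\<^bsub>DM\<^esub> f : extensional {1..}" by (simp add: dual_limit_module_def)
 fix n :: nat assume n: "n >= 1"
 show "(a \<odot>\<^bsub>DM\<^esub> f) n : extensional (D n)" using n by (simp add: dual_limit_module_def group_ring_act_def)
 show "lin (D n) (%x. \<Oplus>C\<in>carrier (Q n). a n C ** f n (\<rho> (inv\<^bsub>Q n\<^esub> C) x))"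
  by (rule lin_dact[OF n \<Lambda>_closed[OF a n] DM_lin[OF f n]])
 fix x assume x: "x : D n"
 show "(a \<odot>\<^bsub>DM\<^esub> f) n x = (\<Oplus>C\<in>carrier (Q n). a n C ** f n (\<rho> (inv\<^bsub>Q n\<^esub> C) x))"
  by (rule smult_eval[of n a f, OF n \<Lambda>_closed[OF a n] DM_lin[OF f n] x])
 show "(\<Oplus>C\<in>carrier (Q (Suc n)). a (Suc n) C ** f (Suc n) (\<rho> (inv\<^bsub>Q (Suc n)\<^esub> C) x)) =
   (\<Oplus>C\<in>carrier (Q n). a n C ** f n (\<rho> (inv\<^bsub>Q n\<^esub> C) x))"
  using level_sum[OF n \<Lambda>_closed[OF a, of "Suc n"] DM_lin[OF f n], of "f (Suc n)" x] \<Lambda>_trans[OF a n] f n x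
  by (simp add: DM_carrier)
qed

lemma DM_add_eval: "n >= 1 ==> x : D n ==> (f \<oplus>\<^bsub>DM\<^esub> g) n x = f n x \<oplus> g n x"
 by (simp add: dual_limit_module_def)

lemma lin_add: assumes "amod B" "lin B f" "lin B g" shows "lin B (%x. f x \<oplus> g x)"
 unfolding lin_def
proof (intro conjI ballI)
 note l = linD[OF assms(2,1)] linD[OF assms(3,1)]
 show "(%x. f x \<oplus> g x) : B \<rightarrow> A" using l(1,7) A_closed by auto
 fix x y assume xy: "x : B" "y : B"
 show "f (x \<oplus> y) \<oplus> g (x \<oplus> y) = f x \<oplus> g x \<oplus> (f y \<oplus> g y)"
  unfolding l(2)[OF xy] l(8)[OF xy]
  using A_carrier[OF l(1)[OF xy(1)]] A_carrier[OF l(1)[OF xy(2)]] A_carrier[OF l(7)[OF xy(1)]] A_carrier[OF l(7)[OF xy(2)]]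
  by algebra
next
 note l = linD[OF assms(2,1)] linD[OF assms(3,1)]
 fix a x assume ax: "a : A" "x : B"
 show "f (a ** x) \<oplus> g (a ** x) = a ** (f x \<oplus> g x)"
  unfolding l(3)[OF ax] l(9)[OF ax] using A_carrier[OF ax(1)] A_carrier[OF l(1)[OF ax(2)]] A_carrier[OF l(7)[OF ax(2)]]
  by (simp add: r_distr)
qed

lemma DM_add_closed: assumes f: "f : carrier DM" and g: "g : carrier DM" shows "f \<oplus>\<^bsub>DM\<^esub> g : carrier DM"
proof (rule DM_I)
 show "f \<oplus>\<^bsub>DM\<^esub> g : extensional {1..}" by (simp add: dual_limit_module_def)
 fix n :: nat assume n: "n >= 1"
 show "(f \<oplus>\<^bsub>DM\<^esub> g) n : extensional (D n)" using n by (simp add: dual_limit_module_def)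
 show "lin (D n) (%x. f n x \<oplus> g n x)" by (rule lin_add[OF amod_D[OF n] DM_lin[OF f n] DM_lin[OF g n]])
 fix x assume x: "x : D n"
 show "(f \<oplus>\<^bsub>DM\<^esub> g) n x = f n x \<oplus> g n x" by (rule DM_add_eval[OF n x])
 show "f (Suc n) x \<oplus> g (Suc n) x = f n x \<oplus> g n x" using f g n x by (simp add: DM_carrier)
qed

lemma DM_zero_closed: "\<zero>\<^bsub>DM\<^esub> : carrier DM"
proof (rule DM_I)
 show "\<zero>\<^bsub>DM\<^esub> : extensional {1..}" by (simp add: dual_limit_module_def)
 fix n :: nat assume n: "n >= 1"
 show "\<zero>\<^bsub>DM\<^esub> n : extensional (D n)" using n by (simp add: dual_limit_module_def)
 show "lin (D n) (%x. \<zero>)" using amodD(1)[OF amod_D[OF n]] A_closed by (auto simp: lin_def)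
 fix x assume x: "x : D n"
 show "\<zero>\<^bsub>DM\<^esub> n x = \<zero>" using n x by (simp add: dual_limit_module_def)
 show "\<zero> = \<zero>" by (rule refl)
qed

lemma DM_zero_eval: "n >= 1 ==> x : D n ==> \<zero>\<^bsub>DM\<^esub> n x = \<zero>"
 by (simp add: dual_limit_module_def)

lemma DM_module: "module \<Lambda> DM"
proof -
 interpret \<Lambda>: cring \<Lambda> by (rule T.iwasawa_cring[OF RA_cring])
 have val: "f n x : carrier R" if "f : carrier DM" "n >= 1" "x : D n" for f n x
  using linD(1)[OF DM_lin[OF that(1,2)] amod_D[OF that(2)] that(3)] by simp
 have sm: "(a \<odot>\<^bsub>DM\<^esub> f) n x = (\<Oplus>C\<in>carrier (Q n). a n C ** f n (\<rho> (inv\<^bsub>Q n\<^esub> C) x))"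
  if "a : carrier \<Lambda>" "f : carrier DM" "n >= 1" "x : D n" for a f n x
  using smult_eval[of n a f, OF that(3) \<Lambda>_closed[OF that(1,3)] DM_lin[OF that(2,3)] that(4)] .
 have neg: "EX g:carrier DM. g \<oplus>\<^bsub>DM\<^esub> f = \<zero>\<^bsub>DM\<^esub>" if f: "f : carrier DM" for f
 proof (intro bexI)
  let ?g = "\<lambda>n\<in>{1..}. \<lambda>x\<in>D n. \<ominus> f n x"
  show g: "?g : carrier DM"
  proof (rule DM_I)
   fix n :: nat assume n: "n >= 1"
   note l = linD[OF DM_lin[OF f n] amod_D[OF n]]
   show "lin (D n) (%x. \<ominus> f n x)" unfolding lin_def
    using l(1-3) A_closed by (auto simp: minus_add r_minus)
   show "?g n x = \<ominus> f n x" if "x : D n" for x using that n by simp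
   show "\<ominus> f (Suc n) x = \<ominus> f n x" if "x : D n" for x using that n f by (simp add: DM_carrier)
  qed auto
  show "?g \<oplus>\<^bsub>DM\<^esub> f = \<zero>\<^bsub>DM\<^esub>"
  proof (rule DM_eqI[OF DM_add_closed[OF g f] DM_zero_closed])
   fix n :: nat and x assume n: "n >= 1" and x: "x : D n"
   show "(?g \<oplus>\<^bsub>DM\<^esub> f) n x = \<zero>\<^bsub>DM\<^esub> n x"
    unfolding DM_add_eval[OF n x] DM_zero_eval[OF n x] using n x val[OF f n x] by (simp add: l_neg)
  qed
 qed
 have ab: "abelian_group DM"
 proof (rule abelian_groupI)
  fix f g h assume f: "f : carrier DM" and g: "g : carrier DM" and h: "h : carrier DM"
  show "f \<oplus>\<^bsub>DM\<^esub> g : carrier DM" by (rule DM_add_closed[OF f g])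
  show "f \<oplus>\<^bsub>DM\<^esub> g \<oplus>\<^bsub>DM\<^esub> h = f \<oplus>\<^bsub>DM\<^esub> (g \<oplus>\<^bsub>DM\<^esub> h)"
   using f g h val by (intro DM_eqI DM_add_closed) (auto simp: DM_add_eval a_assoc)
  show "f \<oplus>\<^bsub>DM\<^esub> g = g \<oplus>\<^bsub>DM\<^esub> f"
   using f g val by (intro DM_eqI DM_add_closed) (auto simp: DM_add_eval a_comm)
  show "\<zero>\<^bsub>DM\<^esub> \<oplus>\<^bsub>DM\<^esub> f = f"
   using f val by (intro DM_eqI DM_add_closed DM_zero_closed) (auto simp: DM_add_eval DM_zero_eval)
 qed (auto intro: DM_zero_closed neg)
 show ?thesis
 proof (rule moduleI)
  show "cring \<Lambda>" by (rule \<Lambda>.is_cring)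
  show "abelian_group DM" by (rule ab)
  fix a b f g assume a: "a : carrier \<Lambda>" and f: "f : carrier DM"
  show "a \<odot>\<^bsub>DM\<^esub> f : carrier DM" by (rule DM_smult_closed[OF a f])
  have c: "a n C : carrier R" "f n (\<rho> (inv\<^bsub>Q n\<^esub> C) x) : carrier R"
   if "n >= 1" "C : carrier (Q n)" "x : D n" for n C x
   using \<Lambda>_A[OF a that(1,2)] val[OF f that(1) \<rho>_inv_D[OF that]] by auto
  { assume b: "b : carrier \<Lambda>"
   have bc: "b n C : carrier R" if "n >= 1" "C : carrier (Q n)" for n C using \<Lambda>_A[OF b that] by simp
   show "(a \<oplus>\<^bsub>\<Lambda>\<^esub> b) \<odot>\<^bsub>DM\<^esub> f = a \<odot>\<^bsub>DM\<^esub> f \<oplus>\<^bsub>DM\<^esub> b \<odot>\<^bsub>DM\<^esub> f"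
   proof (rule DM_eqI)
    fix n :: nat and x assume n: "n >= 1" and x: "x : D n"
    have "((a \<oplus>\<^bsub>\<Lambda>\<^esub> b) \<odot>\<^bsub>DM\<^esub> f) n x = (\<Oplus>C\<in>carrier (Q n).
      a n C ** f n (\<rho> (inv\<^bsub>Q n\<^esub> C) x) \<oplus> b n C ** f n (\<rho> (inv\<^bsub>Q n\<^esub> C) x))"
     unfolding sm[OF \<Lambda>.a_closed[OF a b] f n x] using c[OF n _ x] bc[OF n] n
     by (intro finsum_cong') (auto simp: iwasawa_algebra_def inverse_limit_ring_def finite_group_ring_def l_distr)
    also have "\<dots> = (a \<odot>\<^bsub>DM\<^esub> f) n x \<oplus> (b \<odot>\<^bsub>DM\<^esub> f) n x"
     unfolding sm[OF a f n x] sm[OF b f n x] using c[OF n _ x] bc[OF n] by (intro finsum_addf) auto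
    finally show "((a \<oplus>\<^bsub>\<Lambda>\<^esub> b) \<odot>\<^bsub>DM\<^esub> f) n x = (a \<odot>\<^bsub>DM\<^esub> f \<oplus>\<^bsub>DM\<^esub> b \<odot>\<^bsub>DM\<^esub> f) n x"
     using DM_add_eval[OF n x] by simp
   qed (use a b f DM_smult_closed DM_add_closed in auto)
   show "(a **\<^bsub>\<Lambda>\<^esub> b) \<odot>\<^bsub>DM\<^esub> f = a \<odot>\<^bsub>DM\<^esub> (b \<odot>\<^bsub>DM\<^esub> f)"
   proof (rule DM_eqI)
    fix n :: nat and x assume n: "n >= 1" and x: "x : D n"
    interpret L: galois_action R A t K "Q n" "Mn n" "D n" \<rho> using level[OF n] .
    let ?w = "%C. f n (\<rho> (inv\<^bsub>Q n\<^esub> C) x)"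
    have "((a **\<^bsub>\<Lambda>\<^esub> b) \<odot>\<^bsub>DM\<^esub> f) n x
     = (\<Oplus>C\<in>carrier (Q n). (a n **\<^bsub>finite_group_ring RA (Q n)\<^esub> b n) C ** ?w C)"
     unfolding sm[OF \<Lambda>.m_closed[OF a b] f n x] using n by (simp add: iwasawa_algebra_def inverse_limit_ring_def)
    also have "\<dots> = (\<Oplus>C\<in>carrier (Q n). a n C ** (\<Oplus>E\<in>carrier (Q n). b n E ** ?w (C **\<^bsub>Q n\<^esub> E)))"
     using \<rho>_inv_D[OF n _ x] linD(1)[OF DM_lin[OF f n] amod_D[OF n]]
     by (intro sum_mult_A[OF n \<Lambda>_closed[OF a n] \<Lambda>_closed[OF b n]]) auto
    also have "\<dots> = (\<Oplus>C\<in>carrier (Q n). a n C ** (b \<odot>\<^bsub>DM\<^esub> f) n (\<rho> (inv\<^bsub>Q n\<^esub> C) x))"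
    proof (intro finsum_cong' refl)
     fix C assume C: "C : carrier (Q n)"
     have "(b \<odot>\<^bsub>DM\<^esub> f) n (\<rho> (inv\<^bsub>Q n\<^esub> C) x) = (\<Oplus>E\<in>carrier (Q n). b n E ** ?w (C **\<^bsub>Q n\<^esub> E))"
      unfolding sm[OF b f n \<rho>_inv_D[OF n C x]]
     proof (intro finsum_cong' refl)
      fix E assume E: "E : carrier (Q n)"
      have "inv\<^bsub>Q n\<^esub> (C **\<^bsub>Q n\<^esub> E) = inv\<^bsub>Q n\<^esub> E **\<^bsub>Q n\<^esub> inv\<^bsub>Q n\<^esub> C" using C E by (rule L.G.inv_mult_group)
      then have "\<rho> (inv\<^bsub>Q n\<^esub> (C **\<^bsub>Q n\<^esub> E)) x = \<rho> (inv\<^bsub>Q n\<^esub> E) (\<rho> (inv\<^bsub>Q n\<^esub> C) x)"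
       using L.\<rho>_comp[OF L.G.inv_closed[OF E] L.G.inv_closed[OF C] L.B_M[OF x]] by simp
      then show "b n E ** f n (\<rho> (inv\<^bsub>Q n\<^esub> E) (\<rho> (inv\<^bsub>Q n\<^esub> C) x)) = b n E ** ?w (C **\<^bsub>Q n\<^esub> E)" by simp
     qed (use bc[OF n] c(2)[OF n _ x] L.G.m_closed[OF C] in auto)
     then show "a n C ** (\<Oplus>E\<in>carrier (Q n). b n E ** ?w (C **\<^bsub>Q n\<^esub> E)) = a n C ** (b \<odot>\<^bsub>DM\<^esub> f) n (\<rho> (inv\<^bsub>Q n\<^esub> C) x)" by simp
    qed (use c(1)[OF n _ x] val[OF DM_smult_closed[OF b f] n \<rho>_inv_D[OF n _ x]] in auto)
    finally show "((a **\<^bsub>\<Lambda>\<^esub> b) \<odot>\<^bsub>DM\<^esub> f) n x = (a \<odot>\<^bsub>DM\<^esub> (b \<odot>\<^bsub>DM\<^esub> f)) n x"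
     unfolding sm[OF a DM_smult_closed[OF b f] n x] .
   qed (use a b f DM_smult_closed in auto) }
  { assume g: "g : carrier DM"
   have gc: "g n (\<rho> (inv\<^bsub>Q n\<^esub> C) x) : carrier R" if "n >= 1" "C : carrier (Q n)" "x : D n" for n C x
    using val[OF g that(1) \<rho>_inv_D[OF that]] .
   show "a \<odot>\<^bsub>DM\<^esub> (f \<oplus>\<^bsub>DM\<^esub> g) = a \<odot>\<^bsub>DM\<^esub> f \<oplus>\<^bsub>DM\<^esub> a \<odot>\<^bsub>DM\<^esub> g"
   proof (rule DM_eqI)
    fix n :: nat and x assume n: "n >= 1" and x: "x : D n"
    have "(a \<odot>\<^bsub>DM\<^esub> (f \<oplus>\<^bsub>DM\<^esub> g)) n x = (\<Oplus>C\<in>carrier (Q n).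
      a n C ** f n (\<rho> (inv\<^bsub>Q n\<^esub> C) x) \<oplus> a n C ** g n (\<rho> (inv\<^bsub>Q n\<^esub> C) x))"
     unfolding sm[OF a DM_add_closed[OF f g] n x] using c[OF n _ x] gc[OF n _ x] \<rho>_inv_D[OF n _ x]
     by (intro finsum_cong') (auto simp: DM_add_eval[OF n] r_distr)
    also have "\<dots> = (a \<odot>\<^bsub>DM\<^esub> f) n x \<oplus> (a \<odot>\<^bsub>DM\<^esub> g) n x"
     unfolding sm[OF a f n x] sm[OF a g n x] using c[OF n _ x] gc[OF n _ x] by (intro finsum_addf) auto
    finally show "(a \<odot>\<^bsub>DM\<^esub> (f \<oplus>\<^bsub>DM\<^esub> g)) n x = (a \<odot>\<^bsub>DM\<^esub> f \<oplus>\<^bsub>DM\<^esub> a \<odot>\<^bsub>DM\<^esub> g) n x"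
     using DM_add_eval[OF n x] by simp
   qed (use a f g DM_smult_closed DM_add_closed in auto) }
 next
  fix f assume f: "f : carrier DM"
  show "\<one>\<^bsub>\<Lambda>\<^esub> \<odot>\<^bsub>DM\<^esub> f = f"
  proof (rule DM_eqI)
   fix n :: nat and x assume n: "n >= 1" and x: "x : D n"
   interpret L: galois_action R A t K "Q n" "Mn n" "D n" \<rho> using level[OF n] .
   interpret g: group_ring RA "Q n" using T.group_ring_Q[OF RA_cring n] .
   have o: "\<one>\<^bsub>\<Lambda>\<^esub> n = \<one>\<^bsub>g.S\<^esub>" using n by (simp add: iwasawa_algebra_def inverse_limit_ring_def)
   have "f n (\<rho> (inv\<^bsub>Q n\<^esub> \<one>\<^bsub>Q n\<^esub>) x) : carrier R" using val[OF f n \<rho>_inv_D[OF n L.G.one_closed x]] .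
   then have "(\<one>\<^bsub>\<Lambda>\<^esub> \<odot>\<^bsub>DM\<^esub> f) n x = \<one>\<^bsub>g.S\<^esub> \<one>\<^bsub>Q n\<^esub> ** f n (\<rho> (inv\<^bsub>Q n\<^esub> \<one>\<^bsub>Q n\<^esub>) x)"
    unfolding sm[OF \<Lambda>.one_closed f n x] o using L.finite_G L.G.one_closed val[OF f n \<rho>_inv_D[OF n _ x]]
    by (intro finsum_single) (auto simp: g.S_one simp del: one_FactGroup L.G.inv_one)
   then show "(\<one>\<^bsub>\<Lambda>\<^esub> \<odot>\<^bsub>DM\<^esub> f) n x = f n x"
    using L.\<rho>_id[OF L.B_M[OF x]] L.G.one_closed val[OF f n x] by (simp add: g.S_one L.G.inv_one del: one_FactGroup)
  qed (use f DM_smult_closed \<Lambda>.one_closed in auto)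
 qed
qed

end

section \<open>The residue rings in the limit\<close>

lemma Union_constant: "s : S ==> (!!s. s : S ==> s = k) ==> \<Union>S = k" by blast

lemma direct_limit_ops:
 "c **\<^bsub>direct_limit_ring S \<phi>\<^esub> d = \<Union>{direct_limit_map S \<phi> l (\<phi> m l x **\<^bsub>S l\<^esub> \<phi> n l y) | l m x n y.
  (m, x) : c & (n, y) : d & m <= l & n <= l}"
 "c \<oplus>\<^bsub>direct_limit_ring S \<phi>\<^esub> d = \<Union>{direct_limit_map S \<phi> l (\<phi> m l x \<oplus>\<^bsub>S l\<^esub> \<phi> n l y) | l m x n y.
  (m, x) : c & (n, y) : d & m <= l & n <= l}"
 by (simp_all add: direct_limit_ring_def)

context galois_limit begin

lemma extend_to_family:
 assumes n: "n >= 1" and f: "lin (D n) f"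
 shows "EX F:carrier DM. ALL x:D n. F n x = f x"
proof -
 have "EX h. ALL k. (lin (D (n + k)) (h k) & (k = 0 --> h k = f)) & (ALL x:D (n + k). h (Suc k) x = h k x)"
 proof (rule dependent_nat_choice)
  show "EX h. lin (D (n + 0)) h & (0 = (0::nat) --> h = f)" using f by (intro exI[of _ f]) simp
  fix h and k :: nat assume h: "lin (D (n + k)) h & (k = 0 --> h = f)"
  have "1 <= n + k" "n + k <= n + Suc k" using n by auto
  from galois_tower.extend_lin[OF tower[OF this]] h
  show "EX h'. (lin (D (n + Suc k)) h' & (Suc k = 0 --> h' = f)) & (ALL x:D (n + k). h' x = h x)"
   by (metis nat.distinct(1))
 qed
 then obtain h where h: "!!k. lin (D (n + k)) (h k)" "h 0 = f" "!!k x. x : D (n + k) ==> h (Suc k) x = h k x"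
  by blast
 let ?F = "\<lambda>m\<in>{1..}. \<lambda>x\<in>D m. h (m - n) x"
 show ?thesis
 proof (intro bexI[of _ ?F] ballI)
  show "?F n x = f x" if "x : D n" for x using n that h(2) by simp
  show "?F : carrier DM"
  proof (rule DM_I)
   fix m :: nat assume m: "m >= 1"
   show "?F m : extensional (D m)" using m by simp
   show "?F m x = h (m - n) x" if "x : D m" for x using m that by simp
   show "lin (D m) (h (m - n))"
   proof (cases "n <= m")
    case True
    then show ?thesis using h(1)[of "m - n"] by simp
   next
    case False
    then show ?thesis using galois_tower.restrict_lin[OF tower[OF m, of n]] f h(2) by simp
   qed
   show "h (Suc m - n) x = h (m - n) x" if x: "x : D m" for x
   proof (cases "n <= m")
    case True
    then show ?thesis using h(3)[of x "m - n"] x by (simp add: Suc_diff_le)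
   qed simp
  qed simp
 qed
qed

abbreviation "good_at n \<equiv> galois_action.good R A t (Q n) (D n) \<rho>"
abbreviation "fixed_at n \<equiv> galois_tower.fixed_mod R t (Q 1) (D 1) (Q n) (D n) \<rho> (\<theta> 1)"

lemma generator_good:
 assumes e: "e : carrier DM" and gen: "!!m. m : carrier DM ==> EX a:carrier \<Lambda>. m = a \<odot>\<^bsub>DM\<^esub> e"
  and m: "1 <= m" "m <= n"
 shows "good_at m (e n)"
proof -
 interpret L: galois_action R A t K "Q m" "Mn m" "D m" \<rho> using level[OF m(1)] .
 show ?thesis
 proof (rule L.generating_good)
  have "1 <= n" using m by simp
  then show "lin (D m) (e n)" using galois_tower.restrict_lin[OF tower[OF m]] DM_lin[OF e] by simp
  fix f assume f: "lin (D m) f"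
  obtain F where F: "F : carrier DM" "!!x. x : D m ==> F m x = f x" using extend_to_family[OF m(1) f] by blast
  obtain a where a: "a : carrier \<Lambda>" "F = a \<odot>\<^bsub>DM\<^esub> e" using gen[OF F(1)] by blast
  have "f x = (\<Oplus>C\<in>carrier (Q m). a m C ** e n (\<rho> (inv\<^bsub>Q m\<^esub> C) x))" if x: "x : D m" for x
  proof -
   have i: "\<rho> (inv\<^bsub>Q m\<^esub> C) x : D m" if "C : carrier (Q m)" for C using \<rho>_inv_D[OF m(1) that x] .
   have "f x = (\<Oplus>C\<in>carrier (Q m). a m C ** e m (\<rho> (inv\<^bsub>Q m\<^esub> C) x))"
    using F(2)[OF x] smult_eval[of m a e x, OF m(1) \<Lambda>_closed[OF a(1) m(1)] DM_lin[OF e m(1)] x] a(2) by simp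
   also have "\<dots> = (\<Oplus>C\<in>carrier (Q m). a m C ** e n (\<rho> (inv\<^bsub>Q m\<^esub> C) x))"
   proof (intro finsum_cong' refl)
    fix C assume C: "C : carrier (Q m)"
    show "a m C ** e m (\<rho> (inv\<^bsub>Q m\<^esub> C) x) = a m C ** e n (\<rho> (inv\<^bsub>Q m\<^esub> C) x)"
     by (simp only: DM_compat[OF e m i[OF C]])
   next
    have "e n (\<rho> (inv\<^bsub>Q m\<^esub> C) x) : A" if "C : carrier (Q m)" for C
     using linD(1)[OF DM_lin[OF e m(1)] amod_D[OF m(1)] i[OF that]] DM_compat[OF e m i[OF that]] by simp
    then show "(%C. a m C ** e n (\<rho> (inv\<^bsub>Q m\<^esub> C) x)) : carrier (Q m) \<rightarrow> carrier R"
     using \<Lambda>_A[OF a(1) m(1)] by simp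
   qed
   finally show ?thesis .
  qed
  then show "EX a:carrier (Q m) \<rightarrow> A. ALL x:D m. f x = (\<Oplus>C\<in>carrier (Q m). a C ** e n (\<rho> (inv\<^bsub>Q m\<^esub> C) x))"
   using \<Lambda>_closed[OF a(1) m(1)] by (intro bexI[of _ "a m"]) (auto simp: PiE_iff)
 qed
qed

lemma good_family_basis:
 assumes F: "F : carrier DM" and good: "!!n. n >= 1 ==> good_at n (F n)" and m: "m : carrier DM"
 shows "\<exists>!a. a : carrier \<Lambda> & m = a \<odot>\<^bsub>DM\<^esub> F"
proof -
 define P where "P n c \<longleftrightarrow> c : carrier (Q n) \<rightarrow>\<^sub>E A &
  (ALL x:D n. m n x = (\<Oplus>C\<in>carrier (Q n). c C ** F n (\<rho> (inv\<^bsub>Q n\<^esub> C) x)))" for n c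
 have ex1: "\<exists>!c. P n c" if "n >= 1" for n
  unfolding P_def using galois_action.good_generates[OF level[OF that] good[OF that] DM_lin[OF m that]] .
 define a where "a = (\<lambda>n\<in>{1..}. THE c. P n c)"
 have a: "P n (a n)" if "n >= 1" for n using theI'[OF ex1[OF that]] that by (simp add: a_def)
 have tr: "iwasawa_trans RA \<Gamma> N n (a (Suc n)) = a n" if n: "n >= 1" for n
 proof -
  have aS: "a (Suc n) : carrier (Q (Suc n)) \<rightarrow>\<^sub>E A" using a[of "Suc n"] by (simp add: P_def)
  have "P n (iwasawa_trans RA \<Gamma> N n (a (Suc n)))"
   unfolding P_def
  proof (intro conjI ballI)
   show "iwasawa_trans RA \<Gamma> N n (a (Suc n)) : carrier (Q n) \<rightarrow>\<^sub>E A"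
    using ring_hom_closed[OF T.trans_hom[OF RA_cring n], of "a (Suc n)"] aS by (simp add: finite_group_ring_def)
   fix x assume x: "x : D n"
   then have xS: "x : D (Suc n)" using D_le[of n "Suc n"] n by auto
   have "m n x = m (Suc n) x" using m n x by (simp add: DM_carrier)
   also have "\<dots> = (\<Oplus>C\<in>carrier (Q (Suc n)). a (Suc n) C ** F (Suc n) (\<rho> (inv\<^bsub>Q (Suc n)\<^esub> C) x))"
    using a[of "Suc n"] xS by (simp add: P_def)
   also have "\<dots> = (\<Oplus>C\<in>carrier (Q n). iwasawa_trans RA \<Gamma> N n (a (Suc n)) C ** F n (\<rho> (inv\<^bsub>Q n\<^esub> C) x))"
    using F n by (intro level_sum[OF n aS DM_lin[OF F n] _ x]) (simp add: DM_carrier)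
   finally show "m n x = \<dots>" .
  qed
  then show ?thesis using ex1[OF n] a[OF n] by blast
 qed
 have a\<Lambda>: "a : carrier \<Lambda>" unfolding \<Lambda>_iff
 proof (intro conjI allI impI)
  show "a : extensional {1..}" by (simp add: a_def)
  show "a n : carrier (Q n) \<rightarrow>\<^sub>E A" if "1 <= n" for n using a[OF that] by (simp only: P_def)
 qed (rule tr)
 show ?thesis
 proof (intro ex1I[of _ a] conjI a\<Lambda>)
  show "m = a \<odot>\<^bsub>DM\<^esub> F"
  proof (rule DM_eqI[OF m DM_smult_closed[OF a\<Lambda> F]])
   fix n :: nat and x assume n: "n >= 1" and x: "x : D n"
   show "m n x = (a \<odot>\<^bsub>DM\<^esub> F) n x"
    using smult_eval[of n a F x, OF n \<Lambda>_closed[OF a\<Lambda> n] DM_lin[OF F n] x] a[OF n] x by (simp add: P_def)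
  qed
  fix b assume b: "b : carrier \<Lambda> & m = b \<odot>\<^bsub>DM\<^esub> F"
  have "P n (b n)" if n: "n >= 1" for n
   unfolding P_def using smult_eval[of n b F, OF n \<Lambda>_closed[OF conjunct1[OF b] n] DM_lin[OF F n]]
    \<Lambda>_closed[OF conjunct1[OF b] n] conjunct2[OF b] by simp
  then have "b n = a n" if "n >= 1" for n using ex1[OF that] a[OF that] that by blast
  then show "b = a" using b a\<Lambda> by (intro extensionalityI[of _ "{1..}"]) (auto simp: \<Lambda>_iff)
 qed
qed

lemma free_iff_fixed: "free_module_of_rank \<Lambda> DM 1 \<longleftrightarrow> (\<forall>n\<ge>1. fixed_at n)"
 unfolding free_module_of_rank_1[OF DM_module]
proof (intro iffI allI impI)
 assume "EX e:carrier DM. ALL m:carrier DM. \<exists>!a. a : carrier \<Lambda> & m = a \<odot>\<^bsub>DM\<^esub> e"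
 then obtain e where e0: "e : carrier DM" "ALL m:carrier DM. \<exists>!a. a : carrier \<Lambda> & m = a \<odot>\<^bsub>DM\<^esub> e" by (rule bexE)
 have e: "e : carrier DM" "EX a:carrier \<Lambda>. m = a \<odot>\<^bsub>DM\<^esub> e" if "m : carrier DM" for m
  using e0(1) ex1_implies_ex[OF bspec[OF e0(2) that]] by blast+
 note e = e0(1) e(2)
 fix n :: nat assume n: "1 <= n"
 show "fixed_at n"
  by (rule galois_tower.good_fixed_mod[OF tower[OF le_refl n] generator_good[OF e n le_refl] generator_good[OF e le_refl n]])
next
 assume fixed: "\<forall>n\<ge>1. fixed_at n"
 have one: "(1::nat) <= 1" by simp
 interpret L: galois_action R A t K "Q 1" "Mn 1" "D 1" \<rho> using level[OF one] .
 obtain e where e: "good_at 1 e" using L.good_exists[OF prime_p p_tA p_coprime] by blast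
 obtain F where F: "F : carrier DM" "!!x. x : D 1 ==> F 1 x = e x"
  using extend_to_family[OF one] e unfolding L.good_def by blast
 have "good_at n (F n)" if n: "n >= 1" for n
 proof (rule galois_tower.good_lift[OF tower[OF one n] prime_p p_tA p_kernel[OF n] DM_lin[OF F(1) n]])
  have eq: "F n x = e x" if "x : D 1" for x using DM_compat[OF F(1) one n that] F(2)[OF that] by simp
  show "good_at 1 (F n)" unfolding L.good_def
  proof (intro conjI ballI impI)
   show "lin (D 1) (F n)" using lin_cong[OF L.amod_B _ eq] e by (simp add: L.good_def)
   fix x assume x: "x : D 1" and "ALL C:carrier (Q 1). F n (\<rho> (inv\<^bsub>Q 1\<^esub> C) x) : scale R t 1 A"
   then have "ALL C:carrier (Q 1). e (\<rho> (inv\<^bsub>Q 1\<^esub> C) x) : scale R t 1 A" using eq \<rho>_inv_D[OF one _ x] by simp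
   then show "x : scale R t 1 (D 1)" using e x by (simp add: L.good_def)
  qed
  show "fixed_at n" using fixed n by blast
 qed
 then show "EX e:carrier DM. ALL m:carrier DM. \<exists>!a. a : carrier \<Lambda> & m = a \<odot>\<^bsub>DM\<^esub> e"
  using good_family_basis[OF F(1)] F(1) by blast
qed

definition cl :: "nat => 'a => 'a set" where "cl n x = {y : D n. y \<ominus> x : scale R t 1 (D n)}"
definition lim_ideal :: "'a set" where "lim_ideal = (\<Union>n\<in>{1..}. scale R t 1 (D n))"
definition kl :: "'a => (nat \<times> 'a set) set" where
 "kl x = {(m, cl m y) | m y. m >= 1 & y : D m & y \<ominus> x : lim_ideal}"

lemma D_carrier: "n >= 1 ==> x : D n ==> x : carrier R" using amodD(1)[OF amod_D] .

lemma D_subring: "n >= 1 ==> subring (D n) R"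
proof -
 assume n: "n >= 1"
 interpret L: galois_action R A t K "Q n" "Mn n" "D n" \<rho> using level[OF n] .
 show ?thesis by (rule L.subring_B)
qed

lemma D_cring: "n >= 1 ==> cring (R\<lparr>carrier := D n\<rparr>)"
 using subring_is_domain[OF D_subring] by (simp add: domain_def)

lemma D_mult: "n >= 1 ==> x : D n ==> y : D n ==> x ** y : D n"
 using subringE(6)[OF D_subring] by blast

lemma D_const: "n >= 1 ==> \<one> : D n" "n >= 1 ==> t : D n"
 using subringE(3)[OF D_subring] amodD(4)[OF amod_D, of n t \<one>] t_A t_carrier by force+

abbreviation "I n \<equiv> scale R t 1 (D n)"

lemma amod_I: "n >= 1 ==> amod (I n)" by (rule amod_scale[OF amod_D])

lemma I_mult: assumes n: "n >= 1" and d: "d : D n" and x: "x : I n" shows "d ** x : I n"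
proof -
 obtain z where z: "z : D n" "x = t ** z" using x by (rule scale1E)
 have "d ** x = t ** (d ** z)" unfolding z(2) using D_carrier[OF n] d z(1) by (simp add: m_lcomm)
 then show ?thesis using scale1I[OF D_mult[OF n d z(1)]] by simp
qed

lemma I_D: "n >= 1 ==> x : I n ==> x : D n" using scale_subset[OF amod_D] by blast

lemma I_le: "1 <= m ==> m <= n ==> I m <= I n" using D_le by (intro scale_mono)

lemma I_descend: "1 <= m ==> m <= n ==> x : D m ==> x : I n ==> x : I m"
proof -
 assume m: "1 <= m" "m <= n" and x: "x : D m" "x : I n"
 interpret L: galois_action R A t K "Q m" "Mn m" "D m" \<rho> using level[OF m(1)] .
 show ?thesis by (rule galois_tower.tp_eq[OF tower[OF m] L.B_M[OF x(1)] x(2)])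
qed

lemma lim_ideal_D: assumes "n >= 1" "x : D n" shows "x : lim_ideal \<longleftrightarrow> x : I n"
proof
 assume "x : lim_ideal"
 then obtain m where m: "m >= 1" "x : I m" by (auto simp: lim_ideal_def)
 have "x : I (max m n)" using I_le[of m "max m n"] m by auto
 then show "x : I n" using I_descend[of n "max m n"] assms by simp
qed (use assms in \<open>auto simp: lim_ideal_def\<close>)

lemma diff_self [simp]: "x : carrier R ==> x \<ominus> x = \<zero>" by (simp add: minus_eq r_neg)

lemma diff_trans: assumes "x : carrier R" "y : carrier R" "z : carrier R" shows "(x \<ominus> y) \<oplus> (y \<ominus> z) = x \<ominus> z"
 using assms by algebra

lemma diff_neg: assumes "x : carrier R" "y : carrier R" shows "\<ominus> (x \<ominus> y) = y \<ominus> x"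
 using assms by algebra

lemma cl_eq: assumes n: "n >= 1" and x: "x : D n" and y: "y : D n" shows "cl n x = cl n y \<longleftrightarrow> x \<ominus> y : I n"
proof
 note c = D_carrier[OF n] and am = amodD[OF amod_I[OF n]]
 { assume "cl n x = cl n y"
  moreover have "x : cl n x" using x am(2) c[OF x] by (simp add: cl_def)
  ultimately show "x \<ominus> y : I n" by (simp add: cl_def) }
 assume xy: "x \<ominus> y : I n"
 have "z \<ominus> x : I n \<longleftrightarrow> z \<ominus> y : I n" if z: "z : D n" for z
  using am(3)[OF _ xy, of "z \<ominus> x"] am(3)[OF _ am(5)[OF xy], of "z \<ominus> y"]
   diff_trans[OF c[OF z] c[OF x] c[OF y]] diff_trans[OF c[OF z] c[OF y] c[OF x]] diff_neg[OF c[OF x] c[OF y]] by auto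
 then show "cl n x = cl n y" by (auto simp: cl_def)
qed

lemma red_ideal_eq: "n >= 1 ==> red_ideal R t D n = I n"
 using D_carrier by (auto simp: red_ideal_def cgenideal_def scale_def m_comm image_iff)

lemma coset_cl: assumes n: "n >= 1" and x: "x : D n" shows "red_ideal R t D n +>\<^bsub>R\<lparr>carrier := D n\<rparr>\<^esub> x = cl n x"
proof -
 note c = D_carrier[OF n] and am = amodD[OF amod_D[OF n]]
 have "y : cl n x \<longleftrightarrow> (EX i:I n. y = i \<oplus> x)" for y
 proof
  assume y: "y : cl n x"
  then have "y = (y \<ominus> x) \<oplus> x" using c x unfolding cl_def by (auto simp: minus_eq a_assoc l_neg)
  then show "EX i:I n. y = i \<oplus> x" using y by (auto simp: cl_def)
 next
  assume "EX i:I n. y = i \<oplus> x"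
  then obtain i where i: "i : I n" "y = i \<oplus> x" by blast
  have "y \<ominus> x = i" unfolding i(2) using c[OF I_D[OF n i(1)]] c[OF x] by (simp add: minus_eq a_assoc r_neg)
  then show "y : cl n x" using i am(3)[OF I_D[OF n i(1)] x] by (simp add: cl_def)
 qed
 then show ?thesis unfolding red_ideal_eq[OF n] by (auto simp: a_r_coset_def r_coset_def)
qed

lemma red_ideal: "n >= 1 ==> ideal (red_ideal R t D n) (R\<lparr>carrier := D n\<rparr>)"
 unfolding red_ideal_def by (rule cring.cgenideal_ideal[OF D_cring]) (use D_const in auto)

lemma red_carrier: "n >= 1 ==> carrier (red_ring R t D n) = cl n ` D n"
 by (auto simp: red_ring_def FactRing_def A_RCOSETS_def' coset_cl)

lemma red_ops:
 assumes n: "n >= 1" and x: "x : D n" and y: "y : D n"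
 shows "cl n x **\<^bsub>red_ring R t D n\<^esub> cl n y = cl n (x ** y)" "cl n x \<oplus>\<^bsub>red_ring R t D n\<^esub> cl n y = cl n (x \<oplus> y)"
proof -
 interpret J: ideal "red_ideal R t D n" "R\<lparr>carrier := D n\<rparr>" by (rule red_ideal[OF n])
 have xy: "x \<oplus> y : D n" using amodD(3)[OF amod_D[OF n]] x y by blast
 show "cl n x **\<^bsub>red_ring R t D n\<^esub> cl n y = cl n (x ** y)"
  using J.rcoset_mult_add[of x y] x y D_mult[OF n x y] by (simp add: red_ring_def FactRing_def coset_cl[OF n])
 show "cl n x \<oplus>\<^bsub>red_ring R t D n\<^esub> cl n y = cl n (x \<oplus> y)"
  using J.a_rcos_sum[of x y] x y xy by (simp add: red_ring_def FactRing_def coset_cl[OF n])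
qed

lemma red_trans_cl: assumes m: "1 <= m" "m <= n" and x: "x : D m" shows "red_trans R t D m n (cl m x) = cl n x"
proof -
 have n: "1 <= n" using m by simp
 have le: "D m <= D n" "I m <= I n" using D_le[OF m] I_le[OF m] by auto
 have "red_ideal R t D n +>\<^bsub>R\<lparr>carrier := D n\<rparr>\<^esub> y = cl n x" if y: "y : cl m x" for y
 proof -
  have "y : D n" "x : D n" "y \<ominus> x : I n" using y x le by (auto simp: cl_def)
  then show ?thesis using coset_cl[OF n] cl_eq[OF n] by simp
 qed
 moreover have "x : cl m x" using x amodD(2)[OF amod_I[OF m(1)]] D_carrier[OF m(1) x] by (simp add: cl_def)
 ultimately show ?thesis unfolding red_trans_def by blast
qed

abbreviation "map_at n \<equiv> direct_limit_map (red_ring R t D) (red_trans R t D) n"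

lemma diff_common: assumes "1 <= m" "x : D m" "1 <= n" "y : D n" "m <= k" "n <= k"
 shows "cl k x = cl k y \<longleftrightarrow> x \<ominus> y : lim_ideal"
proof -
 have k: "1 <= k" and xy: "x : D k" "y : D k" using assms D_le[of m k] D_le[of n k] by auto
 then have "x \<ominus> y : D k" using amodD(6)[OF amod_D[OF k]] by blast
 then show ?thesis using cl_eq[OF k xy] lim_ideal_D[OF k] by simp
qed

lemma map_at_cl: assumes n: "n >= 1" and x: "x : D n" shows "map_at n (cl n x) = kl x"
proof (intro equalityI subsetI)
 fix w assume "w : map_at n (cl n x)"
 then obtain m y l where w: "w = (m, cl m y)" "m >= 1" "y : D m" "n <= l" "m <= l"
   "red_trans R t D n l (cl n x) = red_trans R t D m l (cl m y)"
  unfolding direct_limit_map_def direct_limit_rel_def using red_carrier by auto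
 have "cl l x = cl l y" using w n x by (simp add: red_trans_cl)
 then have "y \<ominus> x : lim_ideal" using diff_common[OF w(2,3) n x w(5,4)] by simp
 then show "w : kl x" using w by (auto simp: kl_def)
next
 fix w assume "w : kl x"
 then obtain m y where w: "w = (m, cl m y)" "m >= 1" "y : D m" "y \<ominus> x : lim_ideal" by (auto simp: kl_def)
 let ?l = "max m n"
 have "cl ?l y = cl ?l x" using diff_common[OF w(2,3) n x, of ?l] w(4) by simp
 then have "red_trans R t D n ?l (cl n x) = red_trans R t D m ?l (cl m y)" using w n x by (simp add: red_trans_cl)
 moreover have "cl m y : carrier (red_ring R t D m)" "cl n x : carrier (red_ring R t D n)" using red_carrier w n x by auto
 ultimately show "w : map_at n (cl n x)"
  unfolding direct_limit_map_def direct_limit_rel_def w(1) using w(2) n by (auto intro!: exI[of _ ?l])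
qed

lemma kl_eq: assumes "1 <= m" "x : D m" "1 <= n" "y : D n" shows "kl x = kl y \<longleftrightarrow> x \<ominus> y : lim_ideal"
proof -
 let ?k = "max m n"
 have k: "1 <= ?k" "x : D ?k" "y : D ?k" using assms D_le[of m ?k] D_le[of n ?k] by auto
 have eq: "cl ?k x = cl ?k y \<longleftrightarrow> x \<ominus> y : lim_ideal" using diff_common[OF assms, of ?k] by simp
 have "(?k, cl ?k x) : kl x" using k amodD(2)[OF amod_I[OF k(1)]] lim_ideal_D[OF k(1) amodD(2)[OF amod_D[OF k(1)]]]
  D_carrier[OF k(1)] by (auto simp: kl_def intro!: exI[of _ x])
 moreover have "cl ?k x = cl ?k y" if kk: "(?k, cl ?k x) : kl y"
 proof -
  obtain z where z: "z : D ?k" "z \<ominus> y : lim_ideal" "cl ?k x = cl ?k z" using kk by (auto simp: kl_def)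
  then show ?thesis using diff_common[OF k(1) z(1) k(1) k(3) le_refl le_refl] by simp
 qed
 moreover have "kl x = kl y" if "cl ?k x = cl ?k y"
  using map_at_cl[OF k(1,2)] map_at_cl[OF k(1,3)] that by simp
 ultimately show ?thesis using eq by auto
qed

lemma limit_carrier: "carrier (red_limit R t D) = {kl x | n x. n >= 1 & x : D n}"
proof -
 have "carrier (red_limit R t D) = {map_at n (cl n x) | n x. n >= 1 & x : D n}"
  by (auto simp: red_limit_def direct_limit_ring_def direct_limit_map_def quotient_def red_carrier) blast+
 also have "\<dots> = {kl x | n x. n >= 1 & x : D n}"
  using map_at_cl by (intro Collect_cong iff_exI) auto
 finally show ?thesis .
qed

lemma kl_elem: assumes n: "n >= 1" and x: "x : D n" shows "(n, cl n x) : kl x"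
 using assms amodD(2)[OF amod_D[OF n]] amodD(2)[OF amod_I[OF n]] lim_ideal_D[OF n] D_carrier[OF n x]
 by (auto simp: kl_def intro!: exI[of _ x])

lemma lim_ideal_diff_ops:
 assumes k: "k >= 1" and x: "x : D k" "x' : D k" "x' \<ominus> x : lim_ideal" and y: "y : D k" "y' : D k" "y' \<ominus> y : lim_ideal"
 shows "kl (x' ** y') = kl (x ** y)" "kl (x' \<oplus> y') = kl (x \<oplus> y)"
proof -
 note c = D_carrier[OF k] and am = amodD[OF amod_D[OF k]] and ai = amodD[OF amod_I[OF k]]
 have i: "x' \<ominus> x : I k" "y' \<ominus> y : I k" using lim_ideal_D[OF k am(6)] x y by blast+
 note cc = c[OF x(1)] c[OF x(2)] c[OF y(1)] c[OF y(2)]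
 have "x' ** y' \<ominus> x ** y = x' ** (y' \<ominus> y) \<oplus> y ** (x' \<ominus> x)" using cc by algebra
 then have m: "x' ** y' \<ominus> x ** y : I k" using ai(3)[OF I_mult[OF k x(2) i(2)] I_mult[OF k y(1) i(1)]] by simp
 have "(x' \<oplus> y') \<ominus> (x \<oplus> y) = (x' \<ominus> x) \<oplus> (y' \<ominus> y)" using cc by algebra
 then have a: "(x' \<oplus> y') \<ominus> (x \<oplus> y) : I k" using ai(3)[OF i] by simp
 have D: "x' ** y' : D k" "x ** y : D k" "x' \<oplus> y' : D k" "x \<oplus> y : D k" using x y D_mult[OF k] am(3) by auto
 show "kl (x' ** y') = kl (x ** y)" "kl (x' \<oplus> y') = kl (x \<oplus> y)"
  using kl_eq[OF k D(1) k D(2)] kl_eq[OF k D(3) k D(4)] lim_ideal_D[OF k I_D[OF k]] m a by auto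
qed

lemma kl_op:
 assumes op: "!!n x y. n >= 1 ==> x : D n ==> y : D n ==> op n (cl n x) (cl n y) = cl n (f x y)"
  and fD: "!!n x y. n >= 1 ==> x : D n ==> y : D n ==> f x y : D n"
  and fk: "!!k x x' y y'. k >= 1 ==> x : D k ==> x' : D k ==> x' \<ominus> x : lim_ideal ==>
    y : D k ==> y' : D k ==> y' \<ominus> y : lim_ideal ==> kl (f x' y') = kl (f x y)"
  and n: "n >= 1" and x: "x : D n" and y: "y : D n"
 shows "\<Union>{map_at l (op l (red_trans R t D m l Z) (red_trans R t D k l W)) | l m Z k W.
  (m, Z) : kl x & (k, W) : kl y & m <= l & k <= l} = kl (f x y)" (is "\<Union>?S = _")
proof -
 have "s = kl (f x y)" if sS: "s : ?S" for s
 proof -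
  obtain l m Z k W where s: "s = map_at l (op l (red_trans R t D m l Z) (red_trans R t D k l W))"
   "(m, Z) : kl x" "(k, W) : kl y" "m <= l" "k <= l"
   using sS unfolding mem_Collect_eq by (elim exE conjE) (rule that)
  obtain x' where x': "m >= 1" "Z = cl m x'" "x' : D m" "x' \<ominus> x : lim_ideal" using s(2) by (auto simp: kl_def)
  obtain y' where y': "k >= 1" "W = cl k y'" "y' : D k" "y' \<ominus> y : lim_ideal" using s(3) by (auto simp: kl_def)
  have l: "1 <= l" "x' : D l" "y' : D l" using x' y' s D_le[of m l] D_le[of k l] by auto
  have "s = kl (f x' y')" unfolding s(1) x'(2) y'(2)
   using red_trans_cl[OF x'(1) s(4) x'(3)] red_trans_cl[OF y'(1) s(5) y'(3)] op[OF l] map_at_cl[OF l(1) fD[OF l]] by simp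
  moreover have "kl (f x' y') = kl (f x y)"
   by (rule fk[of "max l n"]) (use l n x y x' y' D_le[of l "max l n"] D_le[of n "max l n"] in auto)
  ultimately show ?thesis by simp
 qed
 moreover have "map_at n (op n (red_trans R t D n n (cl n x)) (red_trans R t D n n (cl n y))) : ?S"
  unfolding mem_Collect_eq
  by (rule exI[of _ n], rule exI[of _ n], rule exI[of _ "cl n x"], rule exI[of _ n], rule exI[of _ "cl n y"])
   (intro conjI refl kl_elem[OF n x] kl_elem[OF n y] le_refl)
 ultimately show ?thesis by (rule Union_constant[rotated])
qed

lemma limit_ops:
 assumes n: "n >= 1" and x: "x : D n" and y: "y : D n"
 shows "kl x **\<^bsub>red_limit R t D\<^esub> kl y = kl (x ** y)" "kl x \<oplus>\<^bsub>red_limit R t D\<^esub> kl y = kl (x \<oplus> y)"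
proof -
 show "kl x **\<^bsub>red_limit R t D\<^esub> kl y = kl (x ** y)"
  unfolding red_limit_def direct_limit_ops
  by (rule kl_op[where op = "%l. (\<otimes>\<^bsub>red_ring R t D l\<^esub>)" and f = "(\<otimes>)", OF red_ops(1) D_mult lim_ideal_diff_ops(1) n x y])
 show "kl x \<oplus>\<^bsub>red_limit R t D\<^esub> kl y = kl (x \<oplus> y)"
  unfolding red_limit_def direct_limit_ops
  by (rule kl_op[where op = "%l. (\<oplus>\<^bsub>red_ring R t D l\<^esub>)" and f = "(\<oplus>)", OF red_ops(2) amodD(3)[OF amod_D] lim_ideal_diff_ops(2) n x y])
qed

lemma cl_image:
 assumes n: "n >= 1" and C: "C : carrier (Q n)" "\<tau> : C" and x: "x : D n"
 shows "\<tau> ` cl n x = cl n (\<tau> x)"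
proof -
 interpret L: galois_action R A t K "Q n" "Mn n" "D n" \<rho> using level[OF n] .
 have s: "\<tau> y = \<rho> C y" if "y : D n" for y using coset_act[OF n C L.B_M[OF that]] by simp
 have tp: "\<rho> E y : I n" if "E : carrier (Q n)" "y : I n" for E y using L.\<rho>_tp[OF that] .
 have diff: "\<rho> E y \<ominus> \<rho> E z = \<rho> E (y \<ominus> z)" if "E : carrier (Q n)" "y : D n" "z : D n" for E y z
  using L.\<rho>_minus[OF that(1) L.B_M[OF that(2)] L.B_M[OF that(3)]] by simp
 have "w : \<rho> C ` cl n x \<longleftrightarrow> w : cl n (\<rho> C x)" for w
 proof
  assume "w : \<rho> C ` cl n x"
  then obtain y where "w = \<rho> C y" "y : D n" "y \<ominus> x : I n" by (auto simp: cl_def)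
  then show "w : cl n (\<rho> C x)" using tp[OF C(1)] diff[OF C(1) _ x] \<rho>_D[OF n C(1)] by (simp add: cl_def)
 next
  assume w: "w : cl n (\<rho> C x)"
  then have wD: "w : D n" by (simp add: cl_def)
  have ic: "inv\<^bsub>Q n\<^esub> C : carrier (Q n)" using C(1) by (rule L.G.inv_closed)
  have e: "\<rho> (inv\<^bsub>Q n\<^esub> C) (\<rho> C x) = x" "\<rho> C (\<rho> (inv\<^bsub>Q n\<^esub> C) w) = w"
   using L.\<rho>_inv'[OF C(1) L.B_M[OF x]] L.\<rho>_inv[OF C(1) L.B_M[OF wD]] by auto
  have "\<rho> (inv\<^bsub>Q n\<^esub> C) w \<ominus> x : I n"
   using tp[OF ic, of "w \<ominus> \<rho> C x"] diff[OF ic wD \<rho>_D[OF n C(1) x]] w e(1) by (simp add: cl_def)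
  then have "\<rho> (inv\<^bsub>Q n\<^esub> C) w : cl n x" using \<rho>_D[OF n ic wD] by (simp add: cl_def)
  then show "w : \<rho> C ` cl n x" using e(2) by force
 qed
 moreover have "\<tau> ` cl n x = \<rho> C ` cl n x" using s by (intro image_cong refl) (simp add: cl_def)
 ultimately show ?thesis using s[OF x] by auto
qed

lemma D_act: assumes n: "n >= 1" and \<tau>: "\<tau> : carrier \<Gamma>" and x: "x : D n"
 shows "\<tau> x = \<rho> (N n #>\<^bsub>\<Gamma>\<^esub> \<tau>) x" "\<tau> x : D n" "\<tau> ` cl n x = cl n (\<tau> x)"
proof -
 interpret L: galois_action R A t K "Q n" "Mn n" "D n" \<rho> using level[OF n] .
 have C: "N n #>\<^bsub>\<Gamma>\<^esub> \<tau> : carrier (Q n)" "\<tau> : N n #>\<^bsub>\<Gamma>\<^esub> \<tau>" using \<tau> T.rcos_self[OF \<tau> T.N_sub[OF n]] by (auto simp: T.Q_elem)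
 show eq: "\<tau> x = \<rho> (N n #>\<^bsub>\<Gamma>\<^esub> \<tau>) x" using coset_act[OF n C L.B_M[OF x]] by simp
 show "\<tau> x : D n" unfolding eq by (rule \<rho>_D[OF n C(1) x])
 show "\<tau> ` cl n x = cl n (\<tau> x)" by (rule cl_image[OF n C x])
qed

lemma limit_act_eq: assumes n: "n >= 1" and \<tau>: "\<tau> : carrier \<Gamma>" and x: "x : D n"
 shows "red_limit_act \<tau> (kl x) = kl (\<tau> x)"
proof -
 have sub: "red_limit_act s (kl z) <= kl (s z)" if n: "n >= 1" and s: "s : carrier \<Gamma>" and z: "z : D n" for n s z
 proof
  fix w assume "w : red_limit_act s (kl z)"
  then obtain m y where w: "w = (m, s ` cl m y)" "m >= 1" "y : D m" "y \<ominus> z : lim_ideal"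
   by (auto simp: red_limit_act_def kl_def)
  define k where "k = max m n"
  have k: "1 <= k" "y : D k" "z : D k" using w z n D_le[of m k] D_le[of n k] by (auto simp: k_def)
  interpret L: galois_action R A t K "Q k" "Mn k" "D k" \<rho> using level[OF k(1)] .
  have C: "N k #>\<^bsub>\<Gamma>\<^esub> s : carrier (Q k)" using s by (auto simp: T.Q_elem)
  have "s y \<ominus> s z = \<rho> (N k #>\<^bsub>\<Gamma>\<^esub> s) (y \<ominus> z)"
   unfolding D_act(1)[OF k(1) s k(2)] D_act(1)[OF k(1) s k(3)] using L.\<rho>_minus[OF C L.B_M[OF k(2)] L.B_M[OF k(3)]] by simp
  also have "\<dots> : I k" using L.\<rho>_tp[OF C] w(4) lim_ideal_D[OF k(1) amodD(6)[OF amod_D[OF k(1)] k(2,3)]] by blast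
  finally have "s y \<ominus> s z : lim_ideal" using lim_ideal_D[OF k(1) I_D[OF k(1)]] by blast
  then show "w : kl (s z)" using w D_act[OF w(2) s w(3)] by (auto simp: kl_def)
 qed
 have can: "s ((inv\<^bsub>\<Gamma>\<^esub> s) y) = y" if s: "s : carrier \<Gamma>" and m: "m >= 1" and y: "y : D m" for s m y
 proof -
  interpret L: galois_action R A t K "Q m" "Mn m" "D m" \<rho> using level[OF m] .
  have C: "N m #>\<^bsub>\<Gamma>\<^esub> s : carrier (Q m)" using s by (auto simp: T.Q_elem)
  show ?thesis using D_act(1,2)[OF m T.inv_closed[OF s] y] D_act(1)[OF m s] T.Q_inv[OF m s] L.\<rho>_inv[OF C L.B_M[OF y]] by simp
 qed
 let ?i = "inv\<^bsub>\<Gamma>\<^esub> \<tau>"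
 have i: "?i : carrier \<Gamma>" using \<tau> by simp
 have "w : red_limit_act \<tau> (red_limit_act ?i (kl (\<tau> x)))" if "w : kl (\<tau> x)" for w
 proof -
  obtain m y where w: "w = (m, cl m y)" "m >= 1" "y : D m" using \<open>w : kl (\<tau> x)\<close> by (auto simp: kl_def)
  have "\<tau> ` ?i ` cl m y = cl m y"
   using D_act(2,3)[OF w(2) i w(3)] D_act(3)[OF w(2) \<tau>] can[OF \<tau> w(2,3)] by simp
  then have "w = (%(n, Z). (n, \<tau> ` Z)) ((%(n, Z). (n, ?i ` Z)) w)" using w(1) by simp
  then show ?thesis unfolding red_limit_act_def by (rule image_eqI) (rule imageI[OF \<open>w : kl (\<tau> x)\<close>])
 qed
 moreover have "red_limit_act ?i (kl (\<tau> x)) <= kl x"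
  using sub[OF n i D_act(2)[OF n \<tau> x]] can[OF i n x] \<tau> by simp
 ultimately have "kl (\<tau> x) <= red_limit_act \<tau> (kl x)" unfolding red_limit_act_def by blast
 then show ?thesis using sub[OF n \<tau> x] by blast
qed

lemma limit_act: assumes n: "n >= 1" and \<tau>: "\<tau> : carrier \<Gamma>" and x: "x : D n"
 shows "red_limit_act \<tau> (kl x) = kl x \<longleftrightarrow> \<tau> x \<ominus> x : I n"
 unfolding limit_act_eq[OF assms] kl_eq[OF n D_act(2)[OF assms] n x]
 by (rule lim_ideal_D[OF n amodD(6)[OF amod_D[OF n] D_act(2)[OF assms] x]])

lemma fixed_at_iff: assumes n: "n >= 1"
 shows "fixed_at n \<longleftrightarrow> (ALL x:D n. (ALL \<tau>:N 1. \<tau> x \<ominus> x : I n) --> (EX y:D 1. x \<ominus> y : I n))"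
proof -
 interpret tw: galois_tower R A t K "Q 1" "Mn 1" "D 1" \<rho> "Q n" "Mn n" "D n" \<rho> "\<theta> 1" using tower[OF le_refl n] .
 have N1: "subgroup (N 1) \<Gamma>" using T.N_sub by simp
 have "(ALL C:carrier (Q n). \<theta> 1 C = \<one>\<^bsub>Q 1\<^esub> --> \<rho> C x \<ominus> x : I n) \<longleftrightarrow> (ALL \<tau>:N 1. \<tau> x \<ominus> x : I n)" if x: "x : D n" for x
 proof -
  have "\<theta> 1 (N n #>\<^bsub>\<Gamma>\<^esub> \<tau>) = \<one>\<^bsub>Q 1\<^esub> \<longleftrightarrow> \<tau> : N 1" if "\<tau> : carrier \<Gamma>" for \<tau>
   using T.\<theta>_coset[OF le_refl n that] T.coset_join1[OF _ that N1] T.coset_join2[OF that N1]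
   by auto
  then have th: "\<tau> : carrier \<Gamma> ==> (\<theta> 1 (N n #>\<^bsub>\<Gamma>\<^esub> \<tau>) = \<one>\<^bsub>Q 1\<^esub>) = (\<tau> : N 1)" for \<tau> .
  show ?thesis
  proof (intro iffI ballI impI)
   fix \<tau> assume a: "ALL C:carrier (Q n). \<theta> 1 C = \<one>\<^bsub>Q 1\<^esub> --> \<rho> C x \<ominus> x : I n" and t: "\<tau> : N 1"
   have tc: "\<tau> : carrier \<Gamma>" using t subgroup.subset[OF N1] by blast
   have "N n #>\<^bsub>\<Gamma>\<^esub> \<tau> : carrier (Q n)" using tc by (auto simp: T.Q_elem)
   then show "\<tau> x \<ominus> x : I n" unfolding D_act(1)[OF n tc x] using a th[OF tc] t by blast
  next
   fix C assume a: "ALL \<tau>:N 1. \<tau> x \<ominus> x : I n" and C: "C : carrier (Q n)" "\<theta> 1 C = \<one>\<^bsub>Q 1\<^esub>"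
   obtain \<tau> where t: "\<tau> : carrier \<Gamma>" "C = N n #>\<^bsub>\<Gamma>\<^esub> \<tau>" using C(1) by (auto simp: T.Q_elem)
   then have "\<tau> : N 1" using th[OF t(1)] C(2) by blast
   then show "\<rho> C x \<ominus> x : I n" using a unfolding t(2) D_act(1)[OF n t(1) x, symmetric] by blast
  qed
 qed
 then show ?thesis unfolding tw.fixed_mod_def by blast
qed

lemma iso_iff_fixed:
 "red_limit_map R t D 1 : ring_iso (red_ring R t D 1) (red_limit_fixed R t D (N 1)) \<longleftrightarrow> (\<forall>n\<ge>1. fixed_at n)"
proof -
 have one: "(1::nat) <= 1" by simp
 let ?h = "red_limit_map R t D 1"
 have N1: "\<tau> : carrier \<Gamma>" if "\<tau> : N 1" for \<tau> using subgroup.subset[OF T.N_sub[OF one]] that by auto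
 have h: "?h (cl 1 x) = kl x" if "x : D 1" for x using map_at_cl[OF one that] by (simp add: red_limit_map_def)
 have triv: "\<tau> x = x" if "x : D 1" "\<tau> : N 1" for x \<tau>
 proof -
  interpret L: galois_action R A t K "Q 1" "Mn 1" "D 1" \<rho> using level[OF one] .
  have "N 1 #>\<^bsub>\<Gamma>\<^esub> \<tau> = \<one>\<^bsub>Q 1\<^esub>" using T.coset_join2[OF N1[OF that(2)] T.N_sub[OF one] that(2)] by simp
  then show ?thesis using D_act(1)[OF one N1[OF that(2)] that(1)] L.\<rho>_id[OF L.B_M[OF that(1)]] by simp
 qed
 have fixed: "kl x : carrier (red_limit_fixed R t D (N 1)) \<longleftrightarrow> (ALL \<tau>:N 1. \<tau> x \<ominus> x : I n)" if n: "n >= 1" and x: "x : D n" for n x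
  using limit_act[OF n N1 x] n x by (auto simp: red_limit_fixed_def limit_carrier)
 have h1: "?h ` carrier (red_ring R t D 1) = kl ` D 1" using h by (auto simp: red_carrier[OF one] image_image)
 have hom: "?h : ring_hom (red_ring R t D 1) (red_limit_fixed R t D (N 1))"
 proof (rule ring_hom_memI)
  fix z assume "z : carrier (red_ring R t D 1)"
  then obtain x where x: "x : D 1" "z = cl 1 x" by (auto simp: red_carrier[OF one])
  have "ALL \<tau>:N 1. \<tau> x \<ominus> x : I 1"
  proof
   fix \<tau> assume "\<tau> : N 1"
   show "\<tau> x \<ominus> x : I 1" unfolding triv[OF x(1) \<open>\<tau> : N 1\<close>]
    using amodD(2)[OF amod_I[OF one]] D_carrier[OF one x(1)] by simp
  qed
  then show "?h z : carrier (red_limit_fixed R t D (N 1))" using fixed[OF one x(1)] h[OF x(1)] x(2) by simp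
  fix w assume "w : carrier (red_ring R t D 1)"
  then obtain y where y: "y : D 1" "w = cl 1 y" by (auto simp: red_carrier[OF one])
  have xy: "x ** y : D 1" "x \<oplus> y : D 1" using D_mult[OF one x(1) y(1)] amodD(3)[OF amod_D[OF one] x(1) y(1)] by auto
  show "?h (z **\<^bsub>red_ring R t D 1\<^esub> w) = ?h z **\<^bsub>red_limit_fixed R t D (N 1)\<^esub> ?h w"
   using limit_ops(1)[OF one x(1) y(1)] red_ops(1)[OF one x(1) y(1)] x y h[OF xy(1)] h by (simp add: red_limit_fixed_def)
  show "?h (z \<oplus>\<^bsub>red_ring R t D 1\<^esub> w) = ?h z \<oplus>\<^bsub>red_limit_fixed R t D (N 1)\<^esub> ?h w"
   using limit_ops(2)[OF one x(1) y(1)] red_ops(2)[OF one x(1) y(1)] x y h[OF xy(2)] h by (simp add: red_limit_fixed_def)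
 next
  show "?h \<one>\<^bsub>red_ring R t D 1\<^esub> = \<one>\<^bsub>red_limit_fixed R t D (N 1)\<^esub>"
   by (simp add: red_limit_fixed_def red_limit_def direct_limit_ring_def red_limit_map_def)
 qed
 have inj: "inj_on ?h (carrier (red_ring R t D 1))"
 proof (rule inj_onI)
  fix z w assume "z : carrier (red_ring R t D 1)" "w : carrier (red_ring R t D 1)" and e: "?h z = ?h w"
  then obtain x y where xy: "x : D 1" "z = cl 1 x" "y : D 1" "w = cl 1 y" by (auto simp: red_carrier[OF one])
  have "x \<ominus> y : lim_ideal" using e h[OF xy(1)] h[OF xy(3)] kl_eq[OF one xy(1) one xy(3)] xy by simp
  then have "x \<ominus> y : I 1" using lim_ideal_D[OF one amodD(6)[OF amod_D[OF one] xy(1,3)]] by simp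
  then show "z = w" using cl_eq[OF one xy(1,3)] xy by simp
 qed
 have "?h ` carrier (red_ring R t D 1) <= carrier (red_limit_fixed R t D (N 1))" using ring_hom_closed[OF hom] by blast
 then have "?h : ring_iso (red_ring R t D 1) (red_limit_fixed R t D (N 1)) \<longleftrightarrow>
   carrier (red_limit_fixed R t D (N 1)) <= kl ` D 1"
  using hom inj h1 by (auto simp: ring_iso_def bij_betw_def)
 also have "\<dots> \<longleftrightarrow> (\<forall>n\<ge>1. ALL x:D n. (ALL \<tau>:N 1. \<tau> x \<ominus> x : I n) --> kl x : kl ` D 1)"
 proof
  assume a: "carrier (red_limit_fixed R t D (N 1)) <= kl ` D 1"
  show "\<forall>n\<ge>1. ALL x:D n. (ALL \<tau>:N 1. \<tau> x \<ominus> x : I n) --> kl x : kl ` D 1" using a fixed by blast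
 next
  assume a: "\<forall>n\<ge>1. ALL x:D n. (ALL \<tau>:N 1. \<tau> x \<ominus> x : I n) --> kl x : kl ` D 1"
  show "carrier (red_limit_fixed R t D (N 1)) <= kl ` D 1"
  proof
   fix c assume c: "c : carrier (red_limit_fixed R t D (N 1))"
   then obtain n x where nx: "n >= 1" "x : D n" "c = kl x" by (auto simp: red_limit_fixed_def limit_carrier)
   then show "c : kl ` D 1" using a fixed[OF nx(1,2)] c by simp
  qed
 qed
 also have "\<dots> \<longleftrightarrow> (\<forall>n\<ge>1. fixed_at n)"
 proof -
  have "kl x : kl ` D 1 \<longleftrightarrow> (EX y:D 1. x \<ominus> y : I n)" if n: "n >= 1" and x: "x : D n" for n x
  proof -
   have "kl x = kl y \<longleftrightarrow> x \<ominus> y : I n" if y: "y : D 1" for y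
   proof -
    have "x \<ominus> y : D n" using amodD(6)[OF amod_D[OF n] x] y D_le[OF one n] by blast
    then show ?thesis using kl_eq[OF n x one y] lim_ideal_D[OF n] by simp
   qed
   then show ?thesis by blast
  qed
  then show ?thesis using fixed_at_iff by auto
 qed
 finally show ?thesis .
qed

theorem free_iff_iso:
 "free_module_of_rank \<Lambda> DM 1 \<longleftrightarrow>
  red_limit_map R t D 1 : ring_iso (red_ring R t D 1) (red_limit_fixed R t D (N 1))"
 unfolding free_iff_fixed iso_iff_fixed ..

end

section \<open>Open subgroups of the Galois group\<close>

lemma (in field) finite_spanning_set:
 assumes K: "subfield K R" and E: "dimension n K E"
 shows "E <= carrier R & \<zero> : E & (\<exists>V\<subseteq>E. finite V & (ALL x:E. EX c:V \<rightarrow> K. x = (\<Oplus>v\<in>V. c v ** v)))"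
 using E K
proof (induction rule: dimension.induct)
 case (zero_dim K)
 show ?case by (intro conjI exI[of _ "{}"]) auto
next
 case (Suc_dim v E n K)
 note Ks = subringE[OF subfieldE(1)[OF Suc_dim.prems]]
 obtain V where E: "E <= carrier R" "\<zero> : E" and V: "V <= E" "finite V"
  "!!x. x : E ==> EX c:V \<rightarrow> K. x = (\<Oplus>v\<in>V. c v ** v)" using Suc_dim.IH[OF Suc_dim.prems] by auto
 have vV: "v \<notin> V" using V(1) Suc_dim.hyps(2) by blast
 have mem: "u : line_extension K v E \<longleftrightarrow> (EX k:K. EX w:E. u = k ** v \<oplus> w)" for u by (rule line_extension_mem_iff)
 have E_le: "E <= line_extension K v E" unfolding subset_iff mem
 proof (intro allI impI)
  fix u assume "u : E"
  then show "EX k:K. EX w:E. u = k ** v \<oplus> w"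
   using E Ks(2) Suc_dim.hyps(1) by (intro bexI[of _ \<zero>] bexI[of _ u]) auto
 qed
 show ?case
 proof (intro conjI exI[of _ "insert v V"] ballI)
  show "line_extension K v E <= carrier R" unfolding subset_iff mem
   using E(1) Ks(1) Suc_dim.hyps(1) by blast
  show "\<zero> : line_extension K v E" using E_le E(2) by blast
  have "v = \<one> ** v \<oplus> \<zero>" using Suc_dim.hyps(1) by simp
  then have "v : line_extension K v E" unfolding mem using E(2) Ks(3) by blast
  then show "insert v V <= line_extension K v E" using E_le V(1) by blast
  show "finite (insert v V)" using V(2) by simp
  fix x assume "x : line_extension K v E"
  then obtain k w where kw: "k : K" "w : E" "x = k ** v \<oplus> w" unfolding mem by blast
  obtain c where c: "c : V \<rightarrow> K" "w = (\<Oplus>v\<in>V. c v ** v)" using V(3)[OF kw(2)] by blast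
  let ?c = "c(v := k)"
  have cl: "?c : V \<rightarrow> K" "?c v = k" "!!u. u : V ==> ?c u = c u" using c(1) vV by (auto simp: Pi_def)
  have "(\<Oplus>u\<in>insert v V. ?c u ** u) = k ** v \<oplus> (\<Oplus>u\<in>V. ?c u ** u)"
   using V(1,2) vV cl E(1) Ks(1) kw(1) Suc_dim.hyps(1) by (subst finsum_insert) (auto simp: Pi_def subset_iff)
  also have "(\<Oplus>u\<in>V. ?c u ** u) = w" unfolding c(2)
   using cl(3) c(1) E(1) Ks(1) V(1) by (intro finsum_cong') (auto simp: Pi_def subset_iff)
  finally have "x = (\<Oplus>u\<in>insert v V. ?c u ** u)" using kw(3) by simp
  then show "EX c:insert v V \<rightarrow> K. x = (\<Oplus>u\<in>insert v V. c u ** u)" using cl kw(1) by (intro bexI[of _ ?c]) auto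
 qed
qed

lemma (in complete_dvr) K_indep_bounded:
 assumes "finite_dimension K M"
 shows "EX N. ALL V. V <= M --> K_indep V --> card V <= N"
proof -
 obtain n where "dimension n K M" using assms by (auto simp: finite_dimension_def)
 from finite_spanning_set[OF subfield_K this] obtain W where M: "M <= carrier R" and W: "W <= M" "finite W"
  "!!x. x : M ==> EX c:W \<rightarrow> K. x = (\<Oplus>w\<in>W. c w ** w)" by auto
 have K: "x : carrier R" if "x : K" for x using subfieldE(3)[OF subfield_K] that by blast
 have "card V <= card W" if V: "V <= M" "K_indep V" for V
 proof (rule ccontr)
  assume "\<not> card V <= card W"
  then have lt: "card W < card V" by simp
  have fV: "finite V" using V(2) by (simp add: K_indep_def)
  have "ALL v:V. EX a. a : W \<rightarrow> K & v = (\<Oplus>w\<in>W. a w ** w)" using W(3) V(1) by blast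
  then obtain a where a: "!!v. v : V ==> a v : W \<rightarrow> K" "!!v. v : V ==> v = (\<Oplus>w\<in>W. a v w ** w)" by metis
  have aK: "a v w : K" if "v : V" "w : W" for v w using a(1)[OF that(1)] that(2) by blast
  obtain c where c: "!!v. v : V ==> c v : K" "EX v:V. c v ~= \<zero>" "!!w. w : W ==> (\<Oplus>v\<in>V. a v w ** c v) = \<zero>"
   using homogeneous_system[OF subfield_K W(2) fV lt, of "%w v. a v w"] aK by blast
  have Wc: "w : carrier R" if "w : W" for w using W(1) M that by blast
  have "comb c V = (\<Oplus>v\<in>V. \<Oplus>w\<in>W. w ** (a v w ** c v))" unfolding comb_def
  proof (intro finsum_cong' refl)
   fix v assume v: "v : V"
   have "c v ** v = c v ** (\<Oplus>w\<in>W. a v w ** w)" using a(2)[OF v] by simp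
   also have "\<dots> = (\<Oplus>w\<in>W. c v ** (a v w ** w))"
    using aK[OF v] c(1)[OF v] Wc K W(2) by (intro finsum_rdistr) auto
   also have "\<dots> = (\<Oplus>w\<in>W. w ** (a v w ** c v))"
    using aK[OF v] c(1)[OF v] Wc K by (intro finsum_cong') (auto simp: m_ac)
   finally show "c v ** v = \<dots>" .
  qed (use aK c(1) Wc K in \<open>auto intro!: finsum_closed\<close>)
  also have "\<dots> = (\<Oplus>w\<in>W. \<Oplus>v\<in>V. w ** (a v w ** c v))"
   using aK c(1) Wc K fV W(2) by (intro finsum_swap) auto
  also have "\<dots> = (\<Oplus>w\<in>W. \<zero>)"
  proof (intro finsum_cong' refl)
   fix w assume w: "w : W"
   have "(\<Oplus>v\<in>V. w ** (a v w ** c v)) = w ** (\<Oplus>v\<in>V. a v w ** c v)"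
    using aK[OF _ w] c(1) Wc[OF w] K fV by (intro finsum_rdistr[symmetric]) auto
   then show "(\<Oplus>v\<in>V. w ** (a v w ** c v)) = \<zero>" using c(3)[OF w] Wc[OF w] by simp
  qed simp
  finally have "comb c V = \<zero>" by simp
  moreover have "c : V \<rightarrow> K" using c(1) by blast
  ultimately have "ALL v:V. c v = \<zero>" using V(2) unfolding K_indep_def by blast
  then show False using c(2) by blast
 qed
 then show ?thesis by blast
qed

lemma (in field) finite_conjugates:
 assumes K: "subfield K R" and x: "integral_over R K x" "x : carrier R"
 shows "finite {y : carrier R. ALL q. polynomial K q --> eval q x = \<zero> --> eval q y = \<zero>}"
proof -
 obtain q where q: "polynomial K q" "q ~= []" "eval q x = \<zero>"
  using x integral_over_iff_poly[OF subfieldE(1)[OF K] x(2) one_not_zero] by blast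
 have "q : carrier (poly_ring R)" using carrier_polynomial[OF subfieldE(1)[OF K] q(1)] by (simp add: univ_poly_carrier)
 then have "{y. is_root q y} = set_mset (roots q)" using roots_mem_iff_is_root[of q] by auto
 then have "finite {y. is_root q y}" by (metis finite_set_mset)
 then show ?thesis by (rule rev_finite_subset) (use q in \<open>auto simp: is_root_def\<close>)
qed

lemma finite_image_factor:
 assumes "finite (f ` A)" "!!a b. a : A ==> b : A ==> f a = f b ==> g a = g b"
 shows "finite (g ` A)"
proof -
 have "g a = g (inv_into A f (f a))" if "a : A" for a
  by (rule assms(2)[OF that inv_into_into[OF imageI[OF that]] f_inv_into_f[where f = f, OF imageI[OF that], THEN sym]])
 then have "g ` A = (%y. g (inv_into A f y)) ` (f ` A)" by (simp add: image_image)
 then show ?thesis using assms(1) by simp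
qed

locale abelian_extension = field F + G: comm_group "galois_group F L" for F (structure) and L +
 assumes gal: "galois_extension F L"
begin

abbreviation "Gal \<equiv> galois_group F L"

lemma subfield_L: "subfield L F" using gal by (simp add: galois_extension_def)

lemma L_carrier: "x : L ==> x : carrier F" using subfieldE(3)[OF subfield_L] by blast

lemma Gal_iff: "s : carrier Gal \<longleftrightarrow> s : Bij (carrier F) & s : ring_hom F F & (ALL x:L. s x = x)"
 by (auto simp: galois_group_def)

lemma autD:
 assumes s: "s : carrier Gal"
 shows "x : carrier F ==> s x : carrier F" "x : carrier F ==> y : carrier F ==> s (x \<oplus> y) = s x \<oplus> s y"
  "x : carrier F ==> y : carrier F ==> s (x ** y) = s x ** s y" "x : L ==> s x = x" "s \<one> = \<one>" "s \<zero> = \<zero>"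
  "x : carrier F ==> y : carrier F ==> s x = s y ==> x = y" "x : carrier F ==> s (\<ominus> x) = \<ominus> s x"
proof -
 have h: "s : ring_hom F F" and b: "s : Bij (carrier F)" and l: "!!x. x : L ==> s x = x" using s by (auto simp: Gal_iff)
 interpret h: ring_hom_ring F F s by (rule ring_hom_ringI2[OF ring_axioms ring_axioms h])
 show "x : carrier F ==> s x : carrier F" "x : carrier F ==> y : carrier F ==> s (x \<oplus> y) = s x \<oplus> s y"
  "x : carrier F ==> y : carrier F ==> s (x ** y) = s x ** s y" "x : L ==> s x = x" "s \<one> = \<one>" "s \<zero> = \<zero>"
  "x : carrier F ==> s (\<ominus> x) = \<ominus> s x"
  using l by auto
 show "x : carrier F ==> y : carrier F ==> s x = s y ==> x = y"
  using b by (auto simp: Bij_def bij_betw_def dest: inj_onD)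
qed

lemma aut_finsum: assumes s: "s : carrier Gal" and f: "f : I \<rightarrow> carrier F"
 shows "s (\<Oplus>i\<in>I. f i) = (\<Oplus>i\<in>I. s (f i))"
 using f
proof (induction I rule: infinite_finite_induct)
 case (insert i I)
 then have "f : I \<rightarrow> carrier F" "f i : carrier F" "s (f i) : carrier F" "(%i. s (f i)) : I \<rightarrow> carrier F"
  using autD(1)[OF s] by auto
 then show ?case using insert autD(2)[OF s] by (simp add: finsum_closed)
qed (use autD(6)[OF s] in auto)

lemma mult_apply: "s : carrier Gal ==> r : carrier Gal ==> x : carrier F ==> (s **\<^bsub>Gal\<^esub> r) x = s (r x)"
 by (simp add: galois_group_def BijGroup_def compose_def)

lemma one_apply: "x : carrier F ==> \<one>\<^bsub>Gal\<^esub> x = x" by (simp add: galois_group_def BijGroup_def)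

lemma inv_apply: "s : carrier Gal ==> x : carrier F ==> s ((inv\<^bsub>Gal\<^esub> s) x) = x"
 "s : carrier Gal ==> x : carrier F ==> (inv\<^bsub>Gal\<^esub> s) (s x) = x"
 using mult_apply[of s "inv\<^bsub>Gal\<^esub> s" x] mult_apply[of "inv\<^bsub>Gal\<^esub> s" s x] one_apply by simp_all

lemma commute_apply: "s : carrier Gal ==> r : carrier Gal ==> x : carrier F ==> s (r x) = r (s x)"
 using mult_apply[of s r x] mult_apply[of r s x] G.m_comm[of s r] by simp

lemma sub_closed:
 assumes E: "subfield E F" "L <= E"
 shows "carrier (galois_group F E) = {g : carrier Gal. ALL x:E. g x = x}"
 using E(2) by (auto simp: galois_group_def)

text \<open>Every basic open set of the Krull topology is determined by the values of its elements on a
  finite set, and this property survives finite intersections and arbitrary unions.\<close>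

lemma openin_krull_imp_finite:
 assumes N: "openin (krull_topology F L) N" and s: "s : N" "s : carrier Gal"
 shows "\<exists>S\<subseteq>carrier F. finite S & (ALL r:carrier Gal. (ALL x:S. r x = s x) --> r : N)"
proof -
 have "generate_topology_on {s <#\<^bsub>galois_group F L\<^esub> carrier (galois_group F E) | s E.
   s : carrier (galois_group F L) & subfield E F & L <= E & finite_dimension L E} N"
  using N unfolding krull_topology_def by (rule openin_topology_generated_by)
 then show ?thesis using s
 proof (induction arbitrary: s rule: generate_topology_on.induct)
  case (Int a b)
  obtain S S' where "S <= carrier F" "finite S" "!!r. r : carrier Gal ==> (ALL x:S. r x = s x) ==> r : a"
   "S' <= carrier F" "finite S'" "!!r. r : carrier Gal ==> (ALL x:S'. r x = s x) ==> r : b"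
   using Int.IH(1)[of s] Int.IH(2)[of s] Int.prems by blast
  then show ?case by (intro exI[of _ "S \<union> S'"]) auto
 next
  case (UN K)
  then obtain k where k: "k : K" "s : k" by blast
  then show ?case using UN.IH[OF k(1) k(2) UN.prems(2)] by blast
 next
  case (Basis b)
  then obtain s0 E where E: "b = s0 <#\<^bsub>Gal\<^esub> carrier (galois_group F E)" "s0 : carrier Gal" "subfield E F" "L <= E"
   "finite_dimension L E" by blast
  obtain n where "dimension n L E" using E(5) by (auto simp: finite_dimension_def)
  from finite_spanning_set[OF subfield_L this] obtain V where V: "V <= E" "finite V" "E <= carrier F"
   "!!x. x : E ==> EX c:V \<rightarrow> L. x = (\<Oplus>v\<in>V. c v ** v)" by auto
  obtain e where e: "e : carrier Gal" "!!x. x : E ==> e x = x" "s = s0 **\<^bsub>Gal\<^esub> e"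
   using Basis.prems(1) unfolding E(1) l_coset_def sub_closed[OF E(3,4)] by blast
  have "r : b" if r: "r : carrier Gal" "ALL x:V. r x = s x" for r
  proof -
   let ?g = "inv\<^bsub>Gal\<^esub> s0 **\<^bsub>Gal\<^esub> r"
   have g: "?g : carrier Gal" using r(1) E(2) by simp
   have gV: "?g v = v" if v: "v : V" for v
   proof -
    have vc: "v : carrier F" "v : E" using v V by auto
    have "?g v = (inv\<^bsub>Gal\<^esub> s0) (s0 (e v))"
     using mult_apply[of "inv\<^bsub>Gal\<^esub> s0" r v] r v vc E(2) e mult_apply[of s0 e v] by simp
    then show ?thesis using inv_apply(2)[OF E(2), of "e v"] e(2)[OF vc(2)] vc(1) by simp
   qed
   have "?g x = x" if x: "x : E" for x
   proof -
    obtain c where c: "c : V \<rightarrow> L" "x = (\<Oplus>v\<in>V. c v ** v)" using V(4)[OF x] by blast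
    have cl: "c v : L" "c v : carrier F" "v : carrier F" if "v : V" for v
     using c(1) L_carrier that V(1,3) by auto
    have "?g x = (\<Oplus>v\<in>V. ?g (c v ** v))" unfolding c(2) using cl by (intro aut_finsum[OF g]) auto
    also have "\<dots> = (\<Oplus>v\<in>V. c v ** v)"
     using cl gV autD(3)[OF g] autD(4)[OF g] by (intro finsum_cong') auto
    finally show ?thesis using c(2) by simp
   qed
   then have "?g : carrier (galois_group F E)" using g unfolding sub_closed[OF E(3,4)] by blast
   moreover have "r = s0 **\<^bsub>Gal\<^esub> ?g" using r(1) E(2) by (simp add: G.m_assoc[symmetric])
   ultimately show ?thesis unfolding E(1) l_coset_def by blast
  qed
  then show ?case using V by blast
 qed simp
qed

lemma integral_over_L: "x : carrier F ==> integral_over F L x"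
 using gal algebraic_imp_integral_over[OF subfield_L] by (simp add: galois_extension_def)

lemma finite_restrictions:
 assumes S: "S <= carrier F" "finite S"
 shows "finite ((%s. restrict s S) ` carrier Gal)"
proof -
 let ?C = "%x. {y : carrier F. ALL q. polynomial L q --> eval q x = \<zero> --> eval q y = \<zero>}"
 have "s x : ?C x" if s: "s : carrier Gal" and x: "x : carrier F" for s x
 proof -
  interpret h: ring_hom_ring F F s using s by (intro ring_hom_ringI2 ring_axioms) (simp add: Gal_iff)
  have "eval q (s x) = \<zero>" if q: "polynomial L q" "eval q x = \<zero>" for q
  proof -
   have "set q <= L" using q(1) by (auto simp: polynomial_def)
   then have "map s q = q" using autD(4)[OF s] by (intro map_idI) auto
   then show ?thesis using h.eval_hom[OF subfieldE(1)[OF subfield_L] x, of q] q autD(6)[OF s]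
    by (simp add: univ_poly_carrier)
  qed
  then show ?thesis using autD(1)[OF s x] by blast
 qed
 then have "restrict s S : (\<Pi>\<^sub>E x\<in>S. ?C x)" if "s : carrier Gal" for s
  unfolding restrict_PiE_iff using S(1) that by blast
 then have "(%s. restrict s S) ` carrier Gal <= (\<Pi>\<^sub>E x\<in>S. ?C x)" by blast
 moreover have "finite (\<Pi>\<^sub>E x\<in>S. ?C x)"
  using S finite_conjugates[OF subfield_L integral_over_L] by (intro finite_PiE) auto
 ultimately show ?thesis by (rule finite_subset)
qed

lemma coset_eq:
 assumes N: "subgroup N Gal" and s: "s : carrier Gal" "r : carrier Gal" and g: "inv\<^bsub>Gal\<^esub> r **\<^bsub>Gal\<^esub> s : N"
 shows "N #>\<^bsub>Gal\<^esub> s = N #>\<^bsub>Gal\<^esub> r"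
proof -
 have "inv\<^bsub>Gal\<^esub> r **\<^bsub>Gal\<^esub> s **\<^bsub>Gal\<^esub> r = s **\<^bsub>Gal\<^esub> (inv\<^bsub>Gal\<^esub> r **\<^bsub>Gal\<^esub> r)"
  using s G.m_comm[of "inv\<^bsub>Gal\<^esub> r" s] G.m_assoc[of s "inv\<^bsub>Gal\<^esub> r" r] by simp
 then have "inv\<^bsub>Gal\<^esub> r **\<^bsub>Gal\<^esub> s **\<^bsub>Gal\<^esub> r = s" using s by simp
 then have "s : N #>\<^bsub>Gal\<^esub> r" using g by (force simp: r_coset_def)
 then show ?thesis using G.repr_independence[OF _ s(2) N] by simp
qed

lemma agree_coset:
 assumes S: "S <= carrier F" "!!r. r : carrier Gal ==> (ALL x:S. r x = x) ==> r : N"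
  and s: "s : carrier Gal" "r : carrier Gal" "restrict s S = restrict r S"
 shows "inv\<^bsub>Gal\<^esub> r **\<^bsub>Gal\<^esub> s : N"
proof -
 have "s x = r x" if "x : S" for x using fun_cong[OF s(3), of x] that by simp
 then have "(inv\<^bsub>Gal\<^esub> r **\<^bsub>Gal\<^esub> s) x = x" if "x : S" for x
  using mult_apply[of "inv\<^bsub>Gal\<^esub> r" s x] inv_apply(2)[OF s(2), of x] s S(1) that by auto
 then show ?thesis using S(2)[of "inv\<^bsub>Gal\<^esub> r **\<^bsub>Gal\<^esub> s"] s by simp
qed

lemma open_subgroup_finite:
 assumes N: "subgroup N Gal" and op: "openin (krull_topology F L) N"
 obtains S where "S <= carrier F" "finite S" "!!r. r : carrier Gal ==> (ALL x:S. r x = x) ==> r : N"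
proof -
 obtain S where S: "S <= carrier F" "finite S" "ALL r:carrier Gal. (ALL x:S. r x = \<one>\<^bsub>Gal\<^esub> x) --> r : N"
  using openin_krull_imp_finite[OF op subgroup.one_closed[OF N] G.one_closed] by blast
 have "r : N" if "r : carrier Gal" "ALL x:S. r x = x" for r
 proof -
  have "ALL x:S. r x = \<one>\<^bsub>Gal\<^esub> x" using that(2) S(1) one_apply by (simp add: subset_iff)
  then show ?thesis using S(3) that(1) by blast
 qed
 then show thesis using that S(1,2) by blast
qed

lemma finite_quotient:
 assumes N: "subgroup N Gal" and op: "openin (krull_topology F L) N"
 shows "finite (carrier (Gal Mod N))"
proof -
 obtain S where S: "S <= carrier F" "finite S" "!!r. r : carrier Gal ==> (ALL x:S. r x = x) ==> r : N"
  using open_subgroup_finite[OF N op] by blast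
 have "finite ((%s. N #>\<^bsub>Gal\<^esub> s) ` carrier Gal)"
  by (rule finite_image_factor[OF finite_restrictions[OF S(1,2)]]) (rule coset_eq[OF N _ _ agree_coset[OF S(1,3)]])
 moreover have "carrier (Gal Mod N) = (%s. N #>\<^bsub>Gal\<^esub> s) ` carrier Gal" by (auto simp: FactGroup_def RCOSETS_def)
 ultimately show ?thesis by simp
qed

lemma fixed_fieldD: "x : fixed_field F N ==> x : carrier F" "x : fixed_field F N ==> g : N ==> g x = x"
 by (auto simp: fixed_field_def)

lemma subfield_fixed:
 assumes N: "N <= carrier Gal"
 shows "subfield (fixed_field F N) F" "L <= fixed_field F N"
proof -
 note a = autD[OF subsetD[OF N]]
 have sr: "subring (fixed_field F N) F"
 proof (rule subringI)
  show "fixed_field F N <= carrier F" using fixed_fieldD(1) by blast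
  show "\<one> : fixed_field F N" using a(5) by (simp add: fixed_field_def)
  fix x y assume x: "x : fixed_field F N" and y: "y : fixed_field F N"
  note d = fixed_fieldD[OF x] fixed_fieldD[OF y]
  have v: "g (\<ominus> x) = \<ominus> x" "g (x ** y) = x ** y" "g (x \<oplus> y) = x \<oplus> y" if g: "g : N" for g
   using d(2)[OF g] d(4)[OF g] a(8)[OF g d(1)] a(3)[OF g d(1) d(3)] a(2)[OF g d(1) d(3)] by simp_all
  show "\<ominus> x : fixed_field F N" "x ** y : fixed_field F N" "x \<oplus> y : fixed_field F N"
   using d(1,3) v by (auto simp: fixed_field_def intro: v)
 qed
 show "subfield (fixed_field F N) F"
 proof (rule subfieldI'[OF sr])
  fix k assume k: "k : fixed_field F N - {\<zero>}"
  then have kc: "k : carrier F" "k ~= \<zero>" by (auto simp: fixed_field_def)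
  note ik = inv_simps[OF kc]
  have "s (inv k) = inv k" if s: "s : N" for s
  proof -
   have "k ** s (inv k) = \<one>" using a(3)[OF s kc(1) ik(1)] fixed_fieldD(2)[OF DiffD1[OF k] s] by (simp only: ik(2) a(5)[OF s])
   then show ?thesis using comm_inv_char[OF kc(1) a(1)[OF s ik(1)]] by simp
  qed
  then show "inv k : fixed_field F N" using ik(1) by (simp add: fixed_field_def)
 qed
 show "L <= fixed_field F N" using a(4) L_carrier by (auto simp: fixed_field_def)
qed

text \<open>If an element of the fixator of the fixed field were not in \<open>N\<close>, the trace over \<open>N\<close> would give a
  linear relation between distinct characters.\<close>

lemma galois_correspondence:
 assumes N: "subgroup N Gal" and op: "openin (krull_topology F L) N"
  and s: "s : carrier Gal" "!!x. x : fixed_field F N ==> s x = x"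
 shows "s : N"
proof (rule ccontr)
 assume nN: "s \<notin> N"
 obtain S where S: "S <= carrier F" "finite S" "!!r. r : carrier Gal ==> (ALL x:S. r x = x) ==> r : N"
  using open_subgroup_finite[OF N op] by blast
 have Nc: "g : carrier Gal" if "g : N" for g using subgroup.subset[OF N] that by blast
 define U where "U = {u : carrier Gal. ALL x:S. u x = x}"
 define E where "E = fixed_field F U"
 define r where "r g = restrict g E" for g :: "'a => 'a"
 define P where "P = r ` N"
 define Q where "Q = r ` ((%g. s **\<^bsub>Gal\<^esub> g) ` N)"
 define comp where "comp \<nu> i = (\<lambda>x\<in>E. \<nu> (i x))" for \<nu> i :: "'a => 'a"
 have sE: "subring E F" unfolding E_def by (rule subfieldE(1)[OF subfield_fixed(1)]) (auto simp: U_def)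
 note Es = subringE[OF sE]
 have Ec: "x : carrier F" if "x : E" for x using Es(1) that by blast
 have SE: "S <= E" using S(1) by (auto simp: E_def U_def fixed_field_def)
 have rr: "r g = r h" if gh: "g : carrier Gal" "h : carrier Gal" "restrict g S = restrict h S" for g h
 proof -
  have u: "inv\<^bsub>Gal\<^esub> h **\<^bsub>Gal\<^esub> g : U" by (rule agree_coset[OF S(1) _ gh]) (simp add: U_def)
  have "g x = h x" if x: "x : E" for x
  proof -
   have "(inv\<^bsub>Gal\<^esub> h) (g x) = x"
    using fixed_fieldD(2)[OF x[unfolded E_def] u] mult_apply[of "inv\<^bsub>Gal\<^esub> h" g x] gh Ec[OF x] by simp
   then show ?thesis using inv_apply(1)[OF gh(2) autD(1)[OF gh(1) Ec[OF x]]] by simp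
  qed
  then show ?thesis by (auto simp: r_def restrict_def)
 qed
 have rN: "inv\<^bsub>Gal\<^esub> h **\<^bsub>Gal\<^esub> g : N" if gh: "g : carrier Gal" "h : carrier Gal" "r g = r h" for g h
 proof -
  have "g x = h x" if "x : E" for x using fun_cong[OF gh(3), of x] that by (simp add: r_def)
  then have e: "restrict g S = restrict h S" using SE by (intro restrict_ext) blast
  show ?thesis by (rule agree_coset[OF S(1) _ gh(1,2) e]) (rule S(3))
 qed
 have finR: "finite (r ` carrier Gal)" by (rule finite_image_factor[OF finite_restrictions[OF S(1,2)] rr])
 have XY: "P <= r ` carrier Gal" "Q <= r ` carrier Gal" using Nc s(1) by (auto simp: P_def Q_def)
 have fin: "finite P" "finite Q" using XY finR finite_subset by auto
 have ch: "i (x ** y) = i x ** i y" "i \<one> = \<one>" "i x : carrier F" if i: "i : r ` carrier Gal" and x: "x : E" "y : E" for i x y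
 proof -
  obtain g where g: "g : carrier Gal" "i = r g" using i by blast
  have v: "i z = g z" if "z : E" for z using that g(2) by (simp add: r_def)
  show "i (x ** y) = i x ** i y" unfolding v[OF x(1)] v[OF x(2)] v[OF Es(6)[OF x]] by (rule autD(3)[OF g(1) Ec[OF x(1)] Ec[OF x(2)]])
  show "i \<one> = \<one>" unfolding v[OF Es(3)] by (rule autD(5)[OF g(1)])
  show "i x : carrier F" unfolding v[OF x(1)] by (rule autD(1)[OF g(1) Ec[OF x(1)]])
 qed
 have comp_r: "comp \<nu> (r g) = r (\<nu> **\<^bsub>Gal\<^esub> g)" if "\<nu> : carrier Gal" "g : carrier Gal" for \<nu> g
  using mult_apply[OF that] Ec by (auto simp: comp_def r_def restrict_def fun_eq_iff)
 define T where "T x = (\<Oplus>i\<in>P. i x)" for x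
 have Tc: "T x : carrier F" if "x : E" for x unfolding T_def using ch(3)[OF _ that that] XY(1) by (intro finsum_closed) auto
 have \<nu>T: "\<nu> (T x) = (\<Oplus>j\<in>comp \<nu> ` P. j x)" if \<nu>: "\<nu> : carrier Gal" and x: "x : E" for \<nu> x
 proof -
  have Xc: "i x : carrier F" if "i : P" "x : E" for i x using ch(3) XY(1) that by blast
  have inj: "inj_on (comp \<nu>) P"
  proof (rule inj_onI)
   fix i j assume ij: "i : P" "j : P" "comp \<nu> i = comp \<nu> j"
   have "i x = j x" if x: "x : E" for x
    using fun_cong[OF ij(3), of x] x autD(7)[OF \<nu> Xc[OF ij(1) x] Xc[OF ij(2) x]] by (simp add: comp_def)
   moreover have "i : extensional E" "j : extensional E" using ij(1,2) by (auto simp: P_def r_def)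
   ultimately show "i = j" by (intro extensionalityI)
  qed
  have cx: "comp \<nu> i x = \<nu> (i x)" for i using x by (simp add: comp_def)
  have "\<nu> (T x) = (\<Oplus>i\<in>P. \<nu> (i x))" unfolding T_def using Xc x by (intro aut_finsum[OF \<nu>]) auto
  also have "\<dots> = (\<Oplus>i\<in>P. comp \<nu> i x)" by (simp only: cx)
  also have "\<dots> = (\<Oplus>j\<in>comp \<nu> ` P. j x)"
   by (rule finsum_reindex[symmetric, OF _ inj]) (use Xc[OF _ x] autD(1)[OF \<nu>] cx in auto)
  finally show ?thesis .
 qed
 have compN: "comp \<nu> ` P = P" if \<nu>: "\<nu> : N" for \<nu>
 proof (intro equalityI subsetI)
  fix i assume "i : comp \<nu> ` P"
  then obtain g where "g : N" "i = comp \<nu> (r g)" by (auto simp: P_def)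
  then show "i : P" using comp_r[OF Nc[OF \<nu>] Nc] subgroup.m_closed[OF N \<nu>] by (auto simp: P_def)
 next
  fix i assume "i : P"
  then obtain g where g: "g : N" "i = r g" by (auto simp: P_def)
  have h: "inv\<^bsub>Gal\<^esub> \<nu> **\<^bsub>Gal\<^esub> g : N" using N \<nu> g(1) by (simp add: subgroup.m_closed subgroup.m_inv_closed)
  have "\<nu> **\<^bsub>Gal\<^esub> (inv\<^bsub>Gal\<^esub> \<nu> **\<^bsub>Gal\<^esub> g) = g" using Nc[OF \<nu>] Nc[OF g(1)] by (simp add: G.m_assoc[symmetric])
  then have "i = comp \<nu> (r (inv\<^bsub>Gal\<^esub> \<nu> **\<^bsub>Gal\<^esub> g))" using comp_r[OF Nc[OF \<nu>] Nc[OF h]] g(2) by simp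
  then show "i : comp \<nu> ` P" using h by (auto simp: P_def)
 qed
 have compY: "comp s ` P = Q" unfolding P_def Q_def image_image using comp_r[OF s(1) Nc] by (intro image_cong refl) simp
 have sumXY: "(\<Oplus>j\<in>Q. j x) = (\<Oplus>j\<in>P. j x)" if x: "x : E" for x
 proof -
  have "T x : fixed_field F N" using Tc[OF x] \<nu>T[OF Nc x] compN by (auto simp: fixed_field_def T_def)
  then have "s (T x) = T x" by (rule s(2))
  then show ?thesis using \<nu>T[OF s(1) x] compY by (simp add: T_def)
 qed
 have disj: "P \<inter> Q = {}"
 proof (rule ccontr)
  assume "P \<inter> Q ~= {}"
  then obtain g h where gh: "g : N" "h : N" "r (s **\<^bsub>Gal\<^esub> h) = r g" unfolding P_def Q_def by (auto dest: sym)
  then have "inv\<^bsub>Gal\<^esub> g **\<^bsub>Gal\<^esub> (s **\<^bsub>Gal\<^esub> h) : N" using rN Nc s(1) by simp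
  then have "g **\<^bsub>Gal\<^esub> (inv\<^bsub>Gal\<^esub> g **\<^bsub>Gal\<^esub> (s **\<^bsub>Gal\<^esub> h)) **\<^bsub>Gal\<^esub> inv\<^bsub>Gal\<^esub> h : N"
   using N gh by (simp add: subgroup.m_closed subgroup.m_inv_closed)
  moreover have "g **\<^bsub>Gal\<^esub> (inv\<^bsub>Gal\<^esub> g **\<^bsub>Gal\<^esub> (s **\<^bsub>Gal\<^esub> h)) **\<^bsub>Gal\<^esub> inv\<^bsub>Gal\<^esub> h = s"
  proof -
   have c: "g : carrier Gal" "h : carrier Gal" using gh Nc by auto
   have "g **\<^bsub>Gal\<^esub> (inv\<^bsub>Gal\<^esub> g **\<^bsub>Gal\<^esub> (s **\<^bsub>Gal\<^esub> h)) = s **\<^bsub>Gal\<^esub> h" using c s(1) by (simp add: G.m_assoc[symmetric])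
   then show ?thesis using c s(1) by (simp add: G.m_assoc)
  qed
  ultimately show False using nN by simp
 qed
 let ?c = "%i. if i : P then \<one> else \<ominus> \<one>"
 have all: "ALL i:P \<union> Q. ?c i = \<zero>"
 proof (rule characters_independent[of "P \<union> Q" E "%i x. i x"])
  have r: "i : r ` carrier Gal" if "i : P \<union> Q" for i using XY that by blast
  show "finite (P \<union> Q)" using fin by simp
  show "\<one> : E" "!!x y. x : E ==> y : E ==> x ** y : E" using Es(3,6) by auto
  show "i (x ** y) = i x ** i y" if "i : P \<union> Q" "x : E" "y : E" for i x y using ch(1)[OF r that(2,3)] that(1) by blast
  show "i \<one> = \<one>" if "i : P \<union> Q" for i using ch(2)[OF r Es(3) Es(3)] that by blast
  show "i x : carrier F" if "i : P \<union> Q" "x : E" for i x using ch(3)[OF r that(2,2)] that(1) by blast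
  show "EX x:E. i x ~= j x" if "i : P \<union> Q" "j : P \<union> Q" "i ~= j" for i j
  proof (rule ccontr)
   assume "\<not> (EX x:E. i x ~= j x)"
   moreover have "i : extensional E" "j : extensional E" using that(1,2) by (auto simp: P_def Q_def r_def)
   ultimately have "i = j" by (intro extensionalityI) auto
   then show False using that(3) by simp
  qed
  show "?c : P \<union> Q \<rightarrow> carrier F" by auto
  fix x assume x: "x : E"
  have xc: "i x : carrier F" if "i : P \<union> Q" for i using ch(3)[OF r x x] that by blast
  have "(\<Oplus>i\<in>P \<union> Q. ?c i ** i x) = (\<Oplus>i\<in>P. ?c i ** i x) \<oplus> (\<Oplus>i\<in>Q. ?c i ** i x)"
   using xc fin disj by (intro finsum_Un_disjoint) auto
  also have "(\<Oplus>i\<in>P. ?c i ** i x) = (\<Oplus>i\<in>P. i x)" using xc by (intro finsum_cong') auto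
  also have "(\<Oplus>i\<in>Q. ?c i ** i x) = (\<Oplus>i\<in>Q. \<ominus> (i x))" using xc disj by (intro finsum_cong') (auto simp: l_minus)
  also have "\<dots> = \<ominus> (\<Oplus>i\<in>Q. i x)" using xc by (intro finsum_minus) auto
  also have "\<dots> = \<ominus> (\<Oplus>i\<in>P. i x)" using sumXY[OF x] by simp
  also have "(\<Oplus>i\<in>P. i x) \<oplus> \<ominus> (\<Oplus>i\<in>P. i x) = \<zero>" using xc by (intro r_neg finsum_closed) auto
  finally show "(\<Oplus>i\<in>P \<union> Q. ?c i ** i x) = \<zero>" .
 qed
 have r1: "r \<one>\<^bsub>Gal\<^esub> : P" using subgroup.one_closed[OF N] by (auto simp: P_def)
 have "?c (r \<one>\<^bsub>Gal\<^esub>) = \<zero>" by (rule bspec[OF all UnI1[OF r1]])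
 then show False using r1 one_not_zero by simp
qed

lemma coset_act_eq:
 assumes N: "subgroup N Gal" and C: "C : carrier (Gal Mod N)" "s : C" and x: "x : fixed_field F N"
 shows "coset_act C x = s x" "s : carrier Gal" "C = N #>\<^bsub>Gal\<^esub> s"
proof -
 obtain r where r: "r : carrier Gal" "C = N #>\<^bsub>Gal\<^esub> r" using C(1) by (auto simp: FactGroup_def RCOSETS_def)
 have val: "g x = r x" "g : carrier Gal" if gC: "g : C" for g
 proof -
  obtain h where h: "h : N" "g = h **\<^bsub>Gal\<^esub> r" using gC unfolding r(2) r_coset_def by blast
  have hc: "h : carrier Gal" using subgroup.subset[OF N] h(1) by blast
  show "g : carrier Gal" using h(2) hc r(1) by simp
  show "g x = r x" unfolding h(2)
   using mult_apply[OF hc r(1), of x] commute_apply[OF hc r(1), of x] fixed_fieldD(1)[OF x] fixed_fieldD(2)[OF x h(1)] by simp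
 qed
 show "coset_act C x = s x" unfolding coset_act_def
  by (rule the_elem_constant[OF C(2)]) (rule trans[OF val(1) val(1)[OF C(2), symmetric]])
 show "s : carrier Gal" using val(2) C(2) by blast
 show "C = N #>\<^bsub>Gal\<^esub> s" unfolding r(2) by (rule G.repr_independence[OF _ r(1) N]) (use C(2) r(2) in simp)
qed

lemma fixed_apply: assumes N: "N <= carrier Gal" and s: "s : carrier Gal" and x: "x : fixed_field F N"
 shows "s x : fixed_field F N"
proof -
 have xc: "x : carrier F" and fx: "!!g. g : N ==> g x = x" using x by (auto simp: fixed_field_def)
 have "g (s x) = s x" if g: "g : N" for g using commute_apply[OF subsetD[OF N g] s xc] fx[OF g] by simp
 then show ?thesis using autD(1)[OF s xc] by (simp add: fixed_field_def)
qed

lemma quotient_action: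
 assumes dvr: "complete_dvr F A t L" and N: "subgroup N Gal" and op: "openin (krull_topology F L) N"
  and B: "B = {x : fixed_field F N. integral_over F A x}"
 shows "galois_action F A t L (Gal Mod N) (fixed_field F N) B coset_act"
proof -
 let ?M = "fixed_field F N"
 have Nc: "N <= carrier Gal" by (rule subgroup.subset[OF N])
 have M: "x : carrier F" if "x : ?M" for x using that by (simp add: fixed_field_def)
 have rep: "EX s. s : carrier Gal & s : C & C = N #>\<^bsub>Gal\<^esub> s & (ALL x:?M. coset_act C x = s x)"
  if C: "C : carrier (Gal Mod N)" for C
 proof -
  obtain s where s: "s : carrier Gal" "C = N #>\<^bsub>Gal\<^esub> s" using C by (auto simp: FactGroup_def RCOSETS_def)
  then have "s : C" using G.rcos_self[OF s(1) N] by simp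
  then show ?thesis using s coset_act_eq(1)[OF N C] by blast
 qed
 interpret norm: normal N Gal using N by (rule G.subgroup_imp_normal)
 show ?thesis
 proof (intro galois_action.intro dvr G.abelian_FactGroup[OF N] galois_action_axioms.intro)
  show "subfield ?M F" "L <= ?M" by (rule subfield_fixed[OF Nc])+
  show "integral_over F L x" if "x : ?M" for x using integral_over_L M[OF that] .
  show "B = {x : ?M. integral_over F A x}" by (rule B)
  show "finite (carrier (Gal Mod N))" by (rule finite_quotient[OF N op])
  fix C assume C: "C : carrier (Gal Mod N)"
  obtain s where s: "s : carrier Gal" "s : C" "C = N #>\<^bsub>Gal\<^esub> s" "!!x. x : ?M ==> coset_act C x = s x"
   using rep[OF C] by blast
  have sr: "subring ?M F" by (rule subfieldE(1)[OF subfield_fixed(1)[OF Nc]])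
  note sM = fixed_apply[OF Nc s(1)]
  show "coset_act C x : ?M" if "x : ?M" for x using sM that s(4) by simp
  show "coset_act C (x \<oplus> y) = coset_act C x \<oplus> coset_act C y" if "x : ?M" "y : ?M" for x y
   using s(4) that subringE(7)[OF sr that] autD(2)[OF s(1) M[OF that(1)] M[OF that(2)]] by simp
  show "coset_act C (x ** y) = coset_act C x ** coset_act C y" if "x : ?M" "y : ?M" for x y
   using s(4) that subringE(6)[OF sr that] autD(3)[OF s(1) M[OF that(1)] M[OF that(2)]] by simp
  show "coset_act C x = x" if "x : L" for x using s(4) subfield_fixed(2)[OF Nc] autD(4)[OF s(1)] that by auto
  fix D assume D: "D : carrier (Gal Mod N)"
  obtain r where r: "r : carrier Gal" "r : D" "D = N #>\<^bsub>Gal\<^esub> r" "!!x. x : ?M ==> coset_act D x = r x"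
   using rep[OF D] by blast
  note rM = fixed_apply[OF Nc r(1)]
  have CD: "C **\<^bsub>Gal Mod N\<^esub> D = N #>\<^bsub>Gal\<^esub> (s **\<^bsub>Gal\<^esub> r)"
   unfolding s(3) r(3) using norm.rcos_sum[OF s(1) r(1)] by (simp add: FactGroup_def)
  show "coset_act (C **\<^bsub>Gal Mod N\<^esub> D) x = coset_act C (coset_act D x)" if x: "x : ?M" for x
  proof -
   have "s **\<^bsub>Gal\<^esub> r : C **\<^bsub>Gal Mod N\<^esub> D" unfolding CD using s(1) r(1) N by (intro G.rcos_self) auto
   moreover have "C **\<^bsub>Gal Mod N\<^esub> D : carrier (Gal Mod N)" unfolding CD using s(1) r(1) by (auto simp: FactGroup_def RCOSETS_def)
   ultimately have "coset_act (C **\<^bsub>Gal Mod N\<^esub> D) x = (s **\<^bsub>Gal\<^esub> r) x" using coset_act_eq(1)[OF N _ _ x] by blast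
   then show ?thesis using mult_apply[OF s(1) r(1) M[OF x]] r(4)[OF x] s(4)[OF rM[OF x]] by simp
  qed
  assume ne: "C ~= D"
  show "EX x:?M. coset_act C x ~= coset_act D x"
  proof (rule ccontr)
   assume "\<not> (EX x:?M. coset_act C x ~= coset_act D x)"
   then have eq: "s x = r x" if "x : ?M" for x using s(4) r(4) that by auto
   have "(inv\<^bsub>Gal\<^esub> r **\<^bsub>Gal\<^esub> s) x = x" if x: "x : ?M" for x
    using mult_apply[of "inv\<^bsub>Gal\<^esub> r" s x] s(1) r(1) M[OF x] eq[OF x] inv_apply(2)[OF r(1) M[OF x]] by simp
   then have "inv\<^bsub>Gal\<^esub> r **\<^bsub>Gal\<^esub> s : N" using s(1) r(1) by (intro galois_correspondence[OF N op]) auto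
   then show False using coset_eq[OF N s(1) r(1)] ne s(3) r(3) by simp
  qed
 next
  have one: "\<one>\<^bsub>Gal Mod N\<^esub> : carrier (Gal Mod N)" "\<one>\<^bsub>Gal\<^esub> : \<one>\<^bsub>Gal Mod N\<^esub>"
   using monoid.one_closed[OF group.is_monoid[OF norm.factorgroup_is_group]] subgroup.one_closed[OF N] by (simp_all add: FactGroup_def)
  show "coset_act \<one>\<^bsub>Gal Mod N\<^esub> x = x" if "x : ?M" for x
   using coset_act_eq(1)[OF N one that] one_apply M[OF that] by simp
  fix x assume x: "x : ?M" and fx: "!!C. C : carrier (Gal Mod N) ==> coset_act C x = x"
  have "s x = x" if s: "s : carrier Gal" for s
  proof -
   have C: "N #>\<^bsub>Gal\<^esub> s : carrier (Gal Mod N)" using s by (auto simp: FactGroup_def RCOSETS_def)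
   show ?thesis using coset_act_eq(1)[OF N C G.rcos_self[OF s N] x] fx[OF C] by simp
  qed
  then have "x : fixed_field F (carrier Gal)" using M[OF x] by (simp add: fixed_field_def)
  then show "x : L" using gal by (simp add: galois_extension_def)
 qed
qed

end

lemma (in padic_embedding) pp_eq: "pp = [p] \<cdot> \<one>"
proof -
 have "j (%_. of_nat n) = [n] \<cdot> \<one>" for n
 proof (induction n)
  case (Suc n)
  have "j (%_. of_nat (Suc n)) = j (%_. of_nat n) \<oplus> j (%_. 1)"
   using j_add[of "%_. of_nat n" "%_. 1"] by (simp add: add.commute)
  then show ?case using Suc by (simp add: add.nat_pow_Suc)
 qed simp
 then show ?thesis .
qed

lemma (in domain) integral_closure_iff:
 assumes "subring A R" "B <= carrier R"
 shows "integral_closure R A B = {x : B. integral_over R A x}"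
 using assms integral_over_iff_poly[OF assms(1) _ one_not_zero] by (auto simp: integral_closure_def)

lemma (in padic_embedding) uniformizer_dvr:
 assumes fin: "finite_dimension Qp L" and B: "B = {x : L. integral_over R Zp x}"
  and \<pi>: "uniformizer (R\<lparr>carrier := B\<rparr>) \<pi>"
 shows "complete_dvr R B \<pi> L" "[p] \<cdot> \<one> : scale R \<pi> 1 B"
proof -
 interpret Z: complete_dvr R Zp pp Qp by (rule complete_dvr_Zp)
 interpret E: dvr_extension R Zp pp Qp L B
 proof (intro dvr_extension.intro Z.complete_dvr_axioms dvr_extension_axioms.intro)
  show "subfield L R" by (rule subfield_L)
  show le: "Qp <= L" using ring_hom_closed[OF iota] by (auto simp: Qp_def)
  show "integral_over R Qp x" if x: "x : L" for x
   using finite_dimension_imp_algebraic[OF subfield_Qp subfieldE(1)[OF subfield_L] fin x]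
   by (intro algebraic_imp_integral_over[OF subfield_Qp L_carrier[OF x]]) (simp add: over_def)
  show "EX N. ALL V. V <= L --> Z.K_indep V --> card V <= N" by (rule Z.K_indep_bounded[OF fin])
  show "B = {x : L. integral_over R Zp x}" by (rule B)
 qed
 show "complete_dvr R B \<pi> L" by (rule E.uniformizer_complete_dvr(1)[OF \<pi>])
 show "[p] \<cdot> \<one> : scale R \<pi> 1 B" using E.uniformizer_complete_dvr(3)[OF \<pi>] pp_eq by simp
qed

lemma (in group) pro_p_kernel_power:
 assumes H: "subgroup H G" and pro: "pro_p_group p (G\<lparr>carrier := H\<rparr>) (subtopology T H)"
  and N: "N \<lhd> G" "openin T N" "N <= H" and s: "s : H"
 shows "EX k. (N #> s) [^]\<^bsub>G Mod N\<^esub> (p ^ k) = \<one>\<^bsub>G Mod N\<^esub>"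
proof -
 let ?H = "G\<lparr>carrier := H\<rparr>"
 interpret H: group ?H by (rule subgroup_imp_group[OF H])
 interpret N: normal N G by (rule N(1))
 have sub: "subgroup N ?H" by (rule subgroup_incl[OF N.subgroup_axioms H N(3)])
 have norm: "N \<lhd> ?H"
 proof (rule H.normal_invI[OF sub])
  fix x h assume x: "x : carrier ?H" "h : N"
  have "x : carrier G" using x(1) subgroup.subset[OF H] by auto
  then show "x **\<^bsub>?H\<^esub> h **\<^bsub>?H\<^esub> inv\<^bsub>?H\<^esub> x : N"
   using N.inv_op_closed2[OF _ x(2)] m_inv_consistent[OF H] x(1) by simp
 qed
 have "openin (subtopology T H) N" using N(2,3) by (auto simp: openin_subtopology)
 then obtain k where k: "card (rcosets\<^bsub>?H\<^esub> N) = p ^ k" using pro norm by (auto simp: pro_p_group_def)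
 interpret Q: group "?H Mod N" by (rule normal.factorgroup_is_group[OF norm])
 have "(N #>\<^bsub>?H\<^esub> s) [^]\<^bsub>?H Mod N\<^esub> (p ^ k) = \<one>\<^bsub>?H Mod N\<^esub>"
  using Q.pow_order_eq_1[of "N #>\<^bsub>?H\<^esub> s"] s k by (auto simp: order_def FactGroup_def RCOSETS_def)
 moreover have "N #>\<^bsub>?H\<^esub> (s [^]\<^bsub>?H\<^esub> (p ^ k)) = (N #>\<^bsub>?H\<^esub> s) [^]\<^bsub>?H Mod N\<^esub> (p ^ k)"
  using hom_nat_pow[OF normal.r_coset_hom_Mod[OF norm] _ H.group_axioms Q.group_axioms, of s "p ^ k"] s by simp
 ultimately have "N #>\<^bsub>?H\<^esub> (s [^]\<^bsub>?H\<^esub> (p ^ k)) = N" by (simp add: FactGroup_def)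
 then have "N #> (s [^] (p ^ k)) = N" using nat_pow_consistent[of s "p ^ k" H] by (simp add: r_coset_def)
 moreover have "N #> (s [^] (p ^ k)) = (N #> s) [^]\<^bsub>G Mod N\<^esub> (p ^ k)"
  using hom_nat_pow[OF N.r_coset_hom_Mod _ group_axioms N.factorgroup_is_group, of s "p ^ k"] s subgroup.subset[OF H] by auto
 ultimately have "(N #> s) [^]\<^bsub>G Mod N\<^esub> (p ^ k) = \<one>\<^bsub>G Mod N\<^esub>" by (simp add: FactGroup_def)
 then show ?thesis by blast
qed

theorem theorem5p22:
  fixes p :: nat
    and Linf :: "('a, 'b) ring_scheme"
    and \<iota> :: "(nat \<Rightarrow> rat) set \<Rightarrow> 'a"
    and L oL :: "'a set"
    and \<pi> :: 'a
    and \<Gamma> :: "('a \<Rightarrow> 'a) monoid"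
    and T :: "('a \<Rightarrow> 'a) topology"
    and \<Gamma>n :: "nat \<Rightarrow> ('a \<Rightarrow> 'a) set"
    and on :: "nat \<Rightarrow> 'a set"
  assumes "Factorial_Ring.prime p"
    and "field Linf" and "subfield L Linf"
    and "\<iota> \<in> ring_hom (padic_field p) (Linf\<lparr>carrier := L\<rparr>)"
    and "ring.finite_dimension Linf (\<iota> ` carrier (padic_field p)) L"
    and "oL = integral_closure Linf (\<iota> ` padic_ints p) L"
    and "uniformizer (Linf\<lparr>carrier := oL\<rparr>) \<pi>"
    and "galois_extension Linf L"
    and "\<not> ring.finite_dimension Linf L (carrier Linf)"
    and "\<Gamma> = galois_group Linf L" and "T = krull_topology Linf L"
    and "\<And>n. n \<ge> 1 \<Longrightarrow> \<Gamma>n n \<lhd> \<Gamma> \<and> openin T (\<Gamma>n n)"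
    and "\<And>n. n \<ge> 1 \<Longrightarrow> \<Gamma>n (Suc n) \<subseteq> \<Gamma>n n"
    and "(\<Inter>n\<in>{1..}. \<Gamma>n n) = {\<one>\<^bsub>\<Gamma>\<^esub>}"
    and "\<And>n. n \<ge> 1 \<Longrightarrow> on n = integral_closure Linf oL (fixed_field Linf (\<Gamma>n n))"
    and "comm_group \<Gamma>"
    and "\<not> p dvd order (\<Gamma> Mod \<Gamma>n 1)"
    and "torsionfree_group (\<Gamma>\<lparr>carrier := \<Gamma>n 1\<rparr>)"
    and "pro_p_group p (\<Gamma>\<lparr>carrier := \<Gamma>n 1\<rparr>) (subtopology T (\<Gamma>n 1))"
    and "finite_rank (\<Gamma>\<lparr>carrier := \<Gamma>n 1\<rparr>) (subtopology T (\<Gamma>n 1))"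
  shows "free_module_of_rank
           (iwasawa_algebra (Linf\<lparr>carrier := oL\<rparr>) \<Gamma> \<Gamma>n)
           (dual_limit_module (Linf\<lparr>carrier := oL\<rparr>) \<Gamma> \<Gamma>n on) 1
         \<longleftrightarrow>
         red_limit_map Linf \<pi> on 1
           \<in> ring_iso (red_ring Linf \<pi> on 1) (red_limit_fixed Linf \<pi> on (\<Gamma>n 1))"
proof -
 note prime = assms(1) and field = assms(2) and \<Gamma> = assms(10) and T = assms(11)
 note \<Gamma>n = assms(12)[unfolded \<Gamma> T] and \<Gamma>n_Suc = assms(13) and on = assms(15)
 have \<Gamma>nN: "\<Gamma>n n \<lhd> galois_group Linf L" "openin (krull_topology Linf L) (\<Gamma>n n)" if "n >= 1" for n using \<Gamma>n[OF that] by auto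
 have \<Gamma>sub: "subgroup (\<Gamma>n n) (galois_group Linf L)" if "n >= 1" for n using normal_imp_subgroup[OF \<Gamma>nN(1)[OF that]] .
 interpret F: field Linf by (rule field)
 interpret P: padic_embedding p Linf \<iota> L
  using prime field assms(3,4) by (intro padic_embedding.intro padic.intro padic_embedding_axioms.intro)
 interpret E: abelian_extension Linf L
  using field assms(8) assms(16)[unfolded \<Gamma>] by (intro abelian_extension.intro abelian_extension_axioms.intro)
 have oL: "oL = {x : L. integral_over Linf P.Zp x}"
  unfolding assms(6) using F.integral_closure_iff[OF P.subring_Zp, of L] E.L_carrier by (auto simp: P.Zp_def)
 have dvr: "complete_dvr Linf oL \<pi> L" "add_pow Linf p \<one>\<^bsub>Linf\<^esub> : scale Linf \<pi> 1 oL"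
  using P.uniformizer_dvr[OF _ oL assms(7)] assms(5) by (simp_all add: P.Qp_def)
 interpret C: complete_dvr Linf oL \<pi> L by (rule dvr(1))
 have on': "on n = {x : fixed_field Linf (\<Gamma>n n). integral_over Linf oL x}" if "n >= 1" for n
  unfolding on[OF that] by (rule F.integral_closure_iff[OF C.subring_A]) (auto simp: fixed_field_def)
 interpret T: group_tower "galois_group Linf L" \<Gamma>n
  by (intro group_tower.intro group_tower_axioms.intro E.G.comm_group_axioms \<Gamma>nN(1) \<Gamma>n_Suc E.finite_quotient \<Gamma>sub \<Gamma>nN(2))
 interpret G: galois_limit Linf oL \<pi> L "galois_group Linf L" \<Gamma>n "%n. fixed_field Linf (\<Gamma>n n)" on p
 proof (intro galois_limit.intro dvr(1) T.group_tower_axioms galois_limit_axioms.intro prime dvr(2))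
  fix n :: nat assume n: "n >= 1"
  show "galois_action Linf oL \<pi> L (galois_group Linf L Mod \<Gamma>n n) (fixed_field Linf (\<Gamma>n n)) (on n) coset_act"
   by (rule E.quotient_action[OF dvr(1) \<Gamma>sub[OF n] \<Gamma>nN(2)[OF n] on'[OF n]])
  show "coset_act C x = s x" if "C : carrier (galois_group Linf L Mod \<Gamma>n n)" "s : C" "x : fixed_field Linf (\<Gamma>n n)" for C s x
   by (rule E.coset_act_eq(1)[OF \<Gamma>sub[OF n] that])
  show "fixed_field Linf (\<Gamma>n n) <= fixed_field Linf (\<Gamma>n (Suc n))" using \<Gamma>n_Suc[OF n] by (auto simp: fixed_field_def)
  fix C assume C: "C : carrier (galois_group Linf L Mod \<Gamma>n n)" "T.\<theta> 1 C = \<one>\<^bsub>galois_group Linf L Mod \<Gamma>n 1\<^esub>"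
  obtain s where s: "s : carrier (galois_group Linf L)" "C = \<Gamma>n n #>\<^bsub>galois_group Linf L\<^esub> s" using C(1) by (auto simp: T.Q_elem)
  have "\<Gamma>n 1 #>\<^bsub>galois_group Linf L\<^esub> s = \<Gamma>n 1" using C(2) T.\<theta>_coset[OF le_refl n s(1)] s(2) by simp
  then have s1: "s : \<Gamma>n 1" using E.G.coset_join1[OF _ s(1) \<Gamma>sub[OF le_refl]] by blast
  show "EX k. C [^]\<^bsub>galois_group Linf L Mod \<Gamma>n n\<^esub> (p ^ k) = \<one>\<^bsub>galois_group Linf L Mod \<Gamma>n n\<^esub>"
   unfolding s(2) by (rule E.G.pro_p_kernel_power[OF \<Gamma>sub[OF le_refl] assms(19)[unfolded \<Gamma> T] \<Gamma>nN[OF n] T.N_mono[OF le_refl n] s1])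
 next
  show "coprime p (order (galois_group Linf L Mod \<Gamma>n 1))" using prime assms(17)[unfolded \<Gamma>] by (rule prime_imp_coprime)
 qed
 show ?thesis unfolding \<Gamma> by (rule G.free_iff_iso)
qed

end
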